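(* Let $\varphi$ be an Orlicz function and $\omega$ a decreasing weight. Then $\Lambda_{\varphi,\omega}^{o}$ has the strongly exposed property (i.e. every point of $S(\Lambda_{\varphi,\omega}^{o})$ is a strongly exposed point of $B(\Lambda_{\varphi,\omega}^{o})$) if and only if both of the following hold: (1) $\varphi\in\Delta_2\cap\nabla_2$; (2) $\varphi$ is strictly convex (on $[0,\infty)$).
   Context: **Measure space and rearrangement.** $\mathbb{R}^+=(0,\infty)$ carries Lebesgue measure $\mu$, and $L_0$ is the space of (classes of) real measurable functions on it. For $f\in L_0$, $\mu_f(\lambda)=\mu\{s: |f(s)|>\lambda\}$ and $f^{*}(t)=\inf\{\lambda>0:\mu_f(\lambda)\le t\}$ is the decreasing rearrangement. **Weight.** A decreasing weight is a non-increasing, locally integrable function $\omega:(0,\infty)\to(0,\infty)$ with $\int_0^t\omega(s)\,ds<\infty$ for all $t>0$ and $\int_0^\infty\omega(t)\,dt=\infty$. **Orlicz function.** $\varphi:\mathbb{R}\to[0,\infty)$ is an Orlicz function if it is convex, $\varphi(0)=0$ and $\varphi(u)>0$ for $u>0$ (only its values on $[0,\infty)$ are used). Its complementary function is $\psi(v)=\sup_{u>0}\{uv-\varphi(u)\}$, $v\ge0$. We write $\varphi\in\Delta_2$ if there is $C>0$ with $\varphi(2t)\le C\varphi(t)$ for all $t>0$, and $\varphi\in\nabla_2$ if $\psi\in\Delta_2$. **Orlicz–Lorentz space.** $\rho_{\varphi,\omega}(f)=\int_0^\infty\varphi(f^{*}(t))\omega(t)\,dt$, and $\Lambda_{\varphi,\omega}=\{f\in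 L_0:\rho_{\varphi,\omega}(\lambda f)<\infty\text{ for some }\lambda>0\}$. $\Lambda^{o}_{\varphi,\omega}$ denotes $\Lambda_{\varphi,\omega}$ with the Orlicz norm $$\|f\|^{o}_{\varphi,\omega}=\sup_{\rho_{\psi,\omega}(g)\le1}\int_0^\infty f^{*}(t)g^{*}(t)\omega(t)\,dt=\inf_{k>0}\frac1k\bigl(1+\rho_{\varphi,\omega}(kf)\bigr);$$ it is a Banach space. **Strongly exposed points.** For a Banach space $X$, $B(X)$ and $S(X)$ are the closed unit ball and the unit sphere. A point $x\in S(X)$ is a strongly exposed point of $B(X)$ if there is $f\in X^{*}$ with $\|f\|=1=f(x)$ such that, for every sequence $x_n\in B(X)$, $f(x_n)\to1$ implies $\|x_n-x\|\to0$. $X$ has the strongly exposed property if every $x\in S(X)$ is a strongly exposed point of $B(X)$. *)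

theory Defs
  imports "HOL-Analysis.Analysis"
begin

section \<open>Classes of measurable functions on the positive half-line\<close>

abbreviation pos_lebesgue :: "real measure" where
  "pos_lebesgue \<equiv> lebesgue_on {0<..}"

definition ae_equal :: "(real \<Rightarrow> real) \<Rightarrow> (real \<Rightarrow> real) \<Rightarrow> bool" where
  "ae_equal f g \<longleftrightarrow> f \<in> borel_measurable pos_lebesgue \<and> g \<in> borel_measurable pos_lebesgue \<and>
     (AE s in pos_lebesgue. f s = g s)"

quotient_type L0 = "real \<Rightarrow> real" / partial: ae_equal
proof (rule part_equivpI)
  show "\<exists>f. ae_equal f f"
    by (rule exI[of _ "\<lambda>_. 0"]) (simp add: ae_equal_def)
  show "symp ae_equal"
    by (rule sympI) (auto simp: ae_equal_def elim: AE_mp)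
  show "transp ae_equal"
  proof (rule transpI)
    fix f g h assume "ae_equal f g" "ae_equal g h"
    then show "ae_equal f h"
      unfolding ae_equal_def by (auto elim: eventually_elim2)
  qed
qed

instantiation L0 :: real_vector
begin

lift_definition zero_L0 :: L0 is "\<lambda>_. 0"
  by (simp add: ae_equal_def)

lift_definition plus_L0 :: "L0 \<Rightarrow> L0 \<Rightarrow> L0" is "\<lambda>f g s. f s + g s"
  unfolding ae_equal_def by (auto elim: eventually_elim2)

lift_definition minus_L0 :: "L0 \<Rightarrow> L0 \<Rightarrow> L0" is "\<lambda>f g s. f s - g s"
  unfolding ae_equal_def by (auto elim: eventually_elim2)

lift_definition uminus_L0 :: "L0 \<Rightarrow> L0" is "\<lambda>f s. - f s"
  unfolding ae_equal_def by (auto elim: eventually_mono)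

lift_definition scaleR_L0 :: "real \<Rightarrow> L0 \<Rightarrow> L0" is "\<lambda>c f s. c * f s"
  unfolding ae_equal_def by (auto elim: eventually_mono)

instance
  by standard (transfer; auto simp: ae_equal_def algebra_simps)+

end

lift_definition distribution_fun :: "L0 \<Rightarrow> real \<Rightarrow> ennreal" is
  "\<lambda>f l. emeasure pos_lebesgue {s \<in> space pos_lebesgue. \<bar>f s\<bar> > l}"
proof (rule ext)
  fix f g :: "real \<Rightarrow> real" and l :: real
  assume "ae_equal f g"
  then have [measurable]: "f \<in> borel_measurable pos_lebesgue" "g \<in> borel_measurable pos_lebesgue"
    and eq: "AE s in pos_lebesgue. f s = g s"
    by (auto simp: ae_equal_def)
  show "emeasure pos_lebesgue {s \<in> space pos_lebesgue. \<bar>f s\<bar> > l} =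
        emeasure pos_lebesgue {s \<in> space pos_lebesgue. \<bar>g s\<bar> > l}"
  proof (rule emeasure_eq_AE)
    show "AE s in pos_lebesgue. s \<in> {s \<in> space pos_lebesgue. \<bar>f s\<bar> > l} \<longleftrightarrow>
        s \<in> {s \<in> space pos_lebesgue. \<bar>g s\<bar> > l}"
      using eq by eventually_elim simp
  qed measurable
qed

text \<open>The infimum is taken in the extended half-line, so that it is \<^term>\<open>\<infinity>\<close> when no
  \<open>l\<close> qualifies.\<close>

definition rearrangement :: "L0 \<Rightarrow> real \<Rightarrow> ennreal" where
  "rearrangement f t = (INF l\<in>{l. 0 < l \<and> distribution_fun f l \<le> ennreal t}. ennreal l)"


section \<open>Weights and Orlicz functions\<close>

text \<open>Integrability on every \<open>(0, t]\<close> includes local integrability.\<close>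

definition decreasing_weight :: "(real \<Rightarrow> real) \<Rightarrow> bool" where
  "decreasing_weight \<omega> \<longleftrightarrow>
     (\<forall>t>0. \<omega> t > 0) \<and> antimono_on {0<..} \<omega> \<and>
     (\<forall>t>0. set_integrable lebesgue {0<..t} \<omega>) \<and>
     (\<integral>\<^sup>+t. ennreal (\<omega> t) \<partial>pos_lebesgue) = \<infinity>"

definition orlicz_function :: "(real \<Rightarrow> real) \<Rightarrow> bool" where
  "orlicz_function \<phi> \<longleftrightarrow>
     convex_on UNIV \<phi> \<and> (\<forall>u. \<phi> u \<ge> 0) \<and> \<phi> 0 = 0 \<and> (\<forall>u>0. \<phi> u > 0)"

definition strictly_convex_on :: "real set \<Rightarrow> (real \<Rightarrow> real) \<Rightarrow> bool" where
  "strictly_convex_on A \<phi> \<longleftrightarrow> convex A \<and>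
     (\<forall>u\<in>A. \<forall>v\<in>A. \<forall>t. u \<noteq> v \<longrightarrow> 0 < t \<longrightarrow> t < 1 \<longrightarrow>
        \<phi> ((1 - t) * u + t * v) < (1 - t) * \<phi> u + t * \<phi> v)"

text \<open>The complementary function may take the value \<^term>\<open>\<infinity>\<close>, and a rearrangement may be
  infinite, so both \<open>\<phi>\<close> and its complementary function are regarded as functions on
  \<^typ>\<open>ennreal\<close>, with value \<^term>\<open>\<infinity>\<close> at \<^term>\<open>\<infinity>\<close>.\<close>

definition extend :: "(real \<Rightarrow> real) \<Rightarrow> ennreal \<Rightarrow> ennreal" where
  "extend \<phi> x = (if x = \<infinity> then \<infinity> else ennreal (\<phi> (enn2real x)))"

text \<open>Subtraction on \<^typ>\<open>ennreal\<close> truncates at 0. This does not change the supremum, which is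
  nonnegative because \<open>u * v - \<phi> u\<close> tends to 0 as \<open>u\<close> does.\<close>

definition complementary :: "(real \<Rightarrow> real) \<Rightarrow> ennreal \<Rightarrow> ennreal" where
  "complementary \<phi> v = (SUP u\<in>{0<..}. ennreal u * v - ennreal (\<phi> u))"

definition Delta2 :: "(ennreal \<Rightarrow> ennreal) \<Rightarrow> bool" where
  "Delta2 \<Phi> \<longleftrightarrow> (\<exists>C::real. C > 0 \<and>
     (\<forall>t::real. t > 0 \<longrightarrow> \<Phi> (ennreal (2 * t)) \<le> ennreal C * \<Phi> (ennreal t)))"

definition Nabla2 :: "(real \<Rightarrow> real) \<Rightarrow> bool" where
  "Nabla2 \<phi> \<longleftrightarrow> Delta2 (complementary \<phi>)"


section \<open>Orlicz--Lorentz spaces with the Orlicz norm\<close>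

definition modular :: "(ennreal \<Rightarrow> ennreal) \<Rightarrow> (real \<Rightarrow> real) \<Rightarrow> L0 \<Rightarrow> ennreal" where
  "modular \<Phi> \<omega> f = (\<integral>\<^sup>+t. \<Phi> (rearrangement f t) * ennreal (\<omega> t) \<partial>pos_lebesgue)"

definition orlicz_lorentz :: "(real \<Rightarrow> real) \<Rightarrow> (real \<Rightarrow> real) \<Rightarrow> L0 set" where
  "orlicz_lorentz \<phi> \<omega> = {f. \<exists>l>0. modular (extend \<phi>) \<omega> (l *\<^sub>R f) < \<infinity>}"

definition orlicz_norm :: "(real \<Rightarrow> real) \<Rightarrow> (real \<Rightarrow> real) \<Rightarrow> L0 \<Rightarrow> real" where
  "orlicz_norm \<phi> \<omega> f = enn2real
     (SUP g\<in>{g. modular (complementary \<phi>) \<omega> g \<le> 1}.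
        \<integral>\<^sup>+t. rearrangement f t * rearrangement g t * ennreal (\<omega> t) \<partial>pos_lebesgue)"


section \<open>Strongly exposed points\<close>

text \<open>Here a normed space is given by a linear subspace \<open>V\<close> of a real vector space together with
  a norm \<open>N\<close> on \<open>V\<close>; functionals matter only through their values on \<open>V\<close>.\<close>

definition bounded_functional_on ::
    "'a::real_vector set \<Rightarrow> ('a \<Rightarrow> real) \<Rightarrow> ('a \<Rightarrow> real) \<Rightarrow> bool" where
  "bounded_functional_on V N F \<longleftrightarrow>
     (\<forall>x\<in>V. \<forall>y\<in>V. F (x + y) = F x + F y) \<and>
     (\<forall>c. \<forall>x\<in>V. F (c *\<^sub>R x) = c * F x) \<and>
     (\<exists>C. \<forall>x\<in>V. \<bar>F x\<bar> \<le> C * N x)"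

definition unit_ball_on :: "'a::real_vector set \<Rightarrow> ('a \<Rightarrow> real) \<Rightarrow> 'a set" where
  "unit_ball_on V N = {x \<in> V. N x \<le> 1}"

definition unit_sphere_on :: "'a::real_vector set \<Rightarrow> ('a \<Rightarrow> real) \<Rightarrow> 'a set" where
  "unit_sphere_on V N = {x \<in> V. N x = 1}"

definition dual_norm_on :: "'a::real_vector set \<Rightarrow> ('a \<Rightarrow> real) \<Rightarrow> ('a \<Rightarrow> real) \<Rightarrow> real" where
  "dual_norm_on V N F = (SUP x\<in>unit_ball_on V N. \<bar>F x\<bar>)"

definition strongly_exposed_point ::
    "'a::real_vector set \<Rightarrow> ('a \<Rightarrow> real) \<Rightarrow> 'a \<Rightarrow> bool" where
  "strongly_exposed_point V N x \<longleftrightarrow> x \<in> unit_sphere_on V N \<and>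
     (\<exists>F. bounded_functional_on V N F \<and> dual_norm_on V N F = 1 \<and> F x = 1 \<and>
        (\<forall>y :: nat \<Rightarrow> 'a. (\<forall>n. y n \<in> unit_ball_on V N) \<longrightarrow> (\<lambda>n. F (y n)) \<longlonglongrightarrow> 1 \<longrightarrow>
           (\<lambda>n. N (y n - x)) \<longlonglongrightarrow> 0))"

definition strongly_exposed_property ::
    "'a::real_vector set \<Rightarrow> ('a \<Rightarrow> real) \<Rightarrow> bool" where
  "strongly_exposed_property V N \<longleftrightarrow> (\<forall>x\<in>unit_sphere_on V N. strongly_exposed_point V N x)"

end

theory Submission
  imports Defs
begin

text \<open>
  Write \<open>W t = \<integral>\<^sub>0\<^sup>t \<omega>\<close> and \<open>\<rho>\<close> for the modular. By Young's inequality
  \<open>\<parallel>f\<parallel> \<le> (1 + \<rho> (k f)) / k\<close> for every \<open>k > 0\<close>, with equality as soon as some subgradient selection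
  \<open>G\<close> of \<open>\<phi>\<close> satisfies \<open>\<integral> \<psi> (G (f\<^sup>*)) \<omega> = 1\<close>; a minimiser \<open>k\<close> of the right-hand side provides such a \<open>G\<close>.

  Necessity. If \<open>\<phi>\<close> is affine on an interval, a step function with values in that interval is
  the midpoint of a segment in the sphere. If \<open>\<phi>\<close> violates \<open>\<Delta>\<^sub>2\<close>, there is \<open>x = \<Sum>\<^sub>n x\<^sub>n\<close> with disjoint pieces
  whose norms are bounded below; a functional \<open>F\<close> satisfies \<open>F x\<^sub>n \<rightarrow> 0\<close>, so the points
  \<open>x - x\<^sub>n\<close> contradict exposure. If \<open>\<psi>\<close> violates \<open>\<Delta>\<^sub>2\<close>, then \<open>\<phi>\<close> is almost linear on arbitrarily long
  intervals near \<open>0\<close> or near \<open>\<infinity>\<close>, and there is a decreasing step function such that the normalised indicators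
  of its steps nearly attain the norm of every functional supporting it.

  Sufficiency. With \<open>k\<close>, \<open>G\<close> as above for \<open>x\<close> in the sphere, and \<open>\<Omega>\<close> a rearrangement of \<open>\<omega>\<close> aligned with
  \<open>\<bar>x\<bar>\<close>, the functional \<open>F f = \<integral> f sgn(x) G(\<bar>x\<bar>) \<Omega>\<close> supports the ball at \<open>x\<close>. If \<open>F y\<^sub>n \<rightarrow> 1\<close> and \<open>k\<^sub>n\<close> is optimal for
  \<open>y\<^sub>n\<close>, the gaps in Young's inequality for \<open>k\<^sub>n \<bar>y\<^sub>n\<bar>\<close> and \<open>G(\<bar>x\<bar>)\<close> tend to \<open>0\<close> in \<open>L\<^sub>1(\<Omega>)\<close>. Strict convexity turns this
  into pointwise convergence \<open>k\<^sub>n y\<^sub>n \<rightarrow> k x\<close> on the support of \<open>x\<close>, the growth condition on \<open>\<psi>\<close> into convergence of the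
  modulars, and both together with \<open>\<Delta>\<^sub>2\<close> force norm convergence.
\<close>

text \<open>The condition on \<open>\<psi>\<close> is the last of the necessity claims because it
  rests on the other two. \<open>Delta2\<close> makes every multiple of a function in the space have
  finite modular, so the minimum of \<open>(1 + \<rho>(k f)) / k\<close> can be studied through
  one-sided derivatives. Strict convexity gives a uniform growth gap on compact intervals and
  thereby confines a failure to \<open>0\<close> and infinity. A minimiser need not exist: for
  linear \<open>\<phi>\<close> the quotient is \<open>1 / k\<close> plus a constant. Its existence
  is always deduced from a pair \<open>K1 < K2\<close> at which the quotient has risen. The growth
  of \<open>\<phi>\<close> dual to \<open>Nabla2\<close> provides such a pair for sufficiency, a
  specially sized first block for necessity. The norm sees only rearrangements, while functionals
  are linear in the function itself. The bridge is the layer-cake formula: modulars become integrals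
  of \<open>W\<close> over level measures, so limits can be taken on superlevel sets. There,
  convergence on the support of \<open>x\<close> yields only liminf inequalities; convergence of the
  modulars closes the gap.\<close>

section \<open>Distribution functions and decreasing rearrangements\<close>

definition level_measure :: "(real \<Rightarrow> real) \<Rightarrow> real \<Rightarrow> ennreal" where
  "level_measure f l = emeasure pos_lebesgue {s \<in> space pos_lebesgue. \<bar>f s\<bar> > l}"

text \<open>Works on representatives: the argument runs on functions, and
  \<open>rearrangement_abs\<close> carries it back to classes.\<close>

definition rearr :: "(real \<Rightarrow> real) \<Rightarrow> real \<Rightarrow> ennreal" where
  "rearr f t = (INF l\<in>{l. 0 < l \<and> level_measure f l \<le> ennreal t}. ennreal l)"

lemma emeasure_pos_lebesgue_Ioc: "0 \<le> a \<Longrightarrow> emeasure pos_lebesgue {0<..a} = ennreal a"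
  by (subst emeasure_restrict_space) auto

lemma emeasure_pos_lebesgue_Ioo: "0 \<le> a \<Longrightarrow> emeasure pos_lebesgue {0<..<a} = ennreal a"
  by (subst emeasure_restrict_space) auto

lemma sigma_finite_pos_lebesgue: "sigma_finite_measure pos_lebesgue"
proof
  have "x \<in> (\<Union>n. {0<..real n})" if "0 < x" for x
    using real_arch_simple[of x] that by auto
  then have "(\<Union>n. {0<..real n}) = space pos_lebesgue" by auto
  moreover have "{0<..real n} \<in> sets pos_lebesgue" for n by (subst sets_restrict_space_iff) auto
  ultimately show "\<exists>A. countable A \<and> A \<subseteq> sets pos_lebesgue \<and> \<Union> A = space pos_lebesgue \<and>
      (\<forall>a\<in>A. emeasure pos_lebesgue a \<noteq> \<infinity>)"
    by (intro exI[of _ "range (\<lambda>n. {0<..real n})"]) (auto simp: emeasure_pos_lebesgue_Ioc)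
qed

interpretation pos_lebesgue: sigma_finite_measure pos_lebesgue
  by (rule sigma_finite_pos_lebesgue)

lemma space_pos_lebesgue [simp]: "space pos_lebesgue = {0<..}"
  by simp

lemma borel_pos_lebesgue: "g \<in> borel_measurable borel \<Longrightarrow> g \<in> borel_measurable pos_lebesgue"
  by (rule measurable_restrict_space1) (simp add: measurable_completion)

lemma level_sets [measurable]:
  fixes f :: "real \<Rightarrow> real"
  assumes [measurable]: "f \<in> borel_measurable pos_lebesgue"
  shows "{s. 0 < s \<and> l < \<bar>f s\<bar>} \<in> sets pos_lebesgue"
proof -
  have "{s \<in> space pos_lebesgue. l < \<bar>f s\<bar>} \<in> sets pos_lebesgue" by measurable
  then show ?thesis by simp
qed

lemma level_measure_mono: "l \<le> l' \<Longrightarrow> f \<in> borel_measurable pos_lebesgue \<Longrightarrow> level_measure f l' \<le> level_measure f l"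
  unfolding level_measure_def by (rule emeasure_mono) (auto intro: level_sets)

lemma level_measure_mono_fun:
  assumes "f \<in> borel_measurable pos_lebesgue" "g \<in> borel_measurable pos_lebesgue"
    "AE s in pos_lebesgue. \<bar>f s\<bar> \<le> \<bar>g s\<bar>"
  shows "level_measure f l \<le> level_measure g l"
  unfolding level_measure_def
proof (rule emeasure_mono_AE)
  show "AE s in pos_lebesgue. s \<in> {s \<in> space pos_lebesgue. l < \<bar>f s\<bar>} \<longrightarrow> s \<in> {s \<in> space pos_lebesgue. l < \<bar>g s\<bar>}"
    using assms(3) by eventually_elim auto
qed (use assms(1,2) in measurable)

text \<open>Continuity of the measure from below along the thresholds \<open>l + 1 / Suc n\<close>.
  It is what makes both inequalities in \<open>rearr_gt_iff\<close> strict.\<close>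

lemma level_measure_right_cont:
  assumes [measurable]: "f \<in> borel_measurable pos_lebesgue" and "b < level_measure f l"
  shows "\<exists>l'>l. b < level_measure f l'"
proof -
  define A where "A n = {s \<in> space pos_lebesgue. l + 1 / Suc n < \<bar>f s\<bar>}" for n
  have [measurable]: "A n \<in> sets pos_lebesgue" for n unfolding A_def by measurable
  have "incseq A"
  proof (rule incseq_SucI)
    fix n show "A n \<le> A (Suc n)"
    proof
      fix s assume "s \<in> A n"
      moreover have "1 / real (Suc (Suc n)) \<le> 1 / real (Suc n)" by (intro divide_left_mono) auto
      ultimately show "s \<in> A (Suc n)" unfolding A_def by (auto simp del: of_nat_Suc)
    qed
  qed
  have U: "(\<Union>n. A n) = {s \<in> space pos_lebesgue. l < \<bar>f s\<bar>}"
  proof (intro set_eqI iffI)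
    fix s assume "s \<in> (\<Union>n. A n)"
    then obtain n where "l + 1 / Suc n < \<bar>f s\<bar>" "s \<in> space pos_lebesgue" by (auto simp: A_def)
    moreover have "0 < 1 / real (Suc n)" by simp
    ultimately show "s \<in> {s \<in> space pos_lebesgue. l < \<bar>f s\<bar>}" by (smt (verit) mem_Collect_eq)
  next
    fix s assume s: "s \<in> {s \<in> space pos_lebesgue. l < \<bar>f s\<bar>}"
    then obtain n where "inverse (Suc n) < \<bar>f s\<bar> - l" using reals_Archimedean[of "\<bar>f s\<bar> - l"] by auto
    then show "s \<in> (\<Union>n. A n)" using s by (auto simp: A_def inverse_eq_divide intro!: exI[of _ n])
  qed
  have "(SUP n. emeasure pos_lebesgue (A n)) = level_measure f l"
    unfolding level_measure_def U[symmetric] using \<open>incseq A\<close> by (intro SUP_emeasure_incseq) auto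
  then obtain n where "b < emeasure pos_lebesgue (A n)" using assms(2) by (metis less_SUP_iff)
  then have "b < level_measure f (l + 1 / Suc n)" by (simp add: level_measure_def A_def)
  moreover have "l + 1 / Suc n > l" by simp
  ultimately show ?thesis by blast
qed

text \<open>Distribution function and rearrangement are generalised inverses of each other. Most
  later facts on \<open>rearr\<close> are proved by comparing the thresholds \<open>l\<close> that
  lie below both sides.\<close>

lemma rearr_gt_iff:
  assumes f: "f \<in> borel_measurable pos_lebesgue" and "0 \<le> l"
  shows "ennreal l < rearr f t \<longleftrightarrow> ennreal t < level_measure f l"
proof
  assume a: "ennreal l < rearr f t"
  show "ennreal t < level_measure f l"
  proof (rule ccontr)
    assume "\<not> ?thesis"
    then have le: "level_measure f l \<le> ennreal t" by simp
    have "rearr f t \<le> ennreal (l + e)" if "e > 0" for e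
      unfolding rearr_def using that le level_measure_mono[of l "l+e" f] f assms(2)
      by (intro INF_lower) (auto intro: order_trans)
    then have "rearr f t \<le> ennreal l + ennreal e" if "0 < e" for e
      using that assms(2) by (simp add: ennreal_plus[symmetric] del: ennreal_plus)
    then have "rearr f t \<le> ennreal l" by (rule ennreal_le_epsilon)
    then show False using a by simp
  qed
next
  assume "ennreal t < level_measure f l"
  then obtain l' where l': "l' > l" "ennreal t < level_measure f l'"
    using level_measure_right_cont[OF f] by blast
  have "ennreal l' \<le> rearr f t"
    unfolding rearr_def
  proof (rule INF_greatest)
    fix m assume "m \<in> {m. 0 < m \<and> level_measure f m \<le> ennreal t}"
    then have "\<not> m < l'" using l'(2) level_measure_mono[of m l' f] f by (auto simp: not_less[symmetric])
    then show "ennreal l' \<le> ennreal m" by (intro ennreal_leI) simp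
  qed
  then show "ennreal l < rearr f t" using l'(1) assms(2) by (meson ennreal_lessI order_less_le_trans order_le_less_trans)
qed

lemma ennreal_eqI_less:
  fixes a b :: ennreal
  assumes "\<And>l. 0 \<le> l \<Longrightarrow> ennreal l < a \<longleftrightarrow> ennreal l < b"
  shows "a = b"
proof (rule ccontr)
  assume "a \<noteq> b"
  then consider "a < b" | "b < a" by fastforce
  then show False
  proof cases
    case 1
    then have "ennreal (enn2real a) = a" by (metis ennreal_enn2real top.extremum_strict top.not_eq_extremum)
    then show ?thesis using assms[of "enn2real a"] 1 by simp
  next
    case 2
    then have "ennreal (enn2real b) = b" by (metis ennreal_enn2real top.extremum_strict top.not_eq_extremum)
    then show ?thesis using assms[of "enn2real b"] 2 by simp
  qed
qed

lemma ennreal_leI_less: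
  fixes a b :: ennreal
  assumes "\<And>l. 0 \<le> l \<Longrightarrow> ennreal l < a \<Longrightarrow> ennreal l < b"
  shows "a \<le> b"
proof (rule ccontr)
  assume "\<not> a \<le> b"
  then have "b < a" by simp
  moreover from this have "ennreal (enn2real b) = b" by (metis ennreal_enn2real top.extremum_strict top.not_eq_extremum)
  ultimately show False using assms[of "enn2real b"] by simp
qed

lemma rearr_mono:
  assumes "f \<in> borel_measurable pos_lebesgue" "g \<in> borel_measurable pos_lebesgue"
    "AE s in pos_lebesgue. \<bar>f s\<bar> \<le> \<bar>g s\<bar>"
  shows "rearr f t \<le> rearr g t"
  by (rule ennreal_leI_less)
    (use level_measure_mono_fun[OF assms] in \<open>auto simp: rearr_gt_iff assms intro: order_less_le_trans\<close>)

lemma rearr_antimono: "t \<le> t' \<Longrightarrow> rearr f t' \<le> rearr f t"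
  unfolding rearr_def by (rule INF_superset_mono) (auto intro: order_trans ennreal_leI)

lemma borel_measurable_rearr [measurable]: "rearr f \<in> borel_measurable borel"
proof (rule borel_measurableI_greater)
  fix y :: ennreal
  have "is_interval {t. y < rearr f t}"
    unfolding is_interval_1 using rearr_antimono[of _ _ f] by (auto intro: order_less_le_trans)
  then have "{t. y < rearr f t} \<in> sets borel" by (rule real_interval_borel_measurable)
  then show "{t \<in> space borel. y < rearr f t} \<in> sets borel" by simp
qed

lemma rearr_scale:
  assumes f: "f \<in> borel_measurable pos_lebesgue"
  shows "rearr (\<lambda>s. c * f s) t = ennreal \<bar>c\<bar> * rearr f t"
proof (cases "c = 0")
  case True
  have "\<not> 0 < rearr (\<lambda>s. 0) t"
    using rearr_gt_iff[of "\<lambda>_. 0" 0 t] by (simp add: level_measure_def)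
  then show ?thesis using True by simp
next
  case False
  show ?thesis
  proof (rule ennreal_eqI_less)
    fix l :: real assume l: "0 \<le> l"
    have "level_measure (\<lambda>s. c * f s) l = level_measure f (l / \<bar>c\<bar>)"
      unfolding level_measure_def using False
      by (intro arg_cong[where f="emeasure _"]) (auto simp: abs_mult field_simps)
    then have "ennreal l < rearr (\<lambda>s. c * f s) t \<longleftrightarrow> ennreal (l / \<bar>c\<bar>) < rearr f t"
      using l f by (subst (1 2) rearr_gt_iff) auto
    also have "\<dots> \<longleftrightarrow> ennreal \<bar>c\<bar> * ennreal (l / \<bar>c\<bar>) < ennreal \<bar>c\<bar> * rearr f t"
      using False ennreal_mult_strict_left_mono[of "ennreal (l / \<bar>c\<bar>)" "rearr f t" "ennreal \<bar>c\<bar>"]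
        mult_left_mono[of "rearr f t" "ennreal (l / \<bar>c\<bar>)" "ennreal \<bar>c\<bar>"]
      by (auto simp: not_less[symmetric])
    also have "ennreal \<bar>c\<bar> * ennreal (l / \<bar>c\<bar>) = ennreal l"
      using False l by (simp add: ennreal_mult[symmetric])
    finally show "ennreal l < rearr (\<lambda>s. c * f s) t \<longleftrightarrow> ennreal l < ennreal \<bar>c\<bar> * rearr f t" .
  qed
qed

text \<open>If \<open>\<bar>f + g\<bar>\<close> exceeds \<open>a + b\<close>, then
  \<open>\<bar>f\<bar>\<close> exceeds \<open>a\<close> or \<open>\<bar>g\<bar>\<close> exceeds
  \<open>b\<close>; with \<open>a\<close>, \<open>b\<close> the values of the two rearrangements
  these sets have measure at most \<open>s\<close> and \<open>t\<close>.\<close>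

lemma rearr_add:
  assumes [measurable]: "f \<in> borel_measurable pos_lebesgue" "g \<in> borel_measurable pos_lebesgue"
    and st: "0 \<le> s" "0 \<le> t"
  shows "rearr (\<lambda>x. f x + g x) (s + t) \<le> rearr f s + rearr g t"
proof (cases "rearr f s = \<infinity> \<or> rearr g t = \<infinity>")
  case True then show ?thesis by auto
next
  case False
  define a b where "a = enn2real (rearr f s)" and "b = enn2real (rearr g t)"
  have ab: "rearr f s = ennreal a" "rearr g t = ennreal b" "0 \<le> a" "0 \<le> b"
    using False by (auto simp: a_def b_def less_top)
  have la: "level_measure f a \<le> ennreal s" "level_measure g b \<le> ennreal t"
    using rearr_gt_iff[of f a s] rearr_gt_iff[of g b t] ab by auto
  have "level_measure (\<lambda>x. f x + g x) (a + b)
      \<le> emeasure pos_lebesgue ({x \<in> space pos_lebesgue. a < \<bar>f x\<bar>} \<union> {x \<in> space pos_lebesgue. b < \<bar>g x\<bar>})"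
    unfolding level_measure_def by (rule emeasure_mono) (auto simp: level_sets)
  also have "\<dots> \<le> level_measure f a + level_measure g b"
    unfolding level_measure_def by (rule emeasure_subadditive) measurable
  also have "\<dots> \<le> ennreal (s + t)" using la st by (simp add: ennreal_plus add_mono)
  finally have "\<not> ennreal (a + b) < rearr (\<lambda>x. f x + g x) (s + t)"
    using ab by (subst rearr_gt_iff) auto
  then show ?thesis using ab by (simp add: ennreal_plus)
qed

text \<open>An increasing bijection of the half-line merely relabels the thresholds. With
  \<open>\<Phi> = \<phi>\<close> this turns the modular into the integral of a rearrangement, to
  which the layer-cake formula applies.\<close>

lemma rearr_comp:
  assumes [measurable]: "f \<in> borel_measurable pos_lebesgue"
    and mono: "\<And>x y. 0 \<le> x \<Longrightarrow> x < y \<Longrightarrow> \<Phi> x < \<Phi> y" and \<Phi>0: "\<Phi> 0 = 0"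
    and surj: "\<And>l. 0 \<le> l \<Longrightarrow> \<exists>m\<ge>0. \<Phi> m = l"
    and [measurable]: "\<Phi> \<in> borel_measurable borel"
  shows "rearr (\<lambda>s. \<Phi> \<bar>f s\<bar>) t = extend \<Phi> (rearr f t)"
proof (rule ennreal_eqI_less)
  fix l :: real assume l: "0 \<le> l"
  obtain m where m: "0 \<le> m" "\<Phi> m = l" using surj[OF l] by blast
  have iff: "\<Phi> m < \<Phi> x \<longleftrightarrow> m < x" if "0 \<le> x" for x
    using mono[of m x] mono[of x m] m that by (metis less_asym linorder_neqE)
  have pos: "0 \<le> \<Phi> x" if "0 \<le> x" for x
    using mono[of 0 x] \<Phi>0 that by (cases "x = 0") auto
  have "ennreal l < rearr (\<lambda>s. \<Phi> \<bar>f s\<bar>) t \<longleftrightarrow> ennreal t < level_measure (\<lambda>s. \<Phi> \<bar>f s\<bar>) l"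
    using l by (intro rearr_gt_iff) measurable
  also have "level_measure (\<lambda>s. \<Phi> \<bar>f s\<bar>) l = level_measure f m"
    unfolding level_measure_def using iff m pos by (intro arg_cong[where f="emeasure _"]) auto
  also have "ennreal t < level_measure f m \<longleftrightarrow> ennreal m < rearr f t"
    using m by (subst rearr_gt_iff) auto
  also have "\<dots> \<longleftrightarrow> ennreal l < extend \<Phi> (rearr f t)"
  proof (cases "rearr f t = \<infinity>")
    case True then show ?thesis by (simp add: extend_def)
  next
    case False
    then obtain r where r: "rearr f t = ennreal r" "0 \<le> r" by (metis ennreal_cases infinity_ennreal_def)
    then show ?thesis using iff[of r] m l pos[of r] by (simp add: extend_def ennreal_less_iff)
  qed
  finally show "ennreal l < rearr (\<lambda>s. \<Phi> \<bar>f s\<bar>) t \<longleftrightarrow> ennreal l < extend \<Phi> (rearr f t)" .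
qed

lemma antimono_measurable_pos_lebesgue:
  assumes "antimono_on {0<..} (f :: real \<Rightarrow> real)"
  shows "f \<in> borel_measurable pos_lebesgue"
proof -
  have "mono_on {0<..} (\<lambda>x. - f x)" using assms by (auto simp: monotone_on_def)
  then have "(\<lambda>x. - f x) \<in> borel_measurable (restrict_space borel {0<..})"
    by (rule borel_measurable_mono_on_fnc)
  then have "(\<lambda>x. - (- f x)) \<in> borel_measurable (restrict_space borel {0<..})" by (rule borel_measurable_uminus)
  then have "(\<lambda>x. f x) \<in> borel_measurable (restrict_space borel {0<..})" by simp
  moreover have "id \<in> measurable pos_lebesgue (restrict_space borel {0<..})"
    by (intro measurable_restrict_space3) (auto simp: measurable_completion)
  ultimately have "(\<lambda>x. f (id x)) \<in> borel_measurable pos_lebesgue" by (rule measurable_compose[rotated])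
  then show ?thesis by simp
qed

text \<open>A decreasing function is its own rearrangement except for the convention at jumps: at
  \<open>t\<close> the rearrangement lies between the values to the right of \<open>t\<close> and
  \<open>f t\<close>. As there are only countably many jumps, equality follows almost
  everywhere.\<close>

lemma rearr_antimono_fun:
  assumes f: "antimono_on {0<..} f" and pos: "\<And>t. 0 < t \<Longrightarrow> 0 \<le> f t"
  shows rearr_le_antimono_fun: "0 < t \<Longrightarrow> rearr f t \<le> ennreal (f t)"
    and rearr_ge_antimono_fun: "0 < t \<Longrightarrow> t < t' \<Longrightarrow> ennreal (f t') \<le> rearr f t"
proof -
  note [measurable] = antimono_measurable_pos_lebesgue[OF f]
  have fm: "f y \<le> f x" if "0 < x" "x \<le> y" for x y
    using f that by (auto simp: monotone_on_def)
  show "rearr f t \<le> ennreal (f t)" if t: "0 < t"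
  proof (rule ccontr)
    assume "\<not> ?thesis"
    then have "ennreal (f t) < rearr f t" by simp
    then have "ennreal t < level_measure f (f t)" using pos[OF t] by (subst (asm) rearr_gt_iff) auto
    moreover have "level_measure f (f t) \<le> emeasure pos_lebesgue {0<..t}"
      unfolding level_measure_def
    proof (rule emeasure_mono)
      show "{s \<in> space pos_lebesgue. f t < \<bar>f s\<bar>} \<subseteq> {0<..t}"
      proof
        fix s assume "s \<in> {s \<in> space pos_lebesgue. f t < \<bar>f s\<bar>}"
        then have "0 < s" "f t < f s" using pos by auto
        then show "s \<in> {0<..t}" using fm[of t s] t by force
      qed
      show "{0<..t} \<in> sets pos_lebesgue" by (subst sets_restrict_space_iff) auto
    qed
    ultimately show False using t by (simp add: emeasure_pos_lebesgue_Ioc)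
  qed
  show "ennreal (f t') \<le> rearr f t" if t: "0 < t" "t < t'"
  proof (rule ennreal_leI_less)
    fix l :: real assume l: "0 \<le> l" "ennreal l < ennreal (f t')"
    have "ennreal t < ennreal t'" using t by (simp add: ennreal_less_iff)
    also have "\<dots> = emeasure pos_lebesgue {0<..t'}" using t by (simp add: emeasure_pos_lebesgue_Ioc)
    also have "\<dots> \<le> level_measure f l"
      unfolding level_measure_def
    proof (rule emeasure_mono)
      show "{0<..t'} \<subseteq> {s \<in> space pos_lebesgue. l < \<bar>f s\<bar>}"
      proof
        fix s assume s: "s \<in> {0<..t'}"
        then have "l < f s" using fm[of s t'] l by (auto simp: ennreal_less_iff)
        then show "s \<in> {s \<in> space pos_lebesgue. l < \<bar>f s\<bar>}" using s by simp
      qed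
    qed measurable
    finally show "ennreal l < rearr f t" using l by (subst rearr_gt_iff) auto
  qed
qed

lemma AE_pos_lebesgue_countable: "countable A \<Longrightarrow> AE t in pos_lebesgue. t \<notin> A"
proof -
  assume "countable A"
  then have "A \<in> null_sets lborel" by (rule countable_imp_null_set_lborel)
  then have "A \<in> null_sets lebesgue" by (rule null_sets_completionI)
  then have "AE t in lebesgue. t \<notin> A" by (rule AE_not_in)
  then show ?thesis by (subst AE_restrict_space_iff) auto
qed

lemma AE_rearr_antimono_fun:
  assumes f: "antimono_on {0<..} f" and pos: "\<And>t. 0 < t \<Longrightarrow> 0 \<le> f t"
  shows "AE t in pos_lebesgue. rearr f t = ennreal (f t)"
proof -
  have "mono_on {0<..} (\<lambda>x. - f x)" using f by (auto simp: monotone_on_def)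
  then have "countable {a\<in>{0<..}. \<not> isCont (\<lambda>x. - f x) a}" by (intro mono_on_ctble_discont_open) auto
  from AE_pos_lebesgue_countable[OF this]
  have "AE t in pos_lebesgue. isCont (\<lambda>x. - f x) t"
    by (rule AE_mp) (auto intro!: AE_I2)
  then show ?thesis
  proof (rule AE_mp, intro AE_I2 impI)
    fix t assume "t \<in> space pos_lebesgue" "isCont (\<lambda>x. - f x) t"
    then have t: "0 < t" and c: "isCont f t" using continuous_minus[of "at t" "\<lambda>x. - f x"] by auto
    have "(\<lambda>n. f (t + 1 / Suc n)) \<longlonglongrightarrow> f t"
      using c LIMSEQ_inverse_real_of_nat_add[of t] by (intro isCont_tendsto_compose[OF c]) (simp add: inverse_eq_divide)
    then have "(\<lambda>n. ennreal (f (t + 1 / Suc n))) \<longlonglongrightarrow> ennreal (f t)" by (intro tendsto_ennrealI)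
    then have "ennreal (f t) \<le> rearr f t"
      by (rule LIMSEQ_le_const2) (use rearr_ge_antimono_fun[OF f pos] t in auto)
    then show "rearr f t = ennreal (f t)" using rearr_le_antimono_fun[OF f pos t] by auto
  qed
qed

lemma rearr_indicator:
  assumes [measurable]: "A \<in> sets pos_lebesgue" and c: "0 \<le> c"
  shows "rearr (\<lambda>s. c * indicator A s) t = (if ennreal t < emeasure pos_lebesgue A then ennreal c else 0)"
proof (rule ennreal_eqI_less)
  fix l :: real assume l: "0 \<le> l"
  have "{s \<in> space pos_lebesgue. l < \<bar>c * indicator A s\<bar>} = (if l < c then A else {})"
    using l c sets.sets_into_space[OF assms(1)] by (auto simp: indicator_def)
  then have lm: "level_measure (\<lambda>s. c * indicator A s) l = (if l < c then emeasure pos_lebesgue A else 0)"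
    unfolding level_measure_def by auto
  have "ennreal l < rearr (\<lambda>s. c * indicator A s) t \<longleftrightarrow> ennreal t < level_measure (\<lambda>s. c * indicator A s) l"
    by (rule rearr_gt_iff[OF _ l]) measurable
  then show "ennreal l < rearr (\<lambda>s. c * indicator A s) t \<longleftrightarrow>
      ennreal l < (if ennreal t < emeasure pos_lebesgue A then ennreal c else 0)"
    unfolding lm using l c by (auto simp: ennreal_less_iff)
qed

text \<open>\<open>g t\<close> is the length of the set of thresholds below it, also when infinite;
  Tonelli's theorem then exchanges the integrals.\<close>

lemma nn_integral_layer_cake:
  assumes "sigma_finite_measure N" and [measurable]: "g \<in> borel_measurable N" "V \<in> borel_measurable N"
  shows "(\<integral>\<^sup>+t. g t * V t \<partial>N) =
    (\<integral>\<^sup>+l. indicator {0..} l * (\<integral>\<^sup>+t. indicator {t. ennreal l < g t} t * V t \<partial>N) \<partial>lborel)"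
proof -
  interpret N: sigma_finite_measure N by fact
  interpret pair_sigma_finite N lborel by standard
  have g: "g t = (\<integral>\<^sup>+l. indicator {0..} l * indicator {l. ennreal l < g t} l \<partial>lborel)" for t
  proof -
    have "(\<integral>\<^sup>+l. indicator {0..} l * indicator {l. ennreal l < g t} l \<partial>lborel) =
        (\<integral>\<^sup>+l. indicator {l. 0 \<le> l \<and> ennreal l < g t} l \<partial>lborel)"
      by (intro nn_integral_cong) (auto split: split_indicator)
    also have "\<dots> = g t"
    proof (cases "g t")
      case (real r)
      then have "{l. 0 \<le> l \<and> ennreal l < g t} = {0..<r}" by (auto simp: ennreal_less_iff)
      then show ?thesis using real by simp
    next
      case top
      then have "{l. 0 \<le> l \<and> ennreal l < g t} = {0..}" by auto
      moreover have "emeasure lborel {0::real..} = \<infinity>"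
      proof (rule ccontr)
        assume "emeasure lborel {0::real..} \<noteq> \<infinity>"
        then obtain c where c: "emeasure lborel {0::real..} = ennreal c" "0 \<le> c" by (cases "emeasure lborel {0::real..}") auto
        have "emeasure lborel {0..c + 1} \<le> emeasure lborel {0::real..}" by (rule emeasure_mono) auto
        then show False using c by (simp add: ennreal_le_iff del: ennreal_plus)
      qed
      ultimately show ?thesis using top by simp
    qed
    finally show ?thesis by simp
  qed
  have "(\<integral>\<^sup>+t. g t * V t \<partial>N) =
      (\<integral>\<^sup>+t. (\<integral>\<^sup>+l. indicator {0..} l * (indicator {l. ennreal l < g t} l * V t) \<partial>lborel) \<partial>N)"
    by (subst g) (simp add: nn_integral_multc[symmetric] mult.assoc)
  also have "\<dots> = (\<integral>\<^sup>+l. (\<integral>\<^sup>+t. indicator {0..} l * (indicator {l. ennreal l < g t} l * V t) \<partial>N) \<partial>lborel)"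
    by (rule Fubini'[symmetric]) measurable
  also have "\<dots> = (\<integral>\<^sup>+l. indicator {0..} l * (\<integral>\<^sup>+t. indicator {t. ennreal l < g t} t * V t \<partial>N) \<partial>lborel)"
    by (subst nn_integral_cmult[symmetric]) (auto intro!: nn_integral_cong split: split_indicator)
  finally show ?thesis .
qed

section \<open>The weight measure, its primitive, and rearrangement inequalities\<close>

locale decreasing_weight_space =
  fixes \<omega> :: "real \<Rightarrow> real"
  assumes weight: "decreasing_weight \<omega>"
begin

definition wm :: "real measure" where "wm = density pos_lebesgue (\<lambda>t. ennreal (\<omega> t))"

text \<open>The argument is extended because level sets may have infinite measure; there
  \<open>W\<close> is infinite.\<close>

definition W :: "ennreal \<Rightarrow> ennreal" where "W a = emeasure wm {t. 0 < t \<and> ennreal t < a}"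

lemma \<omega>_pos: "0 < t \<Longrightarrow> 0 < \<omega> t"
  using weight by (auto simp: decreasing_weight_def)

lemma \<omega>_antimono: "0 < s \<Longrightarrow> s \<le> t \<Longrightarrow> \<omega> t \<le> \<omega> s"
  using weight by (auto simp: decreasing_weight_def monotone_on_def)

lemma \<omega>_measurable [measurable]: "\<omega> \<in> borel_measurable pos_lebesgue"
  using weight by (intro antimono_measurable_pos_lebesgue) (auto simp: decreasing_weight_def)

lemma sets_wm [measurable_cong, simp]: "sets wm = sets pos_lebesgue" by (simp add: wm_def)

lemma space_wm [simp]: "space wm = {0<..}" by (simp add: wm_def)

lemma borel_sets_wm: "A \<in> sets borel \<Longrightarrow> A \<subseteq> {0<..} \<Longrightarrow> A \<in> sets pos_lebesgue"
  by (subst sets_restrict_space_iff) auto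

lemma interval_sets [measurable]: "{t. 0 < t \<and> ennreal t < a} \<in> sets pos_lebesgue"
proof -
  have "{t \<in> space borel. 0 < t \<and> ennreal t < a} \<in> sets borel" by measurable
  then show ?thesis by (intro borel_sets_wm) auto
qed

lemma AE_wm: "(AE t in wm. P t) \<longleftrightarrow> (AE t in pos_lebesgue. P t)"
  unfolding wm_def by (subst AE_density) (auto intro!: AE_cong simp: \<omega>_pos)

lemma nn_integral_wm: "f \<in> borel_measurable pos_lebesgue \<Longrightarrow>
    (\<integral>\<^sup>+t. f t \<partial>wm) = (\<integral>\<^sup>+t. f t * ennreal (\<omega> t) \<partial>pos_lebesgue)"
  unfolding wm_def by (subst nn_integral_density) (auto simp: mult.commute)

lemma emeasure_wm: "A \<in> sets pos_lebesgue \<Longrightarrow>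
    emeasure wm A = (\<integral>\<^sup>+t. ennreal (\<omega> t) * indicator A t \<partial>pos_lebesgue)"
  unfolding wm_def by (rule emeasure_density) auto

lemma emeasure_wm_Ioc_finite: "emeasure wm {0<..a} < \<infinity>"
proof (cases "0 < a")
  case True
  have "set_integrable lebesgue {0<..a} \<omega>" using weight True by (auto simp: decreasing_weight_def)
  then have i: "integrable lebesgue (\<lambda>t. indicator {0<..a} t * \<omega> t)"
    by (simp add: set_integrable_def)
  have "emeasure wm {0<..a} = (\<integral>\<^sup>+t. ennreal (\<omega> t) * indicator {0<..a} t \<partial>pos_lebesgue)"
    by (rule emeasure_wm) (auto intro: borel_sets_wm)
  also have "\<dots> = (\<integral>\<^sup>+t. ennreal (\<omega> t) * indicator {0<..a} t * indicator {0<..} t \<partial>lebesgue)"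
    by (subst nn_integral_restrict_space) auto
  also have "\<dots> = (\<integral>\<^sup>+t. ennreal (norm (indicator {0<..a} t * \<omega> t)) \<partial>lebesgue)"
    by (intro nn_integral_cong) (auto split: split_indicator simp: \<omega>_pos less_imp_le)
  also have "\<dots> < \<infinity>" using i unfolding integrable_iff_bounded by blast
  finally show ?thesis .
qed auto

lemma W_finite: "W (ennreal a) < \<infinity>"
proof -
  have "W (ennreal a) \<le> emeasure wm {0<..a}"
    unfolding W_def by (rule emeasure_mono) (auto simp: ennreal_less_iff intro!: borel_sets_wm)
  then show ?thesis using emeasure_wm_Ioc_finite[of a] by (rule order_le_less_trans)
qed

lemma sigma_finite_wm: "sigma_finite_measure wm"
proof
  have "x \<in> (\<Union>n. {0<..real n})" if "0 < x" for x
    using real_arch_simple[of x] that by auto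
  then have "(\<Union>n. {0<..real n}) = space wm" by auto
  then show "\<exists>A. countable A \<and> A \<subseteq> sets wm \<and> \<Union> A = space wm \<and> (\<forall>a\<in>A. emeasure wm a \<noteq> \<infinity>)"
    using emeasure_wm_Ioc_finite
    by (intro exI[of _ "range (\<lambda>n. {0<..real n})"]) (auto simp: less_top intro!: borel_sets_wm)
qed

sublocale wm: sigma_finite_measure wm by (rule sigma_finite_wm)

lemma W_mono: "a \<le> b \<Longrightarrow> W a \<le> W b"
  unfolding W_def by (rule emeasure_mono) auto

lemma W_0 [simp]: "W 0 = 0" by (simp add: W_def)

lemma W_top [simp]: "W top = \<infinity>"
proof -
  have "W top = emeasure wm {0<..}" unfolding W_def by (rule arg_cong[where f="emeasure _"]) auto
  also have "\<dots> = (\<integral>\<^sup>+t. ennreal (\<omega> t) * indicator {0<..} t \<partial>pos_lebesgue)"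
    by (rule emeasure_wm) (auto intro: borel_sets_wm)
  also have "\<dots> = (\<integral>\<^sup>+t. ennreal (\<omega> t) \<partial>pos_lebesgue)"
    by (intro nn_integral_cong) auto
  also have "\<dots> = \<infinity>" using weight by (simp add: decreasing_weight_def)
  finally show ?thesis .
qed

text \<open>Fatou's lemma for the indicators of the initial intervals. It serves as lower
  semicontinuity at finite and infinite arguments alike.\<close>

lemma W_liminf:
  assumes "a \<le> liminf b" shows "W a \<le> liminf (\<lambda>n. W (b n))"
proof -
  have "W a = (\<integral>\<^sup>+t. indicator {t. 0 < t \<and> ennreal t < a} t \<partial>wm)"
    by (simp add: W_def)
  also have "\<dots> \<le> (\<integral>\<^sup>+t. liminf (\<lambda>n. indicator {t. 0 < t \<and> ennreal t < b n} t) \<partial>wm)"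
  proof (rule nn_integral_mono)
    fix t
    show "indicator {t. 0 < t \<and> ennreal t < a} t \<le> liminf (\<lambda>n. indicator {t. 0 < t \<and> ennreal t < b n} t :: ennreal)"
    proof (cases "0 < t \<and> ennreal t < a")
      case True
      then have "\<forall>\<^sub>F n in sequentially. ennreal t < b n" using assms less_LiminfD order_less_le_trans by blast
      then have "1 \<le> liminf (\<lambda>n. indicator {t. 0 < t \<and> ennreal t < b n} t :: ennreal)"
        by (intro Liminf_bounded) (auto elim!: eventually_mono simp: True)
      then show ?thesis using True by simp
    qed auto
  qed
  also have "\<dots> \<le> liminf (\<lambda>n. \<integral>\<^sup>+t. indicator {t. 0 < t \<and> ennreal t < b n} t \<partial>wm)"
    by (rule nn_integral_liminf) measurable
  finally show ?thesis by (simp add: W_def)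
qed

text \<open>Moving mass of \<open>\<beta>\<close> to the left can only increase the integral,
  because \<open>v\<close> times the weight decreases. Indicators \<open>\<beta>\<close> give the
  inequality for sets; general \<open>\<beta>\<close> are required for the aligned weight.\<close>

lemma bathtub:
  fixes v \<beta> :: "real \<Rightarrow> ennreal"
  assumes v: "\<And>s t. 0 < s \<Longrightarrow> s \<le> t \<Longrightarrow> v t \<le> v s" and [measurable]: "v \<in> borel_measurable pos_lebesgue" "\<beta> \<in> borel_measurable pos_lebesgue"
    and \<beta>: "AE t in pos_lebesgue. \<beta> t \<le> 1" "(\<integral>\<^sup>+t. \<beta> t \<partial>pos_lebesgue) \<le> m"
  shows "(\<integral>\<^sup>+t. \<beta> t * v t \<partial>wm) \<le> (\<integral>\<^sup>+t. indicator {t. 0 < t \<and> ennreal t < m} t * v t \<partial>wm)"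
proof -
  let ?I = "{t. 0 < t \<and> ennreal t < m}"
  have AE\<beta>: "AE t in wm. \<beta> t \<le> 1" using \<beta>(1) by (simp add: AE_wm)
  consider "m = \<infinity>" | "m = 0" | r where "0 < r" "m = ennreal r"
    by (cases m) (auto simp: less_le)
  then show ?thesis
  proof cases
    case 1
    have "AE t in wm. \<beta> t * v t \<le> indicator {t. 0 < t \<and> ennreal t < m} t * v t"
      using AE\<beta> AE_space[of wm] 
    proof eventually_elim
      fix t assume "\<beta> t \<le> 1" "t \<in> space wm"
      then show "\<beta> t * v t \<le> indicator {t. 0 < t \<and> ennreal t < m} t * v t"
        using mult_right_mono[of "\<beta> t" 1 "v t"] 1 by simp
    qed
    then show ?thesis by (rule nn_integral_mono_AE)
  next
    case 2
    then have "AE t in wm. \<beta> t = 0" using \<beta>(2) by (simp add: AE_wm nn_integral_0_iff_AE)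
    then have "(\<integral>\<^sup>+t. \<beta> t * v t \<partial>wm) = (\<integral>\<^sup>+t. 0 \<partial>wm)"
      by (intro nn_integral_cong_AE) (auto elim!: AE_mp)
    then show ?thesis by simp
  next
    case (3 r)
    let ?J = "{t. r \<le> t}"
    have J[measurable]: "?J \<in> sets pos_lebesgue"
    proof -
      have "?J \<in> sets borel" by auto
      then show ?thesis using 3 by (intro borel_sets_wm) auto
    qed
    define k where "k t = v t * ennreal (\<omega> t)" for t
    have [measurable]: "k \<in> borel_measurable pos_lebesgue" unfolding k_def by measurable
    have k: "k t \<le> k s" if "0 < s" "s \<le> t" for s t
      unfolding k_def using that v \<omega>_antimono by (intro mult_mono) (auto intro: ennreal_leI)
    have I: "?I = {0<..<r}" using 3 by (auto simp: ennreal_less_iff)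
    have [measurable]: "{0<..<r} \<in> sets pos_lebesgue" by (rule borel_sets_wm) auto
    have fin: "(\<integral>\<^sup>+t. \<beta> t * indicator ?I t \<partial>pos_lebesgue) < \<infinity>"
    proof -
      have "(\<integral>\<^sup>+t. \<beta> t * indicator ?I t \<partial>pos_lebesgue) \<le> (\<integral>\<^sup>+t. \<beta> t \<partial>pos_lebesgue)"
        by (intro nn_integral_mono) (auto split: split_indicator)
      also have "\<dots> < \<infinity>" using \<beta>(2) 3 by (simp add: order_le_less_trans)
      finally show ?thesis .
    qed
    have split: "(\<integral>\<^sup>+t. f t \<partial>pos_lebesgue) = (\<integral>\<^sup>+t. f t * indicator ?I t \<partial>pos_lebesgue) + (\<integral>\<^sup>+t. f t * indicator ?J t \<partial>pos_lebesgue)"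
      if [measurable]: "f \<in> borel_measurable pos_lebesgue" for f :: "real \<Rightarrow> ennreal"
      by (subst nn_integral_add[symmetric]) (auto intro!: nn_integral_cong split: split_indicator simp: I)
    have one: "(\<integral>\<^sup>+t. (1 - \<beta> t) * indicator ?I t \<partial>pos_lebesgue) + (\<integral>\<^sup>+t. \<beta> t * indicator ?I t \<partial>pos_lebesgue) = m"
    proof -
      have "(\<integral>\<^sup>+t. (1 - \<beta> t) * indicator ?I t \<partial>pos_lebesgue) + (\<integral>\<^sup>+t. \<beta> t * indicator ?I t \<partial>pos_lebesgue)
        = (\<integral>\<^sup>+t. (1 - \<beta> t) * indicator ?I t + \<beta> t * indicator ?I t \<partial>pos_lebesgue)"
        by (rule nn_integral_add[symmetric]) measurable
      also have "\<dots> = (\<integral>\<^sup>+t. indicator ?I t \<partial>pos_lebesgue)"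
        by (rule nn_integral_cong_AE, use \<beta>(1) in eventually_elim)
          (auto split: split_indicator simp: diff_add_cancel_ennreal)
      also have "\<dots> = m" unfolding I using 3 by (simp add: emeasure_pos_lebesgue_Ioo)
      finally show ?thesis .
    qed
    have "(\<integral>\<^sup>+t. \<beta> t * indicator ?J t \<partial>pos_lebesgue) \<le> (\<integral>\<^sup>+t. (1 - \<beta> t) * indicator ?I t \<partial>pos_lebesgue)"
    proof -
      have "(\<integral>\<^sup>+t. \<beta> t * indicator ?J t \<partial>pos_lebesgue) + (\<integral>\<^sup>+t. \<beta> t * indicator ?I t \<partial>pos_lebesgue) \<le> m"
        using \<beta>(2) split[of \<beta>] by (simp add: add.commute)
      then have "(\<integral>\<^sup>+t. \<beta> t * indicator ?I t \<partial>pos_lebesgue) + (\<integral>\<^sup>+t. \<beta> t * indicator ?J t \<partial>pos_lebesgue) \<le>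
          (\<integral>\<^sup>+t. \<beta> t * indicator ?I t \<partial>pos_lebesgue) + (\<integral>\<^sup>+t. (1 - \<beta> t) * indicator ?I t \<partial>pos_lebesgue)"
        using one by (simp only: add.commute)
      then show ?thesis using fin unfolding ennreal_add_left_cancel_le by (metis less_irrefl)
    qed
    \<comment> \<open>The mass of \<open>\<beta>\<close> beyond \<open>r\<close> is at most the mass
      missing before \<open>r\<close>, and the boundary value \<open>k r\<close> separates the
      integrand on the two sides.\<close>
    then have le: "k r * (\<integral>\<^sup>+t. \<beta> t * indicator ?J t \<partial>pos_lebesgue) \<le> k r * (\<integral>\<^sup>+t. (1 - \<beta> t) * indicator ?I t \<partial>pos_lebesgue)"
      by (rule mult_left_mono) simp
    have "(\<integral>\<^sup>+t. \<beta> t * v t \<partial>wm) = (\<integral>\<^sup>+t. \<beta> t * k t \<partial>pos_lebesgue)"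
      by (subst nn_integral_wm) (auto simp: k_def mult.assoc)
    also have "\<dots> = (\<integral>\<^sup>+t. \<beta> t * k t * indicator ?I t \<partial>pos_lebesgue) + (\<integral>\<^sup>+t. \<beta> t * k t * indicator ?J t \<partial>pos_lebesgue)"
      by (rule split) measurable
    also have "(\<integral>\<^sup>+t. \<beta> t * k t * indicator ?J t \<partial>pos_lebesgue) \<le> (\<integral>\<^sup>+t. k r * (\<beta> t * indicator ?J t) \<partial>pos_lebesgue)"
      using k[of r] 3 by (intro nn_integral_mono) (auto split: split_indicator simp: mult.commute intro!: mult_left_mono)
    also have "\<dots> = k r * (\<integral>\<^sup>+t. \<beta> t * indicator ?J t \<partial>pos_lebesgue)"
      by (rule nn_integral_cmult) measurable
    also note le
    also have "k r * (\<integral>\<^sup>+t. (1 - \<beta> t) * indicator ?I t \<partial>pos_lebesgue) = (\<integral>\<^sup>+t. k r * ((1 - \<beta> t) * indicator ?I t) \<partial>pos_lebesgue)"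
      by (rule nn_integral_cmult[symmetric]) measurable
    also have "\<dots> \<le> (\<integral>\<^sup>+t. (1 - \<beta> t) * k t * indicator ?I t \<partial>pos_lebesgue)"
      using k[of _ r] by (intro nn_integral_mono) (auto split: split_indicator simp: I mult.commute intro!: mult_right_mono)
    also have "(\<integral>\<^sup>+t. \<beta> t * k t * indicator ?I t \<partial>pos_lebesgue) + (\<integral>\<^sup>+t. (1 - \<beta> t) * k t * indicator ?I t \<partial>pos_lebesgue)
        = (\<integral>\<^sup>+t. \<beta> t * k t * indicator ?I t + (1 - \<beta> t) * k t * indicator ?I t \<partial>pos_lebesgue)"
      by (rule nn_integral_add[symmetric]) measurable
    also have "\<dots> = (\<integral>\<^sup>+t. indicator ?I t * k t \<partial>pos_lebesgue)"
    proof (rule nn_integral_cong_AE, use \<beta>(1) in eventually_elim)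
      fix t assume "\<beta> t \<le> 1"
      then have "\<beta> t + (1 - \<beta> t) = 1" by (simp add: add_diff_inverse_ennreal)
      then show "\<beta> t * k t * indicator ?I t + (1 - \<beta> t) * k t * indicator ?I t = indicator ?I t * k t"
        by (metis (no_types, lifting) distrib_right mult.commute mult_1)
    qed
    also have "\<dots> = (\<integral>\<^sup>+t. indicator ?I t * v t \<partial>wm)"
      by (subst nn_integral_wm) (auto simp: k_def mult.assoc)
    finally show ?thesis by (simp add: add_left_mono)
  qed
qed

lemma emeasure_wm_le_W:
  assumes [measurable]: "A \<in> sets pos_lebesgue"
  shows "emeasure wm A \<le> W (emeasure pos_lebesgue A)"
proof -
  have "(\<integral>\<^sup>+t. indicator A t * 1 \<partial>wm) \<le>
      (\<integral>\<^sup>+t. indicator {t. 0 < t \<and> ennreal t < emeasure pos_lebesgue A} t * 1 \<partial>wm)"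
    by (rule bathtub) (auto split: split_indicator)
  then show ?thesis by (simp add: W_def)
qed

text \<open>Since the weight decreases, an interval of length \<open>b\<close> starting at
  \<open>a\<close> weighs no more than one starting at \<open>0\<close>.\<close>

lemma W_add_le: "W (a + b) \<le> W a + W b"
proof (cases "a = \<infinity> \<or> b = \<infinity>")
  case False
  then obtain x y where xy: "a = ennreal x" "b = ennreal y" "0 \<le> x" "0 \<le> y"
    by (metis ennreal_cases infinity_ennreal_def)
  let ?B = "{t. 0 < t \<and> x \<le> t \<and> t < x + y}"
  have B[measurable]: "?B \<in> sets pos_lebesgue"
  proof -
    have "{t \<in> space borel. 0 < t \<and> x \<le> t \<and> t < x + y} \<in> sets borel" by measurable
    then show ?thesis by (intro borel_sets_wm) auto
  qed
  have "{t. 0 < t \<and> ennreal t < a + b} = {t. 0 < t \<and> ennreal t < a} \<union> ?B"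
    using xy by (auto simp: ennreal_less_iff ennreal_plus[symmetric] simp del: ennreal_plus)
  then have "W (a + b) = emeasure wm ({t. 0 < t \<and> ennreal t < a} \<union> ?B)" by (simp only: W_def)
  also have "\<dots> \<le> W a + emeasure wm ?B"
    unfolding W_def by (rule emeasure_subadditive) (simp_all add: B)
  also have "emeasure wm ?B \<le> W (emeasure pos_lebesgue ?B)" by (rule emeasure_wm_le_W) (rule B)
  also have "\<dots> \<le> W b"
  proof (rule W_mono)
    have "emeasure pos_lebesgue ?B = emeasure lebesgue ?B" by (subst emeasure_restrict_space) auto
    also have "\<dots> \<le> emeasure lebesgue {x..x+y}" by (rule emeasure_mono) auto
    also have "\<dots> = b" using xy by simp
    finally show "emeasure pos_lebesgue ?B \<le> b" .
  qed
  finally show ?thesis by (simp add: add_left_mono)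
qed auto

text \<open>Finite subadditivity passes to the limit by lower semicontinuity. This later bounds the
  modular of a countable disjoint sum.\<close>

lemma W_suminf_le: "W (\<Sum>n. a n) \<le> (\<Sum>n. W (a n))"
proof -
  have fin: "W (\<Sum>i<n. a i) \<le> (\<Sum>i<n. W (a i))" for n
    by (induction n) (auto intro: order_trans[OF W_add_le] add_right_mono)
  have "(\<lambda>n. \<Sum>i<n. a i) \<longlonglongrightarrow> (\<Sum>n. a n)" using summable_LIMSEQ[of a] by simp
  then have "liminf (\<lambda>n. \<Sum>i<n. a i) = (\<Sum>n. a n)" by (intro lim_imp_Liminf) auto
  then have "W (\<Sum>n. a n) \<le> liminf (\<lambda>n. W (\<Sum>i<n. a i))" by (intro W_liminf) simp
  also have "\<dots> \<le> (\<Sum>n. W (a n))"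
    using order_trans[OF fin sum_le_suminf[of "\<lambda>n. W (a n)"]]
    by (intro Liminf_le[THEN order_trans, OF _ ] ) auto
  finally show ?thesis .
qed

definition Wr :: "real \<Rightarrow> real" where "Wr a = enn2real (W (ennreal a))"

lemma W_ennreal: "W (ennreal a) = ennreal (Wr a)"
  using W_finite[of a] by (simp add: Wr_def)

lemma Wr_nonneg [simp]: "0 \<le> Wr a" by (simp add: Wr_def)

lemma Wr_0 [simp]: "Wr 0 = 0" by (simp add: Wr_def)

lemma emeasure_wm_Ico:
  assumes "0 < a" "a \<le> b" shows "emeasure wm {a..<b} = ennreal (Wr b - Wr a)"
proof -
  have e: "{t. 0 < t \<and> ennreal t < ennreal x} = {0<..<x}" if "0 < x" for x
    using that by (auto simp: ennreal_less_iff)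
  have "{0<..<b} = {0<..<a} \<union> {a..<b}" using assms by auto
  then have "emeasure wm {0<..<b} = emeasure wm {0<..<a} + emeasure wm {a..<b}"
    using assms by (subst plus_emeasure) (auto intro!: borel_sets_wm)
  moreover have "emeasure wm {0<..<b} = ennreal (Wr b)" "emeasure wm {0<..<a} = ennreal (Wr a)"
    using assms W_ennreal[of b] W_ennreal[of a] e[of a] e[of b] by (auto simp: W_def)
  ultimately have "ennreal (Wr b) - ennreal (Wr a) = emeasure wm {a..<b}" by simp
  then show ?thesis by (simp add: ennreal_minus)
qed

lemma emeasure_wm_Ioo: "0 < a \<Longrightarrow> emeasure wm {0<..<a} = ennreal (Wr a)"
proof -
  assume "0 < a"
  then have "{t. 0 < t \<and> ennreal t < ennreal a} = {0<..<a}" by (auto simp: ennreal_less_iff)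
  then show ?thesis using W_ennreal[of a] by (simp add: W_def)
qed

lemma W_strict_mono: assumes "a < b" "a \<noteq> \<infinity>" shows "W a < W b"
proof -
  obtain x where x: "a = ennreal x" "0 \<le> x" using assms(2) by (metis ennreal_cases infinity_ennreal_def)
  show ?thesis
  proof (cases b)
    case top then show ?thesis using W_finite x by simp
  next
    case (real y)
    have xy: "x < y" using assms x real by (simp add: ennreal_less_iff)
    let ?B = "{x<..<y}"
    have B[measurable]: "?B \<in> sets pos_lebesgue" using x by (intro borel_sets_wm) auto
    have "emeasure wm ?B \<noteq> 0"
    proof
      assume "emeasure wm ?B = 0"
      then have "?B \<in> null_sets wm" by (intro null_setsI) auto
      then have "AE t in wm. t \<notin> ?B" by (rule AE_not_in)
      then have "AE t in pos_lebesgue. t \<notin> ?B" by (simp add: AE_wm)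
      then have "emeasure pos_lebesgue ?B = 0" by (subst (asm) AE_iff_null_sets[symmetric]) auto
      then show False using x xy by (subst (asm) emeasure_restrict_space) auto
    qed
    moreover have "W a + emeasure wm ?B \<le> W b"
      unfolding W_def using x real
      using xy by (subst plus_emeasure) (auto intro!: emeasure_mono simp: ennreal_less_iff)
    moreover have "W a < top" using W_finite x by simp
    ultimately show ?thesis
      using ennreal_add_left_cancel_le[of "W a" "emeasure wm ?B" 0]
      by (metis add.right_neutral infinity_ennreal_def le_zero_eq less_irrefl not_less order_trans)
  qed
qed

lemma Wr_mono: "a \<le> b \<Longrightarrow> Wr a \<le> Wr b"
proof -
  assume "a \<le> b"
  then have "ennreal (Wr a) \<le> ennreal (Wr b)" unfolding W_ennreal[symmetric] by (intro W_mono ennreal_leI)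
  then show ?thesis by simp
qed

lemma Wr_strict_mono: "0 \<le> a \<Longrightarrow> a < b \<Longrightarrow> Wr a < Wr b"
  using W_strict_mono[of "ennreal a" "ennreal b"] unfolding W_ennreal by (simp add: ennreal_less_iff)

lemma Wr_pos: "0 < a \<Longrightarrow> 0 < Wr a"
  using Wr_strict_mono[of 0 a] by simp

text \<open>The weight may be unbounded near \<open>0\<close>, so a Lipschitz bound holds only away
  from \<open>0\<close>; smallness near \<open>0\<close> is obtained separately in
  \<open>Wr_small\<close>.\<close>

lemma Wr_lipschitz: "0 < c \<Longrightarrow> c \<le> a \<Longrightarrow> a \<le> b \<Longrightarrow> Wr b - Wr a \<le> \<omega> c * (b - a)"
proof -
  assume *: "0 < c" "c \<le> a" "a \<le> b"
  have [measurable]: "{a..<b} \<in> sets pos_lebesgue" using * by (intro borel_sets_wm) auto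
  have "ennreal (Wr b - Wr a) = emeasure wm {a..<b}" using * by (simp add: emeasure_wm_Ico)
  also have "\<dots> = (\<integral>\<^sup>+t. ennreal (\<omega> t) * indicator {a..<b} t \<partial>pos_lebesgue)"
    by (rule emeasure_wm) measurable
  also have "\<dots> \<le> (\<integral>\<^sup>+t. ennreal (\<omega> c) * indicator {a..<b} t \<partial>pos_lebesgue)"
    using * \<omega>_antimono by (intro nn_integral_mono) (auto split: split_indicator intro!: ennreal_leI)
  also have "\<dots> = ennreal (\<omega> c) * emeasure pos_lebesgue {a..<b}"
    by (rule nn_integral_cmult_indicator) measurable
  also have "emeasure pos_lebesgue {a..<b} = ennreal (b - a)"
    using * by (subst emeasure_restrict_space) auto
  also have "ennreal (\<omega> c) * ennreal (b - a) = ennreal (\<omega> c * (b - a))"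
    using * \<omega>_pos[of c] by (simp add: ennreal_mult)
  finally show ?thesis using * \<omega>_pos[of c] by (simp add: ennreal_le_iff)
qed

lemma Wr_continuous: "continuous_on {0<..} Wr"
proof (rule continuous_at_imp_continuous_on, intro ballI)
  fix a :: real assume "a \<in> {0<..}"
  then have a: "0 < a" by simp
  have "(Wr \<longlongrightarrow> Wr a) (at a)"
  proof (rule Lim_null_comparison[THEN LIM_zero_cancel])
    have L: "\<bar>Wr x - Wr a\<bar> \<le> \<omega> (a/2) * \<bar>x - a\<bar>" if "a/2 < x" for x
      using Wr_lipschitz[of "a/2" x a] Wr_lipschitz[of "a/2" a x] Wr_mono[of a x] Wr_mono[of x a] that a
      by (cases "x \<le> a") auto
    have "\<forall>\<^sub>F x in at a. a/2 < x" using a by (intro order_tendstoD) auto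
    then show "\<forall>\<^sub>F x in at a. norm (Wr x - Wr a) \<le> \<omega> (a/2) * \<bar>x - a\<bar>"
      by eventually_elim (use L in auto)
    show "((\<lambda>x. \<omega> (a/2) * \<bar>x - a\<bar>) \<longlongrightarrow> 0) (at a)"
      by (auto intro!: tendsto_eq_intros)
  qed
  then show "isCont Wr a" by (simp add: isCont_def)
qed

lemma Wr_small: assumes "0 < c" shows "\<exists>a>0. Wr a < c"
proof -
  define A where "A n = {0<..1 / real (Suc n)}" for n
  have "decseq A"
  proof (rule decseq_SucI)
    fix n
    have "1 / real (Suc (Suc n)) \<le> 1 / real (Suc n)" by (intro divide_left_mono) auto
    then show "A (Suc n) \<le> A n" unfolding A_def by (auto simp del: of_nat_Suc)
  qed
  moreover have "(\<Inter>n. A n) = {}"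
  proof -
    have False if "x \<in> (\<Inter>n. A n)" for x
    proof -
      have "0 < x" "\<And>n. x \<le> 1 / real (Suc n)" using that by (auto simp: A_def)
      then show False using reals_Archimedean[of x] by (metis inverse_eq_divide not_less)
    qed
    then show ?thesis by blast
  qed
  ultimately have "(INF n. emeasure wm (A n)) = 0"
    using emeasure_wm_Ioc_finite by (subst INF_emeasure_decseq) (auto simp: A_def less_top intro!: borel_sets_wm)
  then have "(INF n. emeasure wm (A n)) < ennreal c" using assms by simp
  then obtain n where n: "emeasure wm (A n) < ennreal c" by (auto simp: INF_less_iff)
  have "emeasure wm {0<..<1 / real (Suc n)} \<le> emeasure wm (A n)"
    unfolding A_def by (intro emeasure_mono) (auto intro!: borel_sets_wm)
  then have "ennreal (Wr (1 / real (Suc n))) < ennreal c"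
    using n by (subst (asm) emeasure_wm_Ioo) auto
  then show ?thesis by (intro exI[of _ "1 / real (Suc n)"]) (auto simp: ennreal_less_iff)
qed

text \<open>The total mass of the weight is infinite, and lower semicontinuity transfers this to
  large finite arguments.\<close>

lemma Wr_large: "\<exists>a>0. c < Wr a"
proof -
  have "liminf (\<lambda>n. ennreal (real n)) = top"
    using of_nat_tendsto_top_ennreal by (intro lim_imp_Liminf) (auto simp: ennreal_of_nat_eq_real_of_nat)
  then have "W top \<le> liminf (\<lambda>n. W (ennreal (real n)))" by (intro W_liminf) simp
  then have "ennreal c < liminf (\<lambda>n. W (ennreal (real n)))" by (simp add: top.extremum_unique)
  then have "\<forall>\<^sub>F n in sequentially. ennreal c < W (ennreal (real n))" by (rule less_LiminfD)
  then have "\<forall>\<^sub>F n in sequentially. ennreal c < W (ennreal (real n)) \<and> 0 < n"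
    using eventually_gt_at_top[of 0] by (rule eventually_conj)
  then obtain n where "ennreal c < W (ennreal (real n))" "0 < n"
    by (auto simp: eventually_sequentially)
  moreover from this have "c < Wr (real n)" unfolding W_ennreal
    by (cases "0 \<le> c") (auto simp: ennreal_less_iff intro: order_less_le_trans[OF _ Wr_nonneg])
  ultimately show ?thesis by (intro exI[of _ "real n"]) auto
qed

text \<open>The block constructions choose the lengths of their pieces by prescribing
  weights.\<close>

lemma Wr_surj: assumes "0 < c" shows "\<exists>a>0. Wr a = c"
proof -
  obtain a where a: "0 < a" "Wr a < c" using Wr_small[OF assms] by blast
  obtain b where b: "0 < b" "c < Wr b" using Wr_large by blast
  have ab: "a \<le> b" using a b Wr_mono[of b a] by linarith
  have "\<exists>x\<ge>a. x \<le> b \<and> Wr x = c"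
    using a b ab by (intro IVT' continuous_on_subset[OF Wr_continuous]) auto
  then obtain x where "a \<le> x" "Wr x = c" by blast
  then show ?thesis using a by (intro exI[of _ x]) auto
qed

lemma nn_integral_rearr_eq:
  assumes h: "h \<in> borel_measurable pos_lebesgue"
  shows "(\<integral>\<^sup>+t. rearr h t \<partial>wm) = (\<integral>\<^sup>+l. indicator {0..} l * W (level_measure h l) \<partial>lborel)"
proof -
  have "(\<integral>\<^sup>+t. rearr h t * 1 \<partial>wm) =
      (\<integral>\<^sup>+l. indicator {0..} l * (\<integral>\<^sup>+t. indicator {t. ennreal l < rearr h t} t * 1 \<partial>wm) \<partial>lborel)"
    by (rule nn_integral_layer_cake[OF sigma_finite_wm]) (auto simp: wm_def intro: borel_pos_lebesgue)
  also have "\<dots> = (\<integral>\<^sup>+l. indicator {0..} l * W (level_measure h l) \<partial>lborel)"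
  proof (intro nn_integral_cong)
    fix l :: real
    have "(\<integral>\<^sup>+t. indicator {t. ennreal l < rearr h t} t * 1 \<partial>wm) = (\<integral>\<^sup>+t. indicator {t. 0 < t \<and> ennreal t < level_measure h l} t \<partial>wm)"
      if "0 \<le> l"
      using that rearr_gt_iff[OF h that] by (intro nn_integral_cong) (auto split: split_indicator)
    then show "indicator {0..} l * (\<integral>\<^sup>+t. indicator {t. ennreal l < rearr h t} t * 1 \<partial>wm) =
        indicator {0..} l * W (level_measure h l)"
      by (auto split: split_indicator simp: W_def)
  qed
  finally show ?thesis by simp
qed

text \<open>Slicing \<open>f\<close> into superlevel sets reduces the inequality to indicators,
  which is the hypothesis \<open>le\<close>. Leaving \<open>V\<close> and \<open>v\<close> general
  makes room for the aligned weight.\<close>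

lemma Hardy_Littlewood:
  fixes V v :: "real \<Rightarrow> ennreal"
  assumes [measurable]: "V \<in> borel_measurable pos_lebesgue" "v \<in> borel_measurable pos_lebesgue"
    and f[measurable]: "f \<in> borel_measurable pos_lebesgue"
    and le: "\<And>B. B \<in> sets pos_lebesgue \<Longrightarrow> (\<integral>\<^sup>+s. indicator B s * V s \<partial>pos_lebesgue) \<le>
      (\<integral>\<^sup>+t. indicator {t. 0 < t \<and> ennreal t < emeasure pos_lebesgue B} t * v t \<partial>wm)"
  shows "(\<integral>\<^sup>+s. ennreal \<bar>f s\<bar> * V s \<partial>pos_lebesgue) \<le> (\<integral>\<^sup>+t. rearr f t * v t \<partial>wm)"
proof -
  have [measurable]: "rearr f \<in> borel_measurable wm" by (auto simp: wm_def intro: borel_pos_lebesgue)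
  have "(\<integral>\<^sup>+s. ennreal \<bar>f s\<bar> * V s \<partial>pos_lebesgue) =
     (\<integral>\<^sup>+l. indicator {0..} l * (\<integral>\<^sup>+t. indicator {t. ennreal l < ennreal \<bar>f t\<bar>} t * V t \<partial>pos_lebesgue) \<partial>lborel)"
    by (rule nn_integral_layer_cake[OF sigma_finite_pos_lebesgue]) measurable
  also have "\<dots> \<le> (\<integral>\<^sup>+l. indicator {0..} l * (\<integral>\<^sup>+t. indicator {t. ennreal l < rearr f t} t * v t \<partial>wm) \<partial>lborel)"
  proof (intro nn_integral_mono)
    fix l :: real
    have "(\<integral>\<^sup>+t. indicator {t. ennreal l < ennreal \<bar>f t\<bar>} t * V t \<partial>pos_lebesgue) \<le>
      (\<integral>\<^sup>+t. indicator {t. ennreal l < rearr f t} t * v t \<partial>wm)" if l: "0 \<le> l"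
    proof -
      have "(\<integral>\<^sup>+t. indicator {t. ennreal l < ennreal \<bar>f t\<bar>} t * V t \<partial>pos_lebesgue) =
          (\<integral>\<^sup>+t. indicator {s \<in> space pos_lebesgue. l < \<bar>f s\<bar>} t * V t \<partial>pos_lebesgue)"
        using l by (intro nn_integral_cong) (auto split: split_indicator simp: ennreal_less_iff)
      also have "\<dots> \<le> (\<integral>\<^sup>+t. indicator {t. 0 < t \<and> ennreal t < level_measure f l} t * v t \<partial>wm)"
        unfolding level_measure_def by (rule le) measurable
      also have "\<dots> = (\<integral>\<^sup>+t. indicator {t. ennreal l < rearr f t} t * v t \<partial>wm)"
        using rearr_gt_iff[OF f l] by (intro nn_integral_cong) (auto split: split_indicator)
      finally show ?thesis .
    qed
    then show "indicator {0..} l * (\<integral>\<^sup>+t. indicator {t. ennreal l < ennreal \<bar>f t\<bar>} t * V t \<partial>pos_lebesgue) \<le>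
      indicator {0..} l * (\<integral>\<^sup>+t. indicator {t. ennreal l < rearr f t} t * v t \<partial>wm)"
      by (auto split: split_indicator)
  qed
  also have "\<dots> = (\<integral>\<^sup>+t. rearr f t * v t \<partial>wm)"
    by (rule nn_integral_layer_cake[symmetric, OF sigma_finite_wm]) measurable
  finally show ?thesis .
qed

end

lemma antimono_ennreal_borel:
  fixes F :: "real \<Rightarrow> ennreal"
  assumes "\<And>s t. s \<le> t \<Longrightarrow> F t \<le> F s"
  shows "F \<in> borel_measurable borel"
proof (rule borel_measurableI_greater)
  fix y :: ennreal
  have "is_interval {t. y < F t}"
    unfolding is_interval_1 using assms by (auto intro: order_less_le_trans)
  then have "{t. y < F t} \<in> sets borel" by (rule real_interval_borel_measurable)
  then show "{t \<in> space borel. y < F t} \<in> sets borel" by simp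
qed

section \<open>Orlicz functions, subgradients and growth conditions\<close>

locale orlicz_fun =
  fixes \<phi> :: "real \<Rightarrow> real"
  assumes orlicz: "orlicz_function \<phi>"
begin

lemma \<phi>_convex: "convex_on UNIV \<phi>" and \<phi>_nonneg [simp]: "0 \<le> \<phi> u" and \<phi>_0 [simp]: "\<phi> 0 = 0"
  and \<phi>_pos: "0 < u \<Longrightarrow> 0 < \<phi> u"
  using orlicz by (auto simp: orlicz_function_def)

lemma \<phi>_convexD: "0 \<le> t \<Longrightarrow> t \<le> 1 \<Longrightarrow> \<phi> ((1 - t) * x + t * y) \<le> (1 - t) * \<phi> x + t * \<phi> y"
  using convex_onD[OF \<phi>_convex, of t x y] by simp

lemma \<phi>_continuous: "continuous_on UNIV \<phi>"
  by (rule convex_on_continuous) (auto simp: \<phi>_convex)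

lemma \<phi>_isCont: "isCont \<phi> x"
  using \<phi>_continuous by (simp add: continuous_on_eq_continuous_at)

lemma \<phi>_measurable [measurable]: "\<phi> \<in> borel_measurable borel"
  using \<phi>_continuous by (rule borel_measurable_continuous_onI)

lemma \<phi>_scale_le: "0 \<le> c \<Longrightarrow> c \<le> 1 \<Longrightarrow> \<phi> (c * u) \<le> c * \<phi> u"
  using \<phi>_convexD[of c 0 u] by simp

lemma \<phi>_ratio_mono: assumes "0 < u" "u \<le> v" shows "\<phi> u / u \<le> \<phi> v / v"
proof -
  have "\<phi> ((u / v) * v) \<le> (u / v) * \<phi> v" using assms by (intro \<phi>_scale_le) auto
  then show ?thesis using assms by (simp add: field_simps)
qed

lemma \<phi>_scale_ge: "1 \<le> c \<Longrightarrow> 0 \<le> u \<Longrightarrow> c * \<phi> u \<le> \<phi> (c * u)"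
  using \<phi>_scale_le[of "1 / c" "c * u"] by (simp add: field_simps)

lemma \<phi>_strict_mono: assumes "0 \<le> x" "x < y" shows "\<phi> x < \<phi> y"
proof -
  have "\<phi> ((x / y) * y) \<le> (x / y) * \<phi> y" using assms by (intro \<phi>_scale_le) auto
  also have "\<dots> < 1 * \<phi> y" using assms \<phi>_pos[of y] by (intro mult_strict_right_mono) auto
  finally show ?thesis using assms by simp
qed

lemma \<phi>_mono: "0 \<le> x \<Longrightarrow> x \<le> y \<Longrightarrow> \<phi> x \<le> \<phi> y"
  using \<phi>_strict_mono[of x y] by (cases "x = y") auto

lemma \<phi>_surj: assumes "0 \<le> l" shows "\<exists>m\<ge>0. \<phi> m = l"
proof -
  define b where "b = 1 + l / \<phi> 1"
  have p: "0 < \<phi> 1" by (rule \<phi>_pos) simp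
  have b: "1 \<le> b" using assms p by (simp add: b_def)
  have "l \<le> b * \<phi> 1" using p by (simp add: b_def field_simps)
  also have "\<dots> \<le> \<phi> b" using \<phi>_scale_ge[OF b, of 1] by simp
  finally have "\<exists>x\<ge>0. x \<le> b \<and> \<phi> x = l"
    using assms b by (intro IVT' continuous_on_subset[OF \<phi>_continuous]) auto
  then show ?thesis by blast
qed

lemma extend_ennreal: "0 \<le> x \<Longrightarrow> extend \<phi> (ennreal x) = ennreal (\<phi> x)"
  by (simp add: extend_def)

lemma extend_top [simp]: "extend \<phi> top = top" by (simp add: extend_def)

lemma extend_0 [simp]: "extend \<phi> 0 = 0" by (simp add: extend_def)

lemma extend_mono: assumes "a \<le> b" shows "extend \<phi> a \<le> extend \<phi> b"
proof (cases b)
  case (real y)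
  then obtain x where "a = ennreal x" "0 \<le> x" using assms by (cases a) (auto simp: top_unique)
  then show ?thesis using real assms \<phi>_mono[of x y] by (auto simp: extend_ennreal intro!: ennreal_leI)
qed auto

lemma extend_mult_le: assumes "0 \<le> c" "c \<le> 1" shows "extend \<phi> (ennreal c * a) \<le> ennreal c * extend \<phi> a"
proof (cases a)
  case (real x)
  have "extend \<phi> (ennreal c * a) = ennreal (\<phi> (c * x))"
    using real assms by (simp add: ennreal_mult[symmetric] extend_ennreal)
  also have "\<dots> \<le> ennreal (c * \<phi> x)" using assms by (intro ennreal_leI \<phi>_scale_le)
  finally show ?thesis using real assms by (simp add: ennreal_mult extend_ennreal)
next
  case top then show ?thesis using assms by (cases "c = 0") (auto simp: ennreal_mult_top)
qed

lemma extend_add_le: "extend \<phi> (a + b) \<le> (extend \<phi> (2 * a) + extend \<phi> (2 * b)) / 2"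
proof (cases "a = top \<or> b = top")
  case True
  then show ?thesis by (auto simp: ennreal_mult_top ennreal_top_divide)
next
  case False
  then obtain x y where xy: "a = ennreal x" "b = ennreal y" "0 \<le> x" "0 \<le> y" by (metis ennreal_cases)
  have "\<phi> (x + y) \<le> (\<phi> (2 * x) + \<phi> (2 * y)) / 2" using \<phi>_convexD[of "1/2" "2*x" "2*y"] by simp
  then have "ennreal (\<phi> (x + y)) \<le> ennreal ((\<phi> (2 * x) + \<phi> (2 * y)) / 2)" by (rule ennreal_leI)
  also have "\<dots> = (ennreal (\<phi> (2 * x)) + ennreal (\<phi> (2 * y))) / 2"
    by (simp add: divide_ennreal[symmetric])
  finally have "ennreal (\<phi> (x + y)) \<le> (extend \<phi> (ennreal (2 * x)) + extend \<phi> (ennreal (2 * y))) / 2"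
    using xy by (simp add: extend_ennreal del: ennreal_mult'')
  then show ?thesis
    using xy by (simp add: extend_ennreal ennreal_mult ennreal_plus[symmetric] del: ennreal_plus)
qed

abbreviation \<psi> :: "ennreal \<Rightarrow> ennreal" where "\<psi> \<equiv> complementary \<phi>"

lemma \<psi>_mono: "a \<le> b \<Longrightarrow> \<psi> a \<le> \<psi> b"
  unfolding complementary_def by (intro SUP_mono') (auto intro!: ennreal_minus_mono mult_left_mono)

lemma Young_ennreal: "a * b \<le> extend \<phi> a + \<psi> b"
proof (cases a)
  case (real x)
  show ?thesis
  proof (cases "x = 0")
    case False
    then have "ennreal x * b - ennreal (\<phi> x) \<le> \<psi> b"
      unfolding complementary_def using real by (intro SUP_upper) auto
    then have "ennreal x * b \<le> ennreal (\<phi> x) + \<psi> b"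
      by (subst (asm) ennreal_minus_le_iff) auto
    then show ?thesis using real by (simp add: extend_ennreal)
  qed (use real in auto)
qed auto

definition subgrad :: "real \<Rightarrow> real \<Rightarrow> bool" where
  "subgrad x g \<longleftrightarrow> 0 \<le> x \<and> 0 \<le> g \<and> (\<forall>w\<ge>0. \<phi> x + g * (w - x) \<le> \<phi> w)"

lemma subgrad_nonneg: "subgrad x g \<Longrightarrow> \<phi> x \<le> x * g"
  unfolding subgrad_def by (auto simp: algebra_simps dest: spec[of _ 0])

text \<open>The equality case of Young's inequality: \<open>u = x\<close> maximises
  \<open>u * g - \<phi> u\<close>.\<close>

lemma \<psi>_subgrad: assumes "subgrad x g" shows "\<psi> (ennreal g) = ennreal (x * g - \<phi> x)"
proof (rule antisym)
  show "\<psi> (ennreal g) \<le> ennreal (x * g - \<phi> x)"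
    unfolding complementary_def
  proof (rule SUP_least)
    fix u :: real assume u: "u \<in> {0<..}"
    then have "\<phi> x + g * (u - x) \<le> \<phi> u" using assms by (auto simp: subgrad_def)
    then have "u * g - \<phi> u \<le> x * g - \<phi> x" by (simp add: algebra_simps)
    then show "ennreal u * ennreal g - ennreal (\<phi> u) \<le> ennreal (x * g - \<phi> x)"
      using u assms by (simp add: ennreal_mult[symmetric] ennreal_minus subgrad_def ennreal_leI)
  qed
  show "ennreal (x * g - \<phi> x) \<le> \<psi> (ennreal g)"
  proof (cases "x = 0")
    case False
    then have "ennreal x * ennreal g - ennreal (\<phi> x) \<le> \<psi> (ennreal g)"
      unfolding complementary_def using assms by (intro SUP_upper) (auto simp: subgrad_def)
    then show ?thesis using assms by (simp add: ennreal_mult[symmetric] ennreal_minus subgrad_def)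
  qed simp
qed

lemma slope_mono:
  assumes "0 < d" "d \<le> e" shows "(\<phi> (x + d) - \<phi> x) / d \<le> (\<phi> (x + e) - \<phi> x) / e"
proof -
  have eq: "(1 - d/e) * x + d/e * (x + e) = x + d" using assms by (simp add: field_simps)
  have "\<phi> (x + d) \<le> (1 - d/e) * \<phi> x + d/e * \<phi> (x + e)"
    using \<phi>_convexD[of "d/e" x "x+e"] assms unfolding eq by simp
  then show ?thesis using assms by (simp add: field_simps)
qed

lemma slope_mono': 
  assumes "0 < d" "d \<le> e" shows "(\<phi> x - \<phi> (x - e)) / e \<le> (\<phi> x - \<phi> (x - d)) / d"
proof -
  have eq: "(1 - d/e) * x + d/e * (x - e) = x - d" using assms by (simp add: field_simps)
  have "\<phi> (x - d) \<le> (1 - d/e) * \<phi> x + d/e * \<phi> (x - e)"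
    using \<phi>_convexD[of "d/e" x "x-e"] assms unfolding eq by simp
  then show ?thesis using assms by (simp add: field_simps)
qed

lemma slope_left_right:
  assumes "0 < d" "0 < e" shows "(\<phi> x - \<phi> (x - e)) / e \<le> (\<phi> (x + d) - \<phi> x) / d"
proof -
  define t where "t = e/(d+e)"
  have t: "t * (d + e) = e" "(d + e) * (1 - t) = d" using assms by (auto simp: t_def field_simps)
  have eq: "(1 - t) * (x - e) + t * (x + d) = x" using t(1) by (simp add: algebra_simps)
  have "\<phi> x \<le> (1 - t) * \<phi> (x - e) + t * \<phi> (x + d)"
    using \<phi>_convexD[of t "x-e" "x+d"] assms unfolding eq by (simp add: t_def)
  then have "(d + e) * \<phi> x \<le> (d + e) * ((1 - t) * \<phi> (x - e) + t * \<phi> (x + d))"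
    using assms by (intro mult_left_mono) auto
  also have "\<dots> = (d + e) * (1 - t) * \<phi> (x - e) + t * (d + e) * \<phi> (x + d)" by (simp add: algebra_simps)
  finally have "(d + e) * \<phi> x \<le> d * \<phi> (x - e) + e * \<phi> (x + d)" by (simp only: t)
  then show ?thesis using assms by (simp add: field_simps)
qed

text \<open>By convexity the slopes are monotone in the increment, so these two extrema are the
  one-sided derivatives.\<close>

definition dright :: "real \<Rightarrow> real" where "dright x = (INF d\<in>{0<..}. (\<phi> (x + d) - \<phi> x) / d)"
definition dleft :: "real \<Rightarrow> real" where "dleft x = (SUP d\<in>{0<..}. (\<phi> x - \<phi> (x - d)) / d)"

lemma bdd_right: "bdd_below ((\<lambda>d. (\<phi> (x + d) - \<phi> x) / d) ` {0<..})"
  using slope_left_right[of _ 1 x] by (intro bdd_belowI) (auto intro: slope_left_right[of _ 1 x, simplified])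

lemma bdd_left: "bdd_above ((\<lambda>d. (\<phi> x - \<phi> (x - d)) / d) ` {0<..})"
  by (intro bdd_aboveI) (auto intro: slope_left_right[of 1 _ x, simplified])

lemma dright_le: "0 < d \<Longrightarrow> dright x \<le> (\<phi> (x + d) - \<phi> x) / d"
  unfolding dright_def by (intro cINF_lower bdd_right) auto

lemma dleft_ge: "0 < d \<Longrightarrow> (\<phi> x - \<phi> (x - d)) / d \<le> dleft x"
  unfolding dleft_def by (rule cSUP_upper2[OF bdd_left, where x=d]) auto

lemma dleft_le_dright: "dleft x \<le> dright x"
  unfolding dright_def
  by (intro cINF_greatest) (auto simp: dleft_def intro!: cSUP_least slope_left_right)

lemma tendsto_dright:
  assumes "\<And>n. 0 < d n" "d \<longlonglongrightarrow> 0"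
  shows "(\<lambda>n. (\<phi> (x + d n) - \<phi> x) / d n) \<longlonglongrightarrow> dright x"
proof (rule decreasing_tendsto)
  show "\<forall>\<^sub>F n in sequentially. dright x \<le> (\<phi> (x + d n) - \<phi> x) / d n"
    using assms dright_le by auto
  fix y assume "dright x < y"
  then obtain e where e: "0 < e" "(\<phi> (x + e) - \<phi> x) / e < y"
    unfolding dright_def by (subst (asm) cINF_less_iff) (auto intro: bdd_right)
  have "\<forall>\<^sub>F n in sequentially. d n < e" using assms(2) e by (intro order_tendstoD) auto
  then show "\<forall>\<^sub>F n in sequentially. (\<phi> (x + d n) - \<phi> x) / d n < y"
  proof eventually_elim
    fix n assume "d n < e"
    then have "(\<phi> (x + d n) - \<phi> x) / d n \<le> (\<phi> (x + e) - \<phi> x) / e" using assms by (intro slope_mono) auto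
    then show "(\<phi> (x + d n) - \<phi> x) / d n < y" using e by linarith
  qed
qed

lemma tendsto_dleft:
  assumes "\<And>n. 0 < d n" "d \<longlonglongrightarrow> 0"
  shows "(\<lambda>n. (\<phi> x - \<phi> (x - d n)) / d n) \<longlonglongrightarrow> dleft x"
proof (rule increasing_tendsto)
  show "\<forall>\<^sub>F n in sequentially. (\<phi> x - \<phi> (x - d n)) / d n \<le> dleft x"
    using assms dleft_ge by auto
  fix y assume "y < dleft x"
  then obtain e where e: "0 < e" "y < (\<phi> x - \<phi> (x - e)) / e"
    unfolding dleft_def by (subst (asm) less_cSUP_iff) (auto intro: bdd_left)
  have "\<forall>\<^sub>F n in sequentially. d n < e" using assms(2) e by (intro order_tendstoD) auto
  then show "\<forall>\<^sub>F n in sequentially. y < (\<phi> x - \<phi> (x - d n)) / d n"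
  proof eventually_elim
    fix n assume "d n < e"
    then have "(\<phi> x - \<phi> (x - e)) / e \<le> (\<phi> x - \<phi> (x - d n)) / d n" using assms by (intro slope_mono') auto
    then show "y < (\<phi> x - \<phi> (x - d n)) / d n" using e by linarith
  qed
qed

lemma dright_mono_left: "x < y \<Longrightarrow> dright x \<le> dleft y"
  using dright_le[of "y - x" x] dleft_ge[of "y - x" y] by simp

lemma dleft_pos: "0 < x \<Longrightarrow> \<phi> x / x \<le> dleft x"
  using dleft_ge[of x x] by simp

lemma subgrad_between:
  assumes "0 \<le> x" "0 \<le> g" "dleft x \<le> g" "g \<le> dright x"
  shows "subgrad x g"
  unfolding subgrad_def
proof (intro conjI allI impI)
  fix w :: real
  consider "w = x" | "x < w" | "w < x" by linarith
  then show "\<phi> x + g * (w - x) \<le> \<phi> w"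
  proof cases
    case 2
    then have "g \<le> (\<phi> w - \<phi> x) / (w - x)" using dright_le[of "w-x" x] assms by simp
    then show ?thesis using 2 by (simp add: field_simps)
  next
    case 3
    then have "(\<phi> x - \<phi> w) / (x - w) \<le> g" using dleft_ge[of "x-w" x] assms by simp
    then show ?thesis using 3 by (simp add: field_simps)
  qed simp
qed (use assms in auto)

lemma subgrad_exists: assumes "0 < x" shows "\<exists>g. subgrad x g \<and> \<phi> x / x \<le> g"
  using assms dleft_pos[OF assms] dleft_le_dright[of x] \<phi>_pos[OF assms]
  by (intro exI[of _ "dright x"] conjI subgrad_between)
    (auto intro: order_trans[of 0 "\<phi> x / x"] order_trans)

lemma subgrad_mono: "subgrad x g \<Longrightarrow> subgrad y h \<Longrightarrow> x < y \<Longrightarrow> g \<le> h"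
proof -
  assume a: "subgrad x g" "subgrad y h" "x < y"
  then have "\<phi> x + g * (y - x) \<le> \<phi> y" "\<phi> y + h * (x - y) \<le> \<phi> x" by (auto simp: subgrad_def)
  then have "g * (y - x) \<le> h * (y - x)" by (simp add: algebra_simps)
  then show ?thesis using a by simp
qed

lemma Delta2D: assumes "Delta2 (extend \<phi>)" obtains C where "0 < C" "\<And>u. 0 \<le> u \<Longrightarrow> \<phi> (2 * u) \<le> C * \<phi> u"
proof -
  obtain C where C: "0 < C" "\<And>t. 0 < t \<Longrightarrow> extend \<phi> (ennreal (2 * t)) \<le> ennreal C * extend \<phi> (ennreal t)"
    using assms by (auto simp: Delta2_def)
  have "\<phi> (2 * u) \<le> C * \<phi> u" if "0 \<le> u" for u
  proof (cases "u = 0")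
    case False
    then have "extend \<phi> (ennreal (2 * u)) \<le> ennreal C * extend \<phi> (ennreal u)" using C(2)[of u] that by simp
    moreover have "extend \<phi> (ennreal (2 * u)) = ennreal (\<phi> (2 * u))" using that by (intro extend_ennreal) simp
    moreover have "ennreal C * extend \<phi> (ennreal u) = ennreal (C * \<phi> u)"
      using that C(1) by (simp add: extend_ennreal ennreal_mult)
    ultimately have "ennreal (\<phi> (2 * u)) \<le> ennreal (C * \<phi> u)" by simp
    then show ?thesis using C(1) by (simp add: ennreal_le_iff)
  qed simp
  then show ?thesis using that C(1) by blast
qed

lemma Delta2I: assumes "0 < C" "\<And>u. 0 < u \<Longrightarrow> \<phi> (2 * u) \<le> C * \<phi> u" shows "Delta2 (extend \<phi>)"
  unfolding Delta2_def using assms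
  by (auto intro!: exI[of _ C] simp: extend_ennreal ennreal_mult[symmetric] ennreal_leI)

lemma Delta2_scale:
  assumes "Delta2 (extend \<phi>)" obtains C where "1 \<le> C" "\<And>a. extend \<phi> (ennreal c * a) \<le> ennreal C * extend \<phi> a"
proof -
  obtain C where C: "0 < C" "\<And>u. 0 \<le> u \<Longrightarrow> \<phi> (2 * u) \<le> C * \<phi> u" using Delta2D[OF assms] by blast
  obtain n :: nat where n: "c < 2 ^ n" using real_arch_pow[of 2 c] by auto
  define D where "D = max C 1"
  have D: "1 \<le> D" "\<And>u. 0 \<le> u \<Longrightarrow> \<phi> (2 * u) \<le> D * \<phi> u"
    by (auto simp: D_def intro!: order_trans[OF C(2)] mult_right_mono)
  have it: "\<phi> (2 ^ n * u) \<le> D ^ n * \<phi> u" if "0 \<le> u" for u n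
  proof (induction n)
    case (Suc n)
    have "\<phi> (2 * (2 ^ n * u)) \<le> D * \<phi> (2 ^ n * u)" using that by (intro D) auto
    also have "\<dots> \<le> D * (D ^ n * \<phi> u)" using Suc D by (intro mult_left_mono) auto
    finally show ?case by (simp add: mult.assoc)
  qed simp
  show ?thesis
  proof (rule that[of "D ^ n"])
    show "1 \<le> D ^ n" using D by simp
    fix a show "extend \<phi> (ennreal c * a) \<le> ennreal (D ^ n) * extend \<phi> a"
    proof (cases a)
      case (real x)
      have "extend \<phi> (ennreal c * a) \<le> extend \<phi> (ennreal (2 ^ n * x))"
        using real n by (intro extend_mono) (auto simp: ennreal_mult intro!: mult_right_mono ennreal_leI)
      also have "\<dots> \<le> ennreal (D ^ n * \<phi> x)" using real it[of x n] by (simp add: extend_ennreal ennreal_leI)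
      finally show ?thesis using real D by (simp add: ennreal_mult extend_ennreal)
    next
      case top then show ?thesis using D by (simp add: ennreal_mult_top)
    qed
  qed
qed

text \<open>Substituting \<open>u = M * x\<close> in the supremum turns the growth of
  \<open>\<phi>\<close> into \<open>\<psi> ((1 + e) v) \<le> M (1 + e) \<psi> v\<close>; iterating
  until \<open>(1 + e) ^ n\<close> exceeds \<open>2\<close> gives the doubling condition.\<close>

lemma Nabla2_iterate:
  assumes "1 < M" "0 < e" "\<And>u. 0 < u \<Longrightarrow> M * (1 + e) * \<phi> u \<le> \<phi> (M * u)"
  shows "Nabla2 \<phi>"
proof -
  have step: "\<psi> (ennreal (1 + e) * v) \<le> ennreal (M * (1 + e)) * \<psi> v" for v
    unfolding complementary_def
  proof (rule SUP_least)
    fix u :: real assume u: "u \<in> {0<..}"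
    define x where "x = u / M"
    have x: "0 < x" "u = M * x" using u assms by (auto simp: x_def)
    have "ennreal u * (ennreal (1 + e) * v) - ennreal (\<phi> u) \<le>
        ennreal (M * (1 + e)) * (ennreal x * v) - ennreal (M * (1 + e)) * ennreal (\<phi> x)"
    proof (rule ennreal_minus_mono)
      show "ennreal u * (ennreal (1 + e) * v) \<le> ennreal (M * (1 + e)) * (ennreal x * v)"
        using x assms by (simp add: ennreal_mult mult_ac)
      show "ennreal (M * (1 + e)) * ennreal (\<phi> x) \<le> ennreal (\<phi> u)"
        using assms(3)[OF x(1)] x assms(1,2) by (simp add: ennreal_mult[symmetric] ennreal_leI)
    qed
    also have "\<dots> = ennreal (M * (1 + e)) * (ennreal x * v - ennreal (\<phi> x))"
      by (rule ennreal_right_diff_distrib[symmetric]) simp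
    also have "\<dots> \<le> ennreal (M * (1 + e)) * (SUP u\<in>{0<..}. ennreal u * v - ennreal (\<phi> u))"
      using x by (intro mult_left_mono SUP_upper) auto
    finally show "ennreal u * (ennreal (1 + e) * v) - ennreal (\<phi> u) \<le>
        ennreal (M * (1 + e)) * (SUP u\<in>{0<..}. ennreal u * v - ennreal (\<phi> u))" .
  qed
  have it: "\<psi> (ennreal ((1 + e) ^ n) * v) \<le> ennreal ((M * (1 + e)) ^ n) * \<psi> v" for n v
  proof (induction n)
    case (Suc n)
    have "\<psi> (ennreal ((1 + e) ^ Suc n) * v) = \<psi> (ennreal (1 + e) * (ennreal ((1 + e) ^ n) * v))"
      using assms by (simp add: ennreal_mult mult_ac)
    also have "\<dots> \<le> ennreal (M * (1 + e)) * \<psi> (ennreal ((1 + e) ^ n) * v)" by (rule step)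
    also have "\<dots> \<le> ennreal (M * (1 + e)) * (ennreal ((M * (1 + e)) ^ n) * \<psi> v)"
      by (intro mult_left_mono Suc) simp
    finally show ?case using assms by (simp add: ennreal_mult mult_ac)
  qed simp
  obtain n where n: "2 < (1 + e) ^ n" using real_arch_pow[of "1 + e" 2] assms by auto
  show ?thesis
    unfolding Nabla2_def Delta2_def
  proof (intro exI[of _ "(M * (1 + e)) ^ n"] conjI allI impI)
    show "0 < (M * (1 + e)) ^ n" using assms by simp
    fix t :: real assume "0 < t"
    then have "\<psi> (ennreal (2 * t)) \<le> \<psi> (ennreal ((1 + e) ^ n) * ennreal t)"
      using n assms by (intro \<psi>_mono) (auto simp: ennreal_mult[symmetric] intro!: ennreal_leI)
    also note it
    finally show "\<psi> (ennreal (2 * t)) \<le> ennreal ((M * (1 + e)) ^ n) * \<psi> (ennreal t)" .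
  qed
qed

text \<open>For a subgradient \<open>g\<close> at \<open>u\<close>, Young's inequality for the pair
  \<open>l * u\<close>, \<open>2 * g\<close> with \<open>l = C / 2\<close> reads
  \<open>C u g \<le> \<phi> (l u) + C (u g - \<phi> u)\<close>, and the terms \<open>C u g\<close>
  cancel.\<close>

lemma Nabla2D:
  assumes "Nabla2 \<phi>"
  obtains l C where "1 < l" "0 < C" "\<And>u. 0 < u \<Longrightarrow> 2 * l * \<phi> u \<le> \<phi> (l * u)"
    "\<And>v. 0 < v \<Longrightarrow> \<psi> (ennreal (2 * v)) \<le> ennreal C * \<psi> (ennreal v)"
proof -
  obtain C0 where C0: "0 < C0" "\<And>t. 0 < t \<Longrightarrow> \<psi> (ennreal (2 * t)) \<le> ennreal C0 * \<psi> (ennreal t)"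
    using assms by (auto simp: Nabla2_def Delta2_def)
  \<comment> \<open>The bound \<open>3\<close> makes \<open>l = C / 2\<close> exceed
    \<open>1\<close>.\<close>
  define C where "C = max C0 3"
  have C: "3 \<le> C" "\<And>t. 0 < t \<Longrightarrow> \<psi> (ennreal (2 * t)) \<le> ennreal C * \<psi> (ennreal t)"
    by (auto simp: C_def intro!: order_trans[OF C0(2)] mult_right_mono ennreal_leI)
  show ?thesis
  proof (rule that[of "C/2" C])
    fix u :: real assume u: "0 < u"
    obtain g where g: "subgrad u g" "\<phi> u / u \<le> g" using subgrad_exists[OF u] by blast
    have g0: "0 < g" using g(2) \<phi>_pos[OF u] u by (meson divide_pos_pos order_less_le_trans)
    have "ennreal (C/2 * u) * ennreal (2 * g) \<le> extend \<phi> (ennreal (C/2 * u)) + \<psi> (ennreal (2 * g))"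
      by (rule Young_ennreal)
    also have "\<psi> (ennreal (2 * g)) \<le> ennreal C * ennreal (u * g - \<phi> u)"
      using C(2)[OF g0] \<psi>_subgrad[OF g(1)] by simp
    finally have "ennreal (C/2 * u * (2 * g)) \<le> ennreal (\<phi> (C/2 * u) + C * (u * g - \<phi> u))"
      using C(1) u g0 subgrad_nonneg[OF g(1)]
      by (simp add: ennreal_mult[symmetric] extend_ennreal ennreal_plus[symmetric] del: ennreal_plus)
    then have "C/2 * u * (2 * g) \<le> \<phi> (C/2 * u) + C * (u * g - \<phi> u)"
      using C(1) subgrad_nonneg[OF g(1)] by (subst (asm) ennreal_le_iff) auto
    then show "2 * (C/2) * \<phi> u \<le> \<phi> (C/2 * u)" by (simp add: algebra_simps)
  qed (use C in auto)
qed

end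

section \<open>From classes to representatives\<close>

lemma ae_equal_refl: "f \<in> borel_measurable pos_lebesgue \<Longrightarrow> ae_equal f f"
  by (simp add: ae_equal_def)

lemma L0_cases:
  obtains f where "f \<in> borel_measurable pos_lebesgue" "a = abs_L0 f"
proof (rule that[of "rep_L0 a"])
  have "ae_equal (rep_L0 a) (rep_L0 a)" using Quotient3_rep_reflp[OF Quotient3_L0, of a] .
  then show "rep_L0 a \<in> borel_measurable pos_lebesgue" by (simp add: ae_equal_def)
  show "a = abs_L0 (rep_L0 a)" by (rule Quotient3_abs_rep[OF Quotient3_L0, symmetric])
qed

lemma rearrangement_abs: "f \<in> borel_measurable pos_lebesgue \<Longrightarrow> rearrangement (abs_L0 f) = rearr f"
  unfolding rearrangement_def rearr_def level_measure_def
  by (simp add: distribution_fun.abs_eq[OF ae_equal_refl])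

lemma abs_L0_eqD:
  "f \<in> borel_measurable pos_lebesgue \<Longrightarrow> g \<in> borel_measurable pos_lebesgue \<Longrightarrow>
    abs_L0 f = abs_L0 g \<Longrightarrow> AE s in pos_lebesgue. f s = g s"
  using Quotient3_rel[OF Quotient3_L0, of f g] by (auto simp: ae_equal_def)

lemma scaleR_abs_L0: "f \<in> borel_measurable pos_lebesgue \<Longrightarrow> c *\<^sub>R abs_L0 f = abs_L0 (\<lambda>s. c * f s)"
  by (simp add: scaleR_L0.abs_eq[OF ae_equal_refl])

lemma plus_abs_L0: "f \<in> borel_measurable pos_lebesgue \<Longrightarrow> g \<in> borel_measurable pos_lebesgue \<Longrightarrow>
    abs_L0 f + abs_L0 g = abs_L0 (\<lambda>s. f s + g s)"
  by (simp add: plus_L0.abs_eq[OF ae_equal_refl ae_equal_refl])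

lemma minus_abs_L0: "f \<in> borel_measurable pos_lebesgue \<Longrightarrow> g \<in> borel_measurable pos_lebesgue \<Longrightarrow>
    abs_L0 f - abs_L0 g = abs_L0 (\<lambda>s. f s - g s)"
  by (simp add: minus_L0.abs_eq[OF ae_equal_refl ae_equal_refl])

context decreasing_weight_space
begin

lemma borel_measurable_wm: "f \<in> borel_measurable borel \<Longrightarrow> f \<in> borel_measurable wm"
  by (simp add: borel_pos_lebesgue cong: measurable_cong_sets)

lemma measurable_wm_iff: "f \<in> borel_measurable wm \<longleftrightarrow> f \<in> borel_measurable pos_lebesgue"
  by (rule arg_cong[where f="\<lambda>S. f \<in> S"], rule measurable_cong_sets) auto

text \<open>Stretching by \<open>2\<close> costs at most a factor \<open>2\<close>, since
  \<open>\<omega> t \<le> \<omega> (t / 2)\<close>. This pays for the halved arguments that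
  \<open>rearr_add\<close> produces.\<close>

lemma nn_integral_half_le:
  fixes F :: "real \<Rightarrow> ennreal"
  assumes [measurable]: "F \<in> borel_measurable borel"
  shows "(\<integral>\<^sup>+t. F (t / 2) \<partial>wm) \<le> 2 * (\<integral>\<^sup>+t. F t \<partial>wm)"
proof -
  define k where "k t = F t * ennreal (\<omega> t) * indicator {0<..} t" for t
  have [measurable]: "k \<in> borel_measurable lebesgue"
  proof -
    have "(\<lambda>t. F t * ennreal (\<omega> t)) \<in> borel_measurable pos_lebesgue"
      using borel_pos_lebesgue[OF assms] by measurable
    then show ?thesis
      unfolding k_def by (subst (asm) borel_measurable_restrict_space_iff_ennreal) auto
  qed
  have "(\<integral>\<^sup>+t. F (t / 2) \<partial>wm) = (\<integral>\<^sup>+t. F (t / 2) * ennreal (\<omega> t) \<partial>pos_lebesgue)"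
    by (rule nn_integral_wm) (auto intro!: borel_pos_lebesgue)
  also have "\<dots> \<le> (\<integral>\<^sup>+t. k (t / 2) \<partial>pos_lebesgue)"
    using \<omega>_antimono by (intro nn_integral_mono) (auto simp: k_def intro!: mult_left_mono ennreal_leI)
  also have "\<dots> = (\<integral>\<^sup>+t. k (t / 2) * indicator {0<..} t \<partial>lebesgue)"
    by (subst nn_integral_restrict_space) auto
  also have "\<dots> = (\<integral>\<^sup>+t. k (0 + (1/2) * t) \<partial>lebesgue)"
    by (intro nn_integral_cong) (auto simp: k_def split: split_indicator)
  also have "\<dots> = 2 * (ennreal \<bar>1/2\<bar> * (\<integral>\<^sup>+t. k (0 + (1/2) * t) \<partial>lebesgue))"
  proof -
    have "(2::ennreal) * ennreal \<bar>1/2\<bar> = 1"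
      by (subst ennreal_numeral[symmetric], subst ennreal_mult[symmetric]) auto
    then show ?thesis by (metis mult.assoc mult_1)
  qed
  also have "ennreal \<bar>1/2\<bar> * (\<integral>\<^sup>+t. k (0 + (1/2) * t) \<partial>lebesgue) = (\<integral>\<^sup>+t. k t \<partial>lebesgue)"
    by (rule nn_integral_real_affine_lebesgue[symmetric]) auto
  also have "\<dots> = (\<integral>\<^sup>+t. F t * ennreal (\<omega> t) \<partial>pos_lebesgue)"
    unfolding k_def by (subst nn_integral_restrict_space) auto
  also have "\<dots> = (\<integral>\<^sup>+t. F t \<partial>wm)"
    by (rule nn_integral_wm[symmetric]) (auto intro!: borel_pos_lebesgue)
  finally show ?thesis .
qed

end

section \<open>Modulars, the Orlicz norm and the function space\<close>

locale orlicz_lorentz_space = orlicz_fun \<phi> + decreasing_weight_space \<omega> for \<phi> \<omega>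
begin

abbreviation measurable_fun :: "(real \<Rightarrow> real) \<Rightarrow> bool" where
  "measurable_fun f \<equiv> f \<in> borel_measurable pos_lebesgue"

definition rho :: "(real \<Rightarrow> real) \<Rightarrow> ennreal" where
  "rho f = (\<integral>\<^sup>+t. extend \<phi> (rearr f t) \<partial>wm)"

definition rhoc :: "(real \<Rightarrow> real) \<Rightarrow> ennreal" where
  "rhoc g = (\<integral>\<^sup>+t. \<psi> (rearr g t) \<partial>wm)"

text \<open>Kept in the extended half-line so that the supremum can be handled before finiteness is
  known; on \<open>X\<close> it agrees with the real norm.\<close>

definition enorm :: "(real \<Rightarrow> real) \<Rightarrow> ennreal" where
  "enorm f = (SUP g\<in>{g. measurable_fun g \<and> rhoc g \<le> 1}. \<integral>\<^sup>+t. rearr f t * rearr g t \<partial>wm)"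

definition X :: "(real \<Rightarrow> real) set" where
  "X = {f. measurable_fun f \<and> (\<exists>l>0. rho (\<lambda>s. l * f s) < \<infinity>)}"

abbreviation V :: "L0 set" where "V \<equiv> orlicz_lorentz \<phi> \<omega>"
abbreviation N :: "L0 \<Rightarrow> real" where "N \<equiv> orlicz_norm \<phi> \<omega>"

lemma extend_rearr_borel [measurable]: "(\<lambda>t. extend \<phi> (rearr f t)) \<in> borel_measurable borel"
  by (intro antimono_ennreal_borel extend_mono rearr_antimono)

lemma \<psi>_rearr_borel [measurable]: "(\<lambda>t. \<psi> (rearr f t)) \<in> borel_measurable borel"
  by (intro antimono_ennreal_borel \<psi>_mono rearr_antimono)

lemma rearr_wm [measurable]: "rearr f \<in> borel_measurable wm"
  by (intro borel_measurable_wm) measurable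

lemma extend_rearr_wm [measurable]: "(\<lambda>t. extend \<phi> (rearr f t)) \<in> borel_measurable wm"
  by (intro borel_measurable_wm) measurable

lemma \<psi>_rearr_wm [measurable]: "(\<lambda>t. \<psi> (rearr f t)) \<in> borel_measurable wm"
  by (intro borel_measurable_wm) measurable

lemma modular_extend: "measurable_fun f \<Longrightarrow> modular (extend \<phi>) \<omega> (abs_L0 f) = rho f"
  unfolding modular_def rho_def
  by (subst nn_integral_wm) (auto simp: rearrangement_abs intro!: borel_pos_lebesgue)

lemma modular_complementary: "measurable_fun f \<Longrightarrow> modular \<psi> \<omega> (abs_L0 f) = rhoc f"
  unfolding modular_def rhoc_def
  by (subst nn_integral_wm) (auto simp: rearrangement_abs intro!: borel_pos_lebesgue)

lemma V_iff: "measurable_fun f \<Longrightarrow> abs_L0 f \<in> V \<longleftrightarrow> f \<in> X"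
  unfolding orlicz_lorentz_def X_def by (auto simp: scaleR_abs_L0 modular_extend)

lemma N_abs: assumes f: "measurable_fun f" shows "N (abs_L0 f) = enn2real (enorm f)"
proof -
  have "(SUP g\<in>{g. modular \<psi> \<omega> g \<le> 1}. \<integral>\<^sup>+t. rearrangement (abs_L0 f) t * rearrangement g t * ennreal (\<omega> t) \<partial>pos_lebesgue)
     = enorm f"
    unfolding enorm_def
  proof (intro SUP_eq)
    fix a :: L0 assume a: "a \<in> {g. modular \<psi> \<omega> g \<le> 1}"
    obtain g where g: "measurable_fun g" "a = abs_L0 g" by (rule L0_cases)
    then have "rhoc g \<le> 1" using a by (simp add: modular_complementary)
    then show "\<exists>g\<in>{g. measurable_fun g \<and> rhoc g \<le> 1}.
        (\<integral>\<^sup>+t. rearrangement (abs_L0 f) t * rearrangement a t * ennreal (\<omega> t) \<partial>pos_lebesgue) \<le> (\<integral>\<^sup>+t. rearr f t * rearr g t \<partial>wm)"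
      using g f by (intro bexI[of _ g]) (auto simp: rearrangement_abs nn_integral_wm borel_pos_lebesgue)
  next
    fix g assume g: "g \<in> {g. measurable_fun g \<and> rhoc g \<le> 1}"
    then show "\<exists>a\<in>{g. modular \<psi> \<omega> g \<le> 1}. (\<integral>\<^sup>+t. rearr f t * rearr g t \<partial>wm)
        \<le> (\<integral>\<^sup>+t. rearrangement (abs_L0 f) t * rearrangement a t * ennreal (\<omega> t) \<partial>pos_lebesgue)"
      using f by (intro bexI[of _ "abs_L0 g"]) (auto simp: modular_complementary rearrangement_abs nn_integral_wm borel_pos_lebesgue)
  qed
  then show ?thesis unfolding orlicz_norm_def by simp
qed

lemma rho_mono:
  "measurable_fun f \<Longrightarrow> measurable_fun g \<Longrightarrow> (AE s in pos_lebesgue. \<bar>f s\<bar> \<le> \<bar>g s\<bar>) \<Longrightarrow> rho f \<le> rho g"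
  unfolding rho_def by (intro nn_integral_mono extend_mono rearr_mono)

lemma rho_scale: "measurable_fun f \<Longrightarrow> rho (\<lambda>s. c * f s) = (\<integral>\<^sup>+t. extend \<phi> (ennreal \<bar>c\<bar> * rearr f t) \<partial>wm)"
  unfolding rho_def by (simp add: rearr_scale)

lemma rho_scale_le:
  assumes "measurable_fun f" "0 \<le> c" "c \<le> 1" shows "rho (\<lambda>s. c * f s) \<le> ennreal c * rho f"
proof -
  have "rho (\<lambda>s. c * f s) \<le> (\<integral>\<^sup>+t. ennreal c * extend \<phi> (rearr f t) \<partial>wm)"
    using assms by (subst rho_scale) (auto intro!: nn_integral_mono extend_mult_le)
  also have "\<dots> = ennreal c * rho f" unfolding rho_def by (rule nn_integral_cmult) measurable
  finally show ?thesis .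
qed

text \<open>The rearrangement of the sum at \<open>t\<close> is controlled by those at
  \<open>t / 2\<close>; the factor \<open>2\<close> of this dilation cancels the factor
  \<open>1/2\<close> from midpoint convexity.\<close>

lemma rho_add_le:
  assumes f: "measurable_fun f" and g: "measurable_fun g"
  shows "rho (\<lambda>s. f s + g s) \<le> rho (\<lambda>s. 2 * f s) + rho (\<lambda>s. 2 * g s)"
proof -
  define F where "F t = extend \<phi> (rearr (\<lambda>s. 2 * f s) t) + extend \<phi> (rearr (\<lambda>s. 2 * g s) t)" for t
  have [measurable]: "F \<in> borel_measurable borel" unfolding F_def by measurable
  have "rho (\<lambda>s. f s + g s) \<le> (\<integral>\<^sup>+t. F (t / 2) / 2 \<partial>wm)"
    unfolding rho_def
  proof (rule nn_integral_mono)
    fix t assume "t \<in> space wm"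
    then have "rearr (\<lambda>s. f s + g s) t \<le> rearr f (t/2) + rearr g (t/2)"
      using rearr_add[OF f g, of "t/2" "t/2"] by simp
    then have "extend \<phi> (rearr (\<lambda>s. f s + g s) t) \<le> extend \<phi> (rearr f (t/2) + rearr g (t/2))"
      by (rule extend_mono)
    also have "\<dots> \<le> (extend \<phi> (2 * rearr f (t/2)) + extend \<phi> (2 * rearr g (t/2))) / 2"
      by (rule extend_add_le)
    finally show "extend \<phi> (rearr (\<lambda>s. f s + g s) t) \<le> F (t / 2) / 2"
      by (simp add: F_def rearr_scale f g)
  qed
  also have "\<dots> = (\<integral>\<^sup>+t. F (t / 2) \<partial>wm) / 2"
    by (rule nn_integral_divide) (auto intro!: borel_measurable_wm)
  also have "\<dots> \<le> (2 * (\<integral>\<^sup>+t. F t \<partial>wm)) / 2"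
    by (intro divide_right_mono_ennreal nn_integral_half_le) measurable
  also have "\<dots> = (\<integral>\<^sup>+t. F t \<partial>wm)" by (simp add: ennreal_mult_divide_eq mult.commute[of 2])
  also have "\<dots> = rho (\<lambda>s. 2 * f s) + rho (\<lambda>s. 2 * g s)"
    unfolding F_def rho_def by (rule nn_integral_add) measurable
  finally show ?thesis .
qed

lemma X_measurable: "f \<in> X \<Longrightarrow> measurable_fun f" by (simp add: X_def)

lemma X_mono:
  assumes "g \<in> X" "measurable_fun f" "AE s in pos_lebesgue. \<bar>f s\<bar> \<le> \<bar>g s\<bar>" shows "f \<in> X"
proof -
  obtain l where l: "0 < l" "rho (\<lambda>s. l * g s) < \<infinity>" and g: "measurable_fun g" using assms(1) by (auto simp: X_def)
  have "AE s in pos_lebesgue. \<bar>l * f s\<bar> \<le> \<bar>l * g s\<bar>"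
    using assms(3) by eventually_elim (use l in \<open>auto simp: abs_mult\<close>)
  then have "rho (\<lambda>s. l * f s) \<le> rho (\<lambda>s. l * g s)" using assms g by (intro rho_mono) auto
  then show ?thesis using l assms by (auto simp: X_def intro: order_le_less_trans)
qed

lemma X_scale: assumes "f \<in> X" shows "(\<lambda>s. c * f s) \<in> X"
proof (cases "c = 0")
  case True
  have "rho (\<lambda>s. l * (0 * f s)) = 0" for l
    unfolding rho_def using rearr_scale[of "\<lambda>_. 0" 0] by simp
  then show ?thesis using True by (auto simp: X_def intro!: exI[of _ 1])
next
  case False
  obtain l where l: "0 < l" "rho (\<lambda>s. l * f s) < \<infinity>" and f: "measurable_fun f" using assms by (auto simp: X_def)
  have "rho (\<lambda>s. (l / \<bar>c\<bar>) * (c * f s)) = rho (\<lambda>s. l * f s)"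
    using False f l by (subst (1 2) rho_scale, measurable) (simp add: rearr_scale mult.assoc[symmetric] ennreal_mult[symmetric])
  then show ?thesis using l f False by (auto simp: X_def intro!: exI[of _ "l / \<bar>c\<bar>"])
qed

lemma X_add: assumes "f \<in> X" "g \<in> X" shows "(\<lambda>s. f s + g s) \<in> X"
proof -
  obtain l where l: "0 < l" "rho (\<lambda>s. l * f s) < \<infinity>" and f: "measurable_fun f" using assms by (auto simp: X_def)
  obtain m where m: "0 < m" "rho (\<lambda>s. m * g s) < \<infinity>" and g: "measurable_fun g" using assms by (auto simp: X_def)
  define k where "k = min l m / 2"
  have k: "0 < k" using l m by (simp add: k_def)
  have "rho (\<lambda>s. k * f s + k * g s) \<le> rho (\<lambda>s. 2 * (k * f s)) + rho (\<lambda>s. 2 * (k * g s))"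
    using f g by (intro rho_add_le) auto
  also have "\<dots> \<le> rho (\<lambda>s. l * f s) + rho (\<lambda>s. m * g s)"
    using f g k l m by (intro add_mono rho_mono) (auto simp: abs_mult k_def intro!: mult_right_mono)
  also have "\<dots> < \<infinity>" using l m by simp
  finally show ?thesis using f g k by (auto simp: X_def distrib_left intro!: exI[of _ k])
qed

lemma X_diff: "f \<in> X \<Longrightarrow> g \<in> X \<Longrightarrow> (\<lambda>s. f s - g s) \<in> X"
  using X_add[of f "\<lambda>s. (-1) * g s"] X_scale[of g "-1"] by simp

lemma enorm_le:
  assumes f: "measurable_fun f" and k: "0 < k"
  shows "enorm f \<le> (1 + rho (\<lambda>s. k * f s)) / ennreal k"
  unfolding enorm_def
proof (rule SUP_least)
  fix g assume g: "g \<in> {g. measurable_fun g \<and> rhoc g \<le> 1}"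
  have "ennreal k * (\<integral>\<^sup>+t. rearr f t * rearr g t \<partial>wm) = (\<integral>\<^sup>+t. ennreal k * (rearr f t * rearr g t) \<partial>wm)"
    by (rule nn_integral_cmult[symmetric]) measurable
  also have "\<dots> \<le> (\<integral>\<^sup>+t. \<psi> (rearr g t) + extend \<phi> (rearr (\<lambda>s. k * f s) t) \<partial>wm)"
    using Young_ennreal k f by (intro nn_integral_mono) (simp add: rearr_scale mult.assoc[symmetric] add.commute)
  also have "\<dots> = rhoc g + rho (\<lambda>s. k * f s)"
    unfolding rho_def rhoc_def by (rule nn_integral_add) measurable
  also have "\<dots> \<le> 1 + rho (\<lambda>s. k * f s)" using g by (intro add_right_mono) auto
  finally have *: "ennreal k * (\<integral>\<^sup>+t. rearr f t * rearr g t \<partial>wm) \<le> 1 + rho (\<lambda>s. k * f s)" .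
  have "(\<integral>\<^sup>+t. rearr f t * rearr g t \<partial>wm) = ennreal k * (\<integral>\<^sup>+t. rearr f t * rearr g t \<partial>wm) / ennreal k"
    using k by (subst mult.commute, subst ennreal_mult_divide_eq) auto
  also have "\<dots> \<le> (1 + rho (\<lambda>s. k * f s)) / ennreal k" using * by (rule divide_right_mono_ennreal)
  finally show "(\<integral>\<^sup>+t. rearr f t * rearr g t \<partial>wm) \<le> (1 + rho (\<lambda>s. k * f s)) / ennreal k" .
qed

lemma enorm_ge: "measurable_fun g \<Longrightarrow> rhoc g \<le> 1 \<Longrightarrow> (\<integral>\<^sup>+t. rearr f t * rearr g t \<partial>wm) \<le> enorm f"
  unfolding enorm_def by (rule SUP_upper) auto

lemma enorm_finite: assumes "f \<in> X" shows "enorm f < \<infinity>"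
proof -
  obtain l where l: "0 < l" "rho (\<lambda>s. l * f s) < \<infinity>" and f: "measurable_fun f" using assms by (auto simp: X_def)
  have "enorm f \<le> (1 + rho (\<lambda>s. l * f s)) / ennreal l" by (rule enorm_le) (use f l in auto)
  also have "\<dots> < \<infinity>" using l by (simp add: ennreal_divide_eq_top_iff less_top[symmetric])
  finally show ?thesis .
qed

lemma enorm_mono:
  "measurable_fun f \<Longrightarrow> measurable_fun g \<Longrightarrow> (AE s in pos_lebesgue. \<bar>f s\<bar> \<le> \<bar>g s\<bar>) \<Longrightarrow> enorm f \<le> enorm g"
  unfolding enorm_def by (intro SUP_mono') (auto intro!: nn_integral_mono mult_right_mono rearr_mono)

lemma enorm_scale: "measurable_fun f \<Longrightarrow> enorm (\<lambda>s. c * f s) = ennreal \<bar>c\<bar> * enorm f"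
proof -
  assume f: "measurable_fun f"
  have "enorm (\<lambda>s. c * f s) = (SUP g\<in>{g. measurable_fun g \<and> rhoc g \<le> 1}. ennreal \<bar>c\<bar> * (\<integral>\<^sup>+t. rearr f t * rearr g t \<partial>wm))"
    unfolding enorm_def by (simp add: rearr_scale f nn_integral_cmult[symmetric] mult.assoc)
  also have "\<dots> = ennreal \<bar>c\<bar> * enorm f" unfolding enorm_def
    by (rule SUP_mult_left_ennreal[symmetric])
  finally show ?thesis .
qed

lemma N_nonneg [simp]: "0 \<le> N a" by (simp add: orlicz_norm_def)

lemma ennreal_N: "f \<in> X \<Longrightarrow> ennreal (N (abs_L0 f)) = enorm f"
  using enorm_finite[of f] by (simp add: N_abs X_measurable)

lemma N_mono:
  assumes "g \<in> X" "measurable_fun f" "AE s in pos_lebesgue. \<bar>f s\<bar> \<le> \<bar>g s\<bar>"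
  shows "N (abs_L0 f) \<le> N (abs_L0 g)"
proof -
  have "ennreal (N (abs_L0 f)) \<le> ennreal (N (abs_L0 g))"
    using assms X_mono[OF assms] by (simp add: ennreal_N) (intro enorm_mono X_measurable)
  then show ?thesis by simp
qed

lemma N_scale: assumes "f \<in> X" shows "N (c *\<^sub>R abs_L0 f) = \<bar>c\<bar> * N (abs_L0 f)"
proof -
  have f: "measurable_fun f" using assms by (rule X_measurable)
  then have "measurable_fun (\<lambda>s. c * f s)" by measurable
  then show ?thesis using f by (simp add: scaleR_abs_L0 N_abs enorm_scale enn2real_mult)
qed

lemma N_le:
  assumes f: "f \<in> X" and k: "0 < k" and r: "rho (\<lambda>s. k * f s) \<le> ennreal r" "0 \<le> r"
  shows "N (abs_L0 f) \<le> (1 + r) / k"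
proof -
  have "ennreal (N (abs_L0 f)) \<le> (1 + rho (\<lambda>s. k * f s)) / ennreal k"
    using f k by (simp add: ennreal_N X_measurable enorm_le)
  also have "\<dots> \<le> (1 + ennreal r) / ennreal k" by (intro divide_right_mono_ennreal add_left_mono r)
  also have "\<dots> = ennreal ((1 + r) / k)" using r k
    by (simp add: divide_ennreal[symmetric])
  finally show ?thesis using r k by (simp add: ennreal_le_iff)
qed

lemma N_ge:
  assumes f: "f \<in> X" and g: "measurable_fun g" "rhoc g \<le> 1" and r: "ennreal r \<le> (\<integral>\<^sup>+t. rearr f t * rearr g t \<partial>wm)"
  shows "r \<le> N (abs_L0 f)"
proof -
  have "ennreal r \<le> ennreal (N (abs_L0 f))" using enorm_ge[OF g] r f by (simp add: ennreal_N order_trans)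
  then show ?thesis using N_nonneg[of "abs_L0 f"] by (simp add: ennreal_le_iff2) linarith
qed

lemma rho_comp:
  assumes "measurable_fun f"
  shows "rho f = (\<integral>\<^sup>+t. rearr (\<lambda>s. \<phi> \<bar>f s\<bar>) t \<partial>wm)"
  unfolding rho_def using rearr_comp[OF assms \<phi>_strict_mono \<phi>_0 \<phi>_surj \<phi>_measurable] by simp

text \<open>In this form limits of superlevel sets act directly on the modular, through monotonicity
  and lower semicontinuity of \<open>W\<close>.\<close>

lemma rho_layer:
  assumes [measurable]: "measurable_fun f"
  shows "rho f = (\<integral>\<^sup>+l. indicator {0..} l * W (level_measure (\<lambda>s. \<phi> \<bar>f s\<bar>) l) \<partial>lborel)"
  unfolding rho_comp[OF assms] by (rule nn_integral_rearr_eq) measurable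

lemma rho_indicator:
  assumes "A \<in> sets pos_lebesgue" "0 \<le> c"
  shows "rho (\<lambda>s. c * indicator A s) = ennreal (\<phi> c) * W (emeasure pos_lebesgue A)"
proof -
  have "rho (\<lambda>s. c * indicator A s) = (\<integral>\<^sup>+t. ennreal (\<phi> c) * indicator {t. 0 < t \<and> ennreal t < emeasure pos_lebesgue A} t \<partial>wm)"
    unfolding rho_def using assms by (intro nn_integral_cong) (auto simp: rearr_indicator extend_ennreal)
  also have "\<dots> = ennreal (\<phi> c) * W (emeasure pos_lebesgue A)"
    unfolding W_def by (rule nn_integral_cmult_indicator) simp
  finally show ?thesis .
qed

text \<open>The test function is \<open>1 / (v W) 1\<^sub>A\<close>, whose conjugate modular is at most 1 because
  \<open>1 / (v W) \<le> \<phi> v / v\<close>.\<close>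

lemma enorm_indicator_ge_1:
  assumes A: "A \<in> sets pos_lebesgue" "emeasure pos_lebesgue A = ennreal a" "0 < a"
    and v: "0 < v" "1 \<le> \<phi> v * Wr a"
  shows "1 \<le> enorm (\<lambda>s. v * indicator A s)"
proof -
  have W: "0 < Wr a" by (rule Wr_pos) fact
  define c where "c = 1 / (v * Wr a)"
  have c: "0 < c" using v W by (simp add: c_def)
  have "c \<le> \<phi> v / v" using v W by (simp add: c_def field_simps)
  have \<psi>: "\<psi> (ennreal c) \<le> ennreal (1 / Wr a)"
    unfolding complementary_def
  proof (rule SUP_least)
    fix u :: real assume u: "u \<in> {0<..}"
    have "u * c - \<phi> u \<le> 1 / Wr a"
    proof (cases "u \<le> v")
      case True
      then have "u * c \<le> v * c" using c by simp
      also have "v * c = 1 / Wr a" using v by (simp add: c_def)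
      finally show ?thesis using \<phi>_nonneg[of u] by linarith
    next
      case False
      then have "c \<le> \<phi> u / u" using \<open>c \<le> \<phi> v / v\<close> \<phi>_ratio_mono[of v u] v by linarith
      then have "u * c \<le> \<phi> u" using u by (simp add: field_simps)
      then show ?thesis using W by (smt (verit) divide_nonneg_pos)
    qed
    then show "ennreal u * ennreal c - ennreal (\<phi> u) \<le> ennreal (1 / Wr a)"
      using u c by (simp add: ennreal_mult[symmetric] ennreal_minus ennreal_leI)
  qed
  let ?I = "{t. 0 < t \<and> ennreal t < ennreal a}"
  have \<psi>0: "\<psi> 0 = 0" unfolding complementary_def by simp
  have "rhoc (\<lambda>s. c * indicator A s) \<le> (\<integral>\<^sup>+t. ennreal (1 / Wr a) * indicator ?I t \<partial>wm)"
    unfolding rhoc_def using A c \<psi> by (intro nn_integral_mono) (auto simp: rearr_indicator \<psi>0)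
  also have "\<dots> = ennreal (1 / Wr a) * W (ennreal a)"
    unfolding W_def by (rule nn_integral_cmult_indicator) simp
  also have "\<dots> = 1" using W by (simp add: W_ennreal ennreal_mult[symmetric])
  finally have rc: "rhoc (\<lambda>s. c * indicator A s) \<le> 1" .
  have "1 = ennreal (v * c) * W (ennreal a)" using W v by (simp add: W_ennreal ennreal_mult[symmetric] c_def)
  also have "\<dots> = (\<integral>\<^sup>+t. ennreal (v * c) * indicator ?I t \<partial>wm)"
    unfolding W_def by (rule nn_integral_cmult_indicator[symmetric]) simp
  also have "\<dots> = (\<integral>\<^sup>+t. rearr (\<lambda>s. v * indicator A s) t * rearr (\<lambda>s. c * indicator A s) t \<partial>wm)"
    using A c v by (intro nn_integral_cong) (auto simp: rearr_indicator ennreal_mult)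
  also have "\<dots> \<le> enorm (\<lambda>s. v * indicator A s)"
    by (rule enorm_ge[OF _ rc]) (use A in measurable)
  finally show ?thesis .
qed

text \<open>\<open>v\<close> is chosen with \<open>\<phi> v * Wr a = 1\<close>, so that
  \<open>v\<close> times the indicator of \<open>A\<close> has norm at least \<open>1\<close>;
  scaling and monotonicity do the rest.\<close>

lemma N_pos:
  assumes f: "f \<in> X" and A: "A \<in> sets pos_lebesgue" "emeasure pos_lebesgue A = ennreal a" "0 < a"
    and c: "0 < c" "AE s in pos_lebesgue. c * indicator A s \<le> \<bar>f s\<bar>"
  shows "0 < N (abs_L0 f)"
proof -
  have W: "0 < Wr a" by (rule Wr_pos) fact
  obtain v where v: "0 \<le> v" "\<phi> v = 1 / Wr a" using \<phi>_surj[of "1 / Wr a"] W by auto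
  have v0: "0 < v" using v W by (cases "v = 0") auto
  have [measurable]: "A \<in> sets pos_lebesgue" by fact
  have "1 \<le> enorm (\<lambda>s. v * indicator A s)"
    using W v by (intro enorm_indicator_ge_1[OF A v0]) auto
  also have "\<dots> = enorm (\<lambda>s. (v / c) * (c * indicator A s))" using c by (simp add: field_simps)
  also have "\<dots> = ennreal (v / c) * enorm (\<lambda>s. c * indicator A s)"
    using v0 c by (subst enorm_scale) auto
  also have "\<dots> \<le> ennreal (v / c) * enorm f"
  proof (intro mult_left_mono enorm_mono)
    show "AE s in pos_lebesgue. \<bar>c * indicator A s\<bar> \<le> \<bar>f s\<bar>"
      using c(2) by eventually_elim (use c(1) in \<open>simp add: abs_mult\<close>)
  qed (use f in \<open>auto simp: X_def\<close>)
  finally have "enorm f \<noteq> 0" by auto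
  then show ?thesis using ennreal_N[OF f] N_nonneg[of "abs_L0 f"] by (metis ennreal_0 order_le_less)
qed

text \<open>A superlevel set of infinite measure has infinite weight, hence infinite modular after
  any scaling.\<close>

lemma X_level_finite:
  assumes f: "f \<in> X" and l: "0 < l" shows "level_measure f l < \<infinity>"
proof -
  obtain k where k: "0 < k" "rho (\<lambda>s. k * f s) < \<infinity>" and m: "measurable_fun f" using f by (auto simp: X_def)
  have [measurable]: "measurable_fun f" by fact
  let ?A = "{s \<in> space pos_lebesgue. l < \<bar>f s\<bar>}"
  have "rho (\<lambda>s. (k * l) * indicator ?A s) \<le> rho (\<lambda>s. k * f s)"
    using k l m by (intro rho_mono) (auto simp: abs_mult split: split_indicator)
  then have "ennreal (\<phi> (k * l)) * W (level_measure f l) < \<infinity>"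
    using k l by (subst (asm) rho_indicator) (auto simp: level_measure_def intro: order_le_less_trans)
  then have "W (level_measure f l) \<noteq> \<infinity>" using \<phi>_pos[of "k * l"] k l by (auto simp: ennreal_mult_eq_top_iff)
  then show ?thesis by (metis W_top infinity_ennreal_def less_top)
qed

lemma X_rearr_finite:
  assumes f: "f \<in> X" and t: "0 < t" shows "rearr f t < \<infinity>"
proof (rule ccontr)
  assume "\<not> ?thesis"
  then have inf: "rearr f t = \<infinity>" by (simp add: less_top[symmetric])
  obtain k where k: "0 < k" "rho (\<lambda>s. k * f s) < \<infinity>" and m: "measurable_fun f" using f by (auto simp: X_def)
  have "(\<integral>\<^sup>+s. \<infinity> * indicator {s. 0 < s \<and> ennreal s < ennreal t} s \<partial>wm) \<le> rho (\<lambda>s. k * f s)"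
    unfolding rho_scale[OF m]
  proof (rule nn_integral_mono)
    fix s
    have "rearr f s = \<infinity>" if "s < t" using rearr_antimono[of s t f] that inf by (simp add: top_unique)
    then show "\<infinity> * indicator {s. 0 < s \<and> ennreal s < ennreal t} s \<le> extend \<phi> (ennreal \<bar>k\<bar> * rearr f s)"
      using k by (auto split: split_indicator simp: ennreal_less_iff ennreal_mult_top)
  qed
  also have "(\<integral>\<^sup>+s. \<infinity> * indicator {s. 0 < s \<and> ennreal s < ennreal t} s \<partial>wm) = \<infinity> * W (ennreal t)"
    unfolding W_def by (rule nn_integral_cmult_indicator) simp
  also have "\<dots> = \<infinity>" using Wr_pos[OF t] by (simp add: W_ennreal ennreal_top_mult)
  finally show False using k by (simp add: top_unique)
qed

lemma Delta2_rho_finite: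
  assumes D: "Delta2 (extend \<phi>)" and f: "f \<in> X" shows "rho (\<lambda>s. c * f s) < \<infinity>"
proof -
  obtain l where l: "0 < l" "rho (\<lambda>s. l * f s) < \<infinity>" and m: "measurable_fun f" using f by (auto simp: X_def)
  obtain C where C: "1 \<le> C" "\<And>a. extend \<phi> (ennreal (\<bar>c\<bar> / l) * a) \<le> ennreal C * extend \<phi> a"
    using Delta2_scale[OF D] by blast
  have "rho (\<lambda>s. c * f s) \<le> (\<integral>\<^sup>+t. ennreal C * extend \<phi> (ennreal \<bar>l\<bar> * rearr f t) \<partial>wm)"
    unfolding rho_scale[OF m]
  proof (rule nn_integral_mono)
    fix t
    have "ennreal \<bar>c\<bar> * rearr f t = ennreal (\<bar>c\<bar> / l) * (ennreal \<bar>l\<bar> * rearr f t)"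
      using l by (simp add: mult.assoc[symmetric] ennreal_mult[symmetric])
    then show "extend \<phi> (ennreal \<bar>c\<bar> * rearr f t) \<le> ennreal C * extend \<phi> (ennreal \<bar>l\<bar> * rearr f t)"
      using C(2) by simp
  qed
  also have "\<dots> = ennreal C * rho (\<lambda>s. l * f s)"
    unfolding rho_scale[OF m] rearr_scale[OF m, symmetric] by (rule nn_integral_cmult) measurable
  also have "\<dots> < \<infinity>" using l by (simp add: ennreal_mult_less_top)
  finally show ?thesis .
qed

end

lemma suminf_disjoint_indicator:
  fixes u :: "nat \<Rightarrow> real"
  assumes "disjoint_family A"
  shows suminf_disjoint_indicator_in: "t \<in> A n \<Longrightarrow> (\<Sum>i. u i * indicator (A i) t) = u n"
    and suminf_disjoint_indicator_notin: "t \<notin> (\<Union>i. A i) \<Longrightarrow> (\<Sum>i. u i * indicator (A i) t) = 0"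
proof -
  assume t: "t \<in> A n"
  have "t \<notin> A i" if "i \<noteq> n" for i
    using assms t that by (auto simp: disjoint_family_on_def)
  then have "(\<Sum>i. u i * indicator (A i) t) = (\<Sum>i\<in>{n}. u i * indicator (A i) t)"
    by (intro suminf_finite) auto
  then show "(\<Sum>i. u i * indicator (A i) t) = u n" using t by simp
qed auto

section \<open>Consequences of strong exposure; modulars of decreasing functions\<close>

context orlicz_lorentz_space
begin

text \<open>The data of a strongly exposing functional at \<open>u / N u\<close>, rescaled to the sphere of radius
  \<open>N u\<close>.\<close>

lemma strongly_exposedE:
  assumes SEP: "strongly_exposed_property V N" and u: "u \<in> X" and pos: "0 < N (abs_L0 u)"
  obtains G where
    "\<And>f g. f \<in> X \<Longrightarrow> g \<in> X \<Longrightarrow> G (\<lambda>s. f s + g s) = G f + G g"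
    "\<And>c f. f \<in> X \<Longrightarrow> G (\<lambda>s. c * f s) = c * G f"
    "\<And>f. f \<in> X \<Longrightarrow> G f \<le> N (abs_L0 f)"
    "G u = N (abs_L0 u)"
    "\<And>y :: nat \<Rightarrow> real \<Rightarrow> real. (\<And>n. y n \<in> X) \<Longrightarrow> (\<And>n. N (abs_L0 (y n)) \<le> N (abs_L0 u)) \<Longrightarrow>
      (\<lambda>n. G (y n)) \<longlonglongrightarrow> N (abs_L0 u) \<Longrightarrow> (\<lambda>n. N (abs_L0 (\<lambda>s. y n s - u s))) \<longlonglongrightarrow> 0"
proof -
  define c where "c = N (abs_L0 u)"
  have c: "0 < c" using pos by (simp add: c_def)
  note m = X_measurable
  have "(1 / c) *\<^sub>R abs_L0 u \<in> unit_sphere_on V N"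
    using u c X_scale[OF u, of "1/c"] N_scale[OF u, of "1/c"] m[OF u]
    by (auto simp: unit_sphere_on_def scaleR_abs_L0 V_iff c_def)
  then obtain F where F: "bounded_functional_on V N F" "dual_norm_on V N F = 1" "F ((1 / c) *\<^sub>R abs_L0 u) = 1"
    and ex: "\<And>y :: nat \<Rightarrow> L0. (\<forall>n. y n \<in> unit_ball_on V N) \<Longrightarrow> (\<lambda>n. F (y n)) \<longlonglongrightarrow> 1 \<Longrightarrow>
           (\<lambda>n. N (y n - (1 / c) *\<^sub>R abs_L0 u)) \<longlonglongrightarrow> 0"
    using SEP by (auto simp: strongly_exposed_property_def strongly_exposed_point_def)
  obtain C where C: "\<And>x. x \<in> V \<Longrightarrow> \<bar>F x\<bar> \<le> C * N x" using F(1) unfolding bounded_functional_on_def by blast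
  have Fs: "F (c *\<^sub>R x) = c * F x" if "x \<in> V" for c x using F(1) that by (auto simp: bounded_functional_on_def)
  have Fa: "F (x + y) = F x + F y" if "x \<in> V" "y \<in> V" for x y using F(1) that by (auto simp: bounded_functional_on_def)
  have bdd: "bdd_above ((\<lambda>x. \<bar>F x\<bar>) ` unit_ball_on V N)"
  proof (rule bdd_aboveI2)
    fix x assume x: "x \<in> unit_ball_on V N"
    have "\<bar>F x\<bar> \<le> C * N x" using x C by (auto simp: unit_ball_on_def)
    also have "\<dots> \<le> \<bar>C\<bar> * 1" using x by (intro mult_mono) (auto simp: unit_ball_on_def)
    finally show "\<bar>F x\<bar> \<le> \<bar>C\<bar>" by simp
  qed
  have F1: "\<bar>F x\<bar> \<le> 1" if "x \<in> unit_ball_on V N" for x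
    using cSUP_upper[OF that bdd] F(2) by (simp add: dual_norm_on_def)
  show ?thesis
  proof (rule that[of "\<lambda>f. F (abs_L0 f)"])
    fix f g assume fg: "f \<in> X" "g \<in> X"
    then show "F (abs_L0 (\<lambda>s. f s + g s)) = F (abs_L0 f) + F (abs_L0 g)"
      using Fa[of "abs_L0 f" "abs_L0 g"] m by (simp add: V_iff plus_abs_L0)
  next
    fix c f assume "f \<in> X"
    then show "F (abs_L0 (\<lambda>s. c * f s)) = c * F (abs_L0 f)"
      using Fs[of "abs_L0 f" c] m by (simp add: V_iff scaleR_abs_L0)
  next
    fix f assume f: "f \<in> X"
    then have fV: "abs_L0 f \<in> V" using m by (simp add: V_iff)
    show "F (abs_L0 f) \<le> N (abs_L0 f)"
    proof (cases "N (abs_L0 f) = 0")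
      case True then show ?thesis using C[OF fV] by simp
    next
      case False
      then have p: "0 < N (abs_L0 f)" using N_nonneg[of "abs_L0 f"] by linarith
      have "(1 / N (abs_L0 f)) *\<^sub>R abs_L0 f \<in> unit_ball_on V N"
        using p N_scale[OF f, of "1 / N (abs_L0 f)"] X_scale[OF f, of "1 / N (abs_L0 f)"] m[OF f]
        by (auto simp: unit_ball_on_def scaleR_abs_L0 V_iff)
      from F1[OF this] have "\<bar>F (abs_L0 f)\<bar> / N (abs_L0 f) \<le> 1" using Fs[OF fV] p by (simp add: abs_mult)
      then show ?thesis using p by (simp add: field_simps)
    qed
  next
    show "F (abs_L0 u) = N (abs_L0 u)"
      using F(3) Fs[of "abs_L0 u" "1/c"] u m c by (simp add: V_iff c_def[symmetric] field_simps)
  next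
    fix y :: "nat \<Rightarrow> real \<Rightarrow> real"
    assume y: "\<And>n. y n \<in> X" "\<And>n. N (abs_L0 (y n)) \<le> N (abs_L0 u)" "(\<lambda>n. F (abs_L0 (y n))) \<longlonglongrightarrow> N (abs_L0 u)"
    define z where "z n = (1 / c) *\<^sub>R abs_L0 (y n)" for n
    have "z n \<in> unit_ball_on V N" for n
    proof -
      have "N (z n) = 1 / c * N (abs_L0 (y n))" using N_scale[OF y(1), of "1/c" n] c by (simp add: z_def)
      also have "\<dots> \<le> 1" using y(2)[of n] c by (simp add: c_def[symmetric] field_simps)
      finally have "N (z n) \<le> 1" .
      moreover have "z n \<in> V"
        using X_scale[OF y(1), of "1/c" n] m[OF y(1)] by (simp add: z_def scaleR_abs_L0 V_iff)
      ultimately show ?thesis by (simp add: unit_ball_on_def)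
    qed
    moreover have "(\<lambda>n. F (z n)) \<longlonglongrightarrow> 1"
    proof -
      have "(\<lambda>n. (1/c) * F (abs_L0 (y n))) \<longlonglongrightarrow> (1/c) * c"
        using y(3) unfolding c_def[symmetric] by (intro tendsto_mult tendsto_const)
      then show ?thesis using c y(1) m by (simp add: z_def Fs V_iff)
    qed
    ultimately have "(\<lambda>n. N (z n - (1 / c) *\<^sub>R abs_L0 u)) \<longlonglongrightarrow> 0" by (intro ex) auto
    then have "(\<lambda>n. c * N (z n - (1 / c) *\<^sub>R abs_L0 u)) \<longlonglongrightarrow> c * 0" by (intro tendsto_mult tendsto_const)
    moreover have "c * N (z n - (1 / c) *\<^sub>R abs_L0 u) = N (abs_L0 (\<lambda>s. y n s - u s))" for n
    proof -
      have "z n - (1 / c) *\<^sub>R abs_L0 u = (1 / c) *\<^sub>R abs_L0 (\<lambda>s. y n s - u s)"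
        using m[OF y(1)] m[OF u] by (simp add: z_def scaleR_diff_right[symmetric] minus_abs_L0)
      then show ?thesis using N_scale[OF X_diff[OF y(1) u], of "1/c"] c by simp
    qed
    ultimately show "(\<lambda>n. N (abs_L0 (\<lambda>s. y n s - u s))) \<longlonglongrightarrow> 0" by simp
  qed
qed

text \<open>A functional of maximal value at the midpoint of a segment in the ball is maximal at
  both ends; exposure, applied to the constant sequence \<open>u + h\<close>, then forces the norm
  of \<open>h\<close> to vanish.\<close>

lemma strongly_exposed_no_segment:
  assumes SEP: "strongly_exposed_property V N" and u: "u \<in> X" "0 < N (abs_L0 u)" and h: "h \<in> X"
    and le: "N (abs_L0 (\<lambda>s. u s + h s)) \<le> N (abs_L0 u)" "N (abs_L0 (\<lambda>s. u s - h s)) \<le> N (abs_L0 u)"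
  shows "N (abs_L0 h) = 0"
proof -
  obtain G where G: "\<And>f g. f \<in> X \<Longrightarrow> g \<in> X \<Longrightarrow> G (\<lambda>s. f s + g s) = G f + G g"
    "\<And>c f. f \<in> X \<Longrightarrow> G (\<lambda>s. c * f s) = c * G f"
    "\<And>f. f \<in> X \<Longrightarrow> G f \<le> N (abs_L0 f)" "G u = N (abs_L0 u)"
    "\<And>y :: nat \<Rightarrow> real \<Rightarrow> real. (\<And>n. y n \<in> X) \<Longrightarrow> (\<And>n. N (abs_L0 (y n)) \<le> N (abs_L0 u)) \<Longrightarrow>
      (\<lambda>n. G (y n)) \<longlonglongrightarrow> N (abs_L0 u) \<Longrightarrow> (\<lambda>n. N (abs_L0 (\<lambda>s. y n s - u s))) \<longlonglongrightarrow> 0"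
    by (rule strongly_exposedE[OF SEP u]) blast
  have "G (\<lambda>s. u s + h s) = G u + G h" by (rule G(1)) fact+
  moreover have "G (\<lambda>s. u s - h s) = G u - G h"
    using G(1)[OF u(1) X_scale[OF h, of "-1"]] G(2)[OF h, of "-1"] by simp
  moreover have "G (\<lambda>s. u s + h s) \<le> N (abs_L0 u)" "G (\<lambda>s. u s - h s) \<le> N (abs_L0 u)"
    using G(3)[OF X_add[OF u(1) h]] G(3)[OF X_diff[OF u(1) h]] le by auto
  ultimately have "G (\<lambda>s. u s + h s) = N (abs_L0 u)" using G(4) by linarith
  then have "(\<lambda>n::nat. N (abs_L0 (\<lambda>s. (u s + h s) - u s))) \<longlonglongrightarrow> 0"
    by (intro G(5) X_add u h le) auto
  then show ?thesis by (simp add: LIMSEQ_const_iff)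
qed

lemma rho_antimono_fun:
  assumes "antimono_on {0<..} f" "\<And>t. 0 < t \<Longrightarrow> 0 \<le> f t"
  shows "rho f = (\<integral>\<^sup>+t. ennreal (\<phi> (f t)) \<partial>wm)"
  unfolding rho_def
proof (rule nn_integral_cong_AE)
  have "AE t in wm. rearr f t = ennreal (f t)" using AE_rearr_antimono_fun[OF assms] by (simp add: AE_wm)
  then show "AE t in wm. extend \<phi> (rearr f t) = ennreal (\<phi> (f t))"
    using AE_space by eventually_elim (use assms(2) in \<open>auto simp: extend_ennreal\<close>)
qed

lemma rhoc_antimono_fun:
  assumes "antimono_on {0<..} f" "\<And>t. 0 < t \<Longrightarrow> 0 \<le> f t"
  shows "rhoc f = (\<integral>\<^sup>+t. \<psi> (ennreal (f t)) \<partial>wm)"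
  unfolding rhoc_def
proof (rule nn_integral_cong_AE)
  have "AE t in wm. rearr f t = ennreal (f t)" using AE_rearr_antimono_fun[OF assms] by (simp add: AE_wm)
  then show "AE t in wm. \<psi> (rearr f t) = \<psi> (ennreal (f t))" by eventually_elim simp
qed

lemma pairing_antimono_fun:
  assumes f: "antimono_on {0<..} f" "\<And>t. 0 < t \<Longrightarrow> 0 \<le> f t" and g: "antimono_on {0<..} g" "\<And>t. 0 < t \<Longrightarrow> 0 \<le> g t"
  shows "(\<integral>\<^sup>+t. rearr f t * rearr g t \<partial>wm) = (\<integral>\<^sup>+t. ennreal (f t * g t) \<partial>wm)"
proof (rule nn_integral_cong_AE)
  have "AE t in wm. rearr f t = ennreal (f t)" "AE t in wm. rearr g t = ennreal (g t)"
    using AE_rearr_antimono_fun[OF f] AE_rearr_antimono_fun[OF g] by (simp_all add: AE_wm)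
  then show "AE t in wm. rearr f t * rearr g t = ennreal (f t * g t)"
    using AE_space by eventually_elim (use f(2) g(2) in \<open>auto simp: ennreal_mult\<close>)
qed

subsection \<open>Strict convexity is necessary\<close>

text \<open>The last two steps carry values in an interval where \<open>\<phi>\<close> is affine;
  the first is free to adjust the conjugate modular.\<close>

definition step3 :: "real \<Rightarrow> real \<Rightarrow> real \<Rightarrow> real \<Rightarrow> real \<Rightarrow> real" where
  "step3 \<tau> p q r t = (if t < \<tau> then p else if t < 2 * \<tau> then q else if t < 3 * \<tau> then r else 0)"

lemma step3_antimono: "0 < \<tau> \<Longrightarrow> q \<le> p \<Longrightarrow> r \<le> q \<Longrightarrow> 0 \<le> r \<Longrightarrow> antimono_on {0<..} (step3 \<tau> p q r)"
  by (auto simp: monotone_on_def step3_def)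

lemma step3_nonneg: "q \<le> p \<Longrightarrow> r \<le> q \<Longrightarrow> 0 \<le> r \<Longrightarrow> 0 \<le> step3 \<tau> p q r t"
  by (auto simp: step3_def)

lemma nn_integral_step3:
  assumes \<tau>: "0 < \<tau>" and [simp]: "0 \<le> p" "0 \<le> q" "0 \<le> r"
  shows "(\<integral>\<^sup>+t. ennreal (step3 \<tau> p q r t) \<partial>wm) =
    ennreal (p * Wr \<tau> + q * (Wr (2*\<tau>) - Wr \<tau>) + r * (Wr (3*\<tau>) - Wr (2*\<tau>)))"
proof -
  have [measurable]: "{0<..<\<tau>} \<in> sets pos_lebesgue" "{\<tau>..<2*\<tau>} \<in> sets pos_lebesgue" "{2*\<tau>..<3*\<tau>} \<in> sets pos_lebesgue"
    using \<tau> by (auto intro!: borel_sets_wm)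
  have le: "Wr \<tau> \<le> Wr (2*\<tau>)" "Wr (2*\<tau>) \<le> Wr (3*\<tau>)" using \<tau> by (auto intro: Wr_mono)
  have "(\<integral>\<^sup>+t. ennreal (step3 \<tau> p q r t) \<partial>wm) = (\<integral>\<^sup>+t. ennreal p * indicator {0<..<\<tau>} t +
      ennreal q * indicator {\<tau>..<2*\<tau>} t + ennreal r * indicator {2*\<tau>..<3*\<tau>} t \<partial>wm)"
    using \<tau> by (intro nn_integral_cong) (auto simp: step3_def)
  also have "\<dots> = ennreal p * emeasure wm {0<..<\<tau>} + ennreal q * emeasure wm {\<tau>..<2*\<tau>} + ennreal r * emeasure wm {2*\<tau>..<3*\<tau>}"
    by (simp add: nn_integral_add nn_integral_cmult_indicator)
  also have "\<dots> = ennreal (p * Wr \<tau> + q * (Wr (2*\<tau>) - Wr \<tau>) + r * (Wr (3*\<tau>) - Wr (2*\<tau>)))"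
    using \<tau> le by (simp add: emeasure_wm_Ioo emeasure_wm_Ico ennreal_mult ennreal_plus)
  finally show ?thesis .
qed

lemma step3_comp: "F 0 = 0 \<Longrightarrow> F (step3 \<tau> p q r t) = step3 \<tau> (F p) (F q) (F r) t"
  by (simp add: step3_def)

lemma rho_step3:
  assumes "0 < \<tau>" "q \<le> p" "r \<le> q" "0 \<le> r"
  shows "rho (step3 \<tau> p q r) = ennreal (\<phi> p * Wr \<tau> + \<phi> q * (Wr (2*\<tau>) - Wr \<tau>) + \<phi> r * (Wr (3*\<tau>) - Wr (2*\<tau>)))"
  using assms by (subst rho_antimono_fun) (auto intro!: step3_antimono step3_nonneg simp: step3_comp[of \<phi>] nn_integral_step3)

lemma step3_X:
  assumes "0 < \<tau>" "q \<le> p" "r \<le> q" "0 \<le> r" shows "step3 \<tau> p q r \<in> X"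
proof -
  have "measurable_fun (step3 \<tau> p q r)"
    by (rule antimono_measurable_pos_lebesgue) (rule step3_antimono, use assms in auto)
  then show ?thesis using rho_step3[OF assms] by (auto simp: X_def intro!: exI[of _ 1])
qed

text \<open>The tangent at a point where convexity is not strict must contain the whole chord. Hence
  \<open>\<phi>\<close> is affine between the end points, and one slope \<open>g\<close> is a
  subgradient throughout.\<close>

lemma not_strictly_convexE:
  assumes "\<not> strictly_convex_on {0..} \<phi>"
  obtains a b g where "0 \<le> a" "a < b" "\<And>w. a \<le> w \<Longrightarrow> w \<le> b \<Longrightarrow> subgrad w g"
    "\<And>w. a \<le> w \<Longrightarrow> w \<le> b \<Longrightarrow> \<phi> w = \<phi> a + g * (w - a)"
proof -
  have "\<exists>u v t. 0 \<le> u \<and> u < v \<and> 0 < t \<and> t < 1 \<and> (1 - t) * \<phi> u + t * \<phi> v \<le> \<phi> ((1 - t) * u + t * v)"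
  proof -
    obtain u v t where *: "0 \<le> u" "0 \<le> v" "u \<noteq> v" "0 < t" "t < 1" "(1 - t) * \<phi> u + t * \<phi> v \<le> \<phi> ((1 - t) * u + t * v)"
      using assms by (auto simp: strictly_convex_on_def not_less)
    show ?thesis
    proof (cases "u < v")
      case True then show ?thesis using * by blast
    next
      case False
      then show ?thesis using * by (intro exI[of _ v] exI[of _ u] exI[of _ "1 - t"]) (auto simp: add.commute)
    qed
  qed
  then obtain u v t where uv: "0 \<le> u" "u < v" "0 < t" "t < 1" and
    ge: "(1 - t) * \<phi> u + t * \<phi> v \<le> \<phi> ((1 - t) * u + t * v)" by blast
  define m where "m = (1 - t) * u + t * v"
  have "0 < t * v" using uv by simp
  then have m: "0 < m" using uv by (auto simp: m_def intro!: add_nonneg_pos)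
  obtain g where g: "subgrad m g" using subgrad_exists[OF m] by blast
  have gu: "\<phi> m + g * (u - m) \<le> \<phi> u" and gv: "\<phi> m + g * (v - m) \<le> \<phi> v"
    using g uv by (auto simp: subgrad_def)
  have "(1 - t) * (\<phi> u - (\<phi> m + g * (u - m))) + t * (\<phi> v - (\<phi> m + g * (v - m))) = (1 - t) * \<phi> u + t * \<phi> v - \<phi> m"
    by (simp add: m_def algebra_simps)
  also have "\<dots> \<le> 0" using ge by (simp add: m_def)
  finally have s: "(1 - t) * (\<phi> u - (\<phi> m + g * (u - m))) + t * (\<phi> v - (\<phi> m + g * (v - m))) \<le> 0" .
  have "0 \<le> (1 - t) * (\<phi> u - (\<phi> m + g * (u - m)))" "0 \<le> t * (\<phi> v - (\<phi> m + g * (v - m)))"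
    using uv gu gv by auto
  then have "(1 - t) * (\<phi> u - (\<phi> m + g * (u - m))) = 0" "t * (\<phi> v - (\<phi> m + g * (v - m))) = 0"
    using s by linarith+
  then have eu: "\<phi> u = \<phi> m + g * (u - m)" and ev: "\<phi> v = \<phi> m + g * (v - m)" using uv by auto
  have ew: "\<phi> w = \<phi> m + g * (w - m)" if w: "u \<le> w" "w \<le> v" for w
  proof (rule antisym)
    define \<theta> where "\<theta> = (w - u) / (v - u)"
    have th: "\<theta> * (v - u) = w - u" using uv by (simp add: \<theta>_def)
    have weq: "w = (1 - \<theta>) * u + \<theta> * v" using th by (simp add: algebra_simps)
    have "\<phi> w \<le> (1 - \<theta>) * \<phi> u + \<theta> * \<phi> v"
      unfolding weq using uv w by (intro \<phi>_convexD) (auto simp: \<theta>_def)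
    also have "\<dots> = \<phi> m + g * (w - m)" unfolding eu ev weq by (simp add: algebra_simps)
    finally show "\<phi> w \<le> \<phi> m + g * (w - m)" .
    show "\<phi> m + g * (w - m) \<le> \<phi> w" using g w uv by (auto simp: subgrad_def)
  qed
  show ?thesis
  proof (rule that[of u v g])
    show "subgrad w g" if "u \<le> w" "w \<le> v" for w
      using g ew[OF that] uv that unfolding subgrad_def by (auto simp: algebra_simps)
    show "\<phi> w = \<phi> u + g * (w - u)" if "u \<le> w" "w \<le> v" for w
      using ew[OF that] eu by (simp add: algebra_simps)
  qed (use uv in auto)
qed

text \<open>On the last two steps \<open>\<phi>\<close> is affine with slope \<open>g\<close>, so that the balanced perturbation
  \<open>h\<close> changes neither modular nor norm.\<close>

lemma strictly_convex_of_strongly_exposed_aux: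
  assumes SEP: "strongly_exposed_property V N"
    and ab: "0 \<le> a" "a < b" and "\<forall>w\<in>{a..b}. subgrad w g"
    and "\<forall>w\<in>{a..b}. \<phi> w = \<phi> a + g * (w - a)"
    and B: "b \<le> B" "subgrad B gB" and \<tau>: "0 < \<tau>" and \<kappa>: "0 \<le> \<kappa>"
    and k1: "(B * gB - \<phi> B) * Wr \<tau> + (a * g - \<phi> a) * (Wr (3*\<tau>) - Wr \<tau>) = \<kappa>" "\<kappa> \<le> 1"
    and up: "\<And>f r. f \<in> X \<Longrightarrow> 0 \<le> r \<Longrightarrow> rho f \<le> ennreal r \<Longrightarrow> N (abs_L0 f) \<le> \<kappa> + r"
  shows False
proof -
  have sub: "subgrad w g" and aff: "\<phi> w = \<phi> a + g * (w - a)" if "a \<le> w" "w \<le> b" for w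
    using assms(4,5) that atLeastAtMost_iff by blast+
  \<comment> \<open>The thirds of \<open>{a..b}\<close> leave room to move both values without
    leaving the interval or exchanging their order.\<close>
  define c1 c2 where "c1 = a + 2 * (b - a) / 3" and "c2 = a + (b - a) / 3"
  define w1 w2 w3 where "w1 = Wr \<tau>" and "w2 = Wr (2*\<tau>) - Wr \<tau>" and "w3 = Wr (3*\<tau>) - Wr (2*\<tau>)"
  have w: "0 < w1" "0 < w2" "0 < w3"
    using \<tau> by (auto simp: w1_def w2_def w3_def intro!: Wr_pos Wr_strict_mono)
  \<comment> \<open>Both steps receive the same weighted amount \<open>e = h1 * w2 = h2 * w3\<close>
    with opposite signs; the factor \<open>1/9\<close> ensures
    \<open>c2 + h2 \<le> c1 - h1\<close>.\<close>
  define e where "e = (b - a) / 9 * min w2 w3"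
  define h1 h2 where "h1 = e / w2" and "h2 = e / w3"
  have e: "0 < e" using ab w by (simp add: e_def)
  have h: "0 < h1" "0 < h2" "h1 * w2 = h2 * w3" using e w by (auto simp: h1_def h2_def)
  have "h1 \<le> (b - a) / 9" "h2 \<le> (b - a) / 9"
    using w ab by (auto simp: h1_def h2_def e_def divide_le_eq min_def mult_left_mono)
  then have c: "a \<le> c2 - h2" "c2 + h2 \<le> c1 - h1" "c1 + h1 \<le> b"
    using ab by (auto simp: c1_def c2_def field_simps)
  have gB: "g \<le> gB"
  proof -
    have "c2 < B" using c h B by linarith
    then show ?thesis using subgrad_mono[of c2 g B gB] sub[of c2] B(2) c h by auto
  qed
  have g0: "0 \<le> g" using sub[of a] ab by (auto simp: subgrad_def)
  define u h where "u = step3 \<tau> B c1 c2" and "h = step3 \<tau> 0 h1 (- h2)"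
  have uX: "u \<in> X" unfolding u_def using \<tau> c h B ab by (intro step3_X) auto
  have up_eq: "(\<lambda>s. u s + h s) = step3 \<tau> B (c1 + h1) (c2 - h2)"
    and um_eq: "(\<lambda>s. u s - h s) = step3 \<tau> B (c1 - h1) (c2 + h2)"
    by (auto simp: u_def h_def step3_def)
  have pX: "(\<lambda>s. u s + h s) \<in> X" "(\<lambda>s. u s - h s) \<in> X"
    unfolding up_eq um_eq using \<tau> c h B ab \<open>0 < h1\<close> \<open>0 < h2\<close> by (auto intro!: step3_X)
  have hX: "h \<in> X" using X_diff[OF pX(1) uX] by simp
  define R where "R = \<phi> B * w1 + \<phi> c1 * w2 + \<phi> c2 * w3"
  have R: "0 \<le> R" using w by (auto simp: R_def)
  have rp: "rho (\<lambda>s. u s + h s) = ennreal R"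
  proof -
    have "rho (\<lambda>s. u s + h s) = ennreal (\<phi> B * w1 + \<phi> (c1 + h1) * w2 + \<phi> (c2 - h2) * w3)"
      unfolding up_eq w1_def w2_def w3_def using \<tau> c \<open>0 < h1\<close> \<open>0 < h2\<close> B ab by (intro rho_step3) auto
    also have "\<phi> B * w1 + \<phi> (c1 + h1) * w2 + \<phi> (c2 - h2) * w3 = R + g * (h1 * w2 - h2 * w3)"
    proof -
      have "\<phi> (c1 + h1) = \<phi> c1 + g * h1" "\<phi> (c2 - h2) = \<phi> c2 - g * h2"
        using aff[of "c1 + h1"] aff[of "c2 - h2"] aff[of c1] aff[of c2] c \<open>0 < h1\<close> \<open>0 < h2\<close>
        by (simp_all add: algebra_simps)
      then show ?thesis by (simp only: R_def) (simp add: algebra_simps)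
    qed
    finally show ?thesis using \<open>h1 * w2 = h2 * w3\<close> by simp
  qed
  have rm: "rho (\<lambda>s. u s - h s) = ennreal R"
  proof -
    have "rho (\<lambda>s. u s - h s) = ennreal (\<phi> B * w1 + \<phi> (c1 - h1) * w2 + \<phi> (c2 + h2) * w3)"
      unfolding um_eq w1_def w2_def w3_def using \<tau> c \<open>0 < h1\<close> \<open>0 < h2\<close> B ab by (intro rho_step3) auto
    also have "\<phi> B * w1 + \<phi> (c1 - h1) * w2 + \<phi> (c2 + h2) * w3 = R - g * (h1 * w2 - h2 * w3)"
    proof -
      have "\<phi> (c1 - h1) = \<phi> c1 - g * h1" "\<phi> (c2 + h2) = \<phi> c2 + g * h2"
        using aff[of "c1 - h1"] aff[of "c2 + h2"] aff[of c1] aff[of c2] c \<open>0 < h1\<close> \<open>0 < h2\<close>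
        by (simp_all add: algebra_simps)
      then show ?thesis by (simp only: R_def) (simp add: algebra_simps)
    qed
    finally show ?thesis using \<open>h1 * w2 = h2 * w3\<close> by simp
  qed
  \<comment> \<open>On the affine piece \<open>w * g - \<phi> w\<close> does not depend on
    \<open>w\<close>, so \<open>\<kappa>\<close> is the conjugate modular of the step function of
    slopes.\<close>
  have k1': "(B * gB - \<phi> B) * w1 + (c1 * g - \<phi> c1) * w2 + (c2 * g - \<phi> c2) * w3 = \<kappa>"
  proof -
    have "c1 * g - \<phi> c1 = a * g - \<phi> a" "c2 * g - \<phi> c2 = a * g - \<phi> a"
      using aff[of c1] aff[of c2] c \<open>0 < h1\<close> \<open>0 < h2\<close> by (simp_all add: algebra_simps)
    moreover have "w2 + w3 = Wr (3*\<tau>) - Wr \<tau>" by (simp add: w2_def w3_def)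
    ultimately show ?thesis using k1(1) by (simp add: w1_def distrib_left[symmetric] add.assoc)
  qed
  \<comment> \<open>Testing with the slopes gives equality in Young's inequality on every step.
    Together with \<open>up\<close> it puts the norms of both perturbations below that of
    \<open>u\<close>.\<close>
  have ge: "\<kappa> + R \<le> N (abs_L0 u)"
  proof (rule N_ge[OF uX])
    let ?g = "step3 \<tau> gB g g"
    have am: "antimono_on {0<..} ?g" using \<tau> gB g0 by (intro step3_antimono) auto
    have nn: "0 \<le> ?g t" for t using gB g0 by (intro step3_nonneg) auto
    have amu: "antimono_on {0<..} u" unfolding u_def using \<tau> c \<open>0 < h1\<close> \<open>0 < h2\<close> B ab by (intro step3_antimono) auto
    have nnu: "0 \<le> u t" for t unfolding u_def using c \<open>0 < h1\<close> \<open>0 < h2\<close> B ab by (intro step3_nonneg) auto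
    show "measurable_fun ?g" by (rule antimono_measurable_pos_lebesgue) fact
    have s: "subgrad c1 g" "subgrad c2 g" using c \<open>0 < h1\<close> \<open>0 < h2\<close> by (auto intro!: sub)
    have p: "0 \<le> B * gB - \<phi> B" "0 \<le> c1 * g - \<phi> c1" "0 \<le> c2 * g - \<phi> c2"
      using subgrad_nonneg[OF B(2)] subgrad_nonneg[OF s(1)] subgrad_nonneg[OF s(2)] by auto
    have \<psi>0: "\<psi> 0 = 0" unfolding complementary_def by simp
    have "c1 * g - \<phi> c1 = c2 * g - \<phi> c2"
      using aff[of c1] aff[of c2] c \<open>0 < h1\<close> \<open>0 < h2\<close> by (simp add: algebra_simps)
    then have eq: "\<psi> (ennreal (?g t)) = ennreal (step3 \<tau> (B * gB - \<phi> B) (c1 * g - \<phi> c1) (c2 * g - \<phi> c2) t)" for t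
      using \<psi>_subgrad[OF s(1)] \<psi>_subgrad[OF B(2)] \<psi>0 by (simp add: step3_def)
    have "rhoc ?g = ennreal \<kappa>"
      by (subst rhoc_antimono_fun[OF am nn]) (simp only: eq nn_integral_step3[OF \<tau> p] k1'[unfolded w1_def w2_def w3_def])
    then show "rhoc ?g \<le> 1" using k1(2) by (simp add: ennreal_le_1)
    have eq2: "u t * ?g t = step3 \<tau> (B * gB) (c1 * g) (c2 * g) t" for t
      by (simp add: u_def step3_def)
    have "0 \<le> B" "0 \<le> c1" "0 \<le> c2" using ab c \<open>0 < h1\<close> \<open>0 < h2\<close> B by auto
    then have p2: "0 \<le> B * gB" "0 \<le> c1 * g" "0 \<le> c2 * g" using gB g0 by auto
    have "(\<integral>\<^sup>+t. rearr u t * rearr ?g t \<partial>wm) = ennreal (B * gB * w1 + c1 * g * w2 + c2 * g * w3)"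
      by (subst pairing_antimono_fun[OF amu nnu am nn]) (simp only: eq2 nn_integral_step3[OF \<tau> p2] w1_def w2_def w3_def)
    also have "B * gB * w1 + c1 * g * w2 + c2 * g * w3 = \<kappa> + R"
      using k1' by (simp add: R_def algebra_simps)
    finally show "ennreal (\<kappa> + R) \<le> (\<integral>\<^sup>+t. rearr u t * rearr ?g t \<partial>wm)" by simp
  qed
  have "0 < c1" using c ab \<open>0 < h1\<close> \<open>0 < h2\<close> by linarith
  then have "0 < R" unfolding R_def using w by (intro add_pos_nonneg add_nonneg_pos mult_pos_pos) (auto intro: \<phi>_pos)
  have "N (abs_L0 h) = 0"
  proof (rule strongly_exposed_no_segment[OF SEP uX _ hX])
    show "0 < N (abs_L0 u)" using ge \<kappa> \<open>0 < R\<close> by linarith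
    show "N (abs_L0 (\<lambda>s. u s + h s)) \<le> N (abs_L0 u)" using up[OF pX(1) R] rp ge by simp
    show "N (abs_L0 (\<lambda>s. u s - h s)) \<le> N (abs_L0 u)" using up[OF pX(2) R] rm ge by simp
  qed
  moreover have "0 < N (abs_L0 h)"
  proof (rule N_pos[OF hX])
    show "{\<tau>..<2*\<tau>} \<in> sets pos_lebesgue" using \<tau> by (intro borel_sets_wm) auto
    show "emeasure pos_lebesgue {\<tau>..<2*\<tau>} = ennreal \<tau>" using \<tau> by (subst emeasure_restrict_space) auto
    show "AE s in pos_lebesgue. h1 * indicator {\<tau>..<2*\<tau>} s \<le> \<bar>h s\<bar>"
      using \<tau> \<open>0 < h1\<close> by (intro AE_I2) (auto simp: h_def step3_def split: split_indicator)
  qed (use \<tau> \<open>0 < h1\<close> in auto)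
  ultimately show False by simp
qed

text \<open>The previous lemma asks for a conjugate modular \<open>\<kappa>\<close> such that the
  norm is at most \<open>\<kappa>\<close> plus the modular. If some tangent beyond \<open>b\<close>
  has positive conjugate value, \<open>\<tau>\<close> can be tuned to \<open>\<kappa> = 1\<close>.
  Otherwise \<open>\<phi>\<close> is linear, the norm is bounded by the modular, and
  \<open>\<kappa> = 0\<close> works.\<close>

lemma strictly_convex_of_strongly_exposed:
  assumes SEP: "strongly_exposed_property V N" shows "strictly_convex_on {0..} \<phi>"
proof (rule ccontr)
  assume "\<not> ?thesis"
  then obtain a b g where ab: "0 \<le> a" "a < b" and sub: "\<And>w. a \<le> w \<Longrightarrow> w \<le> b \<Longrightarrow> subgrad w g"
    and aff: "\<And>w. a \<le> w \<Longrightarrow> w \<le> b \<Longrightarrow> \<phi> w = \<phi> a + g * (w - a)"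
    by (rule not_strictly_convexE) blast
  have "\<forall>w\<in>{a..b}. subgrad w g" "\<forall>w\<in>{a..b}. \<phi> w = \<phi> a + g * (w - a)"
    using sub aff atLeastAtMost_iff by blast+
  note aux = strictly_convex_of_strongly_exposed_aux[OF SEP ab this]
  have \<kappa>': "0 \<le> a * g - \<phi> a" using subgrad_nonneg[OF sub[of a]] ab by simp
  show False
  proof (cases "\<exists>B gB. b \<le> B \<and> subgrad B gB \<and> \<phi> B < B * gB")
    case True
    then obtain B gB where B: "b \<le> B" "subgrad B gB" "\<phi> B < B * gB" by blast
    define x y where "x = B * gB - \<phi> B" and "y = a * g - \<phi> a"
    have xy: "0 < x" "0 \<le> y" using B \<kappa>' by (auto simp: x_def y_def)
    define K where "K \<tau> = x * Wr \<tau> + y * (Wr (3*\<tau>) - Wr \<tau>)" for \<tau>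
    \<comment> \<open>At \<open>\<tau> = d/3\<close> the three steps together have weight
      \<open>Wr d\<close>, so \<open>K\<close> is at most \<open>1\<close>; at \<open>e\<close> the
      first step alone already contributes \<open>1\<close>.\<close>
    obtain d where d: "0 < d" "Wr d < 1 / (x + y)" using Wr_small[of "1 / (x + y)"] xy by auto
    obtain e where e: "0 < e" "1 / x < Wr e" using Wr_large by blast
    have cont: "continuous_on {d/3..e} K" unfolding K_def
      using d by (intro continuous_intros continuous_on_compose2[OF Wr_continuous]) auto
    have le1: "K (d/3) \<le> 1"
    proof -
      have "Wr (d/3) \<le> Wr d" using d by (intro Wr_mono) auto
      then have "K (d/3) \<le> x * Wr d + y * Wr d" unfolding K_def using xy
        by (intro add_mono mult_left_mono) auto
      also have "\<dots> = (x + y) * Wr d" by (simp add: algebra_simps)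
      also have "\<dots> \<le> 1" using d xy by (simp add: field_simps)
      finally show ?thesis .
    qed
    have ge1: "1 \<le> K e"
    proof -
      have "Wr e \<le> Wr (3 * e)" using e by (intro Wr_mono) auto
      then have "0 \<le> y * (Wr (3 * e) - Wr e)" using xy by simp
      moreover have "1 \<le> x * Wr e" using e xy by (simp add: field_simps)
      ultimately show ?thesis by (simp add: K_def)
    qed
    have "d/3 \<le> e"
    proof (rule ccontr)
      assume "\<not> d/3 \<le> e"
      then have "Wr e \<le> Wr d" using d by (intro Wr_mono) auto
      moreover have "1 / (x + y) \<le> 1 / x" using xy by (simp add: frac_le)
      ultimately show False using e d by linarith
    qed
    then obtain \<tau> where \<tau>: "d/3 \<le> \<tau>" "K \<tau> = 1" using IVT'[OF le1 ge1 _ cont] by blast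
    show False
    proof (rule aux[OF B(1,2), of \<tau> 1])
      show "(B * gB - \<phi> B) * Wr \<tau> + (a * g - \<phi> a) * (Wr (3 * \<tau>) - Wr \<tau>) = 1"
        using \<tau>(2) by (simp add: K_def x_def y_def)
      show "N (abs_L0 f) \<le> 1 + r" if "f \<in> X" "0 \<le> r" "rho f \<le> ennreal r" for f r
        using N_le[of f 1 r] that by simp
    qed (use \<tau> d in auto)
  next
    case no: False
    \<comment> \<open>All tangents beyond \<open>b\<close> pass through the origin, which makes
      \<open>\<phi> z / z\<close> constant up to any bound.\<close>
    have lin: "\<phi> w = \<phi> b / b * w" if w: "0 \<le> w" for w
    proof (cases "w = 0")
      case False
      define B where "B = max b w"
      have Bp: "0 < B" using ab by (simp add: B_def)
      obtain gB where gB: "subgrad B gB" using subgrad_exists[OF Bp] by blast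
      have "b \<le> B" by (simp add: B_def)
      then have eq: "\<phi> B = B * gB" using no gB subgrad_nonneg[OF gB] by (meson antisym not_less)
      have *: "\<phi> z / z = gB" if z: "0 < z" "z \<le> B" for z
      proof (rule antisym)
        show "\<phi> z / z \<le> gB" using \<phi>_ratio_mono[OF z] eq Bp by simp
        have "gB * z \<le> \<phi> z" using gB z eq by (auto simp: subgrad_def algebra_simps dest: spec[of _ z])
        then show "gB \<le> \<phi> z / z" using z by (simp add: field_simps)
      qed
      show ?thesis using *[of w] *[of b] w False ab by (simp add: B_def field_simps)
    qed simp
    obtain gB where gB: "subgrad b gB" using subgrad_exists[of b] ab by auto
    have eq: "\<phi> b = b * gB" using no gB subgrad_nonneg[OF gB] by (meson antisym not_less order_refl)
    have "\<phi> b / b = gB" using eq ab by simp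
    then have "\<phi> a = gB * a" using lin[of a] ab by simp
    have "\<phi> b = \<phi> a + g * (b - a)" using aff[of b] ab by auto
    then have "(g - gB) * (b - a) = 0" using \<open>\<phi> a = gB * a\<close> eq by (simp add: algebra_simps)
    then have gg: "g = gB" using ab by simp
    show False
    proof (rule aux[OF order_refl gB, of 1 0])
      show "(b * gB - \<phi> b) * Wr 1 + (a * g - \<phi> a) * (Wr (3 * 1) - Wr 1) = 0"
        using eq \<open>\<phi> a = gB * a\<close> gg by simp
      show "N (abs_L0 f) \<le> 0 + r" if f: "f \<in> X" "0 \<le> r" "rho f \<le> ennreal r" for f r
      proof -
        have m: "measurable_fun f" using f by (simp add: X_measurable)
        have "N (abs_L0 f) \<le> r + 1 / k" if k: "0 < k" for k
        proof -
          have "rho (\<lambda>s. k * f s) = ennreal k * rho f"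
            unfolding rho_scale[OF m] unfolding rho_def
          proof (subst nn_integral_cmult[symmetric])
            show "(\<integral>\<^sup>+t. extend \<phi> (ennreal \<bar>k\<bar> * rearr f t) \<partial>wm) = (\<integral>\<^sup>+t. ennreal k * extend \<phi> (rearr f t) \<partial>wm)"
            proof (rule nn_integral_cong)
              fix t show "extend \<phi> (ennreal \<bar>k\<bar> * rearr f t) = ennreal k * extend \<phi> (rearr f t)"
              proof (cases "rearr f t")
                case (real z)
                then have "\<phi> (k * z) = k * \<phi> z" using k by (subst (1 2) lin) auto
                then show ?thesis using k real
                  by (simp add: ennreal_mult[symmetric] extend_ennreal)
              qed (use k in \<open>simp add: ennreal_mult_top\<close>)
            qed
          qed measurable
          also have "\<dots> \<le> ennreal k * ennreal r" using f by (intro mult_left_mono) auto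
          also have "\<dots> = ennreal (k * r)" using k f by (simp add: ennreal_mult)
          finally have "N (abs_L0 f) \<le> (1 + k * r) / k" using f k by (intro N_le) auto
          then show ?thesis using k by (simp add: field_simps)
        qed
        from this[of "1 / e" for e] have "N (abs_L0 f) \<le> r + e" if "0 < e" for e using that by simp
        then show ?thesis by (simp add: field_le_epsilon)
      qed
    qed auto
  qed
qed

subsection \<open>The growth condition on \<open>\<phi>\<close> is necessary\<close>

text \<open>The superlevel sets are disjoint unions of pieces \<open>A n\<close>, so the layer-cake
  formula and countable subadditivity of \<open>W\<close> separate the pieces.\<close>

lemma rho_disjoint_le:
  assumes A: "disjoint_family A" "\<And>n. A n \<in> sets pos_lebesgue" "\<And>n. emeasure pos_lebesgue (A n) = ennreal (a n)"
    and u: "\<And>n. 0 \<le> u n"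
  shows "rho (\<lambda>t. \<Sum>i. u i * indicator (A i) t) \<le> (\<Sum>n. ennreal (\<phi> (u n) * Wr (a n)))"
proof -
  define f where "f t = (\<Sum>i. u i * indicator (A i) t)" for t
  have [measurable]: "A n \<in> sets pos_lebesgue" for n by (rule A)
  have f[measurable]: "measurable_fun f" unfolding f_def by measurable
  have fin: "f t = u n" if "t \<in> A n" for t n unfolding f_def by (rule suminf_disjoint_indicator_in[OF A(1) that])
  have fout: "f t = 0" if "t \<notin> (\<Union>i. A i)" for t unfolding f_def by (rule suminf_disjoint_indicator_notin[OF A(1) that])
  have lev: "W (level_measure (\<lambda>s. \<phi> \<bar>f s\<bar>) l) \<le> (\<Sum>n. indicator {..<\<phi> (u n)} l * W (ennreal (a n)))" if l: "0 \<le> l" for l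
  proof -
    define B where "B n = (if l < \<phi> (u n) then A n else {})" for n
    have "{s \<in> space pos_lebesgue. l < \<bar>\<phi> \<bar>f s\<bar>\<bar>} = (\<Union>n. B n)"
    proof (intro set_eqI iffI)
      fix s assume s: "s \<in> {s \<in> space pos_lebesgue. l < \<bar>\<phi> \<bar>f s\<bar>\<bar>}"
      then have "f s \<noteq> 0" using l by (metis (no_types, lifting) \<phi>_0 abs_zero mem_Collect_eq not_less)
      then obtain n where "s \<in> A n" using fout by blast
      then show "s \<in> (\<Union>n. B n)" using s u fin by (auto simp: B_def intro!: exI[of _ n])
    next
      fix s assume "s \<in> (\<Union>n. B n)"
      then obtain n where "s \<in> A n" "l < \<phi> (u n)" by (auto simp: B_def split: if_splits)
      then show "s \<in> {s \<in> space pos_lebesgue. l < \<bar>\<phi> \<bar>f s\<bar>\<bar>}"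
        using fin u sets.sets_into_space[OF A(2)[of n]] by auto
    qed
    then have "level_measure (\<lambda>s. \<phi> \<bar>f s\<bar>) l = emeasure pos_lebesgue (\<Union>n. B n)" by (simp add: level_measure_def)
    also have "\<dots> = (\<Sum>n. emeasure pos_lebesgue (B n))"
      using A(1) by (intro suminf_emeasure[symmetric]) (auto simp: B_def disjoint_family_on_def)
    finally have "W (level_measure (\<lambda>s. \<phi> \<bar>f s\<bar>) l) \<le> (\<Sum>n. W (emeasure pos_lebesgue (B n)))"
      using W_suminf_le by simp
    also have "(\<lambda>n. W (emeasure pos_lebesgue (B n))) = (\<lambda>n. indicator {..<\<phi> (u n)} l * W (ennreal (a n)))"
      by (auto simp: B_def A(3))
    finally show ?thesis .
  qed
  have "rho f \<le> (\<integral>\<^sup>+l. (\<Sum>n. W (ennreal (a n)) * indicator {0..<\<phi> (u n)} l) \<partial>lborel)"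
    unfolding rho_layer[OF f]
  proof (rule nn_integral_mono)
    fix l :: real
    show "indicator {0..} l * W (level_measure (\<lambda>s. \<phi> \<bar>f s\<bar>) l) \<le> (\<Sum>n. W (ennreal (a n)) * indicator {0..<\<phi> (u n)} l)"
    proof (cases "0 \<le> l")
      case True
      then have "indicator {..<\<phi> (u n)} l = (indicator {0..<\<phi> (u n)} l :: ennreal)" for n by (auto split: split_indicator)
      then show ?thesis using lev[OF True] True by (simp add: mult.commute)
    qed auto
  qed
  also have "\<dots> = (\<Sum>n. \<integral>\<^sup>+l. W (ennreal (a n)) * indicator {0..<\<phi> (u n)} l \<partial>lborel)"
    by (rule nn_integral_suminf) measurable
  also have "\<dots> = (\<Sum>n. ennreal (\<phi> (u n) * Wr (a n)))"
    by (simp add: nn_integral_cmult_indicator W_ennreal ennreal_mult[symmetric] mult.commute)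
  finally show ?thesis unfolding f_def .
qed

lemma Delta2_of_strongly_exposed:
  assumes SEP: "strongly_exposed_property V N" shows "Delta2 (extend \<phi>)"
proof (rule ccontr)
  assume nD: "\<not> ?thesis"
  have "\<exists>u>0. 2 ^ n * \<phi> u < \<phi> (2 * u)" for n :: nat
  proof (rule ccontr)
    assume "\<not> (\<exists>u>0. 2 ^ n * \<phi> u < \<phi> (2 * u))"
    then have "\<phi> (2 * u) \<le> 2 ^ n * \<phi> u" if "0 < u" for u using that by (meson not_less)
    then show False using nD Delta2I[of "2 ^ n"] by simp
  qed
  then obtain u where u: "\<And>n. 0 < u n" "\<And>n::nat. 2 ^ n * \<phi> (u n) < \<phi> (2 * u n)" by metis
  have pp: "0 < \<phi> (u n)" for n by (rule \<phi>_pos) (rule u)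
  \<comment> \<open>With this weight the \<open>n\<close>-th piece has modular
    \<open>(1/2) ^ n\<close>, so the sum lies in \<open>X\<close>; yet doubling the piece raises its
    modular above \<open>1\<close>, which keeps its norm at least \<open>1/2\<close>.\<close>
  have "\<exists>a>0. Wr a = (1/2) ^ n / \<phi> (u n)" for n by (rule Wr_surj) (use pp in auto)
  then obtain a where a: "\<And>n. 0 < a n" "\<And>n. Wr (a n) = (1/2) ^ n / \<phi> (u n)" by metis
  define c where "c n = (\<Sum>i<n. a i)" for n
  have c0: "0 \<le> c n" for n unfolding c_def using a by (intro sum_nonneg) (auto intro: less_imp_le)
  have cS: "c (Suc n) = c n + a n" for n by (simp add: c_def)
  have cm: "incseq c" by (rule incseq_SucI) (use a cS in \<open>auto intro: less_imp_le\<close>)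
  define A where "A n = {c n<..c (Suc n)}" for n
  have A[measurable]: "A n \<in> sets pos_lebesgue" for n unfolding A_def using c0[of n] by (intro borel_sets_wm) auto
  have disj: "disjoint_family A"
    unfolding disjoint_family_on_def
  proof (intro ballI impI)
    fix m n :: nat assume "m \<noteq> n"
    then consider "Suc m \<le> n" | "Suc n \<le> m" by linarith
    then show "A m \<inter> A n = {}"
      using incseqD[OF cm, of "Suc m" n] incseqD[OF cm, of "Suc n" m] by cases (auto simp: A_def)
  qed
  have eA: "emeasure pos_lebesgue (A n) = ennreal (a n)" for n
    unfolding A_def using c0[of n] a(1)[of n] by (subst emeasure_restrict_space) (auto simp: cS)
  define f where "f t = (\<Sum>i. u i * indicator (A i) t)" for t
  have fin: "f t = u n" if "t \<in> A n" for t n unfolding f_def by (rule suminf_disjoint_indicator_in[OF disj that])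
  have f[measurable]: "measurable_fun f" unfolding f_def by measurable
  have "rho f \<le> (\<Sum>n. ennreal (\<phi> (u n) * Wr (a n)))"
    unfolding f_def using u by (intro rho_disjoint_le disj A eA) (auto intro: less_imp_le)
  also have "\<dots> = (\<Sum>n. ennreal ((1/2) ^ n))"
  proof -
    have "\<phi> (u n) * Wr (a n) = (1/2) ^ n" for n using pp[of n] by (simp add: a(2))
    then show ?thesis by simp
  qed
  also have "\<dots> < \<infinity>" by (subst suminf_ennreal2) (auto intro!: summable_geometric)
  finally have fX: "f \<in> X" by (auto simp: X_def intro!: exI[of _ 1])
  have fA: "f t * indicator (A n) t = u n * indicator (A n) t" for n t using fin by (auto split: split_indicator)
  have N1: "1 / 2 \<le> N (abs_L0 (\<lambda>t. f t * indicator (A n) t))" for n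
  proof -
    have X: "(\<lambda>t. f t * indicator (A n) t) \<in> X"
      by (rule X_mono[OF fX]) (auto split: split_indicator)
    have "1 \<le> enorm (\<lambda>s. 2 * u n * indicator (A n) s)"
    proof (rule enorm_indicator_ge_1[OF A eA])
      have "1 = 2 ^ n * \<phi> (u n) * Wr (a n)" using pp[of n] by (simp add: a power_divide)
      also have "\<dots> \<le> \<phi> (2 * u n) * Wr (a n)" using u(2)[of n] by (intro mult_right_mono) auto
      finally show "1 \<le> \<phi> (2 * u n) * Wr (a n)" .
    qed (use a u in auto)
    also have "\<dots> = enorm (\<lambda>s. 2 * (f s * indicator (A n) s))" by (simp add: fA mult.assoc)
    also have "\<dots> = ennreal (2 * N (abs_L0 (\<lambda>t. f t * indicator (A n) t)))"
      by (subst enorm_scale) (auto simp: ennreal_N[OF X, symmetric] ennreal_mult)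
    finally show ?thesis by (simp add: ennreal_1[symmetric] del: ennreal_1)
  qed
  have Np: "0 < N (abs_L0 f)"
    by (rule N_pos[OF fX A eA, of 0 "u 0"]) (use u a fin in \<open>auto split: split_indicator\<close>)
  obtain G where G: "\<And>f g. f \<in> X \<Longrightarrow> g \<in> X \<Longrightarrow> G (\<lambda>s. f s + g s) = G f + G g"
    "\<And>c f. f \<in> X \<Longrightarrow> G (\<lambda>s. c * f s) = c * G f"
    "\<And>f. f \<in> X \<Longrightarrow> G f \<le> N (abs_L0 f)" "G f = N (abs_L0 f)"
    "\<And>y :: nat \<Rightarrow> real \<Rightarrow> real. (\<And>n. y n \<in> X) \<Longrightarrow> (\<And>n. N (abs_L0 (y n)) \<le> N (abs_L0 f)) \<Longrightarrow>
      (\<lambda>n. G (y n)) \<longlonglongrightarrow> N (abs_L0 f) \<Longrightarrow> (\<lambda>n. N (abs_L0 (\<lambda>s. y n s - f s))) \<longlonglongrightarrow> 0"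
    by (rule strongly_exposedE[OF SEP fX Np]) blast
  define fn where "fn n t = f t * indicator (A n) t" for n t
  have fnX: "fn n \<in> X" for n unfolding fn_def by (rule X_mono[OF fX]) (auto split: split_indicator)
  \<comment> \<open>The signs turn the partial sums of \<open>\<bar>G (fn i)\<bar>\<close> into
    values of \<open>G\<close> at functions dominated by \<open>f\<close>, hence bounded by the norm
    of \<open>f\<close>.\<close>
  define s where "s n = sgn (G (fn n))" for n
  define gn where "gn n t = (\<Sum>i<n. s i * fn i t)" for n t
  have gnX: "gn n \<in> X \<and> G (gn n) = (\<Sum>i<n. \<bar>G (fn i)\<bar>)" for n
  proof (induction n)
    case 0
    have "(\<lambda>t. 0 * f t) \<in> X" "G (\<lambda>t. 0 * f t) = 0" using X_scale[OF fX, of 0] G(2)[OF fX, of 0] by auto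
    then show ?case by (simp add: gn_def[abs_def])
  next
    case (Suc n)
    have eq: "gn (Suc n) = (\<lambda>t. gn n t + s n * fn n t)" by (auto simp: gn_def)
    show ?case using Suc X_add[OF _ X_scale[OF fnX[of n]], of "gn n" "s n"] G(1)[OF _ X_scale[OF fnX[of n]], of "gn n" "s n"]
      G(2)[OF fnX[of n], of "s n"] unfolding eq by (simp add: s_def abs_sgn mult.commute)
  qed
  have gnle: "\<bar>gn n t\<bar> \<le> \<bar>f t\<bar>" for n t
  proof (cases "\<exists>m. t \<in> A m")
    case True
    then obtain m where m: "t \<in> A m" by blast
    have "t \<notin> A i" if "i \<noteq> m" for i using disj m that by (auto simp: disjoint_family_on_def)
    then have "gn n t = (\<Sum>i<n. if i = m then s m * f t else 0)"
      unfolding gn_def fn_def using m by (intro sum.cong) auto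
    also have "\<dots> = (if m < n then s m * f t else 0)" by simp
    finally show ?thesis using m by (auto simp: s_def sgn_if abs_mult)
  qed (auto simp: gn_def fn_def)
  have "(\<Sum>i<n. \<bar>G (fn i)\<bar>) \<le> N (abs_L0 f)" for n
  proof -
    have "(\<Sum>i<n. \<bar>G (fn i)\<bar>) \<le> N (abs_L0 (gn n))" using gnX[of n] G(3)[of "gn n"] by simp
    also have "\<dots> \<le> N (abs_L0 f)" using gnX[of n] gnle by (intro N_mono fX) (auto simp: X_measurable)
    finally show ?thesis .
  qed
  then have "summable (\<lambda>i. \<bar>G (fn i)\<bar>)" by (intro summableI_nonneg_bounded[of _ "N (abs_L0 f)"]) auto
  then have G0: "(\<lambda>n. G (fn n)) \<longlonglongrightarrow> 0" using summable_LIMSEQ_zero tendsto_rabs_zero_iff by blast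
  define y where "y n t = f t - fn n t" for n t
  have "(\<lambda>n. N (abs_L0 (\<lambda>s. y n s - f s))) \<longlonglongrightarrow> 0"
  proof (rule G(5))
    fix n
    show yX: "y n \<in> X" unfolding y_def by (intro X_diff fX fnX)
    show "N (abs_L0 (y n)) \<le> N (abs_L0 f)"
      by (rule N_mono[OF fX]) (use yX in \<open>auto simp: X_measurable y_def fn_def split: split_indicator\<close>)
  next
    have "G (y n) = N (abs_L0 f) - G (fn n)" for n
      using G(1)[OF fX X_scale[OF fnX, of "-1" n]] G(2)[OF fnX, of "-1" n] G(4) by (simp add: y_def[abs_def])
    then show "(\<lambda>n. G (y n)) \<longlonglongrightarrow> N (abs_L0 f)" using tendsto_diff[OF tendsto_const G0, of "N (abs_L0 f)"] by simp
  qed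
  moreover have "N (abs_L0 (\<lambda>s. y n s - f s)) = N (abs_L0 (fn n))" for n
  proof -
    have "abs_L0 (\<lambda>s. y n s - f s) = (-1) *\<^sub>R abs_L0 (fn n)"
      using X_measurable[OF fnX] by (subst scaleR_abs_L0) (auto simp: y_def)
    then show ?thesis using N_scale[OF fnX, of "-1" n] by simp
  qed
  ultimately have "(\<lambda>n. N (abs_L0 (fn n))) \<longlonglongrightarrow> 0" by simp
  then have "\<forall>\<^sub>F n in sequentially. N (abs_L0 (fn n)) < 1/2" by (rule order_tendstoD) auto
  then show False using N1 unfolding fn_def by (auto simp: eventually_sequentially not_less[symmetric])
qed

end

context orlicz_lorentz_space
begin

subsection \<open>The Amemiya formula and its minimiser\<close>

definition frearr :: "(real \<Rightarrow> real) \<Rightarrow> real \<Rightarrow> real" where "frearr f t = enn2real (rearr f t)"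

lemma frearr_nonneg [simp]: "0 \<le> frearr f t" by (simp add: frearr_def)

lemma ennreal_frearr: "f \<in> X \<Longrightarrow> 0 < t \<Longrightarrow> ennreal (frearr f t) = rearr f t"
  using X_rearr_finite[of f t] by (simp add: frearr_def)

lemma frearr_antimono: "f \<in> X \<Longrightarrow> antimono_on {0<..} (frearr f)"
  unfolding monotone_on_def
proof (intro ballI impI)
  fix s t :: real assume *: "f \<in> X" "s \<in> {0<..}" "t \<in> {0<..}" "s \<le> t"
  then have "ennreal (frearr f t) \<le> ennreal (frearr f s)" by (simp add: ennreal_frearr rearr_antimono)
  then show "frearr f t \<le> frearr f s" by simp
qed

lemma frearr_measurable [measurable]: "frearr f \<in> borel_measurable wm"
  unfolding frearr_def by measurable

lemma rho_frearr:
  assumes "f \<in> X" "0 \<le> c" shows "rho (\<lambda>s. c * f s) = (\<integral>\<^sup>+t. ennreal (\<phi> (c * frearr f t)) \<partial>wm)"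
  unfolding rho_scale[OF X_measurable[OF assms(1)]]
  using assms by (intro nn_integral_cong) (simp add: ennreal_frearr[symmetric] ennreal_mult[symmetric] extend_ennreal)

lemma dright_measurable [measurable]: "dright \<in> borel_measurable borel"
proof (rule borel_measurable_mono, rule monoI)
  fix x y :: real assume "x \<le> y"
  then show "dright x \<le> dright y"
    using dright_mono_left[of x y] dleft_le_dright[of y] by (cases "x = y") auto
qed

lemma dleft_measurable [measurable]: "dleft \<in> borel_measurable borel"
proof (rule borel_measurable_mono, rule monoI)
  fix x y :: real assume "x \<le> y"
  then show "dleft x \<le> dleft y"
    using dright_mono_left[of x y] dleft_le_dright[of x] by (cases "x = y") auto
qed

text \<open>Near \<open>0\<close> the summand \<open>1 / x\<close> lifts the quotient above its
  value at \<open>K1\<close>. Beyond \<open>K2\<close>, convexity of \<open>\<Phi>\<close> does not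
  let it fall back once it has risen between \<open>K1\<close> and \<open>K2\<close>. A minimum over
  a compact interval is therefore global.\<close>

lemma amemiya_minimiser:
  fixes \<Phi> :: "real \<Rightarrow> real"
  assumes conv: "convex_on {0<..} \<Phi>" and nn: "\<And>k. 0 < k \<Longrightarrow> 0 \<le> \<Phi> k"
    and K: "0 < K1" "K1 < K2" "(1 + \<Phi> K1) / K1 < (1 + \<Phi> K2) / K2"
  obtains k where "0 < k" "\<And>x. 0 < x \<Longrightarrow> (1 + \<Phi> k) / k * x \<le> 1 + \<Phi> x"
proof -
  define h where "h x = (1 + \<Phi> x) / x" for x
  have cont: "continuous_on {0<..} \<Phi>" by (rule convex_on_continuous[OF _ conv]) auto
  have h1: "0 < h K1" using K nn[of K1] by (simp add: h_def add_pos_nonneg)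
  \<comment> \<open>For \<open>x < e\<close> the quotient is at least \<open>1 / x\<close>, hence
    above \<open>h K1\<close>.\<close>
  define e where "e = min K1 (1 / h K1)"
  have e: "0 < e" "e \<le> K1" "e \<le> 1 / h K1" using K h1 by (auto simp: e_def)
  have "continuous_on {e..K2} h" unfolding h_def
    using e by (intro continuous_intros continuous_on_subset[OF cont]) auto
  then obtain k where k: "k \<in> {e..K2}" "\<And>y. y \<in> {e..K2} \<Longrightarrow> h k \<le> h y"
    using continuous_attains_inf[of "{e..K2}" h] e K by fastforce
  have k1: "h k \<le> h K1" using k e K by auto
  have min: "h k \<le> h x" if x: "0 < x" for x
  proof -
    consider "x < e" | "x \<in> {e..K2}" | "K2 < x" by force
    then show ?thesis
    proof cases
      case 1
      have "h K1 \<le> 1 / e" using e h1 by (simp add: field_simps)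
      also have "\<dots> \<le> 1 / x" using 1 x by (simp add: frac_le)
      also have "\<dots> \<le> h x" unfolding h_def using x nn[OF x] by (intro divide_right_mono) auto
      finally show ?thesis using k1 by simp
    next
      case 2 then show ?thesis using k by simp
    next
      case 3
      show ?thesis
      proof (rule ccontr)
        assume "\<not> h k \<le> h x"
        then have hx: "h x < h K2" using k1 K by (simp add: h_def)
        define t where "t = (K2 - K1) / (x - K1)"
        have t: "0 < t" "t < 1" using 3 K by (auto simp: t_def field_simps)
        have "t * (x - K1) = K2 - K1" using 3 K by (simp add: t_def)
        then have eq: "(1 - t) * K1 + t * x = K2" by (simp add: algebra_simps)
        have "\<Phi> ((1 - t) * K1 + t * x) \<le> (1 - t) * \<Phi> K1 + t * \<Phi> x"
          using convex_onD[OF conv, of t K1 x] t K x by simp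
        then have "1 + \<Phi> K2 \<le> (1 - t) * (1 + \<Phi> K1) + t * (1 + \<Phi> x)" unfolding eq by (simp add: algebra_simps)
        also have "\<dots> = (1 - t) * (K1 * h K1) + t * (x * h x)" using K x by (auto simp: h_def)
        also have "(1 - t) * (K1 * h K1) + t * (x * h x) < (1 - t) * (K1 * h K2) + t * (x * h K2)"
          using t K hx x by (intro add_strict_mono mult_strict_left_mono) (auto simp: h_def)
        also have "\<dots> = K2 * h K2" unfolding eq[symmetric] by (simp add: algebra_simps)
        also have "\<dots> = 1 + \<Phi> K2" using K by (simp add: h_def)
        finally show False by simp
      qed
    qed
  qed
  show ?thesis
  proof (rule that[of k])
    show "0 < k" using k e by auto
    fix x :: real assume x: "0 < x"
    have "h k * x \<le> h x * x" using min[OF x] x by (intro mult_right_mono) auto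
    then show "(1 + \<Phi> k) / k * x \<le> 1 + \<Phi> x" using x by (simp add: h_def)
  qed
qed

text \<open>The one-sided derivatives at the minimiser \<open>k\<close> of \<open>(1 + \<rho>(k f)) / k\<close> bracket the minimum;
  the subgradient selection \<open>G\<close> interpolates linearly between them so that the optimality
  condition holds with equality.\<close>

lemma amemiya_attained:
  assumes f: "f \<in> X" and fin: "\<And>c. 0 < c \<Longrightarrow> rho (\<lambda>s. c * f s) < \<infinity>"
    and K: "0 < K1" "K1 < K2"
      "(1 + enn2real (rho (\<lambda>s. K1 * f s))) / K1 < (1 + enn2real (rho (\<lambda>s. K2 * f s))) / K2"
  obtains k G where "0 < k" "\<And>y. 0 \<le> y \<Longrightarrow> subgrad (k * y) (G y)" "\<And>x y. 0 \<le> x \<Longrightarrow> x \<le> y \<Longrightarrow> G x \<le> G y"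
    "G \<in> borel_measurable borel" "G 0 = 0"
    "(\<integral>\<^sup>+t. \<psi> (ennreal (G (frearr f t))) \<partial>wm) = 1"
    "(\<integral>\<^sup>+t. ennreal (frearr f t * G (frearr f t)) \<partial>wm) = ennreal (N (abs_L0 f))"
    "N (abs_L0 f) = (1 + enn2real (rho (\<lambda>s. k * f s))) / k"
proof -
  define \<Phi> where "\<Phi> c = enn2real (rho (\<lambda>s. c * f s))" for c
  let ?y = "frearr f"
  have int: "integrable wm (\<lambda>t. \<phi> (c * ?y t))" if "0 < c" for c
    using fin[OF that] rho_frearr[OF f, of c] that by (intro integrableI_bounded) (auto simp: less_imp_le)
  have \<Phi>: "\<Phi> c = (\<integral>t. \<phi> (c * ?y t) \<partial>wm)" if "0 < c" for c
    unfolding \<Phi>_def using rho_frearr[OF f, of c] that by (subst integral_eq_nn_integral) auto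
  have conv: "convex_on {0<..} \<Phi>"
  proof (rule convex_onI)
    fix t x y :: real assume t: "0 < t" "t < 1" and xy: "x \<in> {0<..}" "y \<in> {0<..}"
    have z: "0 < (1 - t) * x + t * y" using t xy by (intro add_pos_pos mult_pos_pos) auto
    have "\<Phi> ((1 - t) * x + t * y) \<le> (\<integral>s. (1 - t) * \<phi> (x * ?y s) + t * \<phi> (y * ?y s) \<partial>wm)"
      unfolding \<Phi>[OF z]
    proof (rule integral_mono)
      fix s
      show "\<phi> (((1 - t) * x + t * y) * ?y s) \<le> (1 - t) * \<phi> (x * ?y s) + t * \<phi> (y * ?y s)"
        using \<phi>_convexD[of t "x * ?y s" "y * ?y s"] t by (simp add: algebra_simps)
    qed (use int z xy in auto)
    also have "\<dots> = (1 - t) * \<Phi> x + t * \<Phi> y" using int xy by (simp add: \<Phi>)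
    finally show "\<Phi> ((1 - t) *\<^sub>R x + t *\<^sub>R y) \<le> (1 - t) * \<Phi> x + t * \<Phi> y" by simp
  qed auto
  obtain k where k: "0 < k" and min: "\<And>x. 0 < x \<Longrightarrow> (1 + \<Phi> k) / k * x \<le> 1 + \<Phi> x"
    by (rule amemiya_minimiser[OF conv _ K[folded \<Phi>_def]]) (auto simp: \<Phi>_def)
  \<comment> \<open>Minimality says that the line of slope \<open>c\<close> through
    \<open>(0, -1)\<close> touches \<open>\<Phi>\<close> from below at \<open>k\<close>, so
    \<open>c\<close> lies between the one-sided derivatives of \<open>\<Phi>\<close> there.\<close>
  define c where "c = (1 + \<Phi> k) / k"
  have ck: "c * k = 1 + \<Phi> k" using k by (simp add: c_def)
  have min': "c * x \<le> 1 + \<Phi> x" if "0 < x" for x using min[OF that] by (simp add: c_def)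
  define R where "R t = ?y t * dright (k * ?y t)" for t
  define L where "L t = ?y t * dleft (k * ?y t)" for t
  have [measurable]: "R \<in> borel_measurable wm" "L \<in> borel_measurable wm" unfolding R_def L_def by measurable
  \<comment> \<open>Right difference quotients in \<open>k\<close>; convexity bounds them all by the
    first, which permits dominated convergence.\<close>
  define q where "q n t = (\<phi> ((k + 1 / real (Suc n)) * ?y t) - \<phi> (k * ?y t)) * real (Suc n)" for n t
  have [measurable]: "q n \<in> borel_measurable wm" for n unfolding q_def by measurable
  have qeq: "q n t = ?y t * ((\<phi> (k * ?y t + ?y t * (1 / real (Suc n))) - \<phi> (k * ?y t)) / (?y t * (1 / real (Suc n))))"
    if "0 < ?y t" for n t
  proof -
    have "(k + 1 / real (Suc n)) * ?y t = k * ?y t + ?y t * (1 / real (Suc n))"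
      by (simp add: algebra_simps del: of_nat_Suc)
    then show ?thesis using that by (simp add: q_def del: of_nat_Suc)
  qed
  have qlim: "(\<lambda>n. q n t) \<longlonglongrightarrow> R t" for t
  proof (cases "?y t = 0")
    case False
    then have y: "0 < ?y t" using frearr_nonneg[of f t] by linarith
    have "(\<lambda>n. ?y t * (1 / real (Suc n))) \<longlonglongrightarrow> ?y t * 0"
      by (intro tendsto_mult tendsto_const) (use LIMSEQ_Suc[OF lim_1_over_n] in simp)
    then have "(\<lambda>n. (\<phi> (k * ?y t + ?y t * (1 / real (Suc n))) - \<phi> (k * ?y t)) / (?y t * (1 / real (Suc n)))) \<longlonglongrightarrow> dright (k * ?y t)"
      using y by (intro tendsto_dright) auto
    then have "(\<lambda>n. ?y t * ((\<phi> (k * ?y t + ?y t * (1 / real (Suc n))) - \<phi> (k * ?y t)) / (?y t * (1 / real (Suc n))))) \<longlonglongrightarrow> R t"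
      unfolding R_def by (intro tendsto_mult tendsto_const)
    then show ?thesis unfolding qeq[OF y] .
  qed (simp add: q_def R_def)
  have q0: "0 \<le> q n t" for n t unfolding q_def using k
    by (intro mult_nonneg_nonneg) (auto intro!: \<phi>_mono mult_right_mono)
  have qle: "q n t \<le> q 0 t" for n t
  proof (cases "?y t = 0")
    case False
    then have y: "0 < ?y t" using frearr_nonneg[of f t] by linarith
    have "1 / real (Suc n) \<le> 1" by simp
    then have "?y t * (1 / real (Suc n)) \<le> ?y t * 1" using y by (intro mult_left_mono) auto
    then show ?thesis unfolding qeq[OF y] using y by (intro mult_left_mono slope_mono) auto
  qed (simp add: q_def)
  have iq: "integrable wm (q n)" for n
  proof -
    have p: "0 < k + 1 / real (Suc n)" using k by (intro add_pos_pos) auto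
    show ?thesis unfolding q_def by (rule integrable_mult_left) (rule Bochner_Integration.integrable_diff[OF int[OF p] int[OF k]])
  qed
  have Iq: "(\<integral>t. q n t \<partial>wm) = (\<Phi> (k + 1 / real (Suc n)) - \<Phi> k) * real (Suc n)" for n
  proof -
    have p: "0 < k + 1 / real (Suc n)" using k by (intro add_pos_pos) auto
    show ?thesis unfolding q_def using int[OF p] int[OF k] p k by (simp add: \<Phi>)
  qed
  have cq: "c \<le> (\<integral>t. q n t \<partial>wm)" for n
  proof -
    have p: "0 < k + 1 / real (Suc n)" using k by (intro add_pos_pos) auto
    have "c * (k + 1 / real (Suc n)) - 1 - (c * k - 1) \<le> \<Phi> (k + 1 / real (Suc n)) - \<Phi> k"
      using min'[OF p] ck by linarith
    then have "c / real (Suc n) \<le> \<Phi> (k + 1 / real (Suc n)) - \<Phi> k" by (simp add: algebra_simps)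
    then show ?thesis unfolding Iq by (simp add: divide_le_eq del: of_nat_Suc)
  qed
  have iR: "integrable wm R" and limR: "(\<lambda>n. \<integral>t. q n t \<partial>wm) \<longlonglongrightarrow> (\<integral>t. R t \<partial>wm)"
  proof -
    show "integrable wm R"
      by (rule integrable_dominated_convergence[where w="q 0" and s=q]) (use qlim q0 qle iq in auto)
    show "(\<lambda>n. \<integral>t. q n t \<partial>wm) \<longlonglongrightarrow> (\<integral>t. R t \<partial>wm)"
      by (rule integral_dominated_convergence[where w="q 0"]) (use qlim q0 qle iq in auto)
  qed
  have cR: "c \<le> (\<integral>t. R t \<partial>wm)" by (rule LIMSEQ_le_const[OF limR]) (use cq in auto)
  \<comment> \<open>The shift by \<open>2\<close> keeps \<open>k - d n\<close> positive.\<close>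
  define d where "d n = k / real (n + 2)" for n
  have d: "0 < d n" "d n < k" for n using k by (auto simp: d_def divide_less_eq)
  have dlim: "d \<longlonglongrightarrow> 0"
  proof -
    have "(\<lambda>n. k * (1 / real (n + 2))) \<longlonglongrightarrow> k * 0"
      by (intro tendsto_mult tendsto_const) (rule LIMSEQ_ignore_initial_segment[OF lim_1_over_n])
    then show ?thesis by (simp add: d_def[abs_def])
  qed
  define p where "p n t = (\<phi> (k * ?y t) - \<phi> ((k - d n) * ?y t)) / d n" for n t
  have [measurable]: "p n \<in> borel_measurable wm" for n unfolding p_def by measurable
  have peq: "p n t = ?y t * ((\<phi> (k * ?y t) - \<phi> (k * ?y t - ?y t * d n)) / (?y t * d n))" if "0 < ?y t" for n t
  proof -
    have "(k - d n) * ?y t = k * ?y t - ?y t * d n" by (simp add: algebra_simps)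
    then show ?thesis using that by (simp add: p_def)
  qed
  have plim: "(\<lambda>n. p n t) \<longlonglongrightarrow> L t" for t
  proof (cases "?y t = 0")
    case False
    then have y: "0 < ?y t" using frearr_nonneg[of f t] by linarith
    have "(\<lambda>n. ?y t * d n) \<longlonglongrightarrow> ?y t * 0" by (intro tendsto_mult tendsto_const dlim)
    then have "(\<lambda>n. (\<phi> (k * ?y t) - \<phi> (k * ?y t - ?y t * d n)) / (?y t * d n)) \<longlonglongrightarrow> dleft (k * ?y t)"
      using y d by (intro tendsto_dleft) auto
    then show ?thesis unfolding L_def peq[OF y] by (intro tendsto_mult tendsto_const)
  qed (simp add: p_def L_def)
  have p0: "0 \<le> p n t" for n t unfolding p_def using k d[of n]
    by (intro divide_nonneg_pos) (auto intro!: \<phi>_mono mult_right_mono)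
  \<comment> \<open>Left slopes never exceed the right derivative, so the limit \<open>R\<close> of
    the right quotients dominates the left ones.\<close>
  have ple: "p n t \<le> R t" for n t
  proof (cases "?y t = 0")
    case False
    then have y: "0 < ?y t" using frearr_nonneg[of f t] by linarith
    then show ?thesis unfolding peq[OF y] R_def using d
      by (intro mult_left_mono order_trans[OF dleft_ge dleft_le_dright]) auto
  qed (simp add: p_def R_def)
  have ip: "integrable wm (p n)" for n unfolding p_def using int k d
    by (intro integrable_divide Bochner_Integration.integrable_diff) auto
  have pc: "(\<integral>t. p n t \<partial>wm) \<le> c" for n
  proof -
    have kd: "0 < k - d n" using d[of n] by simp
    have "(\<integral>t. p n t \<partial>wm) = (\<Phi> k - \<Phi> (k - d n)) / d n"
      unfolding p_def using int[OF kd] int[OF k] kd k by (simp add: \<Phi>)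
    also have "\<dots> \<le> (c * d n) / d n"
      using min'[OF kd] ck d[of n] by (intro divide_right_mono) (auto simp: algebra_simps)
    finally show ?thesis using d[of n] by simp
  qed
  have iL: "integrable wm L" and limL: "(\<lambda>n. \<integral>t. p n t \<partial>wm) \<longlonglongrightarrow> (\<integral>t. L t \<partial>wm)"
  proof -
    show "integrable wm L"
      by (rule integrable_dominated_convergence[where w=R and s=p]) (use plim p0 ple ip iR in auto)
    show "(\<lambda>n. \<integral>t. p n t \<partial>wm) \<longlonglongrightarrow> (\<integral>t. L t \<partial>wm)"
      by (rule integral_dominated_convergence[where w=R]) (use plim p0 ple ip iR in auto)
  qed
  have Lc: "(\<integral>t. L t \<partial>wm) \<le> c" by (rule LIMSEQ_le_const2[OF limL]) (use pc in auto)
  obtain s where s: "0 \<le> s" "s \<le> 1" "(1 - s) * (\<integral>t. L t \<partial>wm) + s * (\<integral>t. R t \<partial>wm) = c"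
  proof (cases "(\<integral>t. L t \<partial>wm) = (\<integral>t. R t \<partial>wm)")
    case True then show ?thesis using that[of 0] Lc cR by simp
  next
    case False
    define D where "D = (\<integral>t. R t \<partial>wm) - (\<integral>t. L t \<partial>wm)"
    have D: "0 < D" using False Lc cR by (simp add: D_def)
    define \<sigma> where "\<sigma> = (c - (\<integral>t. L t \<partial>wm)) / D"
    have "\<sigma> * D = c - (\<integral>t. L t \<partial>wm)" using D by (simp add: \<sigma>_def)
    then have "(1 - \<sigma>) * (\<integral>t. L t \<partial>wm) + \<sigma> * (\<integral>t. R t \<partial>wm) = c"
      by (simp add: D_def algebra_simps)
    moreover have "0 \<le> \<sigma>" "\<sigma> \<le> 1" using D Lc cR by (auto simp: \<sigma>_def D_def)
    ultimately show ?thesis using that[of \<sigma>] by blast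
  qed
  \<comment> \<open>The value \<open>0\<close> at \<open>y = 0\<close> is still a subgradient there
    and respects monotonicity; it makes the functional built from \<open>G\<close> ignore the zero
    set of its point.\<close>
  define G where "G y = (if y \<le> 0 then 0 else (1 - s) * dleft (k * y) + s * dright (k * y))" for y
  have Gmeas[measurable]: "G \<in> borel_measurable borel" unfolding G_def by measurable
  have Gb: "dleft (k * y) \<le> G y" "G y \<le> dright (k * y)" if "0 < y" for y
  proof -
    have "(1 - s) * dleft (k * y) + s * dleft (k * y) \<le> G y" "G y \<le> (1 - s) * dright (k * y) + s * dright (k * y)"
      using that s dleft_le_dright[of "k * y"] by (auto simp: G_def intro!: add_mono mult_left_mono)
    then show "dleft (k * y) \<le> G y" "G y \<le> dright (k * y)" by (auto simp: algebra_simps)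
  qed
  have Gpos: "0 \<le> G y" for y
  proof (cases "0 < y")
    case True
    have "0 \<le> \<phi> (k * y) / (k * y)" using True k by simp
    also have "\<dots> \<le> G y" using dleft_pos[of "k * y"] Gb(1)[OF True] True k by simp
    finally show ?thesis .
  qed (simp add: G_def)
  have Gsub: "subgrad (k * y) (G y)" if "0 \<le> y" for y
  proof (cases "y = 0")
    case True then show ?thesis by (simp add: subgrad_def G_def)
  next
    case False
    then show ?thesis using that k Gb[of y] Gpos[of y] by (intro subgrad_between) auto
  qed
  have Gmono: "G x \<le> G y" if "0 \<le> x" "x \<le> y" for x y
  proof (cases "x = y \<or> x = 0")
    case True then show ?thesis using Gpos[of y] by (auto simp: G_def)
  next
    case False
    then have "G x \<le> dright (k * x)" "dright (k * x) \<le> dleft (k * y)" "dleft (k * y) \<le> G y"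
      using Gb that k by (auto intro!: dright_mono_left)
    then show ?thesis by linarith
  qed
  have yG: "?y t * G (?y t) = (1 - s) * L t + s * R t" for t
  proof (cases "?y t = 0")
    case False
    then have "0 < ?y t" using frearr_nonneg[of f t] by linarith
    then show ?thesis by (simp add: G_def L_def R_def algebra_simps)
  qed (simp add: L_def R_def)
  have iyG: "integrable wm (\<lambda>t. ?y t * G (?y t))" unfolding yG using iL iR by auto
  have IyG: "(\<integral>t. ?y t * G (?y t) \<partial>wm) = c" unfolding yG using iL iR s by simp
  have nn1: "(\<integral>\<^sup>+t. ennreal (?y t * G (?y t)) \<partial>wm) = ennreal c"
    using iyG IyG Gpos by (subst nn_integral_eq_integral) auto
  have \<psi>G: "\<psi> (ennreal (G (?y t))) = ennreal (k * (?y t * G (?y t)) - \<phi> (k * ?y t))" for t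
    using \<psi>_subgrad[OF Gsub[of "?y t"]] by (simp add: mult.assoc)
  \<comment> \<open>Integrating the equality case of Young's inequality gives
    \<open>k * c - \<Phi> k\<close>, which is \<open>1\<close> by the choice of
    \<open>c\<close>.\<close>
  have nn2: "(\<integral>\<^sup>+t. \<psi> (ennreal (G (?y t))) \<partial>wm) = 1"
  proof -
    have "(\<integral>\<^sup>+t. \<psi> (ennreal (G (?y t))) \<partial>wm) = ennreal (\<integral>t. k * (?y t * G (?y t)) - \<phi> (k * ?y t) \<partial>wm)"
      unfolding \<psi>G using iyG int[OF k] subgrad_nonneg[OF Gsub[of "?y t" for t]]
      by (intro nn_integral_eq_integral Bochner_Integration.integrable_diff integrable_mult_right) (auto simp: mult.assoc)
    also have "(\<integral>t. k * (?y t * G (?y t)) - \<phi> (k * ?y t) \<partial>wm) = k * c - \<Phi> k"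
      using iyG int[OF k] k by (simp add: IyG \<Phi>)
    also have "\<dots> = 1" using ck by (simp add: mult.commute)
    finally show ?thesis by simp
  qed
  have Nc: "N (abs_L0 f) = c"
  proof (rule antisym)
    have "rho (\<lambda>s. k * f s) \<le> ennreal (\<Phi> k)" using fin[OF k] by (simp add: \<Phi>_def)
    then show "N (abs_L0 f) \<le> c" unfolding c_def using f k by (intro N_le) (auto simp: \<Phi>_def)
    define g where "g t = G (?y t)" for t
    have am: "antimono_on {0<..} g"
      using frearr_antimono[OF f] Gmono by (auto simp: monotone_on_def g_def)
    show "c \<le> N (abs_L0 f)"
    proof (rule N_ge[OF f])
      show "measurable_fun g" using am by (rule antimono_measurable_pos_lebesgue)
      have "rhoc g = (\<integral>\<^sup>+t. \<psi> (ennreal (g t)) \<partial>wm)" using am Gpos by (intro rhoc_antimono_fun) (auto simp: g_def)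
      then show "rhoc g \<le> 1" using nn2 by (simp add: g_def)
      have "AE t in wm. rearr g t = ennreal (g t)"
        using AE_rearr_antimono_fun[OF am] Gpos by (simp add: AE_wm g_def)
      then have "AE t in wm. rearr f t * rearr g t = ennreal (?y t * G (?y t))"
        using AE_space
        by eventually_elim (use Gpos in \<open>auto simp: ennreal_frearr[OF f, symmetric] g_def ennreal_mult\<close>)
      then have "(\<integral>\<^sup>+t. rearr f t * rearr g t \<partial>wm) = ennreal c"
        using nn1 by (subst nn_integral_cong_AE[where v="\<lambda>t. ennreal (?y t * G (?y t))"]) auto
      then show "ennreal c \<le> (\<integral>\<^sup>+t. rearr f t * rearr g t \<partial>wm)" by simp
    qed
  qed
  show ?thesis
    by (rule that[of k G]) (use k Gsub Gmono nn2 nn1 Nc in \<open>auto simp: c_def \<Phi>_def G_def intro: Gmeas[unfolded G_def[abs_def]]\<close>)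
qed

end

context orlicz_lorentz_space
begin

subsection \<open>The growth condition on \<open>\<psi>\<close> is necessary\<close>

lemma emeasure_wm_Ioc: assumes "0 \<le> a" "a \<le> b" shows "emeasure wm {a<..b} = ennreal (Wr b - Wr a)"
proof -
  have [measurable]: "{0<..x} \<in> sets pos_lebesgue" "{0<..<x} \<in> sets pos_lebesgue" for x :: real
    by (auto intro: borel_sets_wm)
  have 0: "emeasure wm {0<..x} = ennreal (Wr x)" if "0 \<le> x" for x
  proof (cases "x = 0")
    case False
    have "AE t in pos_lebesgue. t \<notin> {x}" by (rule AE_pos_lebesgue_countable) simp
    then have "AE t in wm. t \<in> {0<..x} \<longleftrightarrow> t \<in> {0<..<x}" unfolding AE_wm by eventually_elim auto
    then have "emeasure wm {0<..x} = emeasure wm {0<..<x}" by (intro emeasure_eq_AE) auto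
    then show ?thesis using False that by (simp add: emeasure_wm_Ioo)
  qed simp
  have "{0<..b} = {0<..a} \<union> {a<..b}" using assms by auto
  then have "emeasure wm {0<..b} = emeasure wm {0<..a} + emeasure wm {a<..b}"
    using assms by (subst plus_emeasure) (auto intro!: borel_sets_wm)
  then have "ennreal (Wr b) - ennreal (Wr a) = emeasure wm {a<..b}"
    using 0[of a] 0[of b] assms by simp
  then show ?thesis by (simp add: ennreal_minus)
qed

text \<open>The blocks \<open>A n = {\<alpha> n<..\<beta> n}\<close> fill an initial interval and carry values \<open>w n\<close> that decrease
  from left to right; \<open>w' n\<close> bounds the values to the right of \<open>A n\<close>. On
  \<open>[w n / L n, w n * L n]\<close> the function \<open>\<phi>\<close> is almost linear, which makes the normalised
  indicators of the blocks almost maximise every functional that supports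
  \<open>f = \<Sum>\<^sub>n w n 1\<^bsub>A n\<^esub>\<close>.\<close>

lemma Nabla2_of_strongly_exposed_blocks:
  fixes w w' \<alpha> \<beta> L \<epsilon> :: "nat \<Rightarrow> real"
  assumes SEP: "strongly_exposed_property V N" and D2: "Delta2 (extend \<phi>)"
    and pos: "\<And>n. 0 < w n" "\<And>n. 0 \<le> \<alpha> n" "\<And>n. \<alpha> n < \<beta> n" "\<And>n. 0 \<le> w' n" "\<And>n. w' n < w n"
    and disj: "disjoint_family (\<lambda>n. {\<alpha> n<..\<beta> n})"
    and left: "\<And>s t n. 0 < s \<Longrightarrow> s < t \<Longrightarrow> t \<in> {\<alpha> n<..\<beta> n} \<Longrightarrow> \<exists>m. s \<in> {\<alpha> m<..\<beta> m} \<and> w n \<le> w m"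
    and right: "\<And>s t m n. s \<in> {\<alpha> n<..\<beta> n} \<Longrightarrow> s < t \<Longrightarrow> t \<in> {\<alpha> m<..\<beta> m} \<Longrightarrow> m \<noteq> n \<Longrightarrow> w m \<le> w' n"
    and \<epsilon>: "\<And>n. 0 < \<epsilon> n" "\<And>n. \<epsilon> n \<le> 1" "\<epsilon> \<longlonglongrightarrow> 0"
    and fast: "\<And>n. 0 < n \<Longrightarrow> Wr (\<alpha> n) \<le> \<epsilon> n * Wr (\<beta> n)"
    and size: "\<And>n. 0 < n \<Longrightarrow> \<phi> (L n * w n) * Wr (\<beta> n) = 1 / \<epsilon> n"
    and L: "\<And>n. 2 ^ n / \<epsilon> n \<le> L n"
    and lin: "\<And>n. 0 < n \<Longrightarrow> \<phi> (L n * w n) / (L n * w n) \<le> (1 + \<epsilon> n) * (\<phi> (w n / L n) / (w n / L n))"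
    and base: "1 / 2 < (\<phi> (2 * w 0) / 2 - \<phi> (w 0)) * (Wr (\<beta> 0) - Wr (\<alpha> 0))"
  shows False
proof -
  define A where "A n = {\<alpha> n<..\<beta> n}" for n
  have A[measurable]: "A n \<in> sets pos_lebesgue" for n unfolding A_def using pos(2)[of n] by (intro borel_sets_wm) auto
  have eA: "emeasure pos_lebesgue (A n) = ennreal (\<beta> n - \<alpha> n)" for n
    unfolding A_def using pos(2,3)[of n] by (subst emeasure_restrict_space) auto
  have dA: "disjoint_family A" using disj unfolding A_def .
  define W' where "W' n = Wr (\<beta> n) - Wr (\<alpha> n)" for n
  have wA: "emeasure wm (A n) = ennreal (W' n)" for n
    unfolding A_def W'_def using pos(2,3)[of n] by (intro emeasure_wm_Ioc) auto
  have W'pos: "0 < W' n" for n unfolding W'_def using pos(2,3)[of n] Wr_strict_mono by simp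
  have Wa: "Wr (\<beta> n - \<alpha> n) \<le> Wr (\<beta> n)" for n using pos(2)[of n] by (intro Wr_mono) auto
  have Wb: "0 < Wr (\<beta> n)" for n using pos(2,3)[of n] by (intro Wr_pos) auto
  have L1: "2 ^ n \<le> L n" for n
  proof -
    have "(2::real) ^ n * 1 \<le> 2 ^ n * (1 / \<epsilon> n)" using \<epsilon>(1,2)[of n] by (intro mult_left_mono) auto
    then show ?thesis using L[of n] by simp
  qed
  have L1': "1 \<le> L n" for n using L1[of n] one_le_power[of "2::real" n] by linarith
  define f where "f t = (\<Sum>i. w i * indicator (A i) t)" for t
  have fin: "f t = w n" if "t \<in> A n" for t n unfolding f_def by (rule suminf_disjoint_indicator_in[OF dA that])
  have fout: "f t = 0" if "t \<notin> (\<Union>i. A i)" for t unfolding f_def by (rule suminf_disjoint_indicator_notin[OF dA that])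
  have f0: "0 \<le> f t" for t
    by (cases "t \<in> (\<Union>i. A i)") (use fin fout pos(1) in \<open>auto intro: less_imp_le\<close>)
  have fam: "antimono_on {0<..} f"
    unfolding monotone_on_def
  proof (intro ballI impI)
    fix s t :: real assume st: "s \<in> {0<..}" "t \<in> {0<..}" "s \<le> t"
    show "f t \<le> f s"
    proof (cases "s = t \<or> t \<notin> (\<Union>i. A i)")
      case True then show ?thesis using fout f0 by auto
    next
      case False
      then obtain n where n: "t \<in> A n" by blast
      then obtain m where "s \<in> A m" "w n \<le> w m" using left[of s t n] st False by (auto simp: A_def)
      then show ?thesis using n fin by simp
    qed
  qed
  have f[measurable]: "measurable_fun f" using fam by (rule antimono_measurable_pos_lebesgue)
  have f_wm[measurable]: "f \<in> borel_measurable wm" using f by (simp add: measurable_wm_iff)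
  \<comment> \<open>Convexity makes \<open>\<phi> (w n)\<close> smaller than
    \<open>\<phi> (L n * w n)\<close> by the factor \<open>L n \<ge> 2 ^ n / \<epsilon> n\<close>,
    which beats the size \<open>1 / \<epsilon> n\<close>. Thus \<open>f\<close> has finite
    modular.\<close>
  have wle: "\<phi> (w n) * Wr (\<beta> n) \<le> (1/2) ^ n" if n: "0 < n" for n
  proof -
    have "L n * \<phi> (w n) \<le> \<phi> (L n * w n)" using L1'[of n] pos(1)[of n] by (intro \<phi>_scale_ge) auto
    then have "L n * \<phi> (w n) * Wr (\<beta> n) \<le> 1 / \<epsilon> n" using size[OF n] Wb[of n]
      by (metis mult_right_mono less_imp_le)
    moreover have "2 ^ n / \<epsilon> n * (\<phi> (w n) * Wr (\<beta> n)) \<le> L n * (\<phi> (w n) * Wr (\<beta> n))"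
      by (intro mult_right_mono L) auto
    ultimately have "2 ^ n / \<epsilon> n * (\<phi> (w n) * Wr (\<beta> n)) \<le> 1 / \<epsilon> n" by (simp add: mult.assoc)
    then have "2 ^ n * (\<phi> (w n) * Wr (\<beta> n)) \<le> 1" using \<epsilon>(1)[of n] by (simp add: field_simps)
    then show ?thesis by (simp add: field_simps power_one_over)
  qed
  have "rho f \<le> (\<Sum>n. ennreal (\<phi> (w n) * Wr (\<beta> n - \<alpha> n)))"
    unfolding f_def using pos(1) by (intro rho_disjoint_le dA A eA) (auto intro: less_imp_le)
  also have "\<dots> < \<infinity>"
  proof (subst suminf_ennreal2)
    have *: "norm (\<phi> (w n) * Wr (\<beta> n - \<alpha> n)) \<le> (1/2) ^ n" if "1 \<le> n" for n
    proof -
      have "\<phi> (w n) * Wr (\<beta> n - \<alpha> n) \<le> \<phi> (w n) * Wr (\<beta> n)" using Wa by (intro mult_left_mono) auto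
      then show ?thesis using wle[of n] that by simp
    qed
    show "summable (\<lambda>n. \<phi> (w n) * Wr (\<beta> n - \<alpha> n))"
      by (rule summable_comparison_test'[OF _ *, where N=1]) (auto intro: summable_geometric)
  qed auto
  finally have fX: "f \<in> X" by (auto simp: X_def intro!: exI[of _ 1])
  have cam: "antimono_on {0<..} (\<lambda>t. c * f t)" if "0 \<le> c" for c
    using fam that by (auto simp: monotone_on_def intro: mult_left_mono)
  have rho_c: "rho (\<lambda>s. c * f s) = (\<integral>\<^sup>+t. ennreal (\<phi> (c * f t)) \<partial>wm)" if "0 \<le> c" for c
    using f0 that by (intro rho_antimono_fun cam) auto
  have rfin: "rho (\<lambda>s. c * f s) < \<infinity>" for c by (rule Delta2_rho_finite[OF D2 fX])
  define \<Phi> where "\<Phi> c = enn2real (rho (\<lambda>s. c * f s))" for c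
  have \<Phi>: "ennreal (\<Phi> c) = rho (\<lambda>s. c * f s)" for c using rfin[of c] by (simp add: \<Phi>_def)
  \<comment> \<open>Convexity alone gives \<open>\<Phi> 2 \<ge> 2 * \<Phi> 1\<close>; by
    \<open>base\<close> the first block adds an excess larger than \<open>1\<close>, so the quotient
    rises from \<open>1\<close> to \<open>2\<close>.\<close>
  have h12: "(1 + \<Phi> 1) / 1 < (1 + \<Phi> 2) / 2"
  proof -
    define b where "b = \<phi> (2 * w 0) / 2 - \<phi> (w 0)"
    have b0: "0 \<le> b" using \<phi>_scale_ge[of 2 "w 0"] pos(1)[of 0] by (simp add: b_def)
    have "0 \<le> \<Phi> 1" by (simp add: \<Phi>_def)
    then have "ennreal (2 * \<Phi> 1 + 2 * b * W' 0) = 2 * ennreal (\<Phi> 1) + ennreal (2 * b) * ennreal (W' 0)"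
      using b0 W'pos[of 0] by (simp add: ennreal_mult)
    also have "\<dots> = 2 * rho (\<lambda>s. 1 * f s) + ennreal (2 * b) * emeasure wm (A 0)" by (simp only: \<Phi> wA)
    also have "\<dots> = (\<integral>\<^sup>+t. 2 * ennreal (\<phi> (1 * f t)) + ennreal (2 * b) * indicator (A 0) t \<partial>wm)"
      by (subst rho_c) (simp_all add: nn_integral_add nn_integral_cmult nn_integral_cmult_indicator)
    also have "\<dots> \<le> (\<integral>\<^sup>+t. ennreal (\<phi> (2 * f t)) \<partial>wm)"
    proof (rule nn_integral_mono)
      fix t
      have "2 * \<phi> (f t) + 2 * b * indicator (A 0) t \<le> \<phi> (2 * f t)"
      proof (cases "t \<in> A 0")
        case True then show ?thesis using fin[OF True] by (simp add: b_def algebra_simps)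
      next
        case False then show ?thesis using \<phi>_scale_ge[of 2 "f t"] f0[of t] by simp
      qed
      then have "ennreal (2 * \<phi> (f t) + 2 * b * indicator (A 0) t) \<le> ennreal (\<phi> (2 * f t))" by (rule ennreal_leI)
      then show "2 * ennreal (\<phi> (1 * f t)) + ennreal (2 * b) * indicator (A 0) t \<le> ennreal (\<phi> (2 * f t))"
        using b0 by (simp add: ennreal_mult ennreal_indicator split: split_indicator)
    qed
    also have "\<dots> = ennreal (\<Phi> 2)" by (simp add: rho_c \<Phi>)
    finally have "2 * \<Phi> 1 + 2 * b * W' 0 \<le> \<Phi> 2" by (subst (asm) ennreal_le_iff) (simp_all add: \<Phi>_def)
    moreover have "1/2 < b * W' 0" using base by (simp add: b_def W'_def)
    ultimately show ?thesis by (simp add: algebra_simps)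
  qed
  obtain k where k: "0 < k" and Nk: "N (abs_L0 f) = (1 + \<Phi> k) / k"
    by (rule amemiya_attained[OF fX rfin, of 1 2]) (use h12 in \<open>auto simp: \<Phi>_def\<close>)
  define R where "R = N (abs_L0 f)"
  have R: "0 < R" using Nk k by (simp add: R_def \<Phi>_def add_pos_nonneg)
  obtain G where G: "\<And>f g. f \<in> X \<Longrightarrow> g \<in> X \<Longrightarrow> G (\<lambda>s. f s + g s) = G f + G g"
    "\<And>c f. f \<in> X \<Longrightarrow> G (\<lambda>s. c * f s) = c * G f"
    "\<And>f. f \<in> X \<Longrightarrow> G f \<le> N (abs_L0 f)" "G f = N (abs_L0 f)"
    "\<And>y :: nat \<Rightarrow> real \<Rightarrow> real. (\<And>n. y n \<in> X) \<Longrightarrow> (\<And>n. N (abs_L0 (y n)) \<le> N (abs_L0 f)) \<Longrightarrow>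
      (\<lambda>n. G (y n)) \<longlonglongrightarrow> N (abs_L0 f) \<Longrightarrow> (\<lambda>n. N (abs_L0 (\<lambda>s. y n s - f s))) \<longlonglongrightarrow> 0"
    by (rule strongly_exposedE[OF SEP fX]) (use R in \<open>auto simp: R_def\<close>)
  have X1: "(\<lambda>t. indicator (A n) t) \<in> X" for n
  proof -
    have "rho (\<lambda>t. 1 * indicator (A n) t) < \<infinity>"
      by (subst rho_indicator) (auto simp: A eA W_ennreal ennreal_mult_less_top)
    then show ?thesis by (auto simp: X_def intro!: exI[of _ 1])
  qed
  \<comment> \<open>Lowering block \<open>n\<close> to \<open>w' n\<close> keeps the function
    decreasing, so the drop of its modular is explicit. The minimiser \<open>k\<close> gives the
    norm of \<open>f\<close> exactly and bounds that of the lowered function; hence \<open>G\<close>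
    loses at least the drop divided by \<open>k\<close>.\<close>
  have G1: "\<phi> (k * w n) / (k * w n) * W' n \<le> G (indicator (A n))" for n
  proof -
    define d where "d = w n - w' n"
    have d: "0 < d" using pos by (simp add: d_def)
    define v where "v t = f t - d * indicator (A n) t" for t
    have vX: "v \<in> X" unfolding v_def using X_diff[OF fX X_scale[OF X1, of d n]] by simp
    have vin: "v t = w' n" if "t \<in> A n" for t using fin[OF that] that by (simp add: v_def d_def)
    have vout: "v t = f t" if "t \<notin> A n" for t using that by (simp add: v_def)
    have v0: "0 \<le> v t" for t using vin vout f0 pos(4) by (cases "t \<in> A n") auto
    have vam: "antimono_on {0<..} v"
      unfolding monotone_on_def
    proof (intro ballI impI)
      fix s t :: real assume st: "s \<in> {0<..}" "t \<in> {0<..}" "s \<le> t"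
      have vf: "v t \<le> f t" using d by (simp add: v_def)
      have fm: "f t \<le> f s" using fam st by (auto simp: monotone_on_def)
      show "v t \<le> v s"
      proof (cases "s \<in> A n")
        case s: True
        show ?thesis
        proof (cases "t \<in> A n")
          case True then show ?thesis using s vin by simp
        next
          case False
          show ?thesis
          proof (cases "t \<in> (\<Union>i. A i)")
            case True
            then obtain m where m: "t \<in> A m" by blast
            then have "m \<noteq> n" using False by auto
            moreover have "s < t" using st s False by (cases "s = t") auto
            ultimately have "w m \<le> w' n" using right[of s n t m] s m by (auto simp: A_def)
            then show ?thesis using vin[OF s] vout[OF False] fin[OF m] by simp
          next
            case False
            then have "v t = 0" using vout fout by auto
            then show ?thesis using v0 by simp
          qed
        qed
      qed (use vout vf fm in auto)
    qed
    have "antimono_on {0<..} (\<lambda>t. k * v t)"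
      using vam k by (auto simp: monotone_on_def)
    then have rv: "rho (\<lambda>s. k * v s) = (\<integral>\<^sup>+t. ennreal (\<phi> (k * v t)) \<partial>wm)"
      using v0 k by (intro rho_antimono_fun) auto
    have [measurable]: "v \<in> borel_measurable wm" unfolding v_def by measurable
    define D where "D = \<phi> (k * w n) - \<phi> (k * w' n)"
    have D0: "0 \<le> D" unfolding D_def using k pos(4,5)[of n] \<phi>_mono[of "k * w' n" "k * w n"] by simp
    have "rho (\<lambda>s. k * v s) + ennreal (D * W' n) = (\<integral>\<^sup>+t. ennreal (\<phi> (k * v t)) + ennreal D * indicator (A n) t \<partial>wm)"
      using D0 W'pos[of n] by (simp add: rv nn_integral_add nn_integral_cmult_indicator wA ennreal_mult)
    also have "\<dots> = (\<integral>\<^sup>+t. ennreal (\<phi> (k * f t)) \<partial>wm)"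
    proof (rule nn_integral_cong)
      fix t
      show "ennreal (\<phi> (k * v t)) + ennreal D * indicator (A n) t = ennreal (\<phi> (k * f t))"
        using D0 vin vout fin by (cases "t \<in> A n") (auto simp: D_def ennreal_plus[symmetric] simp del: ennreal_plus)
    qed
    also have "\<dots> = ennreal (\<Phi> k)" using k by (simp add: rho_c \<Phi>)
    finally have sum: "rho (\<lambda>s. k * v s) + ennreal (D * W' n) = ennreal (\<Phi> k)" .
    have DW: "0 \<le> D * W' n" using D0 W'pos[of n] by simp
    have "rho (\<lambda>s. k * v s) < \<infinity>" using Delta2_rho_finite[OF D2 vX] .
    then obtain r where r: "rho (\<lambda>s. k * v s) = ennreal r" "0 \<le> r" by (cases "rho (\<lambda>s. k * v s)") auto
    have rD: "r + D * W' n = \<Phi> k" using sum r DW by (simp add: ennreal_plus[symmetric] \<Phi>_def del: ennreal_plus)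
    have "G f = G v + d * G (indicator (A n))"
      using G(1)[OF vX X_scale[OF X1, of d n]] G(2)[OF X1, of d n] by (simp add: v_def)
    moreover have "G v \<le> (1 + r) / k" using G(3)[OF vX] N_le[OF vX k, of r] r by simp
    ultimately have "(1 + \<Phi> k) / k - (1 + r) / k \<le> d * G (indicator (A n))" using G(4) Nk by simp
    also have "(1 + \<Phi> k) / k - (1 + r) / k = D * W' n / k" using rD by (simp add: diff_divide_distrib[symmetric])
    finally have le: "D * W' n / k \<le> d * G (indicator (A n))" .
    have "\<phi> (k * w' n) \<le> w' n / w n * \<phi> (k * w n)"
      using \<phi>_scale_le[of "w' n / w n" "k * w n"] pos(1,4,5)[of n] by (simp add: less_imp_le mult.commute)
    then have "d / w n * \<phi> (k * w n) \<le> D" using pos(1)[of n] by (simp add: D_def d_def diff_divide_distrib left_diff_distrib)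
    then have "d / w n * \<phi> (k * w n) * W' n / k \<le> D * W' n / k"
      using k W'pos[of n] by (intro divide_right_mono mult_right_mono) auto
    then have "d * (\<phi> (k * w n) / (k * w n) * W' n) \<le> d * G (indicator (A n))"
      using le by (simp add: mult.commute mult.left_commute)
    then show ?thesis using d by (rule mult_left_le_imp_le)
  qed
  define z where "z n = L n * w n" for n
  have z: "0 < z n" for n using L1'[of n] pos(1)[of n] by (auto simp: z_def)
  \<comment> \<open>Normalises the indicator of the block to norm at most \<open>1\<close>, by the
    norm bound with parameter \<open>z n / c n\<close>.\<close>
  define c where "c n = z n / (1 + \<phi> (z n) * Wr (\<beta> n - \<alpha> n))" for n
  have den: "0 < 1 + \<phi> (z n) * Wr (\<beta> n - \<alpha> n)" for n by (simp add: add_pos_nonneg)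
  have c: "0 < c n" for n using z den by (simp add: c_def)
  define y where "y n t = R * c n * indicator (A n) t" for n t
  have yX: "y n \<in> X" for n unfolding y_def by (rule X_scale[OF X1])
  have Ny: "N (abs_L0 (y n)) \<le> R" for n
  proof -
    have cX: "(\<lambda>t. c n * indicator (A n) t) \<in> X" by (rule X_scale[OF X1])
    have "N (abs_L0 (\<lambda>t. c n * indicator (A n) t)) \<le> (1 + \<phi> (z n) * Wr (\<beta> n - \<alpha> n)) / (z n / c n)"
    proof (rule N_le[OF cX])
      show "0 < z n / c n" using z c by simp
      have "rho (\<lambda>s. z n / c n * (c n * indicator (A n) s)) = rho (\<lambda>s. z n * indicator (A n) s)"
        using c[of n] by simp
      also have "\<dots> = ennreal (\<phi> (z n)) * ennreal (Wr (\<beta> n - \<alpha> n))"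
        using z[of n] by (subst rho_indicator) (auto simp: A eA W_ennreal)
      finally show "rho (\<lambda>s. z n / c n * (c n * indicator (A n) s)) \<le> ennreal (\<phi> (z n) * Wr (\<beta> n - \<alpha> n))"
        by (simp add: ennreal_mult)
    qed simp
    also have "\<dots> = 1" using z[of n] den[of n] by (simp add: c_def)
    finally have "N (abs_L0 (\<lambda>t. c n * indicator (A n) t)) \<le> 1" .
    moreover have "abs_L0 (y n) = R *\<^sub>R abs_L0 (\<lambda>t. c n * indicator (A n) t)"
      by (subst scaleR_abs_L0) (auto simp: y_def[abs_def] mult.assoc)
    ultimately show ?thesis using N_scale[OF cX, of R] R by simp
  qed
  \<comment> \<open>Once \<open>1 / L n \<le> k\<close>, the ratio \<open>\<phi> u / u\<close> at
    \<open>k * w n\<close> is at least that at \<open>w n / L n\<close>, hence by \<open>lin\<close>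
    at least that at \<open>z n\<close> up to the factor \<open>1 + \<epsilon> n\<close>. The size
    \<open>1 / \<epsilon> n\<close> makes the summand \<open>1\<close> in \<open>c n\<close>
    negligible, and \<open>fast\<close> does the same for the weight to the left of the
    block.\<close>
  have Gy: "R * ((1 - \<epsilon> n) / ((1 + \<epsilon> n) * (1 + \<epsilon> n))) \<le> G (y n)" if n: "0 < n" "1 / L n \<le> k" for n
  proof -
    have "w n / L n \<le> k * w n" using n(2) pos(1)[of n] mult_right_mono[of "1 / L n" k "w n"] by simp
    then have "\<phi> (w n / L n) / (w n / L n) \<le> \<phi> (k * w n) / (k * w n)"
      using pos(1)[of n] L1'[of n] by (intro \<phi>_ratio_mono) auto
    then have "(1 + \<epsilon> n) * (\<phi> (w n / L n) / (w n / L n)) \<le> (1 + \<epsilon> n) * (\<phi> (k * w n) / (k * w n))"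
      using \<epsilon>(1)[of n] by (intro mult_left_mono) auto
    then have "\<phi> (z n) / z n \<le> (1 + \<epsilon> n) * (\<phi> (k * w n) / (k * w n))"
      using lin[OF n(1)] by (simp add: z_def)
    then have r: "\<phi> (z n) / z n / (1 + \<epsilon> n) \<le> \<phi> (k * w n) / (k * w n)"
      using \<epsilon>(1)[of n] by (subst pos_divide_le_eq) (simp_all only: mult.commute add_pos_pos zero_less_one)
    define Q where "Q = \<phi> (z n) * Wr (\<beta> n)"
    have Q: "Q = 1 / \<epsilon> n" using size[OF n(1)] by (simp add: Q_def z_def)
    have "(1 - \<epsilon> n) / ((1 + \<epsilon> n) * (1 + \<epsilon> n)) = Q * (1 - \<epsilon> n) / (1 + \<epsilon> n) / (1 + Q)"
    proof -
      have "1 + Q = (1 + \<epsilon> n) / \<epsilon> n" using \<epsilon>(1)[of n] unfolding Q by (simp add: add_divide_distrib)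
      then show ?thesis using \<epsilon>(1)[of n] unfolding Q by simp
    qed
    also have "\<dots> \<le> \<phi> (z n) * W' n / (1 + \<epsilon> n) / (1 + \<phi> (z n) * Wr (\<beta> n - \<alpha> n))"
    proof (rule frac_le)
      have "\<phi> (z n) * (Wr (\<beta> n) * (1 - \<epsilon> n)) \<le> \<phi> (z n) * W' n"
        using fast[OF n(1)] by (intro mult_left_mono) (auto simp: W'_def algebra_simps)
      then show "Q * (1 - \<epsilon> n) / (1 + \<epsilon> n) \<le> \<phi> (z n) * W' n / (1 + \<epsilon> n)"
        using \<epsilon>(1)[of n] by (intro divide_right_mono) (auto simp: Q_def mult.assoc)
      show "1 + \<phi> (z n) * Wr (\<beta> n - \<alpha> n) \<le> 1 + Q"
        unfolding Q_def using Wa[of n] by (intro add_left_mono mult_left_mono) auto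
      show "0 \<le> \<phi> (z n) * W' n / (1 + \<epsilon> n)" using W'pos[of n] \<epsilon>(1)[of n] by simp
    qed (rule den)
    also have "\<dots> = c n * (\<phi> (z n) / z n / (1 + \<epsilon> n) * W' n)"
      using z[of n] by (simp add: c_def)
    also have "\<dots> \<le> c n * (\<phi> (k * w n) / (k * w n) * W' n)"
      using c[of n] W'pos[of n] r by (intro mult_left_mono mult_right_mono) auto
    also have "\<dots> \<le> c n * G (indicator (A n))" using c[of n] G1[of n] by (intro mult_left_mono) auto
    finally have "R * ((1 - \<epsilon> n) / ((1 + \<epsilon> n) * (1 + \<epsilon> n))) \<le> R * (c n * G (indicator (A n)))"
      using R by (intro mult_left_mono) auto
    also have "\<dots> = G (y n)" using G(2)[OF X1, of "R * c n" n] by (simp add: y_def[abs_def])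
    finally show ?thesis .
  qed
  have ev: "\<forall>\<^sub>F n in sequentially. 0 < n \<and> 1 / L n \<le> k"
  proof -
    obtain m :: nat where m: "1 / k < 2 ^ m" using real_arch_pow[of 2 "1/k"] by auto
    have "1 / L n \<le> k" if "m \<le> n" for n
    proof -
      have "1 / k < L n" using m L1[of n] power_increasing[OF that, of "2::real"] by linarith
      then show ?thesis using k L1'[of n] by (simp add: field_simps)
    qed
    then show ?thesis by (auto simp: eventually_sequentially intro!: exI[of _ "Suc m"])
  qed
  have "(\<lambda>n. G (y n)) \<longlonglongrightarrow> R"
  proof (rule tendsto_sandwich)
    show "\<forall>\<^sub>F n in sequentially. R * ((1 - \<epsilon> n) / ((1 + \<epsilon> n) * (1 + \<epsilon> n))) \<le> G (y n)"
      using ev by eventually_elim (use Gy in auto)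
    show "\<forall>\<^sub>F n in sequentially. G (y n) \<le> R" using G(3)[OF yX] Ny by (auto intro: always_eventually order_trans)
    have "(\<lambda>n. R * ((1 - \<epsilon> n) / ((1 + \<epsilon> n) * (1 + \<epsilon> n)))) \<longlonglongrightarrow> R * ((1 - 0) / ((1 + 0) * (1 + 0)))"
      by (intro tendsto_intros \<epsilon>(3)) auto
    then show "(\<lambda>n. R * ((1 - \<epsilon> n) / ((1 + \<epsilon> n) * (1 + \<epsilon> n)))) \<longlonglongrightarrow> R" by simp
  qed auto
  then have lim: "(\<lambda>n. N (abs_L0 (\<lambda>s. y n s - f s))) \<longlonglongrightarrow> 0"
    using yX Ny unfolding R_def by (intro G(5)) auto
  define b where "b = N (abs_L0 (\<lambda>s. w 0 * indicator (A 0) s))"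
  have b: "0 < b" unfolding b_def
  proof (rule N_pos[OF X_scale[OF X1] A eA])
    show "AE s in pos_lebesgue. w 0 * indicator (A 0) s \<le> \<bar>w 0 * indicator (A 0) s\<bar>" by simp
  qed (use pos in auto)
  \<comment> \<open>For \<open>n > 0\<close> the maximising functions vanish on block
    \<open>0\<close>, where \<open>f\<close> does not; so they cannot converge to
    \<open>f\<close>.\<close>
  have "b \<le> N (abs_L0 (\<lambda>s. y n s - f s))" if "0 < n" for n
    unfolding b_def
  proof (rule N_mono)
    show "(\<lambda>s. y n s - f s) \<in> X" by (intro X_diff yX fX)
    show "AE s in pos_lebesgue. \<bar>w 0 * indicator (A 0) s\<bar> \<le> \<bar>y n s - f s\<bar>"
    proof (rule AE_I2)
      fix s show "\<bar>w 0 * indicator (A 0) s\<bar> \<le> \<bar>y n s - f s\<bar>"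
      proof (cases "s \<in> A 0")
        case True
        then have "s \<notin> A n" using dA that by (auto simp: disjoint_family_on_def)
        then show ?thesis using True fin[OF True] by (simp add: y_def)
      qed simp
    qed
  qed measurable
  moreover have "\<forall>\<^sub>F n in sequentially. N (abs_L0 (\<lambda>s. y n s - f s)) < b" using lim b by (rule order_tendstoD)
  then obtain n0 where "\<And>n. n0 \<le> n \<Longrightarrow> N (abs_L0 (\<lambda>s. y n s - f s)) < b" by (auto simp: eventually_sequentially)
  then have "N (abs_L0 (\<lambda>s. y (Suc n0) s - f s)) < b" by simp
  ultimately show False by (meson not_le zero_less_Suc)
qed

text \<open>Strict convexity yields \<open>\<phi> (M u) > M \<phi> u\<close> pointwise; compactness
  makes the gap uniform.\<close>

lemma ratio_gap_compact:
  assumes sc: "strictly_convex_on {0..} \<phi>" and M: "1 < M" and ab: "0 < a" "a \<le> b"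
  obtains e where "0 < e" "\<And>u. a \<le> u \<Longrightarrow> u \<le> b \<Longrightarrow> M * (1 + e) * \<phi> u \<le> \<phi> (M * u)"
proof -
  define q where "q u = \<phi> (M * u) / \<phi> u" for u
  have "continuous_on {a..b} q" unfolding q_def
    using ab \<phi>_pos by (intro continuous_intros continuous_on_compose2[OF \<phi>_continuous]) (auto simp: less_imp_neq[THEN not_sym])
  then obtain u where u: "u \<in> {a..b}" "\<And>y. y \<in> {a..b} \<Longrightarrow> q u \<le> q y"
    using continuous_attains_inf[of "{a..b}" q] ab by auto
  have "\<phi> ((1 - 1/M) * 0 + 1/M * (M * u)) < (1 - 1/M) * \<phi> 0 + 1/M * \<phi> (M * u)"
    using sc M ab u(1) unfolding strictly_convex_on_def by (intro sc[unfolded strictly_convex_on_def, THEN conjunct2, rule_format]) auto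
  then have "M < q u" using M ab u(1) \<phi>_pos[of u] by (simp add: q_def field_simps)
  moreover have "M * (1 + (q u / M - 1)) * \<phi> x \<le> \<phi> (M * x)" if x: "a \<le> x" "x \<le> b" for x
  proof -
    have "q u * \<phi> x \<le> q x * \<phi> x" using u(2)[of x] x by (intro mult_right_mono) auto
    then show ?thesis using M ab x \<phi>_pos[of x] by (simp add: q_def)
  qed
  ultimately show ?thesis using M by (intro that[of "q u / M - 1"]) auto
qed

text \<open>Uniform superlinear growth near \<open>0\<close> and near infinity would extend to the
  compact range between, and \<open>Nabla2_iterate\<close> would apply. So near-linearity occurs at
  one of the two ends, for all parameters at once.\<close>

lemma not_Nabla2_cases:
  assumes sc: "strictly_convex_on {0..} \<phi>" and nN: "\<not> Nabla2 \<phi>"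
  obtains (zero) "\<And>M e d. 1 < M \<Longrightarrow> 0 < e \<Longrightarrow> 0 < d \<Longrightarrow> \<exists>u. 0 < u \<and> u < d \<and> \<phi> (M * u) < M * (1 + e) * \<phi> u"
    | (infinity) "\<And>M e d. 1 < M \<Longrightarrow> 0 < e \<Longrightarrow> 0 < d \<Longrightarrow> \<exists>u>d. \<phi> (M * u) < M * (1 + e) * \<phi> u"
proof (rule ccontr)
  assume "\<not> thesis"
  then have "\<not> (\<forall>M e d. 1 < M \<longrightarrow> 0 < e \<longrightarrow> 0 < d \<longrightarrow> (\<exists>u. 0 < u \<and> u < d \<and> \<phi> (M * u) < M * (1 + e) * \<phi> u))"
    "\<not> (\<forall>M e d. 1 < M \<longrightarrow> 0 < e \<longrightarrow> 0 < d \<longrightarrow> (\<exists>u>d. \<phi> (M * u) < M * (1 + e) * \<phi> u))"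
    using zero infinity by blast+
  then obtain M1 e1 d1 M2 e2 d2 where 1: "1 < M1" "0 < e1" "0 < d1"
      "\<And>u. 0 < u \<Longrightarrow> u < d1 \<Longrightarrow> M1 * (1 + e1) * \<phi> u \<le> \<phi> (M1 * u)"
    and 2: "1 < M2" "0 < e2" "0 < d2" "\<And>u. d2 < u \<Longrightarrow> M2 * (1 + e2) * \<phi> u \<le> \<phi> (M2 * u)"
    unfolding not_all not_imp not_ex de_Morgan_conj not_less by (metis not_less)
  define M where "M = max M1 M2"
  define b where "b = max d1 d2"
  have M: "1 < M" using 1 by (simp add: M_def)
  obtain e3 where e3: "0 < e3" "\<And>u. d1 \<le> u \<Longrightarrow> u \<le> b \<Longrightarrow> M * (1 + e3) * \<phi> u \<le> \<phi> (M * u)"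
    by (rule ratio_gap_compact[OF sc M, of d1 b]) (use 1 in \<open>auto simp: b_def\<close>)
  define e where "e = min e1 (min e2 e3)"
  have e: "0 < e" "e \<le> e1" "e \<le> e2" "e \<le> e3" using 1 2 e3 by (auto simp: e_def)
  \<comment> \<open>A gap at \<open>M'\<close> persists at the larger factor \<open>M\<close>, since
    \<open>\<phi>\<close> grows at least linearly from \<open>M' * u\<close> to
    \<open>M * u\<close>.\<close>
  have up: "M * (1 + e) * \<phi> u \<le> \<phi> (M * u)"
    if h: "M' * (1 + e') * \<phi> u \<le> \<phi> (M' * u)" "1 < M'" "M' \<le> M" "e \<le> e'" "0 < u" for M' e' u
  proof -
    have "M * (1 + e) * \<phi> u \<le> M * ((1 + e') * \<phi> u)"
      using h M by (simp add: mult.assoc mult_right_mono)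
    also have "\<dots> = M / M' * (M' * (1 + e') * \<phi> u)" using h by simp
    also have "\<dots> \<le> M / M' * \<phi> (M' * u)" using h M by (intro mult_left_mono) auto
    also have "\<dots> \<le> \<phi> (M / M' * (M' * u))" using h M by (intro \<phi>_scale_ge) auto
    finally show ?thesis using h by simp
  qed
  have "M * (1 + e) * \<phi> u \<le> \<phi> (M * u)" if u: "0 < u" for u
  proof -
    consider "u < d1" | "d2 < u" | "d1 \<le> u" "u \<le> b" by (fastforce simp: b_def)
    then show ?thesis
    proof cases
      case le: 1 show ?thesis by (rule up[OF 1(4)[OF u le]]) (use 1 e u in \<open>auto simp: M_def\<close>)
    next
      case ge: 2 show ?thesis by (rule up[OF 2(4)[OF ge]]) (use 2 e u in \<open>auto simp: M_def\<close>)
    next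
      case 3 show ?thesis by (rule up[OF e3(2)[OF 3]]) (use M e u in auto)
    qed
  qed
  then show False using Nabla2_iterate[OF M e(1)] nN by blast
qed

lemma Nabla2_of_strongly_exposed:
  assumes SEP: "strongly_exposed_property V N" and D2: "Delta2 (extend \<phi>)" and sc: "strictly_convex_on {0..} \<phi>"
  shows "Nabla2 \<phi>"
proof (rule ccontr)
  assume nN: "\<not> Nabla2 \<phi>"
  \<comment> \<open>The bound \<open>1/2\<close> makes the weights up to consecutive end points
    differ by a factor of at least \<open>2\<close>; the limit \<open>0\<close> drives the block
    lemma.\<close>
  define \<epsilon> where "\<epsilon> n = 1 / real (n + 2)" for n
  define L where "L n = 2 ^ n / \<epsilon> n" for n
  have \<epsilon>: "0 < \<epsilon> n" "\<epsilon> n \<le> 1" for n by (auto simp: \<epsilon>_def)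
  have half: "\<epsilon> n \<le> 1/2" for n by (simp add: \<epsilon>_def)
  have \<epsilon>lim: "\<epsilon> \<longlonglongrightarrow> 0" unfolding \<epsilon>_def[abs_def] by (rule LIMSEQ_ignore_initial_segment[OF lim_1_over_n])
  have L1: "1 < L n" for n
  proof -
    have "1 * 1 < (2::real) ^ n * real (n + 2)" by (intro mult_le_less_imp_less) auto
    then show ?thesis by (simp add: L_def \<epsilon>_def)
  qed
  have LL: "1 < L n * L n" for n using L1[of n] by (simp add: less_1_mult)
  define \<kappa> where "\<kappa> = \<phi> 2 / 2 - \<phi> 1"
  have \<kappa>: "0 < \<kappa>"
  proof -
    have "\<phi> ((1 - 1/2) * 0 + 1/2 * 2) < (1 - 1/2) * \<phi> 0 + 1/2 * \<phi> 2"
      by (intro sc[unfolded strictly_convex_on_def, THEN conjunct2, rule_format]) auto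
    then show ?thesis by (simp add: \<kappa>_def)
  qed
  \<comment> \<open>Block \<open>0\<close> has height \<open>1\<close>. With
    \<open>\<kappa> * Wr b0 > 1\<close> the requirement \<open>base\<close> survives even if half of
    this weight goes to blocks on its left.\<close>
  obtain b0 where b0: "0 < b0" "1 / \<kappa> < Wr b0" using Wr_large by blast
  define good where "good n w b \<longleftrightarrow> 0 < w \<and> 0 < b \<and> (n = 0 \<longrightarrow> w = 1 \<and> b = b0) \<and> (0 < n \<longrightarrow>
      \<phi> (L n * w) * Wr b = 1 / \<epsilon> n \<and> \<phi> (L n * w) / (L n * w) \<le> (1 + \<epsilon> n) * (\<phi> (w / L n) / (w / L n)))" for n w b
  \<comment> \<open>With \<open>w = L n * u\<close> the interval from \<open>w / L n\<close> to
    \<open>w * L n\<close> is the one from \<open>u\<close> to \<open>L n * L n * u\<close>, so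
    near-linearity is requested for \<open>M = L n * L n\<close>.\<close>
  have good: "\<exists>b. good n (L n * u) b \<and> Wr b = (1 / \<epsilon> n) / \<phi> (L n * L n * u)"
    if u: "0 < u" "\<phi> (L n * L n * u) < L n * L n * (1 + \<epsilon> n) * \<phi> u" and n: "0 < n" for n u
  proof -
    have Lp: "0 < L n" using L1[of n] by simp
    have p: "0 < \<phi> (L n * L n * u)" using u(1) Lp by (intro \<phi>_pos) simp
    obtain b where b: "0 < b" "Wr b = (1 / \<epsilon> n) / \<phi> (L n * L n * u)"
      using Wr_surj[of "(1 / \<epsilon> n) / \<phi> (L n * L n * u)"] p \<epsilon>(1)[of n] by auto
    have "\<phi> (L n * (L n * u)) * Wr b = 1 / \<epsilon> n" using p by (simp add: b(2) mult.assoc)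
    moreover have "\<phi> (L n * (L n * u)) / (L n * (L n * u)) \<le> (1 + \<epsilon> n) * (\<phi> (L n * u / L n) / (L n * u / L n))"
    proof -
      have "\<phi> (L n * (L n * u)) / (L n * (L n * u)) \<le> (L n * L n * (1 + \<epsilon> n) * \<phi> u) / (L n * (L n * u))"
        using u Lp by (intro divide_right_mono) (auto simp: mult.assoc)
      also have "\<dots> = (1 + \<epsilon> n) * (\<phi> u / u)" using Lp by simp
      finally show ?thesis using Lp by simp
    qed
    ultimately have "good n (L n * u) b" unfolding good_def using u Lp b n by auto
    then show ?thesis using b(2) by blast
  qed
  note blocks = Nabla2_of_strongly_exposed_blocks[OF SEP D2 _ _ _ _ _ _ _ _ \<epsilon> \<epsilon>lim, where L=L]
  show False
  proof (rule not_Nabla2_cases[OF sc nN])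
    assume zero: "\<And>M e d. 1 < M \<Longrightarrow> 0 < e \<Longrightarrow> 0 < d \<Longrightarrow> \<exists>u. 0 < u \<and> u < d \<and> \<phi> (M * u) < M * (1 + e) * \<phi> u"
    have "\<exists>wb :: nat \<Rightarrow> real \<times> real. \<forall>n. good n (fst (wb n)) (snd (wb n)) \<and>
      (fst (wb (Suc n)) < fst (wb n) \<and> Wr (snd (wb n)) \<le> \<epsilon> (Suc n) * Wr (snd (wb (Suc n))))"
    proof (rule dependent_nat_choice[where P="\<lambda>n x. good n (fst x) (snd x)"
          and Q="\<lambda>n x y. fst y < fst x \<and> Wr (snd x) \<le> \<epsilon> (Suc n) * Wr (snd y)"])
      show "\<exists>x. good 0 (fst x) (snd x)" by (rule exI[of _ "(1, b0)"]) (use b0 in \<open>simp add: good_def\<close>)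
      fix x :: "real \<times> real" and n :: nat assume g: "good n (fst x) (snd x)"
      obtain w b where x: "x = (w, b)" by (cases x)
      have wb: "0 < w" "0 < b" using g x by (auto simp: good_def)
      have Wb: "0 < Wr b" using wb by (intro Wr_pos)
      obtain m where m: "0 \<le> m" "\<phi> m = 1 / Wr b" using \<phi>_surj[of "1 / Wr b"] Wb by auto
      have m0: "0 < m" using m Wb by (cases "m = 0") auto
      let ?L = "L (Suc n)"
      have Lp: "0 < ?L" using L1[of "Suc n"] by simp
      \<comment> \<open>The first bound makes the new height smaller than \<open>w\<close>. The
        second keeps \<open>\<phi>\<close> at the top of the new interval below
        \<open>1 / Wr b\<close>, so the new weight exceeds the old one by a factor of at least
        \<open>1 / \<epsilon> (Suc n)\<close>.\<close>
      define d where "d = min (w / ?L) (m / (?L * ?L))"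
      have "0 < d" using wb m0 Lp by (simp add: d_def)
      then obtain u where u: "0 < u" "u < d" "\<phi> (?L * ?L * u) < ?L * ?L * (1 + \<epsilon> (Suc n)) * \<phi> u"
        using zero[OF LL[of "Suc n"] \<epsilon>(1)[of "Suc n"]] by blast
      obtain b' where b': "good (Suc n) (?L * u) b'" "Wr b' = (1 / \<epsilon> (Suc n)) / \<phi> (?L * ?L * u)"
        using good[OF u(1) u(3)] by auto
      have "u < w / ?L" "u < m / (?L * ?L)" using u(2) by (auto simp: d_def)
      then have uw: "?L * u < w" and um: "?L * ?L * u < m" using Lp by (auto simp: field_simps)
      have pu: "0 < \<phi> (?L * ?L * u)" using u Lp by (intro \<phi>_pos) simp
      have "\<phi> (?L * ?L * u) \<le> 1 / Wr b" using um u Lp m \<phi>_mono[of "?L * ?L * u" m] by simp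
      then have "Wr b \<le> 1 / \<phi> (?L * ?L * u)" using pu Wb by (simp add: field_simps)
      also have "\<dots> = \<epsilon> (Suc n) * Wr b'" using \<epsilon>(1)[of "Suc n"] by (simp add: b'(2))
      finally show "\<exists>y. good (Suc n) (fst y) (snd y) \<and> (fst y < fst x \<and> Wr (snd x) \<le> \<epsilon> (Suc n) * Wr (snd y))"
        using b'(1) uw x by (intro exI[of _ "(?L * u, b')"]) simp
    qed
    then obtain wb :: "nat \<Rightarrow> real \<times> real" where wb: "\<And>n. good n (fst (wb n)) (snd (wb n))"
      "\<And>n. fst (wb (Suc n)) < fst (wb n)" "\<And>n. Wr (snd (wb n)) \<le> \<epsilon> (Suc n) * Wr (snd (wb (Suc n)))" by blast
    define w \<beta> where "w n = fst (wb n)" and "\<beta> n = snd (wb n)" for n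
    have g: "good n (w n) (\<beta> n)" for n using wb(1) by (simp add: w_def \<beta>_def)
    have pos: "0 < w n" "0 < \<beta> n" for n using g[of n] by (auto simp: good_def)
    have w: "w (Suc n) < w n" for n using wb(2) by (simp add: w_def)
    have \<beta>f: "Wr (\<beta> n) \<le> \<epsilon> (Suc n) * Wr (\<beta> (Suc n))" for n using wb(3) by (simp add: \<beta>_def)
    have wd: "w n \<le> w m" if "m \<le> n" for m n using lift_Suc_antimono_le[of w m n] w that by (simp add: less_imp_le)
    have b12: "Wr (\<beta> n) \<le> 1/2 * Wr (\<beta> (Suc n))" for n
      by (rule order_trans[OF \<beta>f mult_right_mono[OF half]]) simp
    have \<beta>s: "\<beta> n < \<beta> (Suc n)" for n
    proof (rule ccontr)
      assume "\<not> ?thesis"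
      then have "Wr (\<beta> (Suc n)) \<le> Wr (\<beta> n)" by (intro Wr_mono) simp
      then show False using b12[of n] Wr_pos[OF pos(2)[of "Suc n"]] by linarith
    qed
    have \<beta>m: "\<beta> m \<le> \<beta> n" if "m \<le> n" for m n using lift_Suc_mono_le[of \<beta> m n] \<beta>s that by (simp add: less_imp_le)
    \<comment> \<open>The heights decrease, so the blocks follow one another to the right, starting
      at \<open>0\<close>.\<close>
    define \<alpha> where "\<alpha> n = (if n = 0 then 0 else \<beta> (n - 1))" for n
    have least: "\<exists>m\<le>n. s \<in> {\<alpha> m<..\<beta> m}" if s: "0 < s" "s \<le> \<beta> n" for s n
    proof -
      define m where "m = (LEAST m. s \<le> \<beta> m)"
      have m: "s \<le> \<beta> m" "m \<le> n" unfolding m_def using s by (auto intro: LeastI Least_le)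
      have "\<not> s \<le> \<beta> (m - 1)" if "m \<noteq> 0" unfolding m_def using that[unfolded m_def] by (intro not_less_Least) simp
      then have "\<alpha> m < s" using s by (auto simp: \<alpha>_def not_le)
      then show ?thesis using m by auto
    qed
    have sep: "m < n \<Longrightarrow> \<beta> m \<le> \<alpha> n" for m n unfolding \<alpha>_def by (auto intro: \<beta>m)
    show False
    proof (rule blocks[of w \<alpha> \<beta> "\<lambda>n. w (Suc n)"])
      show "disjoint_family (\<lambda>n. {\<alpha> n<..\<beta> n})"
        unfolding disjoint_family_on_def
      proof (intro ballI impI)
        fix m n :: nat assume "m \<noteq> n"
        then consider "m < n" | "n < m" by linarith
        then show "{\<alpha> m<..\<beta> m} \<inter> {\<alpha> n<..\<beta> n} = {}" by cases (use sep[of m n] sep[of n m] in auto)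
      qed
      show "\<exists>m. s \<in> {\<alpha> m<..\<beta> m} \<and> w n \<le> w m" if "0 < s" "s < t" "t \<in> {\<alpha> n<..\<beta> n}" for s t n
      proof -
        have "0 < s" "s \<le> \<beta> n" using that by auto
        then obtain m where "m \<le> n" "s \<in> {\<alpha> m<..\<beta> m}" using least by blast
        then show ?thesis using wd by blast
      qed
      show "w m \<le> w (Suc n)" if "s \<in> {\<alpha> n<..\<beta> n}" "s < t" "t \<in> {\<alpha> m<..\<beta> m}" "m \<noteq> n" for s t m n
      proof -
        have "\<not> m < n" using sep[of m n] that by auto
        then show ?thesis using that by (intro wd) simp
      qed
      show "1 / 2 < (\<phi> (2 * w 0) / 2 - \<phi> (w 0)) * (Wr (\<beta> 0) - Wr (\<alpha> 0))"
      proof -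
        have "1 < \<kappa> * Wr b0" using b0 \<kappa> by (simp add: field_simps)
        then show ?thesis using g[of 0] by (simp add: good_def \<alpha>_def \<kappa>_def)
      qed
      show "Wr (\<alpha> n) \<le> \<epsilon> n * Wr (\<beta> n)" if "0 < n" for n using \<beta>f[of "n - 1"] that by (simp add: \<alpha>_def)
      show "\<alpha> n < \<beta> n" for n using \<beta>s[of "n - 1"] pos(2) by (auto simp: \<alpha>_def)
    qed (use pos w g in \<open>auto simp: good_def L_def \<alpha>_def less_imp_le\<close>)
  next
    assume infinity: "\<And>M e d. 1 < M \<Longrightarrow> 0 < e \<Longrightarrow> 0 < d \<Longrightarrow> \<exists>u>d. \<phi> (M * u) < M * (1 + e) * \<phi> u"
    have "\<exists>wb :: nat \<Rightarrow> real \<times> real. \<forall>n. good n (fst (wb n)) (snd (wb n)) \<and>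
      (fst (wb n) < fst (wb (Suc n)) \<and> Wr (snd (wb (Suc n))) \<le> \<epsilon> n * Wr (snd (wb n)))"
    proof (rule dependent_nat_choice[where P="\<lambda>n x. good n (fst x) (snd x)"
          and Q="\<lambda>n x y. fst x < fst y \<and> Wr (snd y) \<le> \<epsilon> n * Wr (snd x)"])
      show "\<exists>x. good 0 (fst x) (snd x)" by (rule exI[of _ "(1, b0)"]) (use b0 in \<open>simp add: good_def\<close>)
      fix x :: "real \<times> real" and n :: nat assume g: "good n (fst x) (snd x)"
      obtain w b where x: "x = (w, b)" by (cases x)
      have wb: "0 < w" "0 < b" using g x by (auto simp: good_def)
      have Wb: "0 < Wr b" using wb by (intro Wr_pos)
      \<comment> \<open>The value that \<open>\<phi>\<close> has to reach for the new weight to be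
        at most \<open>\<epsilon> n * Wr b\<close>.\<close>
      define c where "c = (1 / \<epsilon> (Suc n)) / (\<epsilon> n * Wr b)"
      have c: "0 < c" using Wb \<epsilon>(1)[of n] \<epsilon>(1)[of "Suc n"] by (simp add: c_def)
      obtain m where m: "0 \<le> m" "\<phi> m = c" using \<phi>_surj[of c] c by auto
      let ?L = "L (Suc n)"
      have Lp: "1 < ?L" by (rule L1)
      define d where "d = max w m"
      have "0 < d" using wb by (simp add: d_def)
      then obtain u where u: "d < u" "\<phi> (?L * ?L * u) < ?L * ?L * (1 + \<epsilon> (Suc n)) * \<phi> u"
        using infinity[OF LL[of "Suc n"] \<epsilon>(1)[of "Suc n"]] by blast
      have u0: "0 < u" using u \<open>0 < d\<close> by linarith
      obtain b' where b': "good (Suc n) (?L * u) b'" "Wr b' = (1 / \<epsilon> (Suc n)) / \<phi> (?L * ?L * u)"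
        using good[OF u0 u(2)] by auto
      have "1 * u < ?L * u" using Lp u0 by (intro mult_strict_right_mono) auto
      then have uw: "w < ?L * u" using u(1) by (simp add: d_def)
      have "1 * u < ?L * ?L * u" using LL[of "Suc n"] u0 by (intro mult_strict_right_mono) auto
      then have "m \<le> ?L * ?L * u" using u(1) by (simp add: d_def)
      then have "c \<le> \<phi> (?L * ?L * u)" using \<phi>_mono[OF m(1)] m(2) by simp
      then have "Wr b' \<le> (1 / \<epsilon> (Suc n)) / c" unfolding b'(2) using c \<epsilon>(1)[of "Suc n"]
        by (intro divide_left_mono mult_pos_pos) auto
      also have "\<dots> = \<epsilon> n * Wr b" using \<epsilon>(1)[of "Suc n"] by (simp add: c_def)
      finally show "\<exists>y. good (Suc n) (fst y) (snd y) \<and> (fst x < fst y \<and> Wr (snd y) \<le> \<epsilon> n * Wr (snd x))"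
        using b'(1) uw x by (intro exI[of _ "(?L * u, b')"]) simp
    qed
    then obtain wb :: "nat \<Rightarrow> real \<times> real" where wb: "\<And>n. good n (fst (wb n)) (snd (wb n))"
      "\<And>n. fst (wb n) < fst (wb (Suc n))" "\<And>n. Wr (snd (wb (Suc n))) \<le> \<epsilon> n * Wr (snd (wb n))" by blast
    define w \<beta> where "w n = fst (wb n)" and "\<beta> n = snd (wb n)" for n
    have g: "good n (w n) (\<beta> n)" for n using wb(1) by (simp add: w_def \<beta>_def)
    have pos: "0 < w n" "0 < \<beta> n" for n using g[of n] by (auto simp: good_def)
    have w: "w n < w (Suc n)" for n using wb(2) by (simp add: w_def)
    have \<beta>f: "Wr (\<beta> (Suc n)) \<le> \<epsilon> n * Wr (\<beta> n)" for n using wb(3) by (simp add: \<beta>_def)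
    have wi: "w m \<le> w n" if "m \<le> n" for m n using lift_Suc_mono_le[of w m n] w that by (simp add: less_imp_le)
    have b12: "Wr (\<beta> (Suc n)) \<le> 1/2 * Wr (\<beta> n)" for n
      by (rule order_trans[OF \<beta>f mult_right_mono[OF half]]) simp
    have \<beta>s: "\<beta> (Suc n) < \<beta> n" for n
    proof (rule ccontr)
      assume "\<not> ?thesis"
      then have "Wr (\<beta> n) \<le> Wr (\<beta> (Suc n))" by (intro Wr_mono) simp
      then show False using b12[of n] Wr_pos[OF pos(2)[of n]] by linarith
    qed
    have \<beta>m: "\<beta> n \<le> \<beta> m" if "m \<le> n" for m n using lift_Suc_antimono_le[of \<beta> m n] \<beta>s that by (simp add: less_imp_le)
    have bpow: "Wr (\<beta> n) \<le> (1/2) ^ n * Wr (\<beta> 0)" for n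
    proof (induction n)
      case (Suc n)
      have "1/2 * Wr (\<beta> n) \<le> 1/2 * ((1/2) ^ n * Wr (\<beta> 0))" using Suc by (intro mult_left_mono) auto
      then show ?case using b12[of n] by simp
    qed simp
    \<comment> \<open>The heights increase, so the blocks run to the left and have to exhaust a
      neighbourhood of \<open>0\<close>; halving weights force the end points to
      \<open>0\<close>.\<close>
    have small: "\<exists>n. \<beta> n < s" if s: "0 < s" for s
    proof -
      have "(\<lambda>n. (1/2) ^ n * Wr (\<beta> 0)) \<longlonglongrightarrow> 0 * Wr (\<beta> 0)" by (intro tendsto_mult tendsto_const LIMSEQ_power_zero) auto
      then have "\<forall>\<^sub>F n in sequentially. (1/2) ^ n * Wr (\<beta> 0) < Wr s" using Wr_pos[OF s] by (intro order_tendstoD) auto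
      then obtain n where "(1/2) ^ n * Wr (\<beta> 0) < Wr s" by (auto simp: eventually_sequentially)
      then have "Wr (\<beta> n) < Wr s" using bpow[of n] by linarith
      then have "\<beta> n < s" using Wr_mono[of s "\<beta> n"] by linarith
      then show ?thesis ..
    qed
    have least: "\<exists>m\<ge>n. s \<in> {\<beta> (Suc m)<..\<beta> m}" if s: "0 < s" "s \<le> \<beta> n" for s n
    proof -
      define m where "m = (LEAST m. \<beta> m < s)"
      obtain m' where m': "\<beta> m' < s" using small[OF s(1)] by blast
      have m: "\<beta> m < s" unfolding m_def by (rule LeastI[of "\<lambda>m. \<beta> m < s", OF m'])
      have "n < m"
      proof (rule ccontr)
        assume "\<not> n < m"
        then show False using \<beta>m[of m n] m s by simp
      qed
      moreover have "\<not> \<beta> (m - 1) < s" unfolding m_def using \<open>n < m\<close>[unfolded m_def] by (intro not_less_Least) simp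
      ultimately show ?thesis using m by (intro exI[of _ "m - 1"]) auto
    qed
    have sep: "m < n \<Longrightarrow> \<beta> n \<le> \<beta> (Suc m)" for m n by (rule \<beta>m) simp
    \<comment> \<open>Block \<open>0\<close> is the rightmost one here, hence the bound
      \<open>0\<close> for the values to its right.\<close>
    show False
    proof (rule blocks[of w "\<lambda>n. \<beta> (Suc n)" \<beta> "\<lambda>n. if n = 0 then 0 else w (n - 1)"])
      show "disjoint_family (\<lambda>n. {\<beta> (Suc n)<..\<beta> n})"
        unfolding disjoint_family_on_def
      proof (intro ballI impI)
        fix m n :: nat assume "m \<noteq> n"
        then consider "m < n" | "n < m" by linarith
        then show "{\<beta> (Suc m)<..\<beta> m} \<inter> {\<beta> (Suc n)<..\<beta> n} = {}" by cases (use sep[of m n] sep[of n m] in auto)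
      qed
      show "\<exists>m. s \<in> {\<beta> (Suc m)<..\<beta> m} \<and> w n \<le> w m" if "0 < s" "s < t" "t \<in> {\<beta> (Suc n)<..\<beta> n}" for s t n
      proof -
        have "0 < s" "s \<le> \<beta> n" using that by auto
        then obtain m where "n \<le> m" "s \<in> {\<beta> (Suc m)<..\<beta> m}" using least by blast
        then show ?thesis using wi by blast
      qed
      show "w m \<le> (if n = 0 then 0 else w (n - 1))" if "s \<in> {\<beta> (Suc n)<..\<beta> n}" "s < t" "t \<in> {\<beta> (Suc m)<..\<beta> m}" "m \<noteq> n" for s t m n
      proof -
        have "\<not> n < m" using sep[of n m] that by auto
        then show ?thesis using that by (auto intro: wi)
      qed
      show "1 / 2 < (\<phi> (2 * w 0) / 2 - \<phi> (w 0)) * (Wr (\<beta> 0) - Wr (\<beta> (Suc 0)))"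
      proof -
        have "1 < \<kappa> * Wr b0" using b0 \<kappa> by (simp add: field_simps)
        moreover have "\<kappa> * (1/2 * Wr (\<beta> 0)) \<le> \<kappa> * (Wr (\<beta> 0) - Wr (\<beta> (Suc 0)))"
          using b12[of 0] \<kappa> by (intro mult_left_mono) auto
        ultimately show ?thesis using g[of 0] by (simp add: good_def \<kappa>_def)
      qed
      show "(if n = 0 then 0 else w (n - 1)) < w n" for n using w[of "n - 1"] pos(1) by auto
    qed (use pos \<beta>s \<beta>f g in \<open>auto simp: good_def L_def less_imp_le\<close>)
  qed
qed

end

context orlicz_lorentz_space
begin

subsection \<open>A weight aligned with a given function\<close>

lemma emeasure_lt_ennreal: "emeasure pos_lebesgue {t. 0 < t \<and> ennreal t < a} = a"
proof (cases a)
  case (real r)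
  then have "{t. 0 < t \<and> ennreal t < a} = {0<..<r}" by (auto simp: ennreal_less_iff)
  then show ?thesis using real by (simp add: emeasure_pos_lebesgue_Ioo)
next
  case top
  have "top \<le> emeasure pos_lebesgue {t. 0 < t \<and> ennreal t < a}"
  proof (rule ccontr)
    assume "\<not> ?thesis"
    then obtain c where c: "emeasure pos_lebesgue {t. 0 < t \<and> ennreal t < a} = ennreal c" "0 \<le> c"
      by (cases "emeasure pos_lebesgue {t. 0 < t \<and> ennreal t < a}") auto
    have "emeasure pos_lebesgue {0<..c + 1} \<le> emeasure pos_lebesgue {t. 0 < t \<and> ennreal t < a}"
      by (rule emeasure_mono) (use interval_sets[of a] in \<open>auto simp: top\<close>)
    then have "ennreal (c + 1) \<le> ennreal c" using c by (simp add: emeasure_pos_lebesgue_Ioc del: ennreal_plus)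
    then show False using c by (simp add: ennreal_le_iff del: ennreal_plus)
  qed
  then show ?thesis using top by (simp add: top_unique)
qed

text \<open>The distribution of \<open>x\<close> is transported to the whole line by the logarithm, so that the
  half-lines form a generator on which the measures are finite.\<close>

definition log_distr :: "(real \<Rightarrow> real) \<Rightarrow> real measure \<Rightarrow> real measure" where
  "log_distr x \<mu> = distr (density \<mu> (\<lambda>s. if x s = 0 then 0 else 1)) borel (\<lambda>s. ln \<bar>x s\<bar>)"

lemma sets_log_distr [simp, measurable_cong]: "sets (log_distr x \<mu>) = sets borel" by (simp add: log_distr_def)

lemma nn_integral_log_distr:
  assumes [measurable]: "x \<in> borel_measurable \<mu>" "h \<in> borel_measurable borel"
  shows "(\<integral>\<^sup>+b. h b \<partial>log_distr x \<mu>) = (\<integral>\<^sup>+s. (if x s = 0 then 0 else 1) * h (ln \<bar>x s\<bar>) \<partial>\<mu>)"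
  unfolding log_distr_def by (subst nn_integral_distr) (auto simp: nn_integral_density)

lemma emeasure_log_distr:
  assumes "x \<in> borel_measurable \<mu>" and B: "B \<in> sets borel"
  shows "emeasure (log_distr x \<mu>) B = (\<integral>\<^sup>+s. (if x s = 0 then 0 else 1) * indicator B (ln \<bar>x s\<bar>) \<partial>\<mu>)"
proof -
  have "emeasure (log_distr x \<mu>) B = (\<integral>\<^sup>+b. indicator B b \<partial>log_distr x \<mu>)" using B by simp
  also have "\<dots> = (\<integral>\<^sup>+s. (if x s = 0 then 0 else 1) * indicator B (ln \<bar>x s\<bar>) \<partial>\<mu>)"
    by (rule nn_integral_log_distr) (use assms in measurable)
  finally show ?thesis .
qed

lemma ln_gt_iff: "a \<noteq> 0 \<and> r < ln \<bar>a\<bar> \<longleftrightarrow> exp r < \<bar>a\<bar>" for a r :: real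
  by (cases "a = 0") (auto simp: ln_less_cancel_iff[of "exp r", simplified, symmetric])

text \<open>Both distributions give the half-line above \<open>r\<close> the measure of the
  superlevel set of \<open>x\<close> at \<open>exp r\<close>, which is finite because
  \<open>x\<close> lies in \<open>X\<close>.\<close>

lemma log_distr_eq:
  assumes x: "x \<in> X" shows "log_distr x pos_lebesgue = log_distr (frearr x) pos_lebesgue"
    and log_distr_sigma_finite: "sigma_finite_measure (log_distr x pos_lebesgue)"
proof -
  have m[measurable]: "measurable_fun x" using x by (rule X_measurable)
  have mf[measurable]: "measurable_fun (frearr x)" using frearr_measurable by (simp add: measurable_wm_iff)
  have e1: "emeasure (log_distr x pos_lebesgue) {r<..} = level_measure x (exp r)" for r
  proof -
    have "emeasure (log_distr x pos_lebesgue) {r<..} = (\<integral>\<^sup>+s. indicator {s \<in> space pos_lebesgue. exp r < \<bar>x s\<bar>} s \<partial>pos_lebesgue)"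
    proof (subst emeasure_log_distr, goal_cases)
      case 3
      show ?case
      proof (rule nn_integral_cong)
        fix s assume "s \<in> space pos_lebesgue"
        then show "(if x s = 0 then 0 else 1) * indicator {r<..} (ln \<bar>x s\<bar>) =
            (indicator {s \<in> space pos_lebesgue. exp r < \<bar>x s\<bar>} s :: ennreal)"
          using ln_gt_iff[of "x s" r] by (auto simp: indicator_def)
      qed
    qed auto
    then show ?thesis by (simp add: level_measure_def)
  qed
  have e2: "emeasure (log_distr (frearr x) pos_lebesgue) {r<..} = level_measure x (exp r)" for r
  proof -
    have "emeasure (log_distr (frearr x) pos_lebesgue) {r<..} =
        (\<integral>\<^sup>+t. indicator {t. 0 < t \<and> ennreal t < level_measure x (exp r)} t \<partial>pos_lebesgue)"
    proof (subst emeasure_log_distr, goal_cases)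
      case 3
      show ?case
      proof (rule nn_integral_cong)
        fix t assume "t \<in> space pos_lebesgue"
        then have t: "0 < t" by simp
        have "exp r < \<bar>frearr x t\<bar> \<longleftrightarrow> ennreal (exp r) < rearr x t"
          using ennreal_frearr[OF x t, symmetric] by (simp add: ennreal_less_iff)
        also have "\<dots> \<longleftrightarrow> ennreal t < level_measure x (exp r)" using m by (intro rearr_gt_iff) auto
        finally show "(if frearr x t = 0 then 0 else 1) * indicator {r<..} (ln \<bar>frearr x t\<bar>) =
            (indicator {t. 0 < t \<and> ennreal t < level_measure x (exp r)} t :: ennreal)"
          using ln_gt_iff[of "frearr x t" r] t by (auto simp: indicator_def)
      qed
    qed auto
    then show ?thesis by (simp add: emeasure_lt_ennreal)
  qed
  have U: "(\<Union>i. {- real i<..}) = UNIV"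
  proof -
    have "x \<in> (\<Union>i. {- real i<..})" for x using reals_Archimedean2[of "-x"] by (auto simp: minus_less_iff)
    then show ?thesis by blast
  qed
  show "log_distr x pos_lebesgue = log_distr (frearr x) pos_lebesgue"
  proof (rule measure_eqI_generator_eq[where E="range greaterThan" and A="\<lambda>i. {- real i<..}" and \<Omega>=UNIV])
    show "Int_stable (range (greaterThan :: real \<Rightarrow> _))"
    proof (rule Int_stableI)
      fix a b :: "real set" assume "a \<in> range greaterThan" "b \<in> range greaterThan"
      then obtain p q where "a = {p<..}" "b = {q<..}" by auto
      then have "a \<inter> b = {max p q<..}" by auto
      then show "a \<inter> b \<in> range greaterThan" by auto
    qed
    show "sets (log_distr x pos_lebesgue) = sigma_sets UNIV (range greaterThan)"
      "sets (log_distr (frearr x) pos_lebesgue) = sigma_sets UNIV (range greaterThan)"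
      by (simp_all add: borel_Ioi sets_measure_of)
    show "emeasure (log_distr x pos_lebesgue) {- real i<..} \<noteq> \<infinity>" for i
      using X_level_finite[OF x, of "exp (- real i)"] by (simp add: e1)
  qed (auto simp: e1 e2 U)
  show "sigma_finite_measure (log_distr x pos_lebesgue)"
  proof
    show "\<exists>A. countable A \<and> A \<subseteq> sets (log_distr x pos_lebesgue) \<and> \<Union> A = space (log_distr x pos_lebesgue) \<and>
        (\<forall>a\<in>A. emeasure (log_distr x pos_lebesgue) a \<noteq> \<infinity>)"
    proof (intro exI[of _ "range (\<lambda>i. {- real i<..})"] conjI ballI)
      show "\<Union> (range (\<lambda>i. {- real i<..})) = space (log_distr x pos_lebesgue)" using U by (simp add: log_distr_def)
      fix a assume "a \<in> range (\<lambda>i. {- real i<..})"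
      then obtain i where "a = {- real i<..}" by auto
      then show "emeasure (log_distr x pos_lebesgue) a \<noteq> \<infinity>"
        using X_level_finite[OF x, of "exp (- real i)"] by (simp add: e1)
    qed auto
  qed
qed

text \<open>\<open>\<Omega>\<close> plays the role of \<open>\<omega> \<circ> \<sigma>\<close> for a measure preserving \<open>\<sigma>\<close> with \<open>\<bar>x\<bar> = x\<^sup>* \<circ> \<sigma>\<close>; it is the
  Radon--Nikodym derivative, as a function of \<open>\<bar>x\<bar>\<close>, of the image of \<open>\<omega> dt\<close> under \<open>x\<^sup>*\<close>.\<close>

lemma aligned_weight:
  assumes x: "x \<in> X"
  obtains \<Omega> :: "real \<Rightarrow> ennreal" where "\<Omega> \<in> borel_measurable pos_lebesgue"
    "\<And>s. x s = 0 \<Longrightarrow> \<Omega> s = 0" "AE s in pos_lebesgue. x s \<noteq> 0 \<longrightarrow> 0 < \<Omega> s"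
    "\<And>H :: real \<Rightarrow> ennreal. H \<in> borel_measurable borel \<Longrightarrow> H 0 = 0 \<Longrightarrow>
      (\<integral>\<^sup>+s. H \<bar>x s\<bar> * \<Omega> s \<partial>pos_lebesgue) = (\<integral>\<^sup>+t. H (frearr x t) \<partial>wm)"
    "\<And>(H :: real \<Rightarrow> ennreal) f. H \<in> borel_measurable borel \<Longrightarrow> (\<And>a b. 0 \<le> a \<Longrightarrow> a \<le> b \<Longrightarrow> H a \<le> H b) \<Longrightarrow> measurable_fun f \<Longrightarrow>
      (\<integral>\<^sup>+s. ennreal \<bar>f s\<bar> * (H \<bar>x s\<bar> * \<Omega> s) \<partial>pos_lebesgue) \<le> (\<integral>\<^sup>+t. rearr f t * H (frearr x t) \<partial>wm)"
proof -
  have m[measurable]: "measurable_fun x" using x by (rule X_measurable)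
  have mf[measurable]: "measurable_fun (frearr x)" using frearr_measurable by (simp add: measurable_wm_iff)
  define D where "D = log_distr x pos_lebesgue"
  have D': "D = log_distr (frearr x) pos_lebesgue" unfolding D_def by (rule log_distr_eq[OF x])
  have setsD[simp, measurable_cong]: "sets D = sets borel" by (simp add: D_def)
  interpret D: sigma_finite_measure D unfolding D_def by (rule log_distr_sigma_finite[OF x])
  define \<nu> where "\<nu> = log_distr (frearr x) wm"
  have sets\<nu>[simp, measurable_cong]: "sets \<nu> = sets borel" by (simp add: \<nu>_def)
  \<comment> \<open>The weight is positive, so \<open>wm\<close> and Lebesgue measure have the same
    null sets. One direction provides the density, the other its positivity.\<close>
  have null_iff: "emeasure D B = 0 \<longleftrightarrow> emeasure \<nu> B = 0" if [measurable]: "B \<in> sets borel" for B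
  proof -
    let ?h = "\<lambda>s. (if frearr x s = 0 then 0 else 1) * indicator B (ln \<bar>frearr x s\<bar>) :: ennreal"
    have [measurable]: "?h \<in> borel_measurable pos_lebesgue" by measurable
    have "emeasure D B = 0 \<longleftrightarrow> (AE s in pos_lebesgue. ?h s = 0)"
      unfolding D' by (subst emeasure_log_distr) (auto simp: nn_integral_0_iff_AE)
    also have "\<dots> \<longleftrightarrow> (AE s in wm. ?h s = 0)" by (simp add: AE_wm)
    also have "\<dots> \<longleftrightarrow> emeasure \<nu> B = 0"
      unfolding \<nu>_def by (subst emeasure_log_distr) (auto simp: nn_integral_0_iff_AE)
    finally show ?thesis .
  qed
  have "absolutely_continuous D \<nu>"
    unfolding absolutely_continuous_def using null_iff by (auto simp: null_sets_def)
  then obtain \<Omega>0 where \<Omega>0[measurable]: "\<Omega>0 \<in> borel_measurable borel" and dens: "density D \<Omega>0 = \<nu>"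
    using D.Radon_Nikodym[of \<nu>] by (auto cong: measurable_cong_sets)
  define \<Omega> where "\<Omega> s = (if x s = 0 then 0 else \<Omega>0 (ln \<bar>x s\<bar>))" for s
  have [measurable]: "\<Omega> \<in> borel_measurable pos_lebesgue" unfolding \<Omega>_def by measurable
  have exp_ln_frearr: "exp (ln (frearr x t)) = frearr x t" if "frearr x t \<noteq> 0" for t
  proof -
    have "0 < frearr x t" using that frearr_nonneg[of x t] by linarith
    then show ?thesis by simp
  qed
  have I1: "(\<integral>\<^sup>+s. h (ln \<bar>x s\<bar>) * \<Omega> s \<partial>pos_lebesgue) = (\<integral>\<^sup>+b. h b \<partial>\<nu>)" if [measurable]: "h \<in> borel_measurable borel" for h
  proof -
    have "(\<integral>\<^sup>+b. h b \<partial>\<nu>) = (\<integral>\<^sup>+b. \<Omega>0 b * h b \<partial>D)" unfolding dens[symmetric] by (rule nn_integral_density) measurable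
    also have "\<dots> = (\<integral>\<^sup>+s. (if x s = 0 then 0 else 1) * (\<Omega>0 (ln \<bar>x s\<bar>) * h (ln \<bar>x s\<bar>)) \<partial>pos_lebesgue)"
      unfolding D_def by (rule nn_integral_log_distr) measurable
    also have "\<dots> = (\<integral>\<^sup>+s. h (ln \<bar>x s\<bar>) * \<Omega> s \<partial>pos_lebesgue)"
      by (intro nn_integral_cong) (auto simp: \<Omega>_def mult.commute)
    finally show ?thesis by simp
  qed
  have I2: "(\<integral>\<^sup>+b. h b \<partial>\<nu>) = (\<integral>\<^sup>+t. (if frearr x t = 0 then 0 else 1) * h (ln \<bar>frearr x t\<bar>) \<partial>wm)"
    if [measurable]: "h \<in> borel_measurable borel" for h
    unfolding \<nu>_def by (rule nn_integral_log_distr) measurable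
  show ?thesis
  proof (rule that[of \<Omega>])
    show "\<Omega> s = 0" if "x s = 0" for s using that by (simp add: \<Omega>_def)
    show "AE s in pos_lebesgue. x s \<noteq> 0 \<longrightarrow> 0 < \<Omega> s"
    proof -
      define Z where "Z = {b. \<Omega>0 b = 0}"
      have Z[measurable]: "Z \<in> sets borel"
      proof -
        have "{b \<in> space borel. \<Omega>0 b = 0} \<in> sets borel" by measurable
        then show ?thesis by (simp add: Z_def)
      qed
      have "emeasure \<nu> Z = (\<integral>\<^sup>+b. \<Omega>0 b * indicator Z b \<partial>D)" unfolding dens[symmetric] by (rule emeasure_density) measurable
      also have "\<dots> = (\<integral>\<^sup>+b. 0 \<partial>D)" by (intro nn_integral_cong) (auto simp: Z_def split: split_indicator)
      finally have "emeasure D Z = 0" using null_iff[OF Z] by simp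
      then have "(\<integral>\<^sup>+s. (if x s = 0 then 0 else 1) * indicator Z (ln \<bar>x s\<bar>) \<partial>pos_lebesgue) = 0"
        unfolding D_def by (subst (asm) emeasure_log_distr) auto
      then have "AE s in pos_lebesgue. (if x s = 0 then 0 else 1) * indicator Z (ln \<bar>x s\<bar>) = (0::ennreal)"
        by (subst (asm) nn_integral_0_iff_AE) measurable
      then show ?thesis
        by eventually_elim (auto simp: \<Omega>_def Z_def zero_less_iff_neq_zero split: if_splits)
    qed
  next
    fix H :: "real \<Rightarrow> ennreal" assume [measurable]: "H \<in> borel_measurable borel" and H0: "H 0 = 0"
    have "(\<integral>\<^sup>+s. H \<bar>x s\<bar> * \<Omega> s \<partial>pos_lebesgue) = (\<integral>\<^sup>+s. H (exp (ln \<bar>x s\<bar>)) * \<Omega> s \<partial>pos_lebesgue)"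
      by (intro nn_integral_cong) (auto simp: \<Omega>_def)
    also have "\<dots> = (\<integral>\<^sup>+b. H (exp b) \<partial>\<nu>)" by (rule I1) measurable
    also have "\<dots> = (\<integral>\<^sup>+t. (if frearr x t = 0 then 0 else 1) * H (exp (ln \<bar>frearr x t\<bar>)) \<partial>wm)" by (rule I2) measurable
    also have "\<dots> = (\<integral>\<^sup>+t. H (frearr x t) \<partial>wm)"
      by (intro nn_integral_cong) (auto simp: H0 exp_ln_frearr)
    finally show "(\<integral>\<^sup>+s. H \<bar>x s\<bar> * \<Omega> s \<partial>pos_lebesgue) = (\<integral>\<^sup>+t. H (frearr x t) \<partial>wm)" .
  next
    fix H :: "real \<Rightarrow> ennreal" and f assume [measurable]: "H \<in> borel_measurable borel" "measurable_fun f"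
      and H: "\<And>a b. 0 \<le> a \<Longrightarrow> a \<le> b \<Longrightarrow> H a \<le> H b"
    show "(\<integral>\<^sup>+s. ennreal \<bar>f s\<bar> * (H \<bar>x s\<bar> * \<Omega> s) \<partial>pos_lebesgue) \<le> (\<integral>\<^sup>+t. rearr f t * H (frearr x t) \<partial>wm)"
    proof (rule Hardy_Littlewood)
      fix B assume B[measurable]: "B \<in> sets pos_lebesgue"
      \<comment> \<open>The distribution of \<open>x\<close> restricted to \<open>C\<close>. Its
        density with respect to \<open>D\<close> is the share that \<open>C\<close> has in each
        value of \<open>\<bar>x\<bar>\<close>.\<close>
      define DB where "DB C = log_distr x (density pos_lebesgue (indicator C))" for C
      have DBe: "emeasure (DB C) A = (\<integral>\<^sup>+s. indicator C s * ((if x s = 0 then 0 else 1) * indicator A (ln \<bar>x s\<bar>)) \<partial>pos_lebesgue)"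
        if [measurable]: "C \<in> sets pos_lebesgue" "A \<in> sets borel" for C A
        unfolding DB_def by (subst emeasure_log_distr) (auto simp: nn_integral_density)
      have De: "emeasure D A = (\<integral>\<^sup>+s. (if x s = 0 then 0 else 1) * indicator A (ln \<bar>x s\<bar>) \<partial>pos_lebesgue)"
        if "A \<in> sets borel" for A unfolding D_def by (rule emeasure_log_distr) (use that in auto)
      have [simp, measurable_cong]: "sets (DB C) = sets borel" for C by (simp add: DB_def)
      have ex: "\<exists>\<beta>\<in>borel_measurable borel. density D \<beta> = DB C" if C: "C \<in> sets pos_lebesgue" for C
      proof -
        have le: "emeasure (DB C) A \<le> emeasure D A" if A: "A \<in> sets borel" for A
          unfolding DBe[OF C A] De[OF A] by (intro nn_integral_mono) (auto split: split_indicator)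
        have "emeasure (DB C) A = 0" if "A \<in> sets borel" "emeasure D A = 0" for A
          using le[OF that(1)] that(2) by simp
        then have "absolutely_continuous D (DB C)"
          unfolding absolutely_continuous_def by (auto simp: null_sets_def)
        then show ?thesis using D.Radon_Nikodym[of "DB C"] by (auto cong: measurable_cong_sets)
      qed
      obtain \<beta> where \<beta>[measurable]: "\<beta> \<in> borel_measurable borel" "density D \<beta> = DB B" using ex[OF B] by blast
      have B'[measurable]: "space pos_lebesgue - B \<in> sets pos_lebesgue" by measurable
      obtain \<beta>' where \<beta>'[measurable]: "\<beta>' \<in> borel_measurable borel" "density D \<beta>' = DB (space pos_lebesgue - B)" using ex[OF B'] by blast
      \<comment> \<open>The shares of \<open>B\<close> and of its complement add up to
        \<open>1\<close>; this yields \<open>\<beta> \<le> 1\<close>.\<close>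
      have "density D (\<lambda>b. \<beta> b + \<beta>' b) = density D (\<lambda>_. 1)"
      proof (rule measure_eqI)
        fix A assume "A \<in> sets (density D (\<lambda>b. \<beta> b + \<beta>' b))"
        then have A[measurable]: "A \<in> sets borel" by simp
        have "emeasure (density D (\<lambda>b. \<beta> b + \<beta>' b)) A = emeasure (DB B) A + emeasure (DB (space pos_lebesgue - B)) A"
          unfolding \<beta>(2)[symmetric] \<beta>'(2)[symmetric] by (rule emeasure_density_add[symmetric]) auto
        also have "\<dots> = emeasure D A"
          unfolding DBe[OF B A] DBe[OF B' A] De[OF A]
        proof (subst nn_integral_add[symmetric])
          show "(\<lambda>s. indicator B s * ((if x s = 0 then 0 else 1) * indicator A (ln \<bar>x s\<bar>)) :: ennreal) \<in> borel_measurable pos_lebesgue"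
            "(\<lambda>s. indicator (space pos_lebesgue - B) s * ((if x s = 0 then 0 else 1) * indicator A (ln \<bar>x s\<bar>)) :: ennreal) \<in> borel_measurable pos_lebesgue"
            by measurable
        qed (auto intro!: nn_integral_cong split: split_indicator)
        finally show "emeasure (density D (\<lambda>b. \<beta> b + \<beta>' b)) A = emeasure (density D (\<lambda>_. 1)) A"
          by (simp add: density_1)
      qed simp
      then have "AE b in D. \<beta> b + \<beta>' b = 1"
        by (intro D.density_unique) (auto cong: measurable_cong_sets)
      then have \<beta>1: "AE b in D. \<beta> b \<le> 1" by eventually_elim (metis le_iff_add)
      \<comment> \<open>Pulled back along the rearrangement, the share becomes a density on the
        half-line bounded by \<open>1\<close>, of mass at most that of \<open>B\<close>. The bathtub
        principle then applies with \<open>H (frearr x t)\<close> as the decreasing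
        integrand.\<close>
      define \<gamma> where "\<gamma> t = (if frearr x t \<noteq> 0 then \<beta> (ln \<bar>frearr x t\<bar>) else 0)" for t
      have [measurable]: "\<gamma> \<in> borel_measurable pos_lebesgue" unfolding \<gamma>_def by measurable
      have \<gamma>1: "AE t in pos_lebesgue. \<gamma> t \<le> 1"
      proof -
        have "emeasure D {b. \<not> \<beta> b \<le> 1} = 0"
        proof -
          have "{b \<in> space D. \<not> \<beta> b \<le> 1} \<in> sets D" by measurable
          then have "emeasure D {b \<in> space D. \<not> \<beta> b \<le> 1} = 0" using \<beta>1 by (simp add: AE_iff_measurable[OF _ refl])
          then show ?thesis by (simp add: D_def log_distr_def)
        qed
        then have "(\<integral>\<^sup>+t. (if frearr x t = 0 then 0 else 1) * indicator {b. \<not> \<beta> b \<le> 1} (ln \<bar>frearr x t\<bar>) \<partial>pos_lebesgue) = 0"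
          unfolding D' by (subst (asm) emeasure_log_distr) auto
        moreover have "(\<lambda>t. (if frearr x t = 0 then 0 else 1) * indicator {b. \<not> \<beta> b \<le> 1} (ln \<bar>frearr x t\<bar>) :: ennreal) \<in> borel_measurable pos_lebesgue"
        proof -
          have "{b \<in> space borel. \<not> \<beta> b \<le> 1} \<in> sets borel" by measurable
          then have [measurable]: "{b. \<not> \<beta> b \<le> 1} \<in> sets borel" by simp
          show ?thesis by measurable
        qed
        ultimately have "AE t in pos_lebesgue. (if frearr x t = 0 then 0 else 1) * indicator {b. \<not> \<beta> b \<le> 1} (ln \<bar>frearr x t\<bar>) = (0::ennreal)"
          by (subst (asm) nn_integral_0_iff_AE)
        then show ?thesis by eventually_elim (auto simp: \<gamma>_def indicator_def split: if_splits)
      qed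
      have \<gamma>int: "(\<integral>\<^sup>+t. \<gamma> t \<partial>pos_lebesgue) \<le> emeasure pos_lebesgue B"
      proof -
        have "(\<integral>\<^sup>+t. \<gamma> t \<partial>pos_lebesgue) = (\<integral>\<^sup>+b. \<beta> b \<partial>D)"
          unfolding D' by (subst nn_integral_log_distr) (auto intro!: nn_integral_cong simp: \<gamma>_def)
        also have "\<dots> = emeasure (DB B) UNIV"
          unfolding \<beta>(2)[symmetric] by (subst emeasure_density) auto
        also have "\<dots> = (\<integral>\<^sup>+s. indicator B s * (if x s = 0 then 0 else 1) \<partial>pos_lebesgue)"
          using DBe[OF B, of UNIV] by simp
        also have "\<dots> \<le> (\<integral>\<^sup>+s. indicator B s \<partial>pos_lebesgue)"
          by (intro nn_integral_mono) auto
        finally show ?thesis by simp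
      qed
      have "(\<integral>\<^sup>+s. indicator B s * (H \<bar>x s\<bar> * \<Omega> s) \<partial>pos_lebesgue) = (\<integral>\<^sup>+b. H (exp b) * \<Omega>0 b \<partial>DB B)"
      proof -
        have "(\<integral>\<^sup>+b. H (exp b) * \<Omega>0 b \<partial>DB B) = (\<integral>\<^sup>+s. (if x s = 0 then 0 else 1) * (H (exp (ln \<bar>x s\<bar>)) * \<Omega>0 (ln \<bar>x s\<bar>)) \<partial>density pos_lebesgue (indicator B))"
          unfolding DB_def by (rule nn_integral_log_distr) measurable
        also have "\<dots> = (\<integral>\<^sup>+s. H \<bar>x s\<bar> * \<Omega> s \<partial>density pos_lebesgue (indicator B))"
          by (intro nn_integral_cong) (auto simp: \<Omega>_def)
        also have "\<dots> = (\<integral>\<^sup>+s. indicator B s * (H \<bar>x s\<bar> * \<Omega> s) \<partial>pos_lebesgue)"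
          by (rule nn_integral_density) measurable
        finally show ?thesis by simp
      qed
      also have "\<dots> = (\<integral>\<^sup>+b. \<beta> b * (H (exp b) * \<Omega>0 b) \<partial>D)"
        unfolding \<beta>(2)[symmetric] by (rule nn_integral_density) auto
      also have "\<dots> = (\<integral>\<^sup>+b. \<Omega>0 b * (\<beta> b * H (exp b)) \<partial>D)" by (simp add: mult_ac)
      also have "\<dots> = (\<integral>\<^sup>+b. \<beta> b * H (exp b) \<partial>\<nu>)"
        unfolding dens[symmetric] by (rule nn_integral_density[symmetric]) auto
      also have "\<dots> = (\<integral>\<^sup>+t. (if frearr x t = 0 then 0 else 1) * (\<beta> (ln \<bar>frearr x t\<bar>) * H (exp (ln \<bar>frearr x t\<bar>))) \<partial>wm)"
        by (rule I2) measurable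
      also have "\<dots> = (\<integral>\<^sup>+t. \<gamma> t * H (frearr x t) \<partial>wm)"
        by (intro nn_integral_cong) (auto simp: \<gamma>_def exp_ln_frearr)
      also have "\<dots> \<le> (\<integral>\<^sup>+t. indicator {t. 0 < t \<and> ennreal t < emeasure pos_lebesgue B} t * H (frearr x t) \<partial>wm)"
      proof (rule bathtub)
        show "H (frearr x t) \<le> H (frearr x s)" if "0 < s" "s \<le> t" for s t
          using frearr_antimono[OF x] that by (intro H) (auto simp: monotone_on_def)
      qed (use \<gamma>1 \<gamma>int in measurable)
      finally show "(\<integral>\<^sup>+s. indicator B s * (H \<bar>x s\<bar> * \<Omega> s) \<partial>pos_lebesgue) \<le>
          (\<integral>\<^sup>+t. indicator {t. 0 < t \<and> ennreal t < emeasure pos_lebesgue B} t * H (frearr x t) \<partial>wm)" .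
    qed measurable
  qed measurable
qed

end

lemma ennreal_half_le: "a / 2 \<le> (a :: ennreal)"
proof (cases a)
  case (real r)
  then have "a / 2 = ennreal (r / 2)" using divide_ennreal[of r 2] by simp
  then show ?thesis using real by (simp add: ennreal_leI)
qed simp

context orlicz_lorentz_space
begin

subsection \<open>Convergence of the modulars and local convergence give norm convergence\<close>

text \<open>Where \<open>U\<close> exceeds \<open>l\<close>, convergence makes \<open>v n\<close>
  exceed it eventually, and Fatou's lemma applies to the indicators. Convergence is asked only where
  \<open>U\<close> is nonzero, the part that the functional controls; \<open>E\<close> separates
  this part from possibly escaping mass.\<close>

lemma level_measure_liminf:
  assumes [measurable]: "measurable_fun U" "\<And>n. measurable_fun (v n)" and E[measurable]: "E \<in> sets pos_lebesgue"
    and lim: "AE s in pos_lebesgue. s \<in> E \<longrightarrow> U s \<noteq> 0 \<longrightarrow> (\<lambda>n. v n s) \<longlonglongrightarrow> U s" and l: "0 \<le> l"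
  shows "emeasure pos_lebesgue ({s \<in> space pos_lebesgue. l < \<bar>U s\<bar>} \<inter> E) \<le>
    liminf (\<lambda>n. emeasure pos_lebesgue ({s \<in> space pos_lebesgue. l < \<bar>v n s\<bar>} \<inter> E))"
proof -
  let ?A = "{s \<in> space pos_lebesgue. l < \<bar>U s\<bar>} \<inter> E" and ?B = "\<lambda>n. {s \<in> space pos_lebesgue. l < \<bar>v n s\<bar>} \<inter> E"
  have [measurable]: "?A \<in> sets pos_lebesgue" "?B n \<in> sets pos_lebesgue" for n by measurable
  have "emeasure pos_lebesgue ?A = (\<integral>\<^sup>+s. indicator ?A s \<partial>pos_lebesgue)" by simp
  also have "\<dots> \<le> (\<integral>\<^sup>+s. liminf (\<lambda>n. indicator (?B n) s) \<partial>pos_lebesgue)"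
  proof (rule nn_integral_mono_AE)
    show "AE s in pos_lebesgue. indicator ?A s \<le> liminf (\<lambda>n. indicator (?B n) s :: ennreal)"
      using lim
    proof eventually_elim
      fix s assume c: "s \<in> E \<longrightarrow> U s \<noteq> 0 \<longrightarrow> (\<lambda>n. v n s) \<longlonglongrightarrow> U s"
      show "indicator ?A s \<le> liminf (\<lambda>n. indicator (?B n) s :: ennreal)"
      proof (cases "s \<in> ?A")
        case True
        then have "(\<lambda>n. \<bar>v n s\<bar>) \<longlonglongrightarrow> \<bar>U s\<bar>" using c l by (intro tendsto_rabs) auto
        then have "\<forall>\<^sub>F n in sequentially. l < \<bar>v n s\<bar>" using True by (intro order_tendstoD) auto
        then have "1 \<le> liminf (\<lambda>n. indicator (?B n) s :: ennreal)"
          by (intro Liminf_bounded) (auto elim!: eventually_mono simp: True[simplified])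
        then show ?thesis using True by simp
      qed auto
    qed
  qed
  also have "\<dots> \<le> liminf (\<lambda>n. \<integral>\<^sup>+s. indicator (?B n) s \<partial>pos_lebesgue)"
    by (rule nn_integral_liminf) measurable
  finally show ?thesis by simp
qed

lemma level_measure_liminf':
  assumes "measurable_fun U" "\<And>n. measurable_fun (v n)"
    and lim: "AE s in pos_lebesgue. U s \<noteq> 0 \<longrightarrow> (\<lambda>n. v n s) \<longlonglongrightarrow> U s" and l: "0 \<le> l"
  shows "level_measure U l \<le> liminf (\<lambda>n. level_measure (v n) l)"
proof -
  have eq: "{s \<in> space pos_lebesgue. P s} \<inter> space pos_lebesgue = {s \<in> space pos_lebesgue. P s}" for P by auto
  have "AE s in pos_lebesgue. s \<in> space pos_lebesgue \<longrightarrow> U s \<noteq> 0 \<longrightarrow> (\<lambda>n. v n s) \<longlonglongrightarrow> U s"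
    using lim by eventually_elim simp
  from level_measure_liminf[where U=U and v=v, OF assms(1,2) sets.top this l] show ?thesis
    unfolding level_measure_def eq .
qed

lemma rearr_liminf:
  assumes U: "measurable_fun U" and v: "\<And>n. measurable_fun (v n)"
    and lim: "AE s in pos_lebesgue. U s \<noteq> 0 \<longrightarrow> (\<lambda>n. v n s) \<longlonglongrightarrow> U s"
  shows "rearr U t \<le> liminf (\<lambda>n. rearr (v n) t)"
proof (rule dense_le)
  fix z assume z: "z < rearr U t"
  then obtain l where l: "z = ennreal l" "0 \<le> l" by (cases z) (auto simp: top_unique)
  then have "ennreal t < level_measure U l" using z U by (simp add: rearr_gt_iff)
  also have "\<dots> \<le> liminf (\<lambda>n. level_measure (v n) l)" by (rule level_measure_liminf'[OF U v lim l(2)])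
  finally have "\<forall>\<^sub>F n in sequentially. ennreal t < level_measure (v n) l" by (rule less_LiminfD)
  then have "\<forall>\<^sub>F n in sequentially. z \<le> rearr (v n) t"
    by eventually_elim (use l v in \<open>auto simp: rearr_gt_iff[symmetric] intro: less_imp_le\<close>)
  then show "z \<le> liminf (\<lambda>n. rearr (v n) t)" by (rule Liminf_bounded)
qed

lemma W_level_measure_borel [measurable]:
  assumes "measurable_fun U" shows "(\<lambda>l. W (level_measure U l)) \<in> borel_measurable borel"
  using assms by (intro antimono_ennreal_borel W_mono level_measure_mono)

text \<open>As in Scheffe's lemma: the minimum of the two rearrangements converges to
  \<open>rearr U\<close> and is dominated by it, so convergence of the total integrals leaves
  nothing for the excess.\<close>

lemma rearr_excess_tendsto_0:
  assumes U: "measurable_fun U" and v: "\<And>n. measurable_fun (v n)"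
    and lim: "AE s in pos_lebesgue. U s \<noteq> 0 \<longrightarrow> (\<lambda>n. v n s) \<longlonglongrightarrow> U s"
    and fin: "(\<integral>\<^sup>+t. rearr U t \<partial>wm) < \<infinity>"
    and int: "(\<lambda>n. \<integral>\<^sup>+t. rearr (v n) t \<partial>wm) \<longlonglongrightarrow> (\<integral>\<^sup>+t. rearr U t \<partial>wm)"
  shows "(\<lambda>n. \<integral>\<^sup>+t. rearr (v n) t - rearr U t \<partial>wm) \<longlonglongrightarrow> 0"
proof -
  define a where "a n t = min (rearr (v n) t) (rearr U t)" for n t
  have [measurable]: "a n \<in> borel_measurable wm" for n unfolding a_def by measurable
  have alim: "(\<lambda>n. a n t) \<longlonglongrightarrow> rearr U t" for t
  proof (rule tendsto_sandwich)
    have "min (liminf (\<lambda>n. rearr (v n) t)) (rearr U t) \<le> liminf (\<lambda>n. a n t)"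
    proof (rule dense_le)
      fix z assume z: "z < min (liminf (\<lambda>n. rearr (v n) t)) (rearr U t)"
      then have "\<forall>\<^sub>F n in sequentially. z < rearr (v n) t" by (auto dest: less_LiminfD)
      then have "\<forall>\<^sub>F n in sequentially. z \<le> a n t"
        by eventually_elim (use z in \<open>auto simp: a_def\<close>)
      then show "z \<le> liminf (\<lambda>n. a n t)" by (rule Liminf_bounded)
    qed
    then have ge: "rearr U t \<le> liminf (\<lambda>n. a n t)" using min_absorb2[OF rearr_liminf[OF U v lim, of t]] by simp
    have le: "limsup (\<lambda>n. a n t) \<le> rearr U t" by (rule Limsup_bounded) (auto simp: a_def)
    show "(\<lambda>n. a n t) \<longlonglongrightarrow> rearr U t"
      by (rule Liminf_eq_Limsup) (use ge le Liminf_le_Limsup[of sequentially "\<lambda>n. a n t"] in auto)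
    then show "(\<lambda>n. a n t) \<longlonglongrightarrow> rearr U t" .
  qed auto
  have aint: "(\<lambda>n. \<integral>\<^sup>+t. a n t \<partial>wm) \<longlonglongrightarrow> (\<integral>\<^sup>+t. rearr U t \<partial>wm)"
    by (rule nn_integral_dominated_convergence[where w="rearr U"]) (use alim fin in \<open>auto simp: a_def\<close>)
  have afin: "(\<integral>\<^sup>+t. a n t \<partial>wm) < \<infinity>" for n
  proof -
    have "(\<integral>\<^sup>+t. a n t \<partial>wm) \<le> (\<integral>\<^sup>+t. rearr U t \<partial>wm)" by (intro nn_integral_mono) (auto simp: a_def)
    then show ?thesis using fin by (rule order_le_less_trans)
  qed
  have "(\<integral>\<^sup>+t. rearr (v n) t - rearr U t \<partial>wm) = (\<integral>\<^sup>+t. rearr (v n) t \<partial>wm) - (\<integral>\<^sup>+t. a n t \<partial>wm)" for n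
  proof -
    have "(\<integral>\<^sup>+t. rearr (v n) t - rearr U t \<partial>wm) = (\<integral>\<^sup>+t. rearr (v n) t - a n t \<partial>wm)"
    proof (rule nn_integral_cong)
      fix t
      consider "rearr U t \<le> rearr (v n) t" | "rearr (v n) t < rearr U t" by fastforce
      then show "rearr (v n) t - rearr U t = rearr (v n) t - a n t"
      proof cases
        case 1 then show ?thesis by (simp add: a_def min_absorb2)
      next
        case 2
        then have "rearr (v n) t < top" using top_greatest order_less_le_trans by blast
        then show ?thesis using 2 by (simp add: a_def min_absorb1 less_imp_le diff_eq_0_ennreal)
      qed
    qed
    also have "\<dots> = (\<integral>\<^sup>+t. rearr (v n) t \<partial>wm) - (\<integral>\<^sup>+t. a n t \<partial>wm)"
    proof (rule nn_integral_diff)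
      show "(\<integral>\<^sup>+t. a n t \<partial>wm) \<noteq> \<infinity>" using afin[of n] by (simp add: less_top)
    qed (auto simp: a_def)
    finally show ?thesis .
  qed
  moreover have "(\<lambda>n. (\<integral>\<^sup>+t. rearr (v n) t \<partial>wm) - (\<integral>\<^sup>+t. a n t \<partial>wm)) \<longlonglongrightarrow> (\<integral>\<^sup>+t. rearr U t \<partial>wm) - (\<integral>\<^sup>+t. rearr U t \<partial>wm)"
    using fin by (intro tendsto_diff_ennreal_general int aint) auto
  ultimately show ?thesis using fin by (simp add: less_top[symmetric])
qed

text \<open>If mass of \<open>v n\<close> escaped the support of \<open>u\<close>, strict monotonicity of \<open>W\<close> and Fatou's lemma in the
  layer-cake formula would make the limit of the modulars too large.\<close>

lemma no_escaping_mass: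
  assumes u: "measurable_fun u" and v: "\<And>n. measurable_fun (v n)"
    and lim: "AE s in pos_lebesgue. u s \<noteq> 0 \<longrightarrow> (\<lambda>n. v n s) \<longlonglongrightarrow> u s"
    and fin: "rho u < \<infinity>" and int: "(\<lambda>n. rho (v n)) \<longlonglongrightarrow> rho u"
    and lev: "\<And>l. 0 < l \<Longrightarrow> level_measure u l < \<infinity>"
    and \<delta>: "0 < \<delta>" "\<delta> < q" and \<eta>: "0 < \<eta>"
  shows "\<exists>n. emeasure pos_lebesgue {s \<in> space pos_lebesgue. \<bar>u s\<bar> \<le> \<delta> \<and> q < \<bar>v n s\<bar>} < \<eta>"
proof (rule ccontr)
  define B where "B n = {s \<in> space pos_lebesgue. \<bar>u s\<bar> \<le> \<delta> \<and> q < \<bar>v n s\<bar>}" for n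
  note [measurable] = u v
  have [measurable]: "B n \<in> sets pos_lebesgue" for n unfolding B_def by measurable
  assume "\<not> ?thesis"
  then have B\<eta>: "\<eta> \<le> emeasure pos_lebesgue (B n)" for n by (auto simp: B_def not_less)
  define E where "E = {s \<in> space pos_lebesgue. \<delta> < \<bar>u s\<bar>}"
  have E[measurable]: "E \<in> sets pos_lebesgue" unfolding E_def by measurable
  define U where "U s = \<phi> \<bar>u s\<bar>" for s
  define Vn where "Vn n s = \<phi> \<bar>v n s\<bar>" for n s
  have Um[measurable]: "measurable_fun U" and Vm[measurable]: "measurable_fun (Vn n)" for n
    unfolding U_def Vn_def by measurable
  have limU: "AE s in pos_lebesgue. U s \<noteq> 0 \<longrightarrow> (\<lambda>n. Vn n s) \<longlonglongrightarrow> U s"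
    using lim
  proof eventually_elim
    fix s assume c: "u s \<noteq> 0 \<longrightarrow> (\<lambda>n. v n s) \<longlonglongrightarrow> u s"
    show "U s \<noteq> 0 \<longrightarrow> (\<lambda>n. Vn n s) \<longlonglongrightarrow> U s"
    proof
      assume "U s \<noteq> 0"
      then have "u s \<noteq> 0" by (auto simp: U_def)
      then show "(\<lambda>n. Vn n s) \<longlonglongrightarrow> U s"
        unfolding U_def Vn_def using c by (intro isCont_tendsto_compose[OF \<phi>_isCont] tendsto_rabs) auto
    qed
  qed
  have lev0: "level_measure U l \<le> liminf (\<lambda>n. level_measure (Vn n) l)" if "0 \<le> l" for l
    by (rule level_measure_liminf'[OF Um Vm limU that])
  \<comment> \<open>For levels in this window the sets \<open>B n\<close> lie inside the superlevel
    sets of \<open>Vn n\<close> but outside \<open>E\<close>, which contains the superlevel set of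
    \<open>U\<close>; so the limit inferior gains \<open>\<eta>\<close>.\<close>
  have lev1: "level_measure U l + \<eta> \<le> liminf (\<lambda>n. level_measure (Vn n) l)" if l: "\<phi> \<delta> \<le> l" "l < \<phi> q" for l
  proof -
    have l0: "0 \<le> l" using l \<phi>_nonneg[of \<delta>] by linarith
    have eq: "{s \<in> space pos_lebesgue. l < \<bar>U s\<bar>} \<inter> E = {s \<in> space pos_lebesgue. l < \<bar>U s\<bar>}"
    proof -
      have "s \<in> E" if "s \<in> space pos_lebesgue" "l < \<bar>U s\<bar>" for s
      proof (rule ccontr)
        assume "s \<notin> E"
        then have "\<phi> \<bar>u s\<bar> \<le> \<phi> \<delta>" using that by (intro \<phi>_mono) (auto simp: E_def)
        then show False using that l by (simp add: U_def)
      qed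
      then show ?thesis by auto
    qed
    have "AE s in pos_lebesgue. s \<in> E \<longrightarrow> U s \<noteq> 0 \<longrightarrow> (\<lambda>n. Vn n s) \<longlonglongrightarrow> U s"
      using limU by eventually_elim simp
    from level_measure_liminf[where U=U and v=Vn, OF Um Vm E this l0]
    have "level_measure U l \<le> liminf (\<lambda>n. emeasure pos_lebesgue ({s \<in> space pos_lebesgue. l < \<bar>Vn n s\<bar>} \<inter> E))"
      unfolding level_measure_def eq .
    then have "level_measure U l + \<eta> \<le> liminf (\<lambda>n. emeasure pos_lebesgue ({s \<in> space pos_lebesgue. l < \<bar>Vn n s\<bar>} \<inter> E)) + \<eta>"
      by (rule add_right_mono)
    also have "\<dots> = liminf (\<lambda>n. emeasure pos_lebesgue ({s \<in> space pos_lebesgue. l < \<bar>Vn n s\<bar>} \<inter> E) + \<eta>)"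
      by (rule Liminf_add_const[symmetric]) auto
    also have "\<dots> \<le> liminf (\<lambda>n. emeasure pos_lebesgue ({s \<in> space pos_lebesgue. l < \<bar>Vn n s\<bar>} \<inter> E) + emeasure pos_lebesgue (B n))"
      using B\<eta> by (intro Liminf_mono always_eventually allI add_left_mono)
    also have "\<dots> \<le> liminf (\<lambda>n. level_measure (Vn n) l)"
    proof (rule Liminf_mono, intro always_eventually allI)
      fix n
      have disj: "({s \<in> space pos_lebesgue. l < \<bar>Vn n s\<bar>} \<inter> E) \<inter> B n = {}" by (auto simp: E_def B_def)
      have "emeasure pos_lebesgue ({s \<in> space pos_lebesgue. l < \<bar>Vn n s\<bar>} \<inter> E) + emeasure pos_lebesgue (B n) =
          emeasure pos_lebesgue (({s \<in> space pos_lebesgue. l < \<bar>Vn n s\<bar>} \<inter> E) \<union> B n)"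
        by (rule plus_emeasure) (use disj in measurable)
      also have "\<dots> \<le> level_measure (Vn n) l"
        unfolding level_measure_def
      proof (rule emeasure_mono)
        have "l < \<bar>Vn n s\<bar>" if "s \<in> B n" for s
        proof -
          have "\<phi> q \<le> Vn n s" unfolding Vn_def using that \<delta> by (intro \<phi>_mono) (auto simp: B_def)
          then show ?thesis using l by simp
        qed
        then show "({s \<in> space pos_lebesgue. l < \<bar>Vn n s\<bar>} \<inter> E) \<union> B n \<subseteq> {s \<in> space pos_lebesgue. l < \<bar>Vn n s\<bar>}"
          by (auto simp: B_def)
      qed measurable
      finally show "emeasure pos_lebesgue ({s \<in> space pos_lebesgue. l < \<bar>Vn n s\<bar>} \<inter> E) + emeasure pos_lebesgue (B n) \<le> level_measure (Vn n) l" .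
    qed
    finally show ?thesis .
  qed
  have levU: "level_measure U l < \<infinity>" if l: "\<phi> \<delta> \<le> l" for l
  proof -
    have "level_measure U l \<le> level_measure u \<delta>"
      unfolding level_measure_def
    proof (rule emeasure_mono)
      show "{s \<in> space pos_lebesgue. l < \<bar>U s\<bar>} \<subseteq> {s \<in> space pos_lebesgue. \<delta> < \<bar>u s\<bar>}"
      proof (intro subsetI, rule ccontr)
        fix s assume s: "s \<in> {s \<in> space pos_lebesgue. l < \<bar>U s\<bar>}" "s \<notin> {s \<in> space pos_lebesgue. \<delta> < \<bar>u s\<bar>}"
        then have "\<phi> \<bar>u s\<bar> \<le> \<phi> \<delta>" by (intro \<phi>_mono) auto
        then show False using s l by (simp add: U_def)
      qed
    qed measurable
    then show ?thesis using lev[OF \<delta>(1)] by (rule order_le_less_trans)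
  qed
  define F where "F l = indicator {0..} l * W (level_measure U l)" for l :: real
  define H where "H l = liminf (\<lambda>n. indicator {0..} l * W (level_measure (Vn n) l))" for l :: real
  have [measurable]: "F \<in> borel_measurable borel" "H \<in> borel_measurable borel" unfolding F_def H_def by measurable
  have FH: "F l \<le> H l" for l
    using W_liminf[OF lev0[of l]] by (cases "0 \<le> l") (auto simp: F_def H_def)
  \<comment> \<open>\<open>W\<close> is strictly increasing at finite arguments, so the gain
    \<open>\<eta>\<close> is not lost under \<open>W\<close>.\<close>
  have FH': "F l < H l" if "\<phi> \<delta> \<le> l" "l < \<phi> q" for l
  proof -
    have l0: "0 \<le> l" using that \<phi>_nonneg[of \<delta>] by linarith
    have "level_measure U l < level_measure U l + \<eta>"
      using levU[OF that(1)] \<eta> by (cases "level_measure U l") (auto simp: ennreal_add_left_cancel_less[of _ 0, simplified])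
    then have "W (level_measure U l) < W (level_measure U l + \<eta>)" using levU[OF that(1)] by (intro W_strict_mono) auto
    also have "\<dots> \<le> liminf (\<lambda>n. W (level_measure (Vn n) l))" by (rule W_liminf[OF lev1[OF that]])
    finally show ?thesis using l0 by (simp add: F_def H_def)
  qed
  have rF: "rho u = (\<integral>\<^sup>+l. F l \<partial>lborel)" unfolding rho_layer[OF u] F_def U_def ..
  have "(\<integral>\<^sup>+l. F l \<partial>lborel) < (\<integral>\<^sup>+l. H l \<partial>lborel)"
  proof (rule nn_integral_less)
    show "(\<integral>\<^sup>+l. F l \<partial>lborel) \<noteq> \<infinity>" using fin rF by simp
    show "\<not> (AE l in lborel. H l \<le> F l)"
    proof
      assume "AE l in lborel. H l \<le> F l"
      then have "AE l in lborel. l \<notin> {\<phi> \<delta>..<\<phi> q}"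
        by eventually_elim (use FH' in \<open>auto simp: not_le[symmetric]\<close>)
      then have "emeasure lborel {\<phi> \<delta>..<\<phi> q} = 0" by (subst (asm) AE_iff_null_sets[symmetric]) auto
      then show False using \<phi>_strict_mono[of \<delta> q] \<delta> by simp
    qed
  qed (use FH in auto)
  also have "\<dots> \<le> liminf (\<lambda>n. \<integral>\<^sup>+l. indicator {0..} l * W (level_measure (Vn n) l) \<partial>lborel)"
    unfolding H_def by (rule nn_integral_liminf) measurable
  also have "(\<lambda>n. \<integral>\<^sup>+l. indicator {0..} l * W (level_measure (Vn n) l) \<partial>lborel) = (\<lambda>n. rho (v n))"
    unfolding rho_layer[OF v] Vn_def ..
  also have "liminf (\<lambda>n. rho (v n)) = rho u" by (rule lim_imp_Liminf[OF _ int]) simp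
  finally show False using rF by simp
qed

lemma level_diff_tendsto_0:
  assumes u: "measurable_fun u" and v: "\<And>n. measurable_fun (v n)"
    and lim: "AE s in pos_lebesgue. u s \<noteq> 0 \<longrightarrow> (\<lambda>n. v n s) \<longlonglongrightarrow> u s"
    and fin: "rho u < \<infinity>" and int: "(\<lambda>n. rho (v n)) \<longlonglongrightarrow> rho u"
    and lev: "\<And>l. 0 < l \<Longrightarrow> level_measure u l < \<infinity>" and q: "0 < q" and t: "0 < t"
  shows "\<forall>\<^sub>F n in sequentially. level_measure (\<lambda>s. v n s - u s) q < ennreal t"
proof -
  note [measurable] = u v
  \<comment> \<open>If \<open>\<bar>u\<bar> \<le> \<delta>\<close> and the difference exceeds
    \<open>3 * \<delta>\<close>, then \<open>\<bar>v n\<bar>\<close> exceeds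
    \<open>2 * \<delta>\<close>: where \<open>u\<close> is small, a large difference is escaping
    mass.\<close>
  define \<delta> where "\<delta> = q / 3"
  have \<delta>: "0 < \<delta>" "\<delta> < 2 * \<delta>" "q = 3 * \<delta>" using q by (auto simp: \<delta>_def)
  define B where "B n = {s \<in> space pos_lebesgue. \<bar>u s\<bar> \<le> \<delta> \<and> 2 * \<delta> < \<bar>v n s\<bar>}" for n
  define C where "C n = {s \<in> space pos_lebesgue. \<delta> < \<bar>u s\<bar> \<and> q < \<bar>v n s - u s\<bar>}" for n
  have [measurable]: "B n \<in> sets pos_lebesgue" "C n \<in> sets pos_lebesgue" for n unfolding B_def C_def by measurable
  have evB: "\<forall>\<^sub>F n in sequentially. emeasure pos_lebesgue (B n) < ennreal (t / 2)"
  proof (rule ccontr)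
    assume "\<not> ?thesis"
    then have "\<exists>\<^sub>F n in sequentially. \<not> emeasure pos_lebesgue (B n) < ennreal (t / 2)" by (simp add: frequently_def)
    then have inf: "infinite {n. \<not> emeasure pos_lebesgue (B n) < ennreal (t / 2)}"
      by (simp add: cofinite_eq_sequentially[symmetric] frequently_cofinite)
    \<comment> \<open>\<open>no_escaping_mass\<close> supplies a single index; applied along the bad
      indices it becomes a statement about almost all \<open>n\<close>.\<close>
    define r where "r = enumerate {n. \<not> emeasure pos_lebesgue (B n) < ennreal (t / 2)}"
    have r: "strict_mono r" "\<And>n. \<not> emeasure pos_lebesgue (B (r n)) < ennreal (t / 2)"
      using strict_mono_enumerate[OF inf] enumerate_in_set[OF inf] by (auto simp: r_def)
    have "\<exists>n. emeasure pos_lebesgue {s \<in> space pos_lebesgue. \<bar>u s\<bar> \<le> \<delta> \<and> 2 * \<delta> < \<bar>v (r n) s\<bar>} < ennreal (t / 2)"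
    proof (rule no_escaping_mass[OF u, of "\<lambda>n. v (r n)"])
      show "AE s in pos_lebesgue. u s \<noteq> 0 \<longrightarrow> (\<lambda>n. v (r n) s) \<longlonglongrightarrow> u s"
        using lim by eventually_elim (use LIMSEQ_subseq_LIMSEQ[OF _ r(1)] in \<open>auto simp: comp_def\<close>)
      show "(\<lambda>n. rho (v (r n))) \<longlonglongrightarrow> rho u" using LIMSEQ_subseq_LIMSEQ[OF int r(1)] by (simp add: comp_def)
    qed (use v fin lev \<delta> t in auto)
    then show False using r(2) by (auto simp: B_def)
  qed
  \<comment> \<open>The set where \<open>\<bar>u\<bar> > \<delta>\<close> has finite measure, so
    pointwise convergence implies convergence in measure there.\<close>
  have limC: "(\<lambda>n. emeasure pos_lebesgue (C n)) \<longlonglongrightarrow> 0"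
  proof -
    have "(\<lambda>n. \<integral>\<^sup>+s. indicator (C n) s \<partial>pos_lebesgue) \<longlonglongrightarrow> (\<integral>\<^sup>+s. 0 \<partial>pos_lebesgue)"
    proof (rule nn_integral_dominated_convergence[where w="indicator {s \<in> space pos_lebesgue. \<delta> < \<bar>u s\<bar>}"])
      show "(\<integral>\<^sup>+s. indicator {s \<in> space pos_lebesgue. \<delta> < \<bar>u s\<bar>} s \<partial>pos_lebesgue) < \<infinity>"
        using lev[OF \<delta>(1)] by (simp add: level_measure_def)
      show "AE s in pos_lebesgue. (\<lambda>n. indicator (C n) s :: ennreal) \<longlonglongrightarrow> 0"
        using lim
      proof eventually_elim
        fix s assume c: "u s \<noteq> 0 \<longrightarrow> (\<lambda>n. v n s) \<longlonglongrightarrow> u s"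
        show "(\<lambda>n. indicator (C n) s :: ennreal) \<longlonglongrightarrow> 0"
        proof (cases "u s = 0")
          case True
          then show ?thesis using \<delta> by (simp add: C_def)
        next
          case False
          then have "(\<lambda>n. \<bar>v n s - u s\<bar>) \<longlonglongrightarrow> \<bar>u s - u s\<bar>" using c by (intro tendsto_intros) auto
          then have "\<forall>\<^sub>F n in sequentially. \<bar>v n s - u s\<bar> < q" using q by (intro order_tendstoD) auto
          then have "\<forall>\<^sub>F n in sequentially. (indicator (C n) s :: ennreal) = 0"
            by eventually_elim (auto simp: C_def)
          then show ?thesis by (simp add: tendsto_eventually)
        qed
      qed
    qed (measurable, auto simp: C_def split: split_indicator)
    then show ?thesis by simp
  qed
  have evC: "\<forall>\<^sub>F n in sequentially. emeasure pos_lebesgue (C n) < ennreal (t / 2)"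
    using limC t by (intro order_tendstoD) auto
  show ?thesis using evB evC
  proof eventually_elim
    fix n assume *: "emeasure pos_lebesgue (B n) < ennreal (t / 2)" "emeasure pos_lebesgue (C n) < ennreal (t / 2)"
    have "level_measure (\<lambda>s. v n s - u s) q \<le> emeasure pos_lebesgue (B n \<union> C n)"
      unfolding level_measure_def
    proof (rule emeasure_mono)
      show "{s \<in> space pos_lebesgue. q < \<bar>v n s - u s\<bar>} \<subseteq> B n \<union> C n" using \<delta> by (auto simp: B_def C_def)
    qed measurable
    also have "\<dots> \<le> emeasure pos_lebesgue (B n) + emeasure pos_lebesgue (C n)" by (rule emeasure_subadditive) measurable
    also have "\<dots> < ennreal (t / 2) + ennreal (t / 2)" using * by (rule add_strict_mono)
    also have "\<dots> = ennreal t" using t by (simp add: ennreal_plus[symmetric] del: ennreal_plus)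
    finally show "level_measure (\<lambda>s. v n s - u s) q < ennreal t" .
  qed
qed

text \<open>The integrand of the modular of the difference is at most an integrable \<open>K\<close>
  plus a multiple of the excess \<open>R\<close>, whose integral vanishes in the limit. Its part
  below \<open>K\<close> tends to \<open>0\<close> pointwise and is treated by dominated
  convergence.\<close>

lemma rho_diff_tendsto_0:
  assumes D2: "Delta2 (extend \<phi>)" and u: "measurable_fun u" and v: "\<And>n. measurable_fun (v n)"
    and lim: "AE s in pos_lebesgue. u s \<noteq> 0 \<longrightarrow> (\<lambda>n. v n s) \<longlonglongrightarrow> u s"
    and fin: "rho u < \<infinity>" and int: "(\<lambda>n. rho (v n)) \<longlonglongrightarrow> rho u"
    and lev: "\<And>l. 0 < l \<Longrightarrow> level_measure u l < \<infinity>"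
  shows "(\<lambda>n. rho (\<lambda>s. v n s - u s)) \<longlonglongrightarrow> 0"
proof -
  note [measurable] = u v
  obtain C where C: "1 \<le> C" "\<And>a. extend \<phi> (ennreal 2 * a) \<le> ennreal C * extend \<phi> a"
    using Delta2_scale[OF D2] by blast
  define U where "U s = \<phi> \<bar>u s\<bar>" for s
  define Vn where "Vn n s = \<phi> \<bar>v n s\<bar>" for n s
  have Um[measurable]: "measurable_fun U" and Vm[measurable]: "measurable_fun (Vn n)" for n
    unfolding U_def Vn_def by measurable
  have limU: "AE s in pos_lebesgue. U s \<noteq> 0 \<longrightarrow> (\<lambda>n. Vn n s) \<longlonglongrightarrow> U s"
    using lim
  proof eventually_elim
    fix s assume c: "u s \<noteq> 0 \<longrightarrow> (\<lambda>n. v n s) \<longlonglongrightarrow> u s"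
    show "U s \<noteq> 0 \<longrightarrow> (\<lambda>n. Vn n s) \<longlonglongrightarrow> U s"
    proof
      assume "U s \<noteq> 0"
      then have "u s \<noteq> 0" by (auto simp: U_def)
      then show "(\<lambda>n. Vn n s) \<longlonglongrightarrow> U s"
        unfolding U_def Vn_def using c by (intro isCont_tendsto_compose[OF \<phi>_isCont] tendsto_rabs) auto
    qed
  qed
  have eU: "extend \<phi> (rearr u t) = rearr U t" for t
    unfolding U_def using rearr_comp[OF u \<phi>_strict_mono \<phi>_0 \<phi>_surj \<phi>_measurable, of t] by simp
  have eV: "extend \<phi> (rearr (v n) t) = rearr (Vn n) t" for n t
    unfolding Vn_def using rearr_comp[OF v \<phi>_strict_mono \<phi>_0 \<phi>_surj \<phi>_measurable, of n t] by simp
  have rU: "rho u = (\<integral>\<^sup>+t. rearr U t \<partial>wm)" and rV: "rho (v n) = (\<integral>\<^sup>+t. rearr (Vn n) t \<partial>wm)" for n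
    by (simp_all add: rho_def eU eV)
  define R where "R n t = rearr (Vn n) t - rearr U t" for n t
  have Rm[measurable]: "R n \<in> borel_measurable borel" for n unfolding R_def by measurable
  have R0: "(\<lambda>n. \<integral>\<^sup>+t. R n t \<partial>wm) \<longlonglongrightarrow> 0"
    unfolding R_def by (rule rearr_excess_tendsto_0[OF Um Vm limU]) (use fin int in \<open>simp_all add: rU[symmetric] rV[symmetric]\<close>)
  define h where "h n t = extend \<phi> (rearr (\<lambda>s. v n s - u s) t)" for n t
  define K where "K t = ennreal (2 * C) * rearr U (t / 2)" for t
  have hm[measurable]: "h n \<in> borel_measurable borel" for n unfolding h_def by (rule extend_rearr_borel)
  have Km[measurable]: "K \<in> borel_measurable borel" unfolding K_def by measurable
  have le: "h n t \<le> K t + ennreal C * R n (t / 2)" if t: "0 < t" for n t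
  proof -
    have mu: "measurable_fun (\<lambda>s. (-1) * u s)" by measurable
    have "rearr (\<lambda>s. v n s + (-1) * u s) (t/2 + t/2) \<le> rearr (v n) (t/2) + rearr (\<lambda>s. (-1) * u s) (t/2)"
      using t by (intro rearr_add[OF v mu]) auto
    then have "rearr (\<lambda>s. v n s - u s) t \<le> rearr (v n) (t/2) + rearr u (t/2)"
      by (subst (asm) rearr_scale[OF u]) simp
    then have "h n t \<le> extend \<phi> (rearr (v n) (t/2) + rearr u (t/2))" unfolding h_def by (rule extend_mono)
    also have "\<dots> \<le> (extend \<phi> (2 * rearr (v n) (t/2)) + extend \<phi> (2 * rearr u (t/2))) / 2" by (rule extend_add_le)
    also have "\<dots> \<le> extend \<phi> (2 * rearr (v n) (t/2)) + extend \<phi> (2 * rearr u (t/2))"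
      by (rule ennreal_half_le)
    also have "\<dots> \<le> ennreal C * rearr (Vn n) (t/2) + ennreal C * rearr U (t/2)"
      using C(2)[of "rearr (v n) (t/2)"] C(2)[of "rearr u (t/2)"] by (simp add: eU eV add_mono)
    also have "\<dots> \<le> ennreal C * (rearr U (t/2) + R n (t/2)) + ennreal C * rearr U (t/2)"
    proof (intro add_right_mono mult_left_mono)
      show "rearr (Vn n) (t/2) \<le> rearr U (t/2) + R n (t/2)" unfolding R_def
        by (metis add.commute diff_le_self_ennreal ennreal_minus_le_iff le_iff_add order_refl infinity_ennreal_def)
    qed simp
    also have "\<dots> = K t + ennreal C * R n (t / 2)"
      using C(1) by (simp add: K_def distrib_left ennreal_mult mult_2 distrib_right ac_simps)
    finally show ?thesis .
  qed
  define mn where "mn n t = min (h n t) (K t)" for n t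
  have [measurable]: "h n \<in> borel_measurable wm" "K \<in> borel_measurable wm" for n
    by (auto intro!: borel_measurable_wm)
  have [measurable]: "mn n \<in> borel_measurable wm" for n unfolding mn_def by measurable
  \<comment> \<open>Convergence in measure of the difference makes its rearrangement tend to
    \<open>0\<close> at every \<open>t > 0\<close>.\<close>
  have h0: "(\<lambda>n. h n t) \<longlonglongrightarrow> 0" if t: "0 < t" for t
  proof (rule order_tendstoI)
    fix e :: ennreal assume e: "0 < e"
    obtain \<epsilon> where \<epsilon>: "0 < \<epsilon>" "ennreal \<epsilon> < e"
      using e ennreal_Ex_less_of_nat by (metis dense ennreal_cases ennreal_less_zero_iff less_imp_le less_top_ennreal not_less_iff_gr_or_eq top.extremum_strict)
    obtain m where m: "0 \<le> m" "\<phi> m = \<epsilon>" using \<phi>_surj[of \<epsilon>] \<epsilon> by auto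
    have m0: "0 < m" using m \<epsilon> by (cases "m = 0") auto
    have "\<forall>\<^sub>F n in sequentially. level_measure (\<lambda>s. v n s - u s) m < ennreal t"
      by (rule level_diff_tendsto_0[OF u v lim fin int lev m0 t])
    then show "\<forall>\<^sub>F n in sequentially. h n t < e"
    proof eventually_elim
      fix n assume *: "level_measure (\<lambda>s. v n s - u s) m < ennreal t"
      have "\<not> ennreal m < rearr (\<lambda>s. v n s - u s) t" using * m by (subst rearr_gt_iff) auto
      then have "h n t \<le> extend \<phi> (ennreal m)" unfolding h_def by (intro extend_mono) simp
      then show "h n t < e" using m \<epsilon> by (simp add: extend_ennreal)
    qed
  qed auto
  have Kfin: "(\<integral>\<^sup>+t. K t \<partial>wm) < \<infinity>"
  proof -
    have "(\<integral>\<^sup>+t. K t \<partial>wm) = ennreal (2 * C) * (\<integral>\<^sup>+t. rearr U (t / 2) \<partial>wm)"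
      unfolding K_def by (rule nn_integral_cmult) (auto intro!: borel_measurable_wm)
    also have "\<dots> \<le> ennreal (2 * C) * (2 * rho u)"
      unfolding rU by (intro mult_left_mono nn_integral_half_le) auto
    also have "\<dots> < \<infinity>" using fin by (simp add: ennreal_mult_less_top)
    finally show ?thesis .
  qed
  have mint: "(\<lambda>n. \<integral>\<^sup>+t. mn n t \<partial>wm) \<longlonglongrightarrow> (\<integral>\<^sup>+t. 0 \<partial>wm)"
  proof (rule nn_integral_dominated_convergence[where w=K])
    show "AE t in wm. (\<lambda>n. mn n t) \<longlonglongrightarrow> 0"
    proof (rule AE_I2)
      fix t assume "t \<in> space wm"
      then have "(\<lambda>n. h n t) \<longlonglongrightarrow> 0" by (intro h0) simp
      then show "(\<lambda>n. mn n t) \<longlonglongrightarrow> 0"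
        by (rule tendsto_sandwich[OF _ _ tendsto_const, rotated 2]) (auto simp: mn_def)
    qed
    show "AE t in wm. mn n t \<le> K t" for n by (simp add: mn_def)
  qed (use Kfin in auto)
  define bn where "bn n = (\<integral>\<^sup>+t. mn n t \<partial>wm) + ennreal C * (2 * (\<integral>\<^sup>+t. R n t \<partial>wm))" for n
  have ble: "rho (\<lambda>s. v n s - u s) \<le> bn n" for n
  proof -
    have "rho (\<lambda>s. v n s - u s) \<le> (\<integral>\<^sup>+t. mn n t + ennreal C * R n (t / 2) \<partial>wm)"
      unfolding rho_def h_def[symmetric]
    proof (rule nn_integral_mono)
      fix t assume "t \<in> space wm"
      then show "h n t \<le> mn n t + ennreal C * R n (t / 2)"
        using le[of t n] by (auto simp: mn_def min_def)
    qed
    also have "\<dots> = (\<integral>\<^sup>+t. mn n t \<partial>wm) + (\<integral>\<^sup>+t. ennreal C * R n (t / 2) \<partial>wm)"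
      by (rule nn_integral_add) (auto intro!: borel_measurable_wm)
    also have "(\<integral>\<^sup>+t. ennreal C * R n (t / 2) \<partial>wm) = ennreal C * (\<integral>\<^sup>+t. R n (t / 2) \<partial>wm)"
      by (rule nn_integral_cmult) (auto intro!: borel_measurable_wm)
    also have "\<dots> \<le> ennreal C * (2 * (\<integral>\<^sup>+t. R n t \<partial>wm))"
      by (intro mult_left_mono nn_integral_half_le) auto
    finally show ?thesis unfolding bn_def by (simp add: add_left_mono)
  qed
  have "bn \<longlonglongrightarrow> 0 + ennreal C * (2 * 0)"
    unfolding bn_def using mint by (intro tendsto_add ennreal_tendsto_cmult R0) auto
  then have blim: "bn \<longlonglongrightarrow> 0" by simp
  show ?thesis
    by (rule tendsto_sandwich[OF _ _ tendsto_const blim]) (use ble in auto)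
qed

end

context orlicz_lorentz_space
begin

subsection \<open>Sufficiency\<close>

lemma subgrad_strict:
  assumes sc: "strictly_convex_on {0..} \<phi>" and s: "subgrad a g" and b: "0 \<le> b" "b \<noteq> a"
  shows "\<phi> a + g * (b - a) < \<phi> b"
proof (rule ccontr)
  assume "\<not> ?thesis"
  moreover have "\<phi> a + g * (b - a) \<le> \<phi> b" using s b by (auto simp: subgrad_def)
  ultimately have eq: "\<phi> b = \<phi> a + g * (b - a)" by simp
  have a: "0 \<le> a" using s by (simp add: subgrad_def)
  have "\<phi> ((1 - 1/2) * a + 1/2 * b) < (1 - 1/2) * \<phi> a + 1/2 * \<phi> b"
    using a b by (intro sc[unfolded strictly_convex_on_def, THEN conjunct2, rule_format]) auto
  moreover have "\<phi> a + g * (((1 - 1/2) * a + 1/2 * b) - a) \<le> \<phi> ((1 - 1/2) * a + 1/2 * b)"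
  proof -
    have "\<phi> a + g * (w - a) \<le> \<phi> w" if "0 \<le> w" for w using s that by (simp add: subgrad_def)
    from this[of "(1 - 1/2) * a + 1/2 * b"] show ?thesis using a b by argo
  qed
  ultimately show False unfolding eq by (simp add: algebra_simps)
qed

text \<open>By strict convexity the gap in Young's inequality vanishes only at \<open>a\<close>, and
  it grows away from \<open>a\<close> on either side. A small gap therefore forces
  \<open>\<sigma> * w n\<close> to be close to \<open>a\<close>.\<close>

lemma young_gap_tendsto:
  assumes sc: "strictly_convex_on {0..} \<phi>" and s: "subgrad a g" and a: "0 < a" and \<sigma>: "\<bar>\<sigma>\<bar> = 1"
    and lim: "(\<lambda>n. \<phi> \<bar>w n\<bar> + (a * g - \<phi> a) - w n * (\<sigma> * g)) \<longlonglongrightarrow> 0"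
  shows "w \<longlonglongrightarrow> \<sigma> * a"
proof (rule LIMSEQ_I)
  fix \<epsilon> :: real assume \<epsilon>: "0 < \<epsilon>"
  define \<eta> where "\<eta> = min \<epsilon> (a / 2)"
  have \<eta>: "0 < \<eta>" "\<eta> \<le> \<epsilon>" "\<eta> < a" using \<epsilon> a by (auto simp: \<eta>_def)
  define e where "e b = \<phi> b + (a * g - \<phi> a) - b * g" for b
  have epos: "0 < e b" if "0 \<le> b" "b \<noteq> a" for b
    using subgrad_strict[OF sc s that] by (simp add: e_def algebra_simps)
  have up: "e (a + \<eta>) \<le> e b" if b: "a + \<eta> \<le> b" for b
  proof -
    obtain h where h: "subgrad (a + \<eta>) h" using subgrad_exists[of "a + \<eta>"] a \<eta> by auto
    have "g \<le> h" using subgrad_mono[OF s h] \<eta> by simp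
    then have "g * (b - (a + \<eta>)) \<le> h * (b - (a + \<eta>))" using b by (intro mult_right_mono) auto
    moreover have "\<phi> (a + \<eta>) + h * (b - (a + \<eta>)) \<le> \<phi> b" using h b a \<eta> by (auto simp: subgrad_def)
    ultimately show ?thesis by (simp add: e_def algebra_simps)
  qed
  have down: "e (a - \<eta>) \<le> e b" if b: "0 \<le> b" "b \<le> a - \<eta>" for b
  proof -
    obtain h where h: "subgrad (a - \<eta>) h" using subgrad_exists[of "a - \<eta>"] \<eta> by auto
    have "h \<le> g" using subgrad_mono[OF h s] \<eta> by simp
    then have "g * (b - (a - \<eta>)) \<le> h * (b - (a - \<eta>))" using b by (intro mult_right_mono_neg) auto
    moreover have "\<phi> (a - \<eta>) + h * (b - (a - \<eta>)) \<le> \<phi> b" using h b by (auto simp: subgrad_def)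
    ultimately show ?thesis by (simp add: e_def algebra_simps)
  qed
  define m where "m = min (e (a - \<eta>)) (e (a + \<eta>))"
  have "0 < m" using epos[of "a - \<eta>"] epos[of "a + \<eta>"] \<eta> a by (simp add: m_def)
  then have "\<forall>\<^sub>F n in sequentially. \<phi> \<bar>w n\<bar> + (a * g - \<phi> a) - w n * (\<sigma> * g) < m" using lim by (intro order_tendstoD) auto
  then obtain n0 where n0: "\<And>n. n0 \<le> n \<Longrightarrow> \<phi> \<bar>w n\<bar> + (a * g - \<phi> a) - w n * (\<sigma> * g) < m" by (auto simp: eventually_sequentially)
  have \<sigma>2: "\<sigma> * \<sigma> = 1" using \<sigma> by (metis abs_mult_self_eq mult_1)
  have g0: "0 \<le> g" using s by (simp add: subgrad_def)
  show "\<exists>no. \<forall>n\<ge>no. norm (w n - \<sigma> * a) < \<epsilon>"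
  proof (intro exI[of _ n0] allI impI)
    fix n assume n: "n0 \<le> n"
    define b where "b = \<sigma> * w n"
    have ab: "\<bar>w n\<bar> = \<bar>b\<bar>" using \<sigma> by (simp add: b_def abs_mult)
    have gap: "\<phi> \<bar>b\<bar> + (a * g - \<phi> a) - b * g < m" using n0[OF n] unfolding ab by (simp add: b_def mult_ac)
    have "\<bar>b - a\<bar> < \<eta>"
    proof (rule ccontr)
      assume "\<not> ?thesis"
      then consider "a + \<eta> \<le> b" | "0 \<le> b" "b \<le> a - \<eta>" | "b < 0" by linarith
      then show False
      proof cases
        case 1 then show False using up[OF 1] gap a \<eta> by (simp add: e_def m_def)
      next
        case 2 then show False using down[OF 2] gap by (simp add: e_def m_def)
      next
        \<comment> \<open>With the wrong sign the gap is at least the one at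
          \<open>b = 0\<close>.\<close>
        case 3
        then have "b * g \<le> 0" using g0 by (simp add: mult_nonpos_nonneg)
        then have "a * g - \<phi> a < m" using gap \<phi>_nonneg[of "\<bar>b\<bar>"] by linarith
        then show False using down[of 0] \<eta> by (simp add: e_def m_def)
      qed
    qed
    moreover have "norm (w n - \<sigma> * a) = \<bar>b - a\<bar>"
    proof -
      have "w n - \<sigma> * a = \<sigma> * (b - a)" using \<sigma>2 by (simp add: b_def right_diff_distrib mult.assoc[symmetric])
      then show ?thesis using \<sigma> by (simp add: abs_mult)
    qed
    ultimately show "norm (w n - \<sigma> * a) < \<epsilon>" using \<eta> by simp
  qed
qed

lemma rho_scale_ge:
  assumes f: "measurable_fun f" and l: "0 < l" "\<And>u. 0 < u \<Longrightarrow> 2 * l * \<phi> u \<le> \<phi> (l * u)" and c: "0 \<le> c"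
  shows "ennreal (2 * l) * rho (\<lambda>s. c * f s) \<le> rho (\<lambda>s. l * c * f s)"
proof -
  have "ennreal (2 * l) * rho (\<lambda>s. c * f s) = (\<integral>\<^sup>+t. ennreal (2 * l) * extend \<phi> (rearr (\<lambda>s. c * f s) t) \<partial>wm)"
    unfolding rho_def by (rule nn_integral_cmult[symmetric]) measurable
  also have "\<dots> \<le> rho (\<lambda>s. l * c * f s)"
    unfolding rho_def
  proof (rule nn_integral_mono)
    fix t
    have eq: "rearr (\<lambda>s. l * c * f s) t = ennreal l * rearr (\<lambda>s. c * f s) t"
      using f l c by (simp add: rearr_scale ennreal_mult mult.assoc)
    show "ennreal (2 * l) * extend \<phi> (rearr (\<lambda>s. c * f s) t) \<le> extend \<phi> (rearr (\<lambda>s. l * c * f s) t)"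
    proof (cases "rearr (\<lambda>s. c * f s) t")
      case (real z)
      have "2 * l * \<phi> z \<le> \<phi> (l * z)" using l(2)[of z] real by (cases "z = 0") auto
      then show ?thesis using real l unfolding eq
        by (simp add: extend_ennreal ennreal_mult[symmetric] ennreal_leI)
    next
      case top then show ?thesis unfolding eq using l by (simp add: ennreal_mult_top)
    qed
  qed
  finally show ?thesis .
qed

text \<open>Each scaling by \<open>l\<close> multiplies the modular by at least
  \<open>2 * l\<close>, so the quotient at \<open>l ^ n\<close> is at least
  \<open>2 ^ n * \<Phi> 1\<close> and finally exceeds the quotient at \<open>1\<close>. This gives
  the rising pair \<open>K1 = 1\<close>, \<open>K2 = l ^ n\<close>.\<close>

lemma amemiya_attained_Nabla2:
  assumes D2: "Delta2 (extend \<phi>)" and N2: "Nabla2 \<phi>" and f: "f \<in> X" and pos: "0 < N (abs_L0 f)"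
  obtains k G where "0 < k" "\<And>y. 0 \<le> y \<Longrightarrow> subgrad (k * y) (G y)" "\<And>x y. 0 \<le> x \<Longrightarrow> x \<le> y \<Longrightarrow> G x \<le> G y"
    "G \<in> borel_measurable borel" "G 0 = 0"
    "(\<integral>\<^sup>+t. \<psi> (ennreal (G (frearr f t))) \<partial>wm) = 1"
    "(\<integral>\<^sup>+t. ennreal (frearr f t * G (frearr f t)) \<partial>wm) = ennreal (N (abs_L0 f))"
    "N (abs_L0 f) = (1 + enn2real (rho (\<lambda>s. k * f s))) / k"
proof -
  obtain l C where l: "1 < l" "\<And>u. 0 < u \<Longrightarrow> 2 * l * \<phi> u \<le> \<phi> (l * u)" using Nabla2D[OF N2] by metis
  have fm: "measurable_fun f" using f by (rule X_measurable)
  have fin: "rho (\<lambda>s. c * f s) < \<infinity>" for c by (rule Delta2_rho_finite[OF D2 f])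
  define \<Phi> where "\<Phi> c = enn2real (rho (\<lambda>s. c * f s))" for c
  have \<Phi>: "ennreal (\<Phi> c) = rho (\<lambda>s. c * f s)" for c using fin[of c] by (simp add: \<Phi>_def)
  have \<Phi>0: "0 \<le> \<Phi> c" for c by (simp add: \<Phi>_def)
  have step: "2 * l * \<Phi> c \<le> \<Phi> (l * c)" if "0 \<le> c" for c
  proof -
    have "ennreal (2 * l * \<Phi> c) \<le> ennreal (\<Phi> (l * c))"
      using rho_scale_ge[OF fm _ l(2) that] l(1) \<Phi>0 by (simp add: \<Phi>[symmetric] ennreal_mult)
    then show ?thesis using \<Phi>0 by simp
  qed
  have it: "(2 * l) ^ n * \<Phi> 1 \<le> \<Phi> (l ^ n)" for n
  proof (induction n)
    case (Suc n)
    have "(2 * l) ^ Suc n * \<Phi> 1 = 2 * l * ((2 * l) ^ n * \<Phi> 1)" by simp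
    also have "\<dots> \<le> 2 * l * \<Phi> (l ^ n)" using Suc l by (intro mult_left_mono) auto
    also have "\<dots> \<le> \<Phi> (l * l ^ n)" using l by (intro step) auto
    finally show ?case by simp
  qed simp
  \<comment> \<open>By \<open>Delta2\<close> a vanishing modular vanishes after every scaling, and
    then the norm is at most \<open>1 / c\<close> for every \<open>c\<close>.\<close>
  have \<Phi>1: "0 < \<Phi> 1"
  proof (rule ccontr)
    assume "\<not> ?thesis"
    then have z: "rho (\<lambda>s. 1 * f s) = 0" using \<Phi>0[of 1] \<Phi>[of 1] by simp
    have "N (abs_L0 f) \<le> 1 / c" if c: "0 < c" for c
    proof -
      obtain C where C: "1 \<le> C" "\<And>a. extend \<phi> (ennreal c * a) \<le> ennreal C * extend \<phi> a"
        using Delta2_scale[OF D2] by blast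
      have "rho (\<lambda>s. c * f s) \<le> (\<integral>\<^sup>+t. ennreal C * extend \<phi> (rearr f t) \<partial>wm)"
        unfolding rho_scale[OF fm] using C(2) c by (intro nn_integral_mono) auto
      also have "\<dots> = ennreal C * rho f" unfolding rho_def by (rule nn_integral_cmult) measurable
      also have "\<dots> = 0" using z by simp
      finally show ?thesis using N_le[OF f c, of 0] by simp
    qed
    from this[of "2 / N (abs_L0 f)"] show False using pos by simp
  qed
  obtain n :: nat where n: "(1 + \<Phi> 1) / \<Phi> 1 < 2 ^ n" using real_arch_pow[of 2 "(1 + \<Phi> 1) / \<Phi> 1"] by auto
  have ln: "1 \<le> l ^ n" using l by simp
  have less: "(1 + \<Phi> 1) / 1 < (1 + \<Phi> (l ^ n)) / l ^ n"
  proof -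
    have "1 + \<Phi> 1 < 2 ^ n * \<Phi> 1" using n \<Phi>1 by (simp add: field_simps)
    also have "\<dots> = (2 * l) ^ n * \<Phi> 1 / l ^ n" using l by (simp add: power_mult_distrib)
    also have "\<dots> \<le> (1 + \<Phi> (l ^ n)) / l ^ n" using it[of n] ln by (intro divide_right_mono) auto
    finally show ?thesis by simp
  qed
  then have "l ^ n \<noteq> 1" by auto
  then have "1 < l ^ n" using ln by linarith
  from amemiya_attained[OF f fin _ this less[unfolded \<Phi>_def]] that show ?thesis by simp blast
qed

lemma N_tendsto_0:
  assumes z: "\<And>n. z n \<in> X" and lim: "\<And>j. 0 < j \<Longrightarrow> (\<lambda>n. rho (\<lambda>s. j * z n s)) \<longlonglongrightarrow> 0"
  shows "(\<lambda>n. N (abs_L0 (z n))) \<longlonglongrightarrow> 0"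
proof (rule order_tendstoI)
  fix e :: real assume e: "0 < e"
  have "\<forall>\<^sub>F n in sequentially. rho (\<lambda>s. 3 / e * z n s) < 1" using e by (intro order_tendstoD[OF lim]) auto
  then show "\<forall>\<^sub>F n in sequentially. N (abs_L0 (z n)) < e"
  proof eventually_elim
    fix n assume "rho (\<lambda>s. 3 / e * z n s) < 1"
    then have "N (abs_L0 (z n)) \<le> (1 + 1) / (3 / e)" using e by (intro N_le[OF z]) auto
    then show "N (abs_L0 (z n)) < e" using e by simp
  qed
qed (auto intro!: always_eventually order_less_le_trans[OF _ N_nonneg])

lemma strongly_exposed_point_abs_L0:
  assumes D2: "Delta2 (extend \<phi>)" and N2: "Nabla2 \<phi>" and sc: "strictly_convex_on {0..} \<phi>"
    and x: "x \<in> X" and Nx: "N (abs_L0 x) = 1"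
  shows "strongly_exposed_point V N (abs_L0 x)"
proof -
  have "0 < N (abs_L0 x)" using Nx by simp
  then obtain k G where k: "0 < k" and sub: "\<And>y. 0 \<le> y \<Longrightarrow> subgrad (k * y) (G y)"
    and Gmono: "\<And>x y. 0 \<le> x \<Longrightarrow> x \<le> y \<Longrightarrow> G x \<le> G y" and [measurable]: "G \<in> borel_measurable borel" and G0: "G 0 = 0"
    and \<psi>G: "(\<integral>\<^sup>+t. \<psi> (ennreal (G (frearr x t))) \<partial>wm) = 1"
    and yG: "(\<integral>\<^sup>+t. ennreal (frearr x t * G (frearr x t)) \<partial>wm) = ennreal (N (abs_L0 x))"
    and Nk: "N (abs_L0 x) = (1 + enn2real (rho (\<lambda>s. k * x s))) / k"
    using amemiya_attained_Nabla2[OF D2 N2 x, of thesis] by fast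
  have Gnn: "0 \<le> G y" if "0 \<le> y" for y using sub[OF that] by (simp add: subgrad_def)
  obtain \<Omega> :: "real \<Rightarrow> ennreal" where \<Omega>[measurable]: "\<Omega> \<in> borel_measurable pos_lebesgue"
    and \<Omega>0: "\<And>s. x s = 0 \<Longrightarrow> \<Omega> s = 0" and \<Omega>pos: "AE s in pos_lebesgue. x s \<noteq> 0 \<longrightarrow> 0 < \<Omega> s"
    and \<Omega>eq: "\<And>H :: real \<Rightarrow> ennreal. H \<in> borel_measurable borel \<Longrightarrow> H 0 = 0 \<Longrightarrow>
      (\<integral>\<^sup>+s. H \<bar>x s\<bar> * \<Omega> s \<partial>pos_lebesgue) = (\<integral>\<^sup>+t. H (frearr x t) \<partial>wm)"
    and \<Omega>le: "\<And>(H :: real \<Rightarrow> ennreal) f. H \<in> borel_measurable borel \<Longrightarrow> (\<And>a b. 0 \<le> a \<Longrightarrow> a \<le> b \<Longrightarrow> H a \<le> H b) \<Longrightarrow> measurable_fun f \<Longrightarrow>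
      (\<integral>\<^sup>+s. ennreal \<bar>f s\<bar> * (H \<bar>x s\<bar> * \<Omega> s) \<partial>pos_lebesgue) \<le> (\<integral>\<^sup>+t. rearr f t * H (frearr x t) \<partial>wm)"
  proof (rule aligned_weight[OF x], goal_cases)
    case (1 \<Omega>)
    show ?case by (rule 1(1)) (fact 1)+
  qed
  have xm[measurable]: "measurable_fun x" using x by (rule X_measurable)
  \<comment> \<open>\<open>\<Omega>\<close> vanishes exactly off the support of \<open>x\<close>, up
    to null sets, so almost everywhere in \<open>Q\<close> means almost everywhere on that
    support.\<close>
  define Q where "Q = density pos_lebesgue \<Omega>"
  have setsQ[simp, measurable_cong]: "sets Q = sets pos_lebesgue" by (simp add: Q_def)
  have Qm: "f \<in> borel_measurable Q" if "measurable_fun f" for f using that by (simp add: Q_def)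
  have nnQ: "(\<integral>\<^sup>+s. h s \<partial>Q) = (\<integral>\<^sup>+s. h s * \<Omega> s \<partial>pos_lebesgue)" if [measurable]: "h \<in> borel_measurable pos_lebesgue" for h
    unfolding Q_def by (subst nn_integral_density) (auto simp: mult.commute)
  have AEQ: "AE s in Q. P s" if "AE s in pos_lebesgue. x s \<noteq> 0 \<longrightarrow> P s" for P
    unfolding Q_def using that by (subst AE_density) (auto elim!: eventually_mono dest: \<Omega>0)
  have AEQ': "AE s in pos_lebesgue. x s \<noteq> 0 \<longrightarrow> P s" if "AE s in Q. P s" for P
  proof -
    have "AE s in pos_lebesgue. 0 < \<Omega> s \<longrightarrow> P s" using that unfolding Q_def by (subst (asm) AE_density) auto
    then show ?thesis using \<Omega>pos by eventually_elim auto
  qed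
  define c where "c s = sgn (x s) * G \<bar>x s\<bar>" for s
  have cm[measurable]: "measurable_fun c" unfolding c_def by measurable
  have cabs: "\<bar>c s\<bar> = G \<bar>x s\<bar>" for s using Gnn[of "\<bar>x s\<bar>"] G0 by (auto simp: c_def abs_mult sgn_if)
  \<comment> \<open>\<open>G\<close> of the rearrangement of \<open>x\<close> has conjugate modular
    \<open>1\<close> and is thus a test function for the norm; the aligned weight carries the
    pairing with it over to the original line.\<close>
  have Fb: "(\<integral>\<^sup>+s. ennreal \<bar>f s * c s\<bar> \<partial>Q) \<le> enorm f" if f[measurable]: "measurable_fun f" for f
  proof -
    define g where "g t = G (frearr x t)" for t
    have am: "antimono_on {0<..} g"
      using frearr_antimono[OF x] Gmono by (auto simp: monotone_on_def g_def)
    have gm: "measurable_fun g" using am by (rule antimono_measurable_pos_lebesgue)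
    have "rhoc g = (\<integral>\<^sup>+t. \<psi> (ennreal (g t)) \<partial>wm)" using am Gnn by (intro rhoc_antimono_fun) (auto simp: g_def)
    then have rg: "rhoc g \<le> 1" using \<psi>G by (simp add: g_def)
    have "AE t in wm. rearr g t = ennreal (g t)"
      using AE_rearr_antimono_fun[OF am] Gnn by (simp add: AE_wm g_def)
    then have "AE t in wm. rearr f t * ennreal (G (frearr x t)) = rearr f t * rearr g t"
      by eventually_elim (simp add: g_def)
    then have eq: "(\<integral>\<^sup>+t. rearr f t * ennreal (G (frearr x t)) \<partial>wm) = (\<integral>\<^sup>+t. rearr f t * rearr g t \<partial>wm)"
      by (rule nn_integral_cong_AE)
    have "(\<integral>\<^sup>+s. ennreal \<bar>f s * c s\<bar> \<partial>Q) = (\<integral>\<^sup>+s. ennreal \<bar>f s\<bar> * (ennreal (G \<bar>x s\<bar>) * \<Omega> s) \<partial>pos_lebesgue)"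
      using Gnn by (subst nnQ) (auto simp: abs_mult cabs ennreal_mult mult.assoc)
    also have "\<dots> \<le> (\<integral>\<^sup>+t. rearr f t * ennreal (G (frearr x t)) \<partial>wm)"
      by (rule \<Omega>le) (auto intro: Gmono ennreal_leI)
    also have "\<dots> \<le> enorm f" unfolding eq by (rule enorm_ge[OF gm rg])
    finally show ?thesis .
  qed
  define L where "L f = (\<integral>s. f s * c s \<partial>Q)" for f
  have Lint: "integrable Q (\<lambda>s. f s * c s)" if f: "f \<in> X" for f
  proof (rule integrableI_bounded)
    show "(\<lambda>s. f s * c s) \<in> borel_measurable Q" by (intro Qm borel_measurable_times X_measurable[OF f] cm)
    show "(\<integral>\<^sup>+s. ennreal (norm (f s * c s)) \<partial>Q) < \<infinity>"
      using Fb[OF X_measurable[OF f]] enorm_finite[OF f] by (auto intro: order_le_less_trans)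
  qed
  have Lle: "\<bar>L f\<bar> \<le> N (abs_L0 f)" if f: "f \<in> X" for f
  proof -
    have "ennreal \<bar>L f\<bar> \<le> (\<integral>\<^sup>+s. ennreal \<bar>f s * c s\<bar> \<partial>Q)"
      unfolding L_def using integral_norm_bound_ennreal[OF Lint[OF f]] by simp
    also have "\<dots> \<le> ennreal (N (abs_L0 f))" using Fb[OF X_measurable[OF f]] f by (simp add: ennreal_N)
    finally show ?thesis by simp
  qed
  have xc: "x s * c s = \<bar>x s\<bar> * G \<bar>x s\<bar>" for s by (auto simp: c_def sgn_if)
  have Lx: "L x = 1"
  proof -
    have "(\<integral>\<^sup>+s. ennreal (x s * c s) \<partial>Q) = (\<integral>\<^sup>+s. ennreal (\<bar>x s\<bar> * G \<bar>x s\<bar>) * \<Omega> s \<partial>pos_lebesgue)"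
      unfolding xc by (rule nnQ) measurable
    also have "\<dots> = (\<integral>\<^sup>+t. ennreal (frearr x t * G (frearr x t)) \<partial>wm)"
      using \<Omega>eq[of "\<lambda>y. ennreal (y * G y)"] by simp
    also have "\<dots> = 1" using yG Nx by simp
    finally have *: "(\<integral>\<^sup>+s. ennreal (x s * c s) \<partial>Q) = 1" .
    have "L x = enn2real (\<integral>\<^sup>+s. ennreal (x s * c s) \<partial>Q)"
      unfolding L_def using Gnn by (intro integral_eq_nn_integral Qm) (auto simp: xc)
    then show ?thesis using * by simp
  qed
  obtain l C where l: "1 < l" and C: "0 < C" and lge: "\<And>u. 0 < u \<Longrightarrow> 2 * l * \<phi> u \<le> \<phi> (l * u)"
    and \<psi>2: "\<And>v. 0 < v \<Longrightarrow> \<psi> (ennreal (2 * v)) \<le> ennreal C * \<psi> (ennreal v)"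
    by (rule Nabla2D[OF N2]) blast
  \<comment> \<open>The conjugate function at the slope \<open>G \<bar>x s\<bar>\<close>, by the
    equality case of Young's inequality.\<close>
  define \<Psi> where "\<Psi> s = k * \<bar>x s\<bar> * G \<bar>x s\<bar> - \<phi> (k * \<bar>x s\<bar>)" for s
  have [measurable]: "measurable_fun \<Psi>" unfolding \<Psi>_def by measurable
  have subx: "subgrad (k * \<bar>x s\<bar>) (G \<bar>x s\<bar>)" for s by (rule sub) simp
  have \<Psi>0: "0 \<le> \<Psi> s" for s using subgrad_nonneg[OF subx[of s]] by (simp add: \<Psi>_def)
  have gap0: "0 \<le> \<phi> \<bar>v\<bar> + \<Psi> s - v * c s" for v s
  proof -
    have "v * c s \<le> \<bar>v\<bar> * G \<bar>x s\<bar>" using abs_ge_self[of "v * c s"] by (simp add: abs_mult cabs)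
    moreover have "\<phi> (k * \<bar>x s\<bar>) + G \<bar>x s\<bar> * (\<bar>v\<bar> - k * \<bar>x s\<bar>) \<le> \<phi> \<bar>v\<bar>" using subx[of s] by (auto simp: subgrad_def)
    ultimately show ?thesis by (simp add: \<Psi>_def algebra_simps)
  qed
  \<comment> \<open>Young's inequality with the doubled slope \<open>2 * G \<bar>x s\<bar>\<close>
    and the growth condition on \<open>\<psi>\<close> bound \<open>\<phi> \<bar>v\<bar>\<close> by
    twice the gap plus an integrable function independent of \<open>v\<close>.\<close>
  have gap_le: "\<phi> \<bar>v\<bar> \<le> 2 * (\<phi> \<bar>v\<bar> + \<Psi> s - v * c s) + C * \<Psi> s" for v s
  proof -
    have "2 * (\<bar>v\<bar> * G \<bar>x s\<bar>) \<le> \<phi> \<bar>v\<bar> + C * \<Psi> s"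
    proof (cases "0 < G \<bar>x s\<bar>")
      case True
      have "ennreal \<bar>v\<bar> * ennreal (2 * G \<bar>x s\<bar>) \<le> extend \<phi> (ennreal \<bar>v\<bar>) + \<psi> (ennreal (2 * G \<bar>x s\<bar>))" by (rule Young_ennreal)
      also have "\<dots> \<le> ennreal (\<phi> \<bar>v\<bar>) + ennreal C * ennreal (\<Psi> s)"
        using \<psi>2[OF True] \<psi>_subgrad[OF subx[of s]] by (simp add: extend_ennreal \<Psi>_def add_left_mono)
      also have "\<dots> = ennreal (\<phi> \<bar>v\<bar> + C * \<Psi> s)" using C \<Psi>0[of s] by (simp add: ennreal_mult)
      finally have "ennreal (\<bar>v\<bar> * (2 * G \<bar>x s\<bar>)) \<le> ennreal (\<phi> \<bar>v\<bar> + C * \<Psi> s)"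
        using True by (simp add: ennreal_mult)
      then have "\<bar>v\<bar> * (2 * G \<bar>x s\<bar>) \<le> \<phi> \<bar>v\<bar> + C * \<Psi> s" using C \<Psi>0[of s] by (subst (asm) ennreal_le_iff) auto
      then show ?thesis by simp
    next
      case False
      then have "G \<bar>x s\<bar> = 0" using Gnn[of "\<bar>x s\<bar>"] by simp
      then show ?thesis using C \<Psi>0[of s] by simp
    qed
    moreover have "v * c s \<le> \<bar>v\<bar> * G \<bar>x s\<bar>" using abs_ge_self[of "v * c s"] by (simp add: abs_mult cabs)
    moreover have "p \<le> 2 * (p + z - q) + t" if "2 * m \<le> p + t" "q \<le> m" "0 \<le> z" for p q m t z :: real
      using that by (simp add: algebra_simps)
    ultimately show ?thesis using \<Psi>0[of s] by blast
  qed
  have nn\<Psi>: "(\<integral>\<^sup>+s. ennreal (\<Psi> s) \<partial>Q) = 1"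
  proof -
    have "(\<integral>\<^sup>+s. ennreal (\<Psi> s) \<partial>Q) = (\<integral>\<^sup>+s. ennreal (k * \<bar>x s\<bar> * G \<bar>x s\<bar> - \<phi> (k * \<bar>x s\<bar>)) * \<Omega> s \<partial>pos_lebesgue)"
      unfolding \<Psi>_def by (rule nnQ) measurable
    also have "\<dots> = (\<integral>\<^sup>+t. ennreal (k * frearr x t * G (frearr x t) - \<phi> (k * frearr x t)) \<partial>wm)"
      using \<Omega>eq[of "\<lambda>y. ennreal (k * y * G y - \<phi> (k * y))"] by simp
    also have "\<dots> = (\<integral>\<^sup>+t. \<psi> (ennreal (G (frearr x t))) \<partial>wm)"
      by (intro nn_integral_cong) (simp add: \<psi>_subgrad[OF sub])
    finally show ?thesis using \<psi>G by simp
  qed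
  have i\<Psi>: "integrable Q \<Psi>" using nn\<Psi> \<Psi>0 by (intro integrableI_nonneg Qm) auto
  have I\<Psi>: "(\<integral>s. \<Psi> s \<partial>Q) = 1" using nn\<Psi> \<Psi>0 by (subst integral_eq_nn_integral) (auto intro!: Qm)
  define u where "u s = k * x s" for s
  have um[measurable]: "measurable_fun u" unfolding u_def by measurable
  have uX: "u \<in> X" unfolding u_def by (rule X_scale[OF x])
  have rufin: "rho u < \<infinity>" using Delta2_rho_finite[OF D2 uX, of 1] by simp
  define ru where "ru = enn2real (rho u)"
  have ru: "rho u = ennreal ru" "0 \<le> ru" using rufin by (auto simp: ru_def)
  have kru: "k = 1 + ru" using Nk Nx k by (simp add: ru_def u_def[abs_def] field_simps)
  have nnu: "(\<integral>\<^sup>+s. ennreal (\<phi> \<bar>u s\<bar>) \<partial>Q) = ennreal ru"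
  proof -
    have "(\<integral>\<^sup>+s. ennreal (\<phi> \<bar>u s\<bar>) \<partial>Q) = (\<integral>\<^sup>+s. ennreal (\<phi> (k * \<bar>x s\<bar>)) * \<Omega> s \<partial>pos_lebesgue)"
      using k by (subst nnQ) (auto simp: u_def abs_mult)
    also have "\<dots> = (\<integral>\<^sup>+t. ennreal (\<phi> (k * frearr x t)) \<partial>wm)"
      using \<Omega>eq[of "\<lambda>y. ennreal (\<phi> (k * y))"] by simp
    also have "\<dots> = rho u" using rho_frearr[OF x, of k] k by (simp add: u_def[abs_def])
    finally show ?thesis using ru by simp
  qed
  have Iu: "(\<integral>s. \<phi> \<bar>u s\<bar> \<partial>Q) = ru" using nnu ru by (subst integral_eq_nn_integral) (auto intro!: Qm)
  have claim: "\<exists>r. strict_mono r \<and> (\<lambda>n. N (abs_L0 (\<lambda>s. y (r n) s - x s))) \<longlonglongrightarrow> 0"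
    if y: "\<And>n. y n \<in> X" "\<And>n. N (abs_L0 (y n)) \<le> 1" and Ny34: "\<And>n. 3/4 \<le> N (abs_L0 (y n))"
      and Ly: "(\<lambda>n. L (y n)) \<longlonglongrightarrow> 1" for y :: "nat \<Rightarrow> real \<Rightarrow> real"
  proof -
    note ym[measurable] = X_measurable[OF y(1)]
    have "\<exists>\<kappa>>0. N (abs_L0 (y n)) = (1 + enn2real (rho (\<lambda>s. \<kappa> * y n s))) / \<kappa>" for n
    proof -
      have "0 < N (abs_L0 (y n))" using Ny34[of n] by linarith
      then show ?thesis using amemiya_attained_Nabla2[OF D2 N2 y(1)] by metis
    qed
    then obtain \<kappa> where \<kappa>: "\<And>n. 0 < \<kappa> n" "\<And>n. N (abs_L0 (y n)) = (1 + enn2real (rho (\<lambda>s. \<kappa> n * y n s))) / \<kappa> n"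
      by metis
    define v where "v n s = \<kappa> n * y n s" for n s
    have vm[measurable]: "measurable_fun (v n)" for n unfolding v_def by measurable
    have vX: "v n \<in> X" for n unfolding v_def by (rule X_scale[OF y(1)])
    have rvfin: "rho (v n) < \<infinity>" for n using Delta2_rho_finite[OF D2 vX, of 1 n] by simp
    define rv where "rv n = enn2real (rho (v n))" for n
    have rv: "rho (v n) = ennreal (rv n)" "0 \<le> rv n" for n using rvfin[of n] by (auto simp: rv_def)
    have \<kappa>N: "\<kappa> n * N (abs_L0 (y n)) = 1 + rv n" for n
      using \<kappa>(1)[of n] by (simp add: \<kappa>(2)[of n] rv_def v_def[abs_def])
    \<comment> \<open>At the smaller parameter \<open>\<kappa> n / l\<close> the modular is at most
      \<open>\<kappa> n / (2 * l)\<close>, so the norm is at most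
      \<open>l / \<kappa> n + 1/2\<close>. The lower bound \<open>3/4\<close> on the norm exceeds
      \<open>1/2\<close> and so bounds \<open>\<kappa> n\<close>.\<close>
    have \<kappa>le: "\<kappa> n \<le> 4 * l" for n
    proof -
      have "ennreal (2 * l) * rho (\<lambda>s. \<kappa> n / l * y n s) \<le> rho (\<lambda>s. l * (\<kappa> n / l) * y n s)"
        using l \<kappa>(1)[of n] by (intro rho_scale_ge ym lge) auto
      also have "\<dots> = ennreal (rv n)" using l rv(1)[of n] by (simp add: v_def[abs_def])
      also have "\<dots> \<le> ennreal (\<kappa> n)"
      proof (rule ennreal_leI)
        have "\<kappa> n * N (abs_L0 (y n)) \<le> \<kappa> n * 1" using y(2)[of n] \<kappa>(1)[of n] by (intro mult_left_mono) auto
        then show "rv n \<le> \<kappa> n" using \<kappa>N[of n] by simp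
      qed
      finally have *: "ennreal (2 * l) * rho (\<lambda>s. \<kappa> n / l * y n s) \<le> ennreal (\<kappa> n)" .
      have "rho (\<lambda>s. \<kappa> n / l * y n s) < \<infinity>" by (rule Delta2_rho_finite[OF D2 y(1)])
      then obtain r where r: "rho (\<lambda>s. \<kappa> n / l * y n s) = ennreal r" "0 \<le> r" by (cases "rho (\<lambda>s. \<kappa> n / l * y n s)") auto
      have rle: "2 * l * r \<le> \<kappa> n" using * r l \<kappa>(1)[of n] by (simp add: ennreal_mult[symmetric] ennreal_le_iff)
      have "N (abs_L0 (y n)) \<le> (1 + r) / (\<kappa> n / l)"
        using r \<kappa>(1)[of n] l by (intro N_le y(1)) auto
      with Ny34[of n] have "3/4 \<le> (1 + r) / (\<kappa> n / l)" by (rule order_trans)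
      then have "3/4 * \<kappa> n \<le> l + l * r" using \<kappa>(1)[of n] l by (simp add: field_simps)
      then show ?thesis using rle by simp
    qed
    define E where "E n s = \<phi> \<bar>v n s\<bar> + \<Psi> s - v n s * c s" for n s
    have E0: "0 \<le> E n s" for n s unfolding E_def by (rule gap0)
    \<comment> \<open>The rearrangement inequality with \<open>H = 1\<close>: integration against
      \<open>Q\<close> can only underestimate the modular of \<open>v n\<close>.\<close>
    have nnv: "(\<integral>\<^sup>+s. ennreal (\<phi> \<bar>v n s\<bar>) \<partial>Q) \<le> ennreal (rv n)" for n
    proof -
      have "(\<integral>\<^sup>+s. ennreal (\<phi> \<bar>v n s\<bar>) \<partial>Q) = (\<integral>\<^sup>+s. ennreal \<bar>\<phi> \<bar>v n s\<bar>\<bar> * (1 * \<Omega> s) \<partial>pos_lebesgue)"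
        by (subst nnQ) auto
      also have "\<dots> \<le> (\<integral>\<^sup>+t. rearr (\<lambda>s. \<phi> \<bar>v n s\<bar>) t * 1 \<partial>wm)" by (rule \<Omega>le) auto
      also have "\<dots> = rho (v n)" by (simp add: rho_comp)
      finally show ?thesis using rv by simp
    qed
    have iv: "integrable Q (\<lambda>s. \<phi> \<bar>v n s\<bar>)" for n
      using nnv[of n] by (intro integrableI_nonneg Qm) (auto intro: order_le_less_trans)
    define A where "A n = (\<integral>s. \<phi> \<bar>v n s\<bar> \<partial>Q)" for n
    have Ale: "A n \<le> rv n" for n
    proof -
      have "ennreal (A n) = (\<integral>\<^sup>+s. ennreal (\<phi> \<bar>v n s\<bar>) \<partial>Q)" unfolding A_def using iv by (subst nn_integral_eq_integral) auto
      then have "ennreal (A n) \<le> ennreal (rv n)" using nnv[of n] by simp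
      then show ?thesis using rv by simp
    qed
    have ivc: "integrable Q (\<lambda>s. v n s * c s)" for n by (rule Lint[OF vX])
    have Ivc: "(\<integral>s. v n s * c s \<partial>Q) = \<kappa> n * L (y n)" for n by (simp add: L_def v_def mult.assoc)
    have iE: "integrable Q (E n)" for n unfolding E_def
      by (intro Bochner_Integration.integrable_diff Bochner_Integration.integrable_add iv i\<Psi> ivc)
    have IE: "(\<integral>s. E n s \<partial>Q) = A n + 1 - \<kappa> n * L (y n)" for n
      unfolding E_def using iv i\<Psi> ivc by (simp add: A_def I\<Psi> Ivc)
    have IE0: "0 \<le> (\<integral>s. E n s \<partial>Q)" for n using E0 by simp
    \<comment> \<open>The deficit \<open>1 - L (y n)\<close> times the bound on
      \<open>\<kappa> n\<close>. It controls both the integrated gap and the amount by which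
      \<open>Q\<close> underestimates the modular.\<close>
    define \<delta> where "\<delta> n = 4 * l * (1 - L (y n))" for n
    have Ly1: "L (y n) \<le> 1" for n using Lle[OF y(1)[of n]] y(2)[of n] by simp
    have \<delta>: "\<kappa> n * (1 - L (y n)) \<le> \<delta> n" for n
      unfolding \<delta>_def using \<kappa>le[of n] Ly1[of n] by (intro mult_right_mono) auto
    have \<delta>0: "\<delta> \<longlonglongrightarrow> 0"
    proof -
      have "(\<lambda>n. 4 * l * (1 - L (y n))) \<longlonglongrightarrow> 4 * l * (1 - 1)" by (intro tendsto_intros Ly)
      then show ?thesis by (simp add: \<delta>_def[abs_def])
    qed
    have \<kappa>N1: "1 + rv n \<le> \<kappa> n" for n
      using \<kappa>N[of n] y(2)[of n] \<kappa>(1)[of n] mult_left_mono[of "N (abs_L0 (y n))" 1 "\<kappa> n"] by simp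
    have IE\<delta>: "(\<integral>s. E n s \<partial>Q) \<le> \<delta> n" for n
      using IE[of n] Ale[of n] \<kappa>N1[of n] \<delta>[of n] by (simp add: algebra_simps)
    have rA: "rv n - A n \<le> \<delta> n" for n
      using IE[of n] IE0[of n] \<kappa>N1[of n] \<delta>[of n] by (simp add: algebra_simps)
    have IElim: "(\<lambda>n. \<integral>s. E n s \<partial>Q) \<longlonglongrightarrow> 0"
      by (rule tendsto_sandwich[OF _ _ tendsto_const \<delta>0]) (use IE0 IE\<delta> in auto)
    obtain r where r: "strict_mono r" and Er: "AE s in Q. (\<lambda>n. E (r n) s) \<longlonglongrightarrow> 0"
      using tendsto_L1_AE_subseq[of Q E] iE IElim E0 by auto
    have vlim: "AE s in pos_lebesgue. x s \<noteq> 0 \<longrightarrow> (\<lambda>n. v (r n) s) \<longlonglongrightarrow> u s"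
      using AEQ'[OF Er]
    proof eventually_elim
      fix s assume e: "x s \<noteq> 0 \<longrightarrow> (\<lambda>n. E (r n) s) \<longlonglongrightarrow> 0"
      show "x s \<noteq> 0 \<longrightarrow> (\<lambda>n. v (r n) s) \<longlonglongrightarrow> u s"
      proof
        assume xs: "x s \<noteq> 0"
        have "(\<lambda>n. v (r n) s) \<longlonglongrightarrow> sgn (x s) * (k * \<bar>x s\<bar>)"
        proof (rule young_gap_tendsto[OF sc subx])
          show "0 < k * \<bar>x s\<bar>" "\<bar>sgn (x s)\<bar> = 1" using k xs by (auto simp: abs_sgn_eq)
          show "(\<lambda>n. \<phi> \<bar>v (r n) s\<bar> + (k * \<bar>x s\<bar> * G \<bar>x s\<bar> - \<phi> (k * \<bar>x s\<bar>)) - v (r n) s * (sgn (x s) * G \<bar>x s\<bar>)) \<longlonglongrightarrow> 0"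
            using e xs by (simp add: E_def \<Psi>_def c_def)
        qed
        moreover have "sgn (x s) * (k * \<bar>x s\<bar>) = u s" by (simp add: u_def sgn_if)
        ultimately show "(\<lambda>n. v (r n) s) \<longlonglongrightarrow> u s" by simp
      qed
    qed
    \<comment> \<open>Truncation at the bound from \<open>gap_le\<close> permits dominated
      convergence; what is cut off is at most twice the gap, whose integral tends to
      \<open>0\<close>.\<close>
    define B where "B n s = min (\<phi> \<bar>v n s\<bar>) (C * \<Psi> s)" for n s
    have Bm[measurable]: "measurable_fun (B n)" for n unfolding B_def by measurable
    have uB: "\<phi> \<bar>u s\<bar> \<le> C * \<Psi> s" for s
    proof -
      have "\<phi> \<bar>u s\<bar> + \<Psi> s - u s * c s = 0"
        using k xc[of s] by (simp add: u_def \<Psi>_def abs_mult mult.assoc)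
      then show ?thesis using gap_le[of "u s" s] by simp
    qed
    have B0: "0 \<le> B n s" for n s using C \<Psi>0[of s] by (simp add: B_def)
    have iC: "integrable Q (\<lambda>s. C * \<Psi> s)" using i\<Psi> by simp
    have iB: "integrable Q (B n)" for n
      by (rule Bochner_Integration.integrable_bound[OF iC]) (use B0 C \<Psi>0 in \<open>auto simp: B_def intro!: Qm AE_I2\<close>)
    have Blim: "(\<lambda>n. \<integral>s. B (r n) s \<partial>Q) \<longlonglongrightarrow> (\<integral>s. \<phi> \<bar>u s\<bar> \<partial>Q)"
    proof (rule integral_dominated_convergence[OF _ _ iC])
      show "(\<lambda>s. \<phi> \<bar>u s\<bar>) \<in> borel_measurable Q" by (intro Qm) measurable
      show "B (r n) \<in> borel_measurable Q" for n by (intro Qm) measurable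
      show "AE s in Q. norm (B (r n) s) \<le> C * \<Psi> s" for n using B0 by (intro AE_I2) (simp add: B_def)
      show "AE s in Q. (\<lambda>n. B (r n) s) \<longlonglongrightarrow> \<phi> \<bar>u s\<bar>"
      proof (rule AEQ)
        show "AE s in pos_lebesgue. x s \<noteq> 0 \<longrightarrow> (\<lambda>n. B (r n) s) \<longlonglongrightarrow> \<phi> \<bar>u s\<bar>"
          using vlim
        proof eventually_elim
          fix s assume e: "x s \<noteq> 0 \<longrightarrow> (\<lambda>n. v (r n) s) \<longlonglongrightarrow> u s"
          show "x s \<noteq> 0 \<longrightarrow> (\<lambda>n. B (r n) s) \<longlonglongrightarrow> \<phi> \<bar>u s\<bar>"
          proof
            assume "x s \<noteq> 0"
            then have "(\<lambda>n. B (r n) s) \<longlonglongrightarrow> min (\<phi> \<bar>u s\<bar>) (C * \<Psi> s)"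
              unfolding B_def using e by (intro tendsto_min isCont_tendsto_compose[OF \<phi>_isCont] tendsto_rabs tendsto_const) auto
            then show "(\<lambda>n. B (r n) s) \<longlonglongrightarrow> \<phi> \<bar>u s\<bar>" using uB[of s] by (simp add: min_absorb1)
          qed
        qed
      qed
    qed
    have AB: "(\<integral>s. B n s \<partial>Q) \<le> A n" "A n \<le> (\<integral>s. B n s \<partial>Q) + 2 * (\<integral>s. E n s \<partial>Q)" for n
    proof -
      show "(\<integral>s. B n s \<partial>Q) \<le> A n" unfolding A_def by (intro integral_mono iB iv) (simp add: B_def)
      have "A n \<le> (\<integral>s. B n s + 2 * E n s \<partial>Q)" unfolding A_def
      proof (intro integral_mono iv)
        show "integrable Q (\<lambda>s. B n s + 2 * E n s)" using iB iE by simp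
        show "\<phi> \<bar>v n s\<bar> \<le> B n s + 2 * E n s" for s
          using gap_le[of "v n s" s] E0[of n s] by (auto simp: B_def E_def min_def)
      qed
      also have "\<dots> = (\<integral>s. B n s \<partial>Q) + 2 * (\<integral>s. E n s \<partial>Q)" using iB iE by simp
      finally show "A n \<le> (\<integral>s. B n s \<partial>Q) + 2 * (\<integral>s. E n s \<partial>Q)" .
    qed
    have IEr: "(\<lambda>n. \<integral>s. E (r n) s \<partial>Q) \<longlonglongrightarrow> 0" using LIMSEQ_subseq_LIMSEQ[OF IElim r] by (simp add: comp_def)
    have \<delta>r: "(\<lambda>n. \<delta> (r n)) \<longlonglongrightarrow> 0" using LIMSEQ_subseq_LIMSEQ[OF \<delta>0 r] by (simp add: comp_def)
    have rvlim: "(\<lambda>n. rv (r n)) \<longlonglongrightarrow> ru"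
    proof (rule tendsto_sandwich)
      show "\<forall>\<^sub>F n in sequentially. (\<integral>s. B (r n) s \<partial>Q) \<le> rv (r n)" using AB(1) Ale by (auto intro: always_eventually order_trans)
      have "rv (r n) \<le> (\<integral>s. B (r n) s \<partial>Q) + 2 * (\<integral>s. E (r n) s \<partial>Q) + \<delta> (r n)" for n
        using AB(2)[of "r n"] rA[of "r n"] by linarith
      then show "\<forall>\<^sub>F n in sequentially. rv (r n) \<le> (\<integral>s. B (r n) s \<partial>Q) + 2 * (\<integral>s. E (r n) s \<partial>Q) + \<delta> (r n)" by simp
      show "(\<lambda>n. \<integral>s. B (r n) s \<partial>Q) \<longlonglongrightarrow> ru" using Blim Iu by simp
      have "(\<lambda>n. (\<integral>s. B (r n) s \<partial>Q) + 2 * (\<integral>s. E (r n) s \<partial>Q) + \<delta> (r n)) \<longlonglongrightarrow> ru + 2 * 0 + 0"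
        using Blim Iu by (intro tendsto_intros IEr \<delta>r) auto
      then show "(\<lambda>n. (\<integral>s. B (r n) s \<partial>Q) + 2 * (\<integral>s. E (r n) s \<partial>Q) + \<delta> (r n)) \<longlonglongrightarrow> ru" by simp
    qed
    have diff: "(\<lambda>n. rho (\<lambda>s. v (r n) s - u s)) \<longlonglongrightarrow> 0"
    proof (rule rho_diff_tendsto_0[OF D2 um vm _ rufin])
      show "AE s in pos_lebesgue. u s \<noteq> 0 \<longrightarrow> (\<lambda>n. v (r n) s) \<longlonglongrightarrow> u s"
        using vlim by eventually_elim (auto simp: u_def)
      show "(\<lambda>n. rho (v (r n))) \<longlonglongrightarrow> rho u" unfolding rv ru using rvlim by (rule tendsto_ennrealI)
    qed (rule X_level_finite[OF uX])
    have Nlim: "(\<lambda>n. N (abs_L0 (y n))) \<longlonglongrightarrow> 1"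
      by (rule tendsto_sandwich[OF _ _ Ly tendsto_const]) (use abs_le_D1[OF Lle[OF y(1)]] y(2) in auto)
    have \<kappa>lim: "(\<lambda>n. \<kappa> (r n)) \<longlonglongrightarrow> k"
    proof -
      have "(\<lambda>n. (1 + rv (r n)) / N (abs_L0 (y (r n)))) \<longlonglongrightarrow> (1 + ru) / 1"
        using LIMSEQ_subseq_LIMSEQ[OF Nlim r] by (intro tendsto_intros rvlim) (auto simp: comp_def)
      moreover have "(1 + rv (r n)) / N (abs_L0 (y (r n))) = \<kappa> (r n)" for n
        using \<kappa>N[of "r n"] Ny34[of "r n"] by (simp add: field_simps)
      ultimately show ?thesis using kru by simp
    qed
    \<comment> \<open>This is \<open>\<kappa> (r n) * (y (r n) - x)\<close>, split into the
      difference with vanishing modular and the error in the parameter.\<close>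
    define z where "z n s = (v (r n) s - u s) + (k - \<kappa> (r n)) * x s" for n s
    have zX: "z n \<in> X" for n unfolding z_def by (intro X_add X_diff vX uX X_scale x)
    have zlim: "(\<lambda>n. N (abs_L0 (z n))) \<longlonglongrightarrow> 0"
    proof (rule N_tendsto_0[OF zX])
      fix j :: real assume j: "0 < j"
      obtain D where D: "1 \<le> D" "\<And>a. extend \<phi> (ennreal (2 * j) * a) \<le> ennreal D * extend \<phi> a"
        using Delta2_scale[OF D2] by blast
      have dm: "measurable_fun (\<lambda>s. v (r n) s - u s)" for n by measurable
      have dle: "rho (\<lambda>s. 2 * j * (v (r n) s - u s)) \<le> ennreal D * rho (\<lambda>s. v (r n) s - u s)" for n
      proof -
        have "rho (\<lambda>s. 2 * j * (v (r n) s - u s)) \<le> (\<integral>\<^sup>+t. ennreal D * extend \<phi> (rearr (\<lambda>s. v (r n) s - u s) t) \<partial>wm)"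
          unfolding rho_scale[OF dm] using D(2) j by (intro nn_integral_mono) simp
        also have "\<dots> = ennreal D * rho (\<lambda>s. v (r n) s - u s)" unfolding rho_def by (rule nn_integral_cmult) measurable
        finally show ?thesis .
      qed
      have xfin: "rho (\<lambda>s. 2 * j * x s) < \<infinity>" by (rule Delta2_rho_finite[OF D2 x])
      have xle: "rho (\<lambda>s. 2 * j * ((k - \<kappa> (r n)) * x s)) \<le> ennreal \<bar>k - \<kappa> (r n)\<bar> * rho (\<lambda>s. 2 * j * x s)"
        if "\<bar>k - \<kappa> (r n)\<bar> < 1" for n
      proof -
        have "rho (\<lambda>s. 2 * j * ((k - \<kappa> (r n)) * x s)) = rho (\<lambda>s. \<bar>k - \<kappa> (r n)\<bar> * (2 * j * x s))"
        proof (rule antisym)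
          show "rho (\<lambda>s. 2 * j * ((k - \<kappa> (r n)) * x s)) \<le> rho (\<lambda>s. \<bar>k - \<kappa> (r n)\<bar> * (2 * j * x s))"
            by (rule rho_mono) (auto simp: abs_mult)
          show "rho (\<lambda>s. \<bar>k - \<kappa> (r n)\<bar> * (2 * j * x s)) \<le> rho (\<lambda>s. 2 * j * ((k - \<kappa> (r n)) * x s))"
            by (rule rho_mono) (auto simp: abs_mult)
        qed
        also have "\<dots> \<le> ennreal \<bar>k - \<kappa> (r n)\<bar> * rho (\<lambda>s. 2 * j * x s)"
          using that by (intro rho_scale_le) auto
        finally show ?thesis .
      qed
      have klim: "(\<lambda>n. \<bar>k - \<kappa> (r n)\<bar>) \<longlonglongrightarrow> 0"
      proof -
        have "(\<lambda>n. \<bar>k - \<kappa> (r n)\<bar>) \<longlonglongrightarrow> \<bar>k - k\<bar>" by (intro tendsto_intros \<kappa>lim)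
        then show ?thesis by simp
      qed
      define b where "b n = ennreal D * rho (\<lambda>s. v (r n) s - u s) + ennreal \<bar>k - \<kappa> (r n)\<bar> * rho (\<lambda>s. 2 * j * x s)" for n
      have "(\<lambda>n. ennreal \<bar>k - \<kappa> (r n)\<bar> * rho (\<lambda>s. 2 * j * x s)) \<longlonglongrightarrow> 0"
      proof -
        obtain q where q: "rho (\<lambda>s. 2 * j * x s) = ennreal q" "0 \<le> q" using xfin by (cases "rho (\<lambda>s. 2 * j * x s)") auto
        have "(\<lambda>n. ennreal (\<bar>k - \<kappa> (r n)\<bar> * q)) \<longlonglongrightarrow> ennreal (0 * q)"
          by (intro tendsto_ennrealI tendsto_mult klim tendsto_const)
        then show ?thesis using q by (simp add: ennreal_mult)
      qed
      then have "b \<longlonglongrightarrow> ennreal D * 0 + 0"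
        unfolding b_def by (intro tendsto_add ennreal_tendsto_cmult diff) auto
      then have blim: "b \<longlonglongrightarrow> 0" by simp
      have "\<forall>\<^sub>F n in sequentially. \<bar>k - \<kappa> (r n)\<bar> < 1" using klim by (rule order_tendstoD) simp
      then have ev: "\<forall>\<^sub>F n in sequentially. rho (\<lambda>s. j * z n s) \<le> b n"
      proof eventually_elim
        fix n assume n: "\<bar>k - \<kappa> (r n)\<bar> < 1"
        have "rho (\<lambda>s. j * z n s) = rho (\<lambda>s. j * (v (r n) s - u s) + j * ((k - \<kappa> (r n)) * x s))"
          by (simp add: z_def distrib_left)
        also have "\<dots> \<le> rho (\<lambda>s. 2 * (j * (v (r n) s - u s))) + rho (\<lambda>s. 2 * (j * ((k - \<kappa> (r n)) * x s)))"
          by (rule rho_add_le) measurable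
        also have "\<dots> \<le> b n" unfolding b_def using dle[of n] xle[OF n] by (intro add_mono) (simp_all add: mult.assoc)
        finally show "rho (\<lambda>s. j * z n s) \<le> b n" .
      qed
      show "(\<lambda>n. rho (\<lambda>s. j * z n s)) \<longlonglongrightarrow> 0"
        by (rule tendsto_sandwich[OF _ ev tendsto_const blim]) simp
    qed
    have "(\<lambda>n. (1 / \<kappa> (r n)) * N (abs_L0 (z n))) \<longlonglongrightarrow> (1 / k) * 0"
      using k by (intro tendsto_mult tendsto_divide tendsto_const \<kappa>lim zlim) auto
    moreover have "(1 / \<kappa> (r n)) * N (abs_L0 (z n)) = N (abs_L0 (\<lambda>s. y (r n) s - x s))" for n
    proof -
      have "(\<lambda>s. 1 / \<kappa> (r n) * z n s) = (\<lambda>s. y (r n) s - x s)"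
        using \<kappa>(1)[of "r n"] by (auto simp: z_def v_def u_def field_simps)
      then have "(1 / \<kappa> (r n)) *\<^sub>R abs_L0 (z n) = abs_L0 (\<lambda>s. y (r n) s - x s)"
        using X_measurable[OF zX] by (simp only: scaleR_abs_L0)
      then show ?thesis using N_scale[OF zX, of "1 / \<kappa> (r n)" n] \<kappa>(1)[of "r n"] by simp
    qed
    ultimately have "(\<lambda>n. N (abs_L0 (\<lambda>s. y (r n) s - x s))) \<longlonglongrightarrow> 0" by simp
    then show ?thesis using r by blast
  qed
  \<comment> \<open>\<open>claim\<close> only gives a convergent subsequence; applied along indices
    whose distance stays at least \<open>\<epsilon>\<close> it proves convergence of the whole
    sequence. The bound \<open>3/4\<close> holds eventually because \<open>L (y n)\<close> tends to
    \<open>1\<close>.\<close>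
  have conv: "(\<lambda>n. N (abs_L0 (\<lambda>s. y n s - x s))) \<longlonglongrightarrow> 0"
    if y: "\<And>n. y n \<in> X" "\<And>n. N (abs_L0 (y n)) \<le> 1" and Ly: "(\<lambda>n. L (y n)) \<longlonglongrightarrow> 1" for y :: "nat \<Rightarrow> real \<Rightarrow> real"
  proof (rule ccontr)
    let ?d = "\<lambda>n. N (abs_L0 (\<lambda>s. y n s - x s))"
    assume "\<not> ?d \<longlonglongrightarrow> 0"
    then obtain \<epsilon> where \<epsilon>: "0 < \<epsilon>" "\<not> (\<forall>\<^sub>F n in sequentially. ?d n < \<epsilon>)"
      by (auto simp: tendsto_iff dist_real_def)
    have "\<forall>\<^sub>F n in sequentially. 3/4 < L (y n)" using Ly by (rule order_tendstoD) simp
    then have ev: "\<forall>\<^sub>F n in sequentially. 3/4 \<le> N (abs_L0 (y n))"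
      by eventually_elim (use Lle[OF y(1)] in \<open>meson abs_le_D1 less_imp_le order_trans\<close>)
    have "\<exists>\<^sub>F n in sequentially. \<not> ?d n < \<epsilon> \<and> 3/4 \<le> N (abs_L0 (y n))"
      unfolding frequently_def
    proof
      assume "\<forall>\<^sub>F n in sequentially. \<not> (\<not> ?d n < \<epsilon> \<and> 3/4 \<le> N (abs_L0 (y n)))"
      then have "\<forall>\<^sub>F n in sequentially. ?d n < \<epsilon>" using ev by eventually_elim auto
      then show False using \<epsilon>(2) by simp
    qed
    then have inf: "infinite {n. \<not> ?d n < \<epsilon> \<and> 3/4 \<le> N (abs_L0 (y n))}"
      by (simp add: cofinite_eq_sequentially[symmetric] frequently_cofinite)
    define p where "p = enumerate {n. \<not> ?d n < \<epsilon> \<and> 3/4 \<le> N (abs_L0 (y n))}"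
    have p: "strict_mono p" "\<And>n. \<not> ?d (p n) < \<epsilon>" "\<And>n. 3/4 \<le> N (abs_L0 (y (p n)))"
      using strict_mono_enumerate[OF inf] enumerate_in_set[OF inf] by (auto simp: p_def)
    have "(\<lambda>n. L (y (p n))) \<longlonglongrightarrow> 1" using LIMSEQ_subseq_LIMSEQ[OF Ly p(1)] by (simp add: comp_def)
    then obtain r where "(\<lambda>n. ?d (p (r n))) \<longlonglongrightarrow> 0" using claim[of "\<lambda>n. y (p n)"] y p(3) by auto
    then have "\<forall>\<^sub>F n in sequentially. ?d (p (r n)) < \<epsilon>" using \<epsilon>(1) by (rule order_tendstoD)
    then show False using p(2) by (auto simp: eventually_sequentially)
  qed
  \<comment> \<open>The choice of representative does not matter, since Lebesgue null sets are null
    for \<open>Q\<close>.\<close>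
  define F where "F a = L (rep_L0 a)" for a
  have Fabs: "F (abs_L0 f) = L f" if f: "measurable_fun f" for f
  proof -
    have eqv: "ae_equal (rep_L0 (abs_L0 f)) (rep_L0 (abs_L0 f))" by (rule Quotient3_rep_reflp[OF Quotient3_L0])
    then have rm[measurable]: "measurable_fun (rep_L0 (abs_L0 f))" by (simp add: ae_equal_def)
    have "abs_L0 (rep_L0 (abs_L0 f)) = abs_L0 f" by (rule Quotient3_abs_rep[OF Quotient3_L0])
    then have "AE s in pos_lebesgue. rep_L0 (abs_L0 f) s = f s" by (rule abs_L0_eqD[OF rm f])
    then have "AE s in Q. rep_L0 (abs_L0 f) s = f s" by (intro AEQ) (auto elim: eventually_mono)
    then show ?thesis unfolding F_def L_def
      using f by (intro integral_cong_AE Qm) (auto elim: eventually_mono)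
  qed
  have repX: "\<exists>f. f \<in> X \<and> a = abs_L0 f" if "a \<in> V" for a
  proof -
    obtain f where "measurable_fun f" "a = abs_L0 f" by (rule L0_cases)
    then show ?thesis using that by (auto simp: V_iff)
  qed
  note m = X_measurable
  have bdd: "bounded_functional_on V N F"
    unfolding bounded_functional_on_def
  proof (intro conjI ballI allI)
    fix a b assume "a \<in> V" "b \<in> V"
    then obtain f g where fg: "f \<in> X" "a = abs_L0 f" "g \<in> X" "b = abs_L0 g" using repX by metis
    have "L (\<lambda>s. f s + g s) = L f + L g"
      unfolding L_def using Lint[OF fg(1)] Lint[OF fg(3)] by (simp add: distrib_right)
    then show "F (a + b) = F a + F b" using fg m by (simp add: plus_abs_L0 Fabs)
  next
    fix q :: real and a assume "a \<in> V"
    then obtain f where f: "f \<in> X" "a = abs_L0 f" using repX by metis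
    have "L (\<lambda>s. q * f s) = q * L f" unfolding L_def by (simp add: mult.assoc)
    then show "F (q *\<^sub>R a) = q * F a" using f m by (simp add: scaleR_abs_L0 Fabs)
  next
    have "\<bar>F a\<bar> \<le> 1 * N a" if "a \<in> V" for a
    proof -
      obtain f where f: "f \<in> X" "a = abs_L0 f" using repX[OF \<open>a \<in> V\<close>] by blast
      then show ?thesis using Lle[OF f(1)] m[OF f(1)] by (simp add: Fabs)
    qed
    then show "\<exists>C. \<forall>a\<in>V. \<bar>F a\<bar> \<le> C * N a" by blast
  qed
  have Fle: "\<bar>F a\<bar> \<le> 1" if "a \<in> unit_ball_on V N" for a
  proof -
    have "a \<in> V" using that by (simp add: unit_ball_on_def)
    then obtain f where f: "f \<in> X" "a = abs_L0 f" using repX by blast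
    then show ?thesis using Lle[OF f(1)] m[OF f(1)] that by (simp add: Fabs unit_ball_on_def)
  qed
  have xV: "abs_L0 x \<in> V" using x m by (simp add: V_iff)
  have Fx: "F (abs_L0 x) = 1" using Fabs[OF m[OF x]] Lx by simp
  have dual: "dual_norm_on V N F = 1"
    unfolding dual_norm_on_def
  proof (rule cSup_eq_maximum)
    show "1 \<in> (\<lambda>a. \<bar>F a\<bar>) ` unit_ball_on V N"
      using xV Nx Fx by (intro image_eqI[of _ _ "abs_L0 x"]) (auto simp: unit_ball_on_def)
  qed (use Fle in auto)
  show ?thesis
    unfolding strongly_exposed_point_def
  proof (intro conjI exI[of _ F] allI impI)
    show "abs_L0 x \<in> unit_sphere_on V N" using xV Nx by (simp add: unit_sphere_on_def)
    fix Y :: "nat \<Rightarrow> L0"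
    assume Y: "\<forall>n. Y n \<in> unit_ball_on V N" "(\<lambda>n. F (Y n)) \<longlonglongrightarrow> 1"
    have "\<exists>f. f \<in> X \<and> Y n = abs_L0 f" for n using Y(1) repX by (auto simp: unit_ball_on_def)
    then obtain y where y: "\<And>n. y n \<in> X" "\<And>n. Y n = abs_L0 (y n)" by metis
    have "(\<lambda>n. N (abs_L0 (\<lambda>s. y n s - x s))) \<longlonglongrightarrow> 0"
      using Y y m by (intro conv) (auto simp: unit_ball_on_def Fabs)
    then show "(\<lambda>n. N (Y n - abs_L0 x)) \<longlonglongrightarrow> 0" using y m x by (simp add: minus_abs_L0)
  qed (use bdd dual Fx in auto)
qed

lemma strongly_exposed_property_iff:
  "strongly_exposed_property V N \<longleftrightarrow> (Delta2 (extend \<phi>) \<and> Nabla2 \<phi>) \<and> strictly_convex_on {0..} \<phi>"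
proof
  assume SEP: "strongly_exposed_property V N"
  have D: "Delta2 (extend \<phi>)" by (rule Delta2_of_strongly_exposed[OF SEP])
  have S: "strictly_convex_on {0..} \<phi>" by (rule strictly_convex_of_strongly_exposed[OF SEP])
  show "(Delta2 (extend \<phi>) \<and> Nabla2 \<phi>) \<and> strictly_convex_on {0..} \<phi>"
    using D S Nabla2_of_strongly_exposed[OF SEP D S] by blast
next
  assume A: "(Delta2 (extend \<phi>) \<and> Nabla2 \<phi>) \<and> strictly_convex_on {0..} \<phi>"
  show "strongly_exposed_property V N"
    unfolding strongly_exposed_property_def
  proof
    fix a assume a: "a \<in> unit_sphere_on V N"
    obtain x where x: "measurable_fun x" "a = abs_L0 x" by (rule L0_cases)
    then have "x \<in> X" "N (abs_L0 x) = 1" using a by (auto simp: unit_sphere_on_def V_iff)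
    then show "strongly_exposed_point V N a" unfolding x(2) using A by (intro strongly_exposed_point_abs_L0) auto
  qed
qed

end

theorem theorem4:
  fixes \<phi> \<omega> :: "real \<Rightarrow> real"
  assumes "orlicz_function \<phi>"
    and "decreasing_weight \<omega>"
  shows "strongly_exposed_property (orlicz_lorentz \<phi> \<omega>) (orlicz_norm \<phi> \<omega>) \<longleftrightarrow>
           (Delta2 (extend \<phi>) \<and> Nabla2 \<phi>) \<and> strictly_convex_on {0..} \<phi>"
proof -
  interpret orlicz_lorentz_space \<phi> \<omega>
    using assms by unfold_locales
  show ?thesis by (rule strongly_exposed_property_iff)
qed

end
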